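(* Let $\Omega\subset\mathbb{R}^N$ be a bounded open set with boundary of class $C^2$, $T>0$, $Q_T=\Omega\times(0,T)$. Let $\boldsymbol b\in\mathbb{R}^N$ be a constant vector, $f=f(t)\in L^\infty(0,T)$ (a function of time only), and $z_0\in\mathbb{K}_1$. Then the two obstacles problem $$z(t)\in\mathbb{K}_\vee^\wedge\ \text{ for a.e. } t\in(0,T),\qquad z(0)=z_0,$$ $$\int_\Omega\partial_tz(t)\,(v-z(t))\,dx+\int_\Omega\boldsymbol b\cdot\nabla z(t)\,(v-z(t))\,dx\ \ge\ \int_\Omega f(t)\,(v-z(t))\,dx\qquad\forall\,v\in\mathbb{K}_\vee^\wedge,\ \text{for a.e. } t\in(0,T),$$ has a unique solution $$z\in L^\infty(0,T;W^{1,\infty}_0(\Omega))\cap H^1(0,T;L^2(\Omega))\cap C(\overline{Q}_T).$$ This solution satisfies $|\nabla z|\le1$ a.e. in $Q_T$, and it is the unique solution of the variational inequality with gradient constraint $$z(t)\in\mathbb{K}_1\ \text{ for a.e. } t\in(0,T),\qquad z(0)=z_0,$$ $$\int_\Omega\partial_tz(t)\,(v-z(t))\,dx+\int_\Omega\boldsymbol b\cdot\nabla z(t)\,(v-z(t))\,dx\ \ge\ \int_\Omega f(t)\,(v-z(t))\,dx\qquad\forall\,v\in\mathbb{K}_1,\ \text{for a.e. } t\in(0,T).$$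
   Context: $\mathbb{K}_1=\{v\in H^1_0(\Omega):|\nabla v(x)|\le1\text{ for a.e. }x\in\Omega\}$ and $\mathbb{K}_\vee^\wedge=\{v\in H^1_0(\Omega): -d(x)\le v(x)\le d(x)\text{ for a.e. }x\in\Omega\}$, where $d(x)=d(x,\partial\Omega)$ is the distance from $x$ to $\partial\Omega$. One has $\mathbb{K}_1\subset\mathbb{K}_\vee^\wedge$. The gradient $\nabla$ is in the space variable only. $W^{1,\infty}_0(\Omega)$ denotes the functions of $W^{1,\infty}(\Omega)$ vanishing on $\partial\Omega$. Solutions of the gradient constraint problem are understood in the class $L^\infty(0,T;W^{1,\infty}_0(\Omega))\cap C(\overline{Q}_T)$ with $\partial_t z\in L^2(Q_T)$. *)

theory Defs
  imports "HOL-Analysis.Analysis"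
begin

text \<open>Functions on a set \<open>S\<close> are total functions whose values outside \<open>S\<close> (outside the
  closure of \<open>S\<close> for continuous ones) are irrelevant.  Every a.e.-class below is represented by
  its members; apart from continuity and the initial condition, which needs the continuous
  representative, everything is invariant under a.e. modification.\<close>

section \<open>Smooth functions and boundary of class C2\<close>

primrec Ck :: "nat \<Rightarrow> ('a::euclidean_space \<Rightarrow> real) \<Rightarrow> bool" where
  "Ck 0 f \<longleftrightarrow> continuous_on UNIV f"
| "Ck (Suc k) f \<longleftrightarrow> (\<forall>x. f differentiable (at x)) \<and>
     (\<forall>i\<in>Basis. Ck k (\<lambda>x. frechet_derivative f (at x) i))"

definition test_functions :: "'a::euclidean_space set \<Rightarrow> ('a \<Rightarrow> real) set" where
  "test_functions S = {\<phi>. (\<forall>k. Ck k \<phi>) \<and> compact (closure {x. \<phi> x \<noteq> 0}) \<and>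
     closure {x. \<phi> x \<noteq> 0} \<subseteq> S}"

text \<open>Near each boundary point, \<open>S\<close> is the strict epigraph of a C2 function in a rotated
  coordinate system with last axis \<open>e\<close>.  The function of the remaining \<open>N - 1\<close> coordinates is
  represented by a function \<open>\<gamma>\<close> on the whole space that is evaluated only on the hyperplane
  orthogonal to \<open>e\<close>; extending it constantly along \<open>e\<close> shows that this is no restriction.\<close>

definition C2_boundary :: "'a::euclidean_space set \<Rightarrow> bool" where
  "C2_boundary S \<longleftrightarrow> (\<forall>x0\<in>frontier S. \<exists>r>0. \<exists>e \<gamma>. norm e = 1 \<and> Ck 2 \<gamma> \<and>
     S \<inter> ball x0 r = {x \<in> ball x0 r. x \<bullet> e > \<gamma> (x - (x \<bullet> e) *\<^sub>R e)})"

section \<open>Lebesgue spaces and weak derivatives\<close>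

definition L2 :: "'a::euclidean_space set \<Rightarrow> ('a \<Rightarrow> real) set" where
  "L2 S = {u. u \<in> borel_measurable (lebesgue_on S) \<and> integrable (lebesgue_on S) (\<lambda>x. (u x)\<^sup>2)}"

definition Linf :: "'a::euclidean_space set \<Rightarrow> ('a \<Rightarrow> real) set" where
  "Linf S = {u. u \<in> borel_measurable (lebesgue_on S) \<and>
     (\<exists>M. AE x in lebesgue_on S. \<bar>u x\<bar> \<le> M)}"

definition L1loc :: "'a::euclidean_space set \<Rightarrow> ('a \<Rightarrow> real) set" where
  "L1loc S = {u. \<forall>C. compact C \<and> C \<subseteq> S \<longrightarrow> integrable (lebesgue_on C) u}"

definition has_weak_deriv ::
    "'a::euclidean_space set \<Rightarrow> 'a \<Rightarrow> ('a \<Rightarrow> real) \<Rightarrow> ('a \<Rightarrow> real) \<Rightarrow> bool" where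
  "has_weak_deriv S e u w \<longleftrightarrow> u \<in> L1loc S \<and> w \<in> L1loc S \<and>
     (\<forall>\<phi>\<in>test_functions S.
        (LINT x|lebesgue_on S. u x * frechet_derivative \<phi> (at x) e) =
        - (LINT x|lebesgue_on S. w x * \<phi> x))"

definition weakly_differentiable :: "'a::euclidean_space set \<Rightarrow> 'a \<Rightarrow> ('a \<Rightarrow> real) \<Rightarrow> bool" where
  "weakly_differentiable S e u \<longleftrightarrow> (\<exists>w. has_weak_deriv S e u w)"

text \<open>A representative of the weak derivative in direction \<open>e\<close>, which is unique up to null sets
  for open \<open>S\<close>; meaningful only together with \<open>weakly_differentiable S e u\<close>.\<close>

definition weak_deriv :: "'a::euclidean_space set \<Rightarrow> 'a \<Rightarrow> ('a \<Rightarrow> real) \<Rightarrow> 'a \<Rightarrow> real" where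
  "weak_deriv S e u = (SOME w. has_weak_deriv S e u w)"

definition weak_grad :: "'a::euclidean_space set \<Rightarrow> ('a \<Rightarrow> real) \<Rightarrow> 'a \<Rightarrow> 'a" where
  "weak_grad S u x = (\<Sum>i\<in>Basis. weak_deriv S i u x *\<^sub>R i)"

section \<open>Sobolev spaces\<close>

definition H1 :: "'a::euclidean_space set \<Rightarrow> ('a \<Rightarrow> real) set" where
  "H1 S = {u \<in> L2 S. \<forall>i\<in>Basis. weakly_differentiable S i u \<and> weak_deriv S i u \<in> L2 S}"

text \<open>The closure of the test functions in the norm of \<open>H1 S\<close>.\<close>

definition H10 :: "'a::euclidean_space set \<Rightarrow> ('a \<Rightarrow> real) set" where
  "H10 S = {u \<in> H1 S. \<exists>\<phi>. (\<forall>k::nat. \<phi> k \<in> test_functions S) \<and>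
     (\<lambda>k. LINT x|lebesgue_on S. (u x - \<phi> k x)\<^sup>2) \<longlonglongrightarrow> 0 \<and>
     (\<forall>i\<in>Basis. (\<lambda>k. LINT x|lebesgue_on S.
         (weak_deriv S i u x - frechet_derivative (\<phi> k) (at x) i)\<^sup>2) \<longlonglongrightarrow> 0)}"

definition W1inf :: "'a::euclidean_space set \<Rightarrow> ('a \<Rightarrow> real) set" where
  "W1inf S = {u \<in> Linf S. \<forall>i\<in>Basis. weakly_differentiable S i u \<and> weak_deriv S i u \<in> Linf S}"

text \<open>Vanishing on the boundary refers to the representative that is continuous up to the
  boundary.\<close>

definition W1inf0 :: "'a::euclidean_space set \<Rightarrow> ('a \<Rightarrow> real) set" where
  "W1inf0 S = {u \<in> W1inf S. \<exists>v. continuous_on (closure S) v \<and>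
     (AE x in lebesgue_on S. v x = u x) \<and> (\<forall>x\<in>frontier S. v x = 0)}"

section \<open>Spaces of functions on the space-time cylinder\<close>

text \<open>A function of space and time is a function of the pair \<open>(x, t)\<close>; its time derivative is the
  weak derivative in direction \<open>(0, 1)\<close>.\<close>

definition QT :: "'a::euclidean_space set \<Rightarrow> real \<Rightarrow> ('a \<times> real) set" where
  "QT \<Omega> T = \<Omega> \<times> {0<..<T}"

definition time_slice :: "('a \<times> real \<Rightarrow> real) \<Rightarrow> real \<Rightarrow> 'a \<Rightarrow> real" where
  "time_slice z t = (\<lambda>x. z (x, t))"

definition dt_in_L2 :: "'a::euclidean_space set \<Rightarrow> real \<Rightarrow> ('a \<times> real \<Rightarrow> real) \<Rightarrow> bool" where
  "dt_in_L2 \<Omega> T z \<longleftrightarrow> weakly_differentiable (QT \<Omega> T) (0, 1) z \<and>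
     weak_deriv (QT \<Omega> T) (0, 1) z \<in> L2 (QT \<Omega> T)"

text \<open>\<open>H\<^sup>1(0,T;L\<^sup>2(\<Omega>))\<close>, with \<open>L\<^sup>2(0,T;L\<^sup>2(\<Omega>))\<close> identified with \<open>L\<^sup>2(Q\<^sub>T)\<close> as usual.\<close>

definition H1_time_L2 :: "'a::euclidean_space set \<Rightarrow> real \<Rightarrow> ('a \<times> real \<Rightarrow> real) set" where
  "H1_time_L2 \<Omega> T = {z \<in> L2 (QT \<Omega> T). dt_in_L2 \<Omega> T z}"

text \<open>\<open>L\<^sup>\<infinity>(0,T;W\<^sup>1\<^sup>,\<^sup>\<infinity>\<^sub>0(\<Omega>))\<close>: the norm of \<open>z(t)\<close> is essentially bounded, and \<open>t \<mapsto> z(t)\<close> is weakly-*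
  measurable.  Strong Bochner measurability would be too much in this non-separable space: it fails
  already for a translated kink.\<close>

definition Linf_time_W1inf0 :: "'a::euclidean_space set \<Rightarrow> real \<Rightarrow> ('a \<times> real \<Rightarrow> real) set" where
  "Linf_time_W1inf0 \<Omega> T = {z.
     (\<exists>M. AE t in lebesgue_on {0<..<T}. time_slice z t \<in> W1inf0 \<Omega> \<and>
        (AE x in lebesgue_on \<Omega>. \<bar>time_slice z t x\<bar> \<le> M \<and>
           norm (weak_grad \<Omega> (time_slice z t) x) \<le> M)) \<and>
     (\<forall>g. integrable (lebesgue_on \<Omega>) g \<longrightarrow>
        (\<lambda>t. LINT x|lebesgue_on \<Omega>. time_slice z t x * g x)
           \<in> borel_measurable (lebesgue_on {0<..<T}) \<and>
        (\<forall>i\<in>Basis. (\<lambda>t. LINT x|lebesgue_on \<Omega>. weak_deriv \<Omega> i (time_slice z t) x * g x)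
           \<in> borel_measurable (lebesgue_on {0<..<T})))}"

text \<open>The bound \<open>\<bar>\<nabla>z\<bar> \<le> c\<close> a.e. in \<open>Q\<^sub>T\<close>, the gradient being taken in the space variable only.\<close>

definition space_grad_le :: "'a::euclidean_space set \<Rightarrow> real \<Rightarrow> ('a \<times> real \<Rightarrow> real) \<Rightarrow> real \<Rightarrow> bool"
  where
  "space_grad_le \<Omega> T z c \<longleftrightarrow> (\<forall>i\<in>Basis. weakly_differentiable (QT \<Omega> T) (i, 0) z) \<and>
     (AE p in lebesgue_on (QT \<Omega> T).
        norm (\<Sum>i\<in>Basis. weak_deriv (QT \<Omega> T) (i, 0) z p *\<^sub>R i) \<le> c)"

section \<open>Convex sets and variational inequalities\<close>

definition K_grad :: "'a::euclidean_space set \<Rightarrow> ('a \<Rightarrow> real) set" where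
  "K_grad \<Omega> = {v \<in> H10 \<Omega>. AE x in lebesgue_on \<Omega>. norm (weak_grad \<Omega> v x) \<le> 1}"

definition K_obst :: "'a::euclidean_space set \<Rightarrow> ('a \<Rightarrow> real) set" where
  "K_obst \<Omega> = {v \<in> H10 \<Omega>. AE x in lebesgue_on \<Omega>.
     - infdist x (frontier \<Omega>) \<le> v x \<and> v x \<le> infdist x (frontier \<Omega>)}"

definition solves_VI :: "'a::euclidean_space set \<Rightarrow> real \<Rightarrow> 'a \<Rightarrow> (real \<Rightarrow> real) \<Rightarrow> ('a \<Rightarrow> real) \<Rightarrow>
    ('a \<Rightarrow> real) set \<Rightarrow> ('a \<times> real \<Rightarrow> real) \<Rightarrow> bool" where
  "solves_VI \<Omega> T b f z0 K z \<longleftrightarrow>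
     (AE t in lebesgue_on {0<..<T}. time_slice z t \<in> K) \<and>
     (AE x in lebesgue_on \<Omega>. time_slice z 0 x = z0 x) \<and>
     (\<forall>v\<in>K. AE t in lebesgue_on {0<..<T}.
        (LINT x|lebesgue_on \<Omega>. weak_deriv (QT \<Omega> T) (0, 1) z (x, t) * (v x - time_slice z t x)) +
        (LINT x|lebesgue_on \<Omega>. (b \<bullet> weak_grad \<Omega> (time_slice z t) x) * (v x - time_slice z t x))
        \<ge> (LINT x|lebesgue_on \<Omega>. f t * (v x - time_slice z t x)))"

definition unique_solution_in ::
    "'a::euclidean_space set \<Rightarrow> real \<Rightarrow> 'a \<Rightarrow> (real \<Rightarrow> real) \<Rightarrow> ('a \<Rightarrow> real) \<Rightarrow>
     ('a \<Rightarrow> real) set \<Rightarrow> ('a \<times> real \<Rightarrow> real) set \<Rightarrow> ('a \<times> real \<Rightarrow> real) \<Rightarrow> bool" where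
  "unique_solution_in \<Omega> T b f z0 K X z \<longleftrightarrow> z \<in> X \<and> solves_VI \<Omega> T b f z0 K z \<and>
     (\<forall>y\<in>X. solves_VI \<Omega> T b f z0 K y \<longrightarrow> (\<forall>p\<in>closure (QT \<Omega> T). y p = z p))"

end

theory Submission
  imports Defs
begin

text \<open>
  Along the characteristics \<open>s \<mapsto> y + s b\<close> the equation becomes the scalar one \<open>w' = f\<close>, and after
  subtracting the primitive \<open>F\<close> of \<open>f\<close> the two obstacles problem becomes, for each \<open>y\<close>, a Skorokhod
  problem with zero driver on the interval between the shifted obstacles. Its solution is an explicit
  combination of minima, maxima, infima and suprema of the data. Since \<open>z0\<close> and \<open>d\<close> are 1-Lipschitz and
  \<open>F\<close> does not depend on \<open>x\<close>, this formula is 1-Lipschitz in \<open>x\<close> at each time: the solution \<open>z\<close> of the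
  obstacle problem satisfies the gradient constraint, and as every function with gradient constraint
  lies between the obstacles, it solves both variational inequalities. The formula gives
  \<open>z\<close> globally Lipschitz in space and time, so its weak derivatives are a.e.
  directional derivatives; in direction \<open>(b, 1)\<close> these are at most \<open>f\<close>
  where \<open>z > - d\<close> and at least \<open>f\<close> where \<open>z < d\<close>, which is
  the variational inequality pointwise.

  For uniqueness, testing the inequalities of two solutions with each other gives
  \<open>\<integral> (\<partial>\<^sub>t w) w \<le> 0\<close> for their difference \<open>w\<close>, as the transport terms cancel by skew-symmetry
  in \<open>H\<^sup>1\<^sub>0\<close>; hence the \<open>L\<^sup>2\<close> norm of \<open>w\<close> vanishes for all times.
\<close>

section \<open>Smooth functions and test functions\<close>

text \<open>Inside the proof the obstacle is the distance to the complement of the domain rather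
  than to its boundary. The two agree on the domain, but the former is 1-Lipschitz on the whole
  space and zero outside. Characteristics may therefore leave the domain: there both obstacles
  coincide and force the value 0, so boundary values need no separate treatment, and all
  differentiation can be done for functions that are Lipschitz on a whole Euclidean space. The
  boundary regularity enters where a member of \<open>K_grad\<close> gets its Lipschitz
  representative: the complement has to be the closure of its interior. Otherwise the
  representative, which vanishes almost everywhere outside the domain, could be nonzero at a point
  of the complement, such as a removed point in dimension two, and would exceed the obstacle nearby.
  Uniqueness has to cope with competitors whose time derivative is merely square integrable. In
  place of a chain rule for the energy, its increments over short time intervals are estimated, with
  an error that is small by uniform continuity of the difference on the closed cylinder.\<close>

abbreviation smooth :: "('a::euclidean_space \<Rightarrow> real) \<Rightarrow> bool" where
  "smooth f \<equiv> \<forall>k. Ck k f"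

lemma Ck_SucI:
  assumes "\<And>x. (f has_derivative f' x) (at x)" "\<And>i. i \<in> Basis \<Longrightarrow> Ck k (\<lambda>x. f' x i)"
  shows "Ck (Suc k) f"
proof -
  have "frechet_derivative f (at x) = f' x" for x
    using assms(1) frechet_derivative_at by metis
  then show ?thesis
    using assms by (auto simp: differentiable_def)
qed

lemma Ck_Suc_has_derivative:
  "Ck (Suc k) f \<Longrightarrow> (f has_derivative frechet_derivative f (at x)) (at x)"
  using frechet_derivative_works by auto

lemma Ck_SucD: "Ck (Suc k) f \<Longrightarrow> Ck k f"
proof (induction k arbitrary: f)
  case 0
  then show ?case
    by (auto intro!: continuous_at_imp_continuous_on differentiable_imp_continuous_within)
next
  case (Suc k)
  then show ?case by (metis Ck.simps(2))
qed

lemma Ck_partial: "Ck (Suc k) f \<Longrightarrow> i \<in> Basis \<Longrightarrow> Ck k (\<lambda>x. frechet_derivative f (at x) i)"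
  by simp

lemma Ck_continuous: "Ck k f \<Longrightarrow> continuous_on UNIV f"
  by (induction k) (auto simp del: Ck.simps(2) dest: Ck_SucD)

declare Ck.simps(2) [simp del]

lemma smooth_has_derivative:
  "smooth f \<Longrightarrow> (f has_derivative frechet_derivative f (at x)) (at x)"
  using Ck_Suc_has_derivative by blast

lemma smooth_continuous: "smooth f \<Longrightarrow> continuous_on UNIV f"
  using Ck_continuous by blast

lemma smooth_partial: "smooth f \<Longrightarrow> i \<in> Basis \<Longrightarrow> smooth (\<lambda>x. frechet_derivative f (at x) i)"
  using Ck_partial by blast

text \<open>Induction on the order runs over a whole family at once, so it is enough to exhibit a
  family closed under partial differentiation. The families used below are the exponential alone,
  the functions \<open>exp_cutoff p\<close>, and the mollifications of one fixed function.\<close>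

lemma smooth_coinduct:
  assumes "P f"
    and step: "\<And>f. P f \<Longrightarrow> \<exists>f'. (\<forall>x. (f has_derivative f' x) (at x)) \<and> (\<forall>i\<in>Basis. P (\<lambda>x. f' x i))"
  shows "smooth f"
proof -
  have "P f \<Longrightarrow> Ck k f" for f k
  proof (induction k arbitrary: f)
    case 0
    then obtain f' where "\<forall>x. (f has_derivative f' x) (at x)" using step by blast
    then show ?case
      by (auto intro!: continuous_at_imp_continuous_on has_derivative_continuous)
  next
    case (Suc k)
    then obtain f' where "\<forall>x. (f has_derivative f' x) (at x)" "\<forall>i\<in>Basis. P (\<lambda>x. f' x i)"
      using step by blast
    then show ?case using Suc.IH by (intro Ck_SucI[of f f']) auto
  qed
  then show ?thesis using \<open>P f\<close> by blast
qed

lemma Ck_const [simp]: "Ck k (\<lambda>x. c)"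
proof (induction k arbitrary: c)
  case (Suc k)
  then show ?case by (intro Ck_SucI[where f' = "\<lambda>x h. 0"]) auto
qed auto

lemma Ck_add: "Ck k f \<Longrightarrow> Ck k g \<Longrightarrow> Ck k (\<lambda>x. f x + g x)"
proof (induction k arbitrary: f g)
  case (Suc k)
  show ?case
    by (rule Ck_SucI[OF has_derivative_add[OF Ck_Suc_has_derivative[OF Suc.prems(1)]
            Ck_Suc_has_derivative[OF Suc.prems(2)]]])
      (use Suc in \<open>auto intro: Ck_partial\<close>)
qed (auto intro: continuous_on_add)

lemma Ck_mult: "Ck k f \<Longrightarrow> Ck k g \<Longrightarrow> Ck k (\<lambda>x. f x * g x)"
proof (induction k arbitrary: f g)
  case (Suc k)
  show ?case
    by (rule Ck_SucI[OF has_derivative_mult[OF Ck_Suc_has_derivative[OF Suc.prems(1)]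
            Ck_Suc_has_derivative[OF Suc.prems(2)]]])
      (use Suc.IH Suc.prems in \<open>auto intro!: Ck_add intro: Ck_partial Ck_SucD\<close>)
qed (auto intro: continuous_on_mult)

lemma Ck_sum: "(\<And>i. i \<in> I \<Longrightarrow> Ck k (f i)) \<Longrightarrow> Ck k (\<lambda>x. \<Sum>i\<in>I. f i x)"
  by (induction I rule: infinite_finite_induct) (auto intro: Ck_add)

lemma Ck_prod: "(\<And>i. i \<in> I \<Longrightarrow> Ck k (f i)) \<Longrightarrow> Ck k (\<lambda>x. \<Prod>i\<in>I. f i x)"
  by (induction I rule: infinite_finite_induct) (auto intro: Ck_mult)

lemma Ck_diff: "Ck k f \<Longrightarrow> Ck k g \<Longrightarrow> Ck k (\<lambda>x. f x - g x)"
  using Ck_add[of k f "\<lambda>x. (- 1) * g x"] Ck_mult[of k "\<lambda>x. - 1" g] by simp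

lemma Ck_affine:
  fixes f :: "'b::euclidean_space \<Rightarrow> real" and L :: "'a::euclidean_space \<Rightarrow> 'b"
  assumes "bounded_linear L" "Ck k f"
  shows "Ck k (\<lambda>x. f (L x + a))"
  using assms(2)
proof (induction k arbitrary: f)
  case 0
  then show ?case
    using linear_continuous_on[OF assms(1)]
    by (auto intro!: continuous_on_compose2[of UNIV f] continuous_on_add continuous_on_const)
next
  case (Suc k)
  let ?D = "\<lambda>y. frechet_derivative f (at y)"
  have der: "((\<lambda>x. f (L x + a)) has_derivative (\<lambda>h. ?D (L x + a) (L h))) (at x)" for x
  proof -
    have "((\<lambda>x. L x + a) has_derivative L) (at x)"
      using bounded_linear.has_derivative[OF assms(1), of "\<lambda>x. x" "\<lambda>x. x" "at x"]
      by (auto intro!: derivative_eq_intros)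
    then show ?thesis
      using diff_chain_at[OF _ Ck_Suc_has_derivative[OF Suc.prems]] by (simp add: o_def)
  qed
  \<comment> \<open>\<open>Ck\<close> speaks of derivatives along \<open>Basis\<close> only, while
    \<open>L i\<close> need not be a basis vector, so the directional derivative is expanded in
    partial derivatives.\<close>
  have eq: "?D (L x + a) (L i) = (\<Sum>j\<in>Basis. (L i \<bullet> j) * ?D (L x + a) j)" for x i
  proof -
    interpret bounded_linear "?D (L x + a)"
      using Ck_Suc_has_derivative[OF Suc.prems] has_derivative_bounded_linear by blast
    have "?D (L x + a) (L i) = ?D (L x + a) (\<Sum>j\<in>Basis. (L i \<bullet> j) *\<^sub>R j)"
      by (simp add: euclidean_representation)
    then show ?thesis by (simp add: sum scaleR)
  qed
  show ?case
  proof (rule Ck_SucI[OF der], unfold eq, rule Ck_sum)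
    fix i :: 'a and j :: 'b assume "j \<in> Basis"
    then show "Ck k (\<lambda>x. (L i \<bullet> j) * ?D (L x + a) j)"
      using Suc.IH[OF Ck_partial[OF Suc.prems]] by (intro Ck_mult Ck_const)
  qed
qed

lemma Ck_compose_real:
  fixes h :: "real \<Rightarrow> real"
  shows "Ck k h \<Longrightarrow> Ck k g \<Longrightarrow> Ck k (\<lambda>x. h (g x))"
proof (induction k arbitrary: h g)
  case 0
  then show ?case
    by (auto intro!: continuous_on_compose2[of UNIV h])
next
  case (Suc k)
  let ?D = "\<lambda>y. frechet_derivative h (at y)"
  have der: "((\<lambda>x. h (g x)) has_derivative
      (\<lambda>i. frechet_derivative g (at x) i * ?D (g x) 1)) (at x)" for x
  proof -
    interpret bounded_linear "?D (g x)"
      using Ck_Suc_has_derivative[OF Suc.prems(1)] has_derivative_bounded_linear by blast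
    have eq: "?D (g x) \<circ> frechet_derivative g (at x) =
        (\<lambda>i. frechet_derivative g (at x) i * ?D (g x) 1)"
      unfolding o_def
      by (rule ext, rule scaleR[of _ 1, unfolded real_scaleR_def mult_1_right])
    show ?thesis
      using diff_chain_at[OF Ck_Suc_has_derivative[OF Suc.prems(2), of x]
            Ck_Suc_has_derivative[OF Suc.prems(1)]] unfolding eq unfolding o_def .
  qed
  show ?case
  proof (rule Ck_SucI[OF der], rule Ck_mult)
    show "Ck k (\<lambda>x. frechet_derivative h (at (g x)) 1)"
      using Suc.IH[OF Ck_partial[OF Suc.prems(1)] Ck_SucD[OF Suc.prems(2)], of 1] by simp
  qed (rule Ck_partial[OF Suc.prems(2)])
qed

lemma Ck_inner: "Ck k (\<lambda>x::'a::euclidean_space. x \<bullet> c)"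
proof (cases k)
  case (Suc m)
  have "((\<lambda>x::'a. x \<bullet> c) has_derivative (\<lambda>h. h \<bullet> c)) (at x)" for x
    by (auto intro!: derivative_eq_intros)
  from Ck_SucI[OF this] show ?thesis using Suc by simp
qed (auto intro!: continuous_intros)

section \<open>Smooth bump functions on boxes\<close>

definition exp_cutoff :: "real poly \<Rightarrow> real \<Rightarrow> real" where
  "exp_cutoff p x = (if x > 0 then poly p (1 / x) * exp (- (1 / x)) else 0)"

lemma exp_cutoff_tendsto_0: "(exp_cutoff p \<longlongrightarrow> 0) (at 0)"
proof -
  have "((\<lambda>y. \<Sum>i\<le>degree p. coeff p i * (y ^ i / exp y)) \<longlongrightarrow> 0) at_top"
    by (intro tendsto_null_sum tendsto_mult_right_zero tendsto_power_div_exp_0)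
  then have "((\<lambda>y. poly p y * exp (- y)) \<longlongrightarrow> 0) at_top"
    by (simp add: poly_altdef sum_distrib_right exp_minus divide_inverse mult.assoc)
  then have "((\<lambda>x. poly p (1 / x) * exp (- (1 / x))) \<longlongrightarrow> 0) (at_right 0)"
    using filterlim_inverse_at_top_right
    by (simp add: filterlim_compose[of "\<lambda>y. poly p y * exp (- y)"] inverse_eq_divide)
  then have "(exp_cutoff p \<longlongrightarrow> 0) (at_right 0)"
    by (rule Lim_transform_eventually)
      (auto simp: exp_cutoff_def intro: eventually_mono[OF eventually_at_right_less])
  moreover have "(exp_cutoff p \<longlongrightarrow> 0) (at_left 0)"
    by (rule tendsto_eventually) (auto simp: exp_cutoff_def eventually_at_filter)
  ultimately show ?thesis by (simp add: filterlim_split_at)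
qed

text \<open>With y = 1/x, the derivative of p(y) exp(-y) in x is y^2 (p - p')(y) exp(-y), which
  explains the factor \<open>[:0, 0, 1:]\<close>. The polynomial parameter is there to make the
  family closed under differentiation; p = 1 is the classical function exp(-1/x).\<close>

lemma exp_cutoff_deriv:
  "(exp_cutoff p has_real_derivative exp_cutoff ([:0, 0, 1:] * (p - pderiv p)) x) (at x)"
proof -
  consider "x > 0" | "x = 0" | "x < 0" by linarith
  then show ?thesis
  proof cases
    case 1
    have "((\<lambda>x. poly p (1 / x) * exp (- (1 / x))) has_real_derivative
        exp_cutoff ([:0, 0, 1:] * (p - pderiv p)) x) (at x)"
      using 1 by (auto intro!: derivative_eq_intros simp: exp_cutoff_def field_simps power2_eq_square)
    then show ?thesis
      by (rule has_field_derivative_transform_within_open[where S = "{0<..}"])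
        (use 1 in \<open>auto simp: exp_cutoff_def\<close>)
  next
    case 2
    \<comment> \<open>At the origin the difference quotient is again a cutoff, with p multiplied by
      the variable 1/h, so its limit 0 is already known.\<close>
    have "(\<lambda>h. (exp_cutoff p (0 + h) - exp_cutoff p 0) / h) = exp_cutoff (pCons 0 p)"
      by (auto simp: exp_cutoff_def)
    then show ?thesis
      using exp_cutoff_tendsto_0[of "pCons 0 p"] 2 by (simp add: DERIV_def) (simp add: exp_cutoff_def)
  next
    case 3
    have "((\<lambda>x. 0) has_real_derivative exp_cutoff ([:0, 0, 1:] * (p - pderiv p)) x) (at x)"
      using 3 by (auto simp: exp_cutoff_def)
    then show ?thesis
      by (rule has_field_derivative_transform_within_open[where S = "{..<0}"])
        (use 3 in \<open>auto simp: exp_cutoff_def\<close>)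
  qed
qed

lemma smooth_exp_cutoff: "smooth (exp_cutoff p)"
proof (rule smooth_coinduct[where P = "\<lambda>f. \<exists>p. f = exp_cutoff p"])
  fix f assume "\<exists>p. f = exp_cutoff p"
  then obtain p where f: "f = exp_cutoff p" by blast
  show "\<exists>f'. (\<forall>x. (f has_derivative f' x) (at x)) \<and>
      (\<forall>i\<in>Basis. \<exists>p. (\<lambda>x. f' x i) = exp_cutoff p)"
    unfolding f using exp_cutoff_deriv[of p, unfolded has_field_derivative_def]
    by (intro exI[of _ "\<lambda>x h. exp_cutoff ([:0, 0, 1:] * (p - pderiv p)) x * h"])
      (auto simp del: mult_pCons_left)
qed auto

text \<open>Boxes instead of balls: the differentiation theorem used below averages over cubes, and
  the product form makes both smoothness and the exact positivity set immediate.\<close>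

definition box_bump :: "'a::euclidean_space \<Rightarrow> 'a \<Rightarrow> 'a \<Rightarrow> real" where
  "box_bump a b x = (\<Prod>i\<in>Basis. exp_cutoff 1 (x \<bullet> i - a \<bullet> i) * exp_cutoff 1 (b \<bullet> i - x \<bullet> i))"

lemma smooth_box_bump: "smooth (box_bump a b)"
proof
  fix k
  have G: "Ck k (exp_cutoff 1)" using smooth_exp_cutoff by blast
  have "Ck k (\<lambda>x. exp_cutoff 1 (x \<bullet> i - a \<bullet> i))" "Ck k (\<lambda>x. exp_cutoff 1 (b \<bullet> i - x \<bullet> i))" for i
    by (rule Ck_compose_real[OF G Ck_diff[OF Ck_inner Ck_const]],
        rule Ck_compose_real[OF G Ck_diff[OF Ck_const Ck_inner]])
  then show "Ck k (box_bump a b)"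
    unfolding box_bump_def[abs_def] by (rule Ck_prod[OF Ck_mult])
qed

lemma box_bump_pos: "x \<in> box a b \<Longrightarrow> box_bump a b x > 0"
  unfolding box_bump_def by (intro prod_pos) (auto simp: mem_box exp_cutoff_def)

lemma box_bump_eq_0:
  assumes "x \<notin> box a b" shows "box_bump a b x = 0"
proof -
  obtain i where i: "i \<in> Basis" "x \<bullet> i \<le> a \<bullet> i \<or> b \<bullet> i \<le> x \<bullet> i"
    using assms unfolding mem_box by (meson not_less)
  then have "exp_cutoff 1 (x \<bullet> i - a \<bullet> i) * exp_cutoff 1 (b \<bullet> i - x \<bullet> i) = 0"
    by (auto simp: exp_cutoff_def)
  with i(1) show ?thesis unfolding box_bump_def prod_zero_iff[OF finite_Basis] by (rule bexI[rotated])
qed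

lemma box_bump_nonneg: "box_bump a b x \<ge> 0"
  using box_bump_pos box_bump_eq_0 by (metis less_eq_real_def)

text \<open>Any compact set off which the function vanishes serves as a witness, so the closure of
  the support never has to be computed; the next lemma goes the other way.\<close>

lemma test_functionsI:
  assumes "smooth \<phi>" "compact C" "C \<subseteq> S" "\<And>x. x \<notin> C \<Longrightarrow> \<phi> x = 0"
  shows "\<phi> \<in> test_functions S"
proof -
  have "closure {x. \<phi> x \<noteq> 0} \<subseteq> C"
    using assms by (intro closure_minimal compact_imp_closed) auto
  then show ?thesis
    using assms bounded_subset[OF compact_imp_bounded closure_subset[THEN subset_trans]]
    by (auto simp: test_functions_def)
qed

lemma test_functionsD:
  assumes "\<phi> \<in> test_functions S"
  obtains C where "smooth \<phi>" "compact C" "C \<subseteq> S" "\<And>x. x \<notin> C \<Longrightarrow> \<phi> x = 0"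
proof (rule that[of "closure {x. \<phi> x \<noteq> 0}"])
  show "\<phi> x = 0" if "x \<notin> closure {x. \<phi> x \<noteq> 0}" for x
    using that closure_subset[of "{x. \<phi> x \<noteq> 0}"] by blast
qed (use assms in \<open>simp_all add: test_functions_def\<close>)

lemma test_function_smooth: "\<phi> \<in> test_functions S \<Longrightarrow> smooth \<phi>"
  by (simp add: test_functions_def)

lemma frechet_derivative_eq_0:
  assumes "open U" "x \<in> U" "\<And>y. y \<in> U \<Longrightarrow> f y = 0"
  shows "frechet_derivative f (at x) = (\<lambda>h. 0)"
proof -
  have "(f has_derivative (\<lambda>h. 0)) (at x)"
    by (rule has_derivative_transform_within_open[of "\<lambda>x. 0" _ _ _ U]) (use assms in auto)
  then show ?thesis using frechet_derivative_at by metis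
qed

lemma test_function_deriv_eq_0:
  assumes "compact C" "\<And>x. x \<notin> C \<Longrightarrow> \<phi> x = 0" "x \<notin> C"
  shows "frechet_derivative \<phi> (at x) i = 0"
  using frechet_derivative_eq_0[of "- C" x \<phi>] assms by (auto simp: open_closed compact_imp_closed)

text \<open>The functions \<open>1 - exp (- n \<beta>)\<close>, with \<open>\<beta>\<close> a bump positive exactly on the box, increase to
  the indicator of the box.\<close>

definition box_approx :: "nat \<Rightarrow> 'a::euclidean_space \<Rightarrow> 'a \<Rightarrow> 'a \<Rightarrow> real" where
  "box_approx n a b x = 1 - exp (- (real n * box_bump a b x))"

lemma smooth_exp: "smooth (exp :: real \<Rightarrow> real)"
proof (rule smooth_coinduct[where P = "\<lambda>f. f = exp"])
  fix f :: "real \<Rightarrow> real" assume f: "f = exp"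
  show "\<exists>f'. (\<forall>x. (f has_derivative f' x) (at x)) \<and> (\<forall>i\<in>Basis. (\<lambda>x. f' x i) = exp)"
    unfolding f
  proof (intro exI[of _ "\<lambda>x h. exp x * h"] conjI allI ballI)
    show "(exp has_derivative (*) (exp x)) (at x)" for x :: real
      using DERIV_exp[of x] unfolding has_field_derivative_def .
  qed simp
qed auto

lemma box_approx_test:
  assumes "cbox a b \<subseteq> S"
  shows "box_approx n a b \<in> test_functions S"
proof (rule test_functionsI[OF _ compact_cbox[of a b] assms])
  show "smooth (box_approx n a b)"
  proof
    fix k
    have "Ck k (\<lambda>x. 1 - exp ((- real n) * box_bump a b x))"
      by (rule Ck_diff[OF Ck_const Ck_compose_real[OF smooth_exp[rule_format]
              Ck_mult[OF Ck_const smooth_box_bump[rule_format]]]])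
    then show "Ck k (box_approx n a b)" by (simp add: box_approx_def[abs_def])
  qed
  show "box_approx n a b x = 0" if "x \<notin> cbox a b" for x
    using box_bump_eq_0[of x a b] subsetD[OF box_subset_cbox, of x a b] that
    by (auto simp: box_approx_def)
qed

lemma box_approx_nonneg: "box_approx n a b x \<ge> 0"
  using box_bump_nonneg[of a b x] by (simp add: box_approx_def)

lemma box_approx_le: "box_approx n a b x \<le> indicator (box a b) x"
  by (cases "x \<in> box a b") (auto simp: box_approx_def box_bump_eq_0)

lemma box_approx_tendsto: "(\<lambda>n. box_approx n a b x) \<longlonglongrightarrow> indicator (box a b) x"
proof (cases "x \<in> box a b")
  case True
  have "LIM n sequentially. real n * box_bump a b x :> at_top"
    using filterlim_at_top_mult_tendsto_pos[OF tendsto_const box_bump_pos[OF True]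
        filterlim_real_sequentially] .
  then have "(\<lambda>n. exp (- (real n * box_bump a b x))) \<longlonglongrightarrow> 0"
    by (intro filterlim_compose[OF exp_at_bot]) (simp add: filterlim_uminus_at_bot)
  from tendsto_diff[OF tendsto_const[of 1] this] show ?thesis
    using True by (simp add: box_approx_def)
qed (simp add: box_approx_def box_bump_eq_0)

section \<open>Square integrable functions and the fundamental lemma\<close>

lemma AE_lebesgue_on_iff:
  assumes "S \<in> sets borel"
  shows "(AE x in lebesgue_on S. P x) \<longleftrightarrow> (AE x in lborel. x \<in> S \<longrightarrow> P x)"
  using assms by (subst AE_restrict_space_iff) (auto simp: AE_completion_iff)

lemma measurable_lebesgue_on_borel:
  "f \<in> borel_measurable borel \<Longrightarrow> f \<in> borel_measurable (lebesgue_on S)"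
  by (intro measurable_restrict_space1 measurable_completion) simp

lemma borel_representative:
  fixes f :: "'a::euclidean_space \<Rightarrow> real"
  assumes S: "S \<in> sets borel" and f: "f \<in> borel_measurable (lebesgue_on S)"
  obtains g where "g \<in> borel_measurable borel" "AE x in lborel. x \<in> S \<longrightarrow> f x = g x"
proof -
  have "(\<lambda>x. if x \<in> S then f x else 0) \<in> borel_measurable lebesgue"
    using f S by (subst borel_measurable_if) auto
  from completion_ex_borel_measurable_real[OF this] obtain g where
    "g \<in> borel_measurable lborel" "AE x in lborel. (if x \<in> S then f x else 0) = g x"
    by auto
  then show thesis by (intro that[of g]) (auto elim: eventually_mono)
qed

text \<open>Fubini arguments and slices live on \<open>lborel\<close>, where products of Borel
  measures are again Borel, whereas the definitions use the completed measure on a set. This is the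
  bridge: \<open>f\<close> may be replaced by any Borel function equal to it almost everywhere on
  \<open>S\<close>, and completeness makes \<open>f\<close> measurable, so that this need not be
  known in advance.\<close>

lemma lebesgue_on_cong_borel:
  fixes f g :: "'a::euclidean_space \<Rightarrow> real"
  assumes S: "S \<in> sets borel" and g: "g \<in> borel_measurable borel"
    and eq: "AE x in lborel. x \<in> S \<longrightarrow> f x = g x"
  shows "f \<in> borel_measurable (lebesgue_on S)"
    and "integrable (lebesgue_on S) f \<longleftrightarrow> integrable lborel (\<lambda>x. indicator S x * g x)"
    and "(LINT x|lebesgue_on S. f x) = (LINT x|lborel. indicator S x * g x)"
proof -
  have eq': "AE x in lebesgue_on S. g x = f x"
    using eq by (subst AE_lebesgue_on_iff[OF S]) (auto elim: eventually_mono)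
  have gm: "g \<in> borel_measurable (lebesgue_on S)"
    by (rule measurable_lebesgue_on_borel[OF g])
  have gm': "(\<lambda>x. indicator S x * g x) \<in> borel_measurable lborel"
    using g S by measurable
  show fm: "f \<in> borel_measurable (lebesgue_on S)"
  proof -
    have eq'': "AE x in lebesgue. (if x \<in> S then g x else 0) = (if x \<in> S then f x else 0)"
      using eq by (intro AE_completion) (auto elim: eventually_mono)
    have "(\<lambda>x. if x \<in> S then g x else 0) \<in> borel_measurable lebesgue"
      using gm S by (subst borel_measurable_if) auto
    from borel_measurable_AE[OF this eq'']
    have "(\<lambda>x. if x \<in> S then f x else 0) \<in> borel_measurable lebesgue" .
    then show ?thesis
      using S by (subst (asm) borel_measurable_if) auto
  qed
  have "integrable (lebesgue_on S) f \<longleftrightarrow> integrable (lebesgue_on S) g"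
    by (rule integrable_cong_AE) (use fm gm eq' in auto)
  also have "\<dots> \<longleftrightarrow> integrable lborel (\<lambda>x. indicator S x * g x)"
    using S gm' by (subst integrable_restrict_space) (auto simp: integrable_completion)
  finally show "integrable (lebesgue_on S) f \<longleftrightarrow> integrable lborel (\<lambda>x. indicator S x * g x)" .
  have "(LINT x|lebesgue_on S. f x) = (LINT x|lebesgue_on S. g x)"
    by (rule integral_cong_AE) (use fm gm eq' in auto)
  also have "\<dots> = (LINT x|lborel. indicator S x * g x)"
    using S gm' by (subst integral_restrict_space) (auto simp: integral_completion)
  finally show "(LINT x|lebesgue_on S. f x) = (LINT x|lborel. indicator S x * g x)" .
qed

lemma lebesgue_on_integral_borel:
  fixes g :: "'a::euclidean_space \<Rightarrow> real"
  assumes "S \<in> sets borel" "g \<in> borel_measurable borel"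
  shows "integrable (lebesgue_on S) g \<longleftrightarrow> integrable lborel (\<lambda>x. indicator S x * g x)"
    and "(LINT x|lebesgue_on S. g x) = (LINT x|lborel. indicator S x * g x)"
  using lebesgue_on_cong_borel(2,3)[OF assms, of g] by auto

lemma emeasure_lborel_bounded:
  fixes S :: "'a::euclidean_space set"
  assumes "bounded S" shows "emeasure lborel S < \<infinity>"
proof -
  obtain a b where "S \<subseteq> cbox a b" using bounded_subset_cbox_symmetric[OF assms] by blast
  then have "emeasure lborel S \<le> emeasure lborel (cbox a b)"
    by (intro emeasure_mono) auto
  then show ?thesis using emeasure_lborel_cbox_finite[of a b] by (metis infinity_ennreal_def le_less_trans less_top)
qed

lemma finite_measure_bounded:
  fixes S :: "'a::euclidean_space set"
  assumes "S \<in> sets borel" "bounded S" shows "finite_measure (lebesgue_on S)"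
  using assms by (intro finite_measure_lebesgue_on bounded_set_imp_lmeasurable) auto

lemma abs_mult_le_squares: "\<bar>a * b\<bar> \<le> a\<^sup>2 + (b::real)\<^sup>2"
  using sum_squares_bound[of "\<bar>a\<bar>" "\<bar>b\<bar>"] mult_nonneg_nonneg[of "\<bar>a\<bar>" "\<bar>b\<bar>"]
  unfolding abs_mult power2_abs by linarith

lemma (in finite_measure) integrable_of_square:
  fixes u :: "'a \<Rightarrow> real"
  assumes "u \<in> borel_measurable M" "integrable M (\<lambda>x. (u x)\<^sup>2)"
  shows "integrable M u"
proof (rule Bochner_Integration.integrable_bound)
  show "integrable M (\<lambda>x. 1 + (u x)\<^sup>2)"
    by (rule Bochner_Integration.integrable_add[OF integrable_const assms(2)])
  show "AE x in M. norm (u x) \<le> norm (1 + (u x)\<^sup>2)"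
  proof (rule AE_I2)
    fix x
    have "\<bar>u x\<bar> \<le> 1 + (u x)\<^sup>2" using abs_mult_le_squares[of 1 "u x"] by simp
    then show "norm (u x) \<le> norm (1 + (u x)\<^sup>2)" by simp
  qed
qed (rule assms(1))

lemma L2_imp_integrable:
  assumes "S \<in> sets borel" "bounded S" "u \<in> L2 S"
  shows "integrable (lebesgue_on S) u"
  by (rule finite_measure.integrable_of_square[OF finite_measure_bounded[OF assms(1,2)]])
    (use assms(3) in \<open>simp_all add: L2_def\<close>)

lemma integrable_mult_squares:
  fixes u v :: "'a \<Rightarrow> real"
  assumes "u \<in> borel_measurable M" "integrable M (\<lambda>x. (u x)\<^sup>2)"
    "v \<in> borel_measurable M" "integrable M (\<lambda>x. (v x)\<^sup>2)"
  shows "integrable M (\<lambda>x. u x * v x)"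
  by (rule Bochner_Integration.integrable_bound[OF Bochner_Integration.integrable_add[OF assms(2,4)]])
    (use assms(1,3) abs_mult_le_squares in auto)

lemma integrable_diff_squared:
  fixes u v :: "'a \<Rightarrow> real"
  assumes "u \<in> borel_measurable M" "integrable M (\<lambda>x. (u x)\<^sup>2)"
    "v \<in> borel_measurable M" "integrable M (\<lambda>x. (v x)\<^sup>2)"
  shows "integrable M (\<lambda>x. (u x - v x)\<^sup>2)"
proof -
  have "(u x - v x)\<^sup>2 = (u x)\<^sup>2 + (v x)\<^sup>2 - 2 * (u x * v x)" for x
    by (simp add: power2_diff)
  then show ?thesis using assms integrable_mult_squares[OF assms] by simp
qed

lemma Cauchy_Schwarz_abs_integral:
  fixes u v :: "'a \<Rightarrow> real"
  assumes "u \<in> borel_measurable M" "integrable M (\<lambda>x. (u x)\<^sup>2)"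
    "v \<in> borel_measurable M" "integrable M (\<lambda>x. (v x)\<^sup>2)"
  shows "(LINT x|M. \<bar>u x * v x\<bar>)\<^sup>2 \<le> (LINT x|M. (u x)\<^sup>2) * (LINT x|M. (v x)\<^sup>2)"
proof -
  have "(\<integral>\<^sup>+x. ennreal \<bar>u x\<bar> * ennreal \<bar>v x\<bar> \<partial>M)\<^sup>2 \<le>
      (\<integral>\<^sup>+x. (ennreal \<bar>u x\<bar>)\<^sup>2 \<partial>M) * (\<integral>\<^sup>+x. (ennreal \<bar>v x\<bar>)\<^sup>2 \<partial>M)"
    by (intro Cauchy_Schwarz_nn_integral) (use assms in measurable)
  moreover have "(\<integral>\<^sup>+x. ennreal \<bar>u x\<bar> * ennreal \<bar>v x\<bar> \<partial>M) = ennreal (LINT x|M. \<bar>u x * v x\<bar>)"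
    using integrable_abs[OF integrable_mult_squares[OF assms]]
    by (subst nn_integral_eq_integral[symmetric]) (simp_all add: abs_mult ennreal_mult)
  moreover have "(\<integral>\<^sup>+x. (ennreal \<bar>u x\<bar>)\<^sup>2 \<partial>M) = ennreal (LINT x|M. (u x)\<^sup>2)"
    using assms by (subst nn_integral_eq_integral[symmetric]) (auto simp: ennreal_power)
  moreover have "(\<integral>\<^sup>+x. (ennreal \<bar>v x\<bar>)\<^sup>2 \<partial>M) = ennreal (LINT x|M. (v x)\<^sup>2)"
    using assms by (subst nn_integral_eq_integral[symmetric]) (auto simp: ennreal_power)
  ultimately have "ennreal ((LINT x|M. \<bar>u x * v x\<bar>)\<^sup>2) \<le>
      ennreal ((LINT x|M. (u x)\<^sup>2) * (LINT x|M. (v x)\<^sup>2))"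
    by (simp add: ennreal_power ennreal_mult)
  then show ?thesis by (subst (asm) ennreal_le_iff) auto
qed

text \<open>By Cauchy-Schwarz the pairings differ by at most the product of one norm and the
  distance. This lets test functions be replaced by their limits in \<open>H10\<close> in an
  integration by parts.\<close>

lemma integral_mult_L2_tendsto:
  fixes u v :: "'a \<Rightarrow> real"
  assumes u: "u \<in> borel_measurable M" "integrable M (\<lambda>x. (u x)\<^sup>2)"
    and v: "v \<in> borel_measurable M" "integrable M (\<lambda>x. (v x)\<^sup>2)"
    and \<psi>: "\<And>k. \<psi> k \<in> borel_measurable M" "\<And>k. integrable M (\<lambda>x. (\<psi> k x)\<^sup>2)"
    and lim: "(\<lambda>k. LINT x|M. (v x - \<psi> k x)\<^sup>2) \<longlonglongrightarrow> 0"
  shows "(\<lambda>k. LINT x|M. u x * \<psi> k x) \<longlonglongrightarrow> (LINT x|M. u x * v x)"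
proof -
  have bnd: "\<bar>(LINT x|M. u x * v x) - (LINT x|M. u x * \<psi> k x)\<bar> \<le>
      sqrt ((LINT x|M. (u x)\<^sup>2) * (LINT x|M. (v x - \<psi> k x)\<^sup>2))" for k
  proof -
    have "(LINT x|M. u x * v x) - (LINT x|M. u x * \<psi> k x) = (LINT x|M. u x * (v x - \<psi> k x))"
      using integrable_mult_squares[OF u v] integrable_mult_squares[OF u \<psi>[of k]]
      by (simp add: algebra_simps)
    moreover have "(LINT x|M. \<bar>u x * (v x - \<psi> k x)\<bar>)\<^sup>2 \<le>
        (LINT x|M. (u x)\<^sup>2) * (LINT x|M. (v x - \<psi> k x)\<^sup>2)"
      using Cauchy_Schwarz_abs_integral[OF u _ integrable_diff_squared[OF v \<psi>[of k]]] v \<psi>[of k] by auto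
    ultimately show ?thesis
      using order_trans[OF integral_abs_bound real_le_rsqrt] by (metis (no_types))
  qed
  have "(\<lambda>k. sqrt ((LINT x|M. (u x)\<^sup>2) * (LINT x|M. (v x - \<psi> k x)\<^sup>2))) \<longlonglongrightarrow> sqrt ((LINT x|M. (u x)\<^sup>2) * 0)"
    by (rule tendsto_real_sqrt[OF tendsto_mult[OF tendsto_const lim]])
  then have "(\<lambda>k. (LINT x|M. u x * v x) - (LINT x|M. u x * \<psi> k x)) \<longlonglongrightarrow> 0"
    unfolding mult_zero_right real_sqrt_zero
    by (rule Lim_null_comparison[rotated], intro always_eventually allI) (simp only: real_norm_def bnd)
  from tendsto_diff[OF tendsto_const[of "LINT x|M. u x * v x"] this] show ?thesis by simp
qed

text \<open>At almost every point the averages over cubes with corner x and side h tend to the value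
  at x. A negative value would make a small average negative, against the hypothesis on
  boxes.\<close>

lemma L1loc_cbox_ae:
  fixes w :: "'a::euclidean_space \<Rightarrow> real"
  assumes C: "w \<in> L1loc S" "cbox c d \<subseteq> S"
    and nn: "\<And>a b. cbox a b \<subseteq> S \<Longrightarrow> (LINT x|lebesgue_on (box a b). w x) \<ge> 0"
  shows "AE x in lborel. x \<in> box c d \<longrightarrow> w x \<ge> 0"
proof -
  \<comment> \<open>The differentiation theorem wants a function integrable over every box, hence
    the extension by zero.\<close>
  define f where "f x = (if x \<in> cbox c d then w x else 0)" for x
  have int: "integrable (lebesgue_on (cbox c d)) w"
    using C by (auto simp: L1loc_def)
  then have "integrable lebesgue f"
    by (subst (asm) integrable_restrict_space)
      (auto simp: f_def[abs_def] indicator_def if_distrib[of "\<lambda>t. t * _"] of_bool_def cong: if_cong)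
  then have "integrable (lebesgue_on (cbox a b)) f" for a b
    using integrable_mult_indicator[of "cbox a b" lebesgue f] by (subst integrable_restrict_space) auto
  then have f_int: "f integrable_on cbox a b" for a b
    by (intro integrable_on_lebesgue_on) auto
  from integrable_ccontinuous_explicit[OF f_int] obtain N where N: "negligible N"
    "\<And>x e. x \<notin> N \<Longrightarrow> 0 < e \<Longrightarrow> \<exists>d>0. \<forall>h. 0 < h \<and> h < d \<longrightarrow>
        norm (integral (cbox x (x + h *\<^sub>R One)) f /\<^sub>R h ^ DIM('a) - f x) < e"
    by blast
  have "w x \<ge> 0" if x: "x \<in> box c d" "x \<notin> N" for x
  proof (rule ccontr)
    assume "\<not> 0 \<le> w x"
    then have fx: "f x < 0" using x box_subset_cbox[of c d] by (auto simp: f_def)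
    from N(2)[OF x(2), of "- f x"] fx obtain D where D: "D > 0" "\<And>h. 0 < h \<Longrightarrow> h < D \<Longrightarrow>
        \<bar>integral (cbox x (x + h *\<^sub>R One)) f /\<^sub>R h ^ DIM('a) - f x\<bar> < - f x" by auto
    obtain e where e: "e > 0" "ball x e \<subseteq> box c d"
      using x(1) open_box open_contains_ball by blast
    \<comment> \<open>The cube with corner x and side h has diameter h times the norm of
      \<open>One\<close>; this choice keeps it inside the ball of radius e, while h < D keeps the
      average close to the value.\<close>
    define h where "h = min D (e / norm (One::'a)) / 2"
    have no: "norm (One::'a) > 0" by (simp only: zero_less_norm_iff) (simp add: euclidean_eq_iff[of One])
    have h: "0 < h" "h < D" "h * norm (One::'a) < e"
    proof -
      show "0 < h" using D(1) e(1) no by (auto simp: h_def)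
      show "h < D" using D(1) e(1) no by (auto simp: h_def)
      have "0 < e / norm (One::'a)" using e no by simp
      moreover have "h \<le> (e / norm (One::'a)) / 2"
        unfolding h_def by (intro divide_right_mono) auto
      moreover have "q / 2 < q" if "q > 0" for q :: real using that by simp
      ultimately have "h < e / norm (One::'a)" by (meson le_less_trans)
      then show "h * norm (One::'a) < e" using no by (simp add: pos_less_divide_eq)
    qed
    have sub: "cbox x (x + h *\<^sub>R One) \<subseteq> box c d"
    proof
      fix y assume y: "y \<in> cbox x (x + h *\<^sub>R One)"
      have "norm (y - x) \<le> norm (h *\<^sub>R (One::'a))"
        using y h(1) by (intro norm_le_componentwise) (auto simp: mem_box inner_diff_left inner_add_left)
      then have "dist x y < e" using h by (simp add: dist_norm norm_minus_commute)
      then show "y \<in> box c d" using e(2) by auto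
    qed
    have fi: "integrable (lebesgue_on (cbox x (x + h *\<^sub>R One))) w"
      using C(1) sub C(2) box_subset_cbox[of c d] by (auto simp: L1loc_def)
    have "integral (cbox x (x + h *\<^sub>R One)) f = integral (cbox x (x + h *\<^sub>R One)) w"
      using sub box_subset_cbox[of c d] by (intro integral_cong) (auto simp: f_def)
    also have "\<dots> = integral (box x (x + h *\<^sub>R One)) w"
      by (rule integral_open_interval[symmetric])
    also have "\<dots> = (LINT x|lebesgue_on (box x (x + h *\<^sub>R One)). w x)"
    proof (rule lebesgue_integral_eq_integral[symmetric])
      show "integrable (lebesgue_on (box x (x + h *\<^sub>R One))) w"
      proof -
        have "integrable lebesgue (\<lambda>y. indicator (box x (x + h *\<^sub>R One)) y *\<^sub>R
            (indicator (cbox x (x + h *\<^sub>R One)) y *\<^sub>R w y))"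
        proof (rule integrable_mult_indicator)
          show "integrable lebesgue (\<lambda>y. indicator (cbox x (x + h *\<^sub>R One)) y *\<^sub>R w y)"
            using fi by (subst (asm) integrable_restrict_space) auto
        qed simp
        moreover have eq: "indicator (box x (x + h *\<^sub>R One)) y *\<^sub>R (indicator (cbox x (x + h *\<^sub>R One)) y *\<^sub>R w y) =
            indicator (box x (x + h *\<^sub>R One)) y *\<^sub>R w y" for y
          using box_subset_cbox[of x "x + h *\<^sub>R One"] by (auto simp: indicator_def)
        ultimately show ?thesis by (subst integrable_restrict_space) (simp, simp only: eq)
      qed
    qed auto
    also have "\<dots> \<ge> 0" using sub C(2) box_subset_cbox[of c d] by (intro nn) auto
    finally have "integral (cbox x (x + h *\<^sub>R One)) f /\<^sub>R h ^ DIM('a) \<ge> 0" using h(1) by simp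
    with D(2)[OF h(1,2)] show False by linarith
  qed
  moreover have "AE x in lborel. x \<notin> N"
    using N(1) AE_not_in[of N lebesgue] by (simp add: negligible_iff_null_sets AE_completion_iff)
  ultimately show ?thesis by (auto elim: eventually_mono)
qed

text \<open>The averages of \<open>w\<close> over boxes inherit the sign from the test functions, and \<open>w\<close> is almost
  everywhere the limit of its averages.\<close>

lemma fundamental_lemma_nonneg:
  fixes w :: "'a::euclidean_space \<Rightarrow> real"
  assumes "open S" and w: "w \<in> L1loc S"
    and test: "\<And>\<phi>. \<phi> \<in> test_functions S \<Longrightarrow> (\<And>x. \<phi> x \<ge> 0) \<Longrightarrow> (LINT x|lebesgue_on S. w x * \<phi> x) \<ge> 0"
  shows "AE x in lebesgue_on S. w x \<ge> 0"
proof -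
  have S: "S \<in> sets borel" using \<open>open S\<close> by auto
  have box_nn: "(LINT x|lebesgue_on (box a b). w x) \<ge> 0" if sub: "cbox a b \<subseteq> S" for a b
  proof -
    have wC: "integrable (lebesgue_on (cbox a b)) w"
      using w sub by (auto simp: L1loc_def)
    have "(\<lambda>n. LINT x|lebesgue_on S. w x * box_approx n a b x)
        = (\<lambda>n. LINT x|lebesgue_on (cbox a b). w x * box_approx n a b x)"
    proof
      fix n
      have eq: "indicator S x *\<^sub>R (w x * box_approx n a b x) =
          indicator (cbox a b) x *\<^sub>R (w x * box_approx n a b x)" for x
      proof (cases "x \<in> cbox a b")
        case False
        then have "box_approx n a b x = 0"
          using box_bump_eq_0[of x a b] subsetD[OF box_subset_cbox, of x a b]
          by (auto simp: box_approx_def)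
        then show ?thesis by simp
      qed (use sub in auto)
      show "(LINT x|lebesgue_on S. w x * box_approx n a b x)
          = (LINT x|lebesgue_on (cbox a b). w x * box_approx n a b x)"
        using S by (subst (1 2) integral_restrict_space) (simp, simp, simp only: eq)
    qed
    moreover have "(\<lambda>n. LINT x|lebesgue_on (cbox a b). w x * box_approx n a b x)
        \<longlonglongrightarrow> (LINT x|lebesgue_on (cbox a b). w x * indicator (box a b) x)"
    proof (rule integral_dominated_convergence[where w = "\<lambda>x. \<bar>w x\<bar>"])
      have ba: "box_approx n a b \<in> borel_measurable borel" for n
        using smooth_continuous[OF test_function_smooth[OF box_approx_test[OF order_refl]]]
        by (rule borel_measurable_continuous_onI)
      show "(\<lambda>x. w x * indicator (box a b) x) \<in> borel_measurable (lebesgue_on (cbox a b))"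
        using wC measurable_lebesgue_on_borel[of "indicator (box a b)"]
        by (intro borel_measurable_times) auto
      show "(\<lambda>x. w x * box_approx n a b x) \<in> borel_measurable (lebesgue_on (cbox a b))" for n
        using wC measurable_lebesgue_on_borel[OF ba]
        by (intro borel_measurable_times) auto
      show "AE x in lebesgue_on (cbox a b). norm (w x * box_approx n a b x) \<le> \<bar>w x\<bar>" for n
      proof (rule AE_I2)
        fix x
        have "box_approx n a b x \<le> 1" by (rule order_trans[OF box_approx_le indicator_le_1])
        then show "norm (w x * box_approx n a b x) \<le> \<bar>w x\<bar>"
          using box_approx_nonneg[of n a b x] by (simp add: abs_mult mult_left_le)
      qed
      show "AE x in lebesgue_on (cbox a b). (\<lambda>n. w x * box_approx n a b x) \<longlonglongrightarrow> w x * indicator (box a b) x"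
        by (intro AE_I2 tendsto_mult tendsto_const box_approx_tendsto)
    qed (use wC in simp)
    moreover have "(LINT x|lebesgue_on (cbox a b). w x * indicator (box a b) x) = (LINT x|lebesgue_on (box a b). w x)"
    proof -
      have eq: "indicator (cbox a b) x *\<^sub>R (w x * indicator (box a b) x) = indicator (box a b) x *\<^sub>R w x" for x
        using box_subset_cbox[of a b] by (auto simp: indicator_def)
      show ?thesis by (subst (1 2) integral_restrict_space) (simp, simp, simp only: eq)
    qed
    moreover have "(LINT x|lebesgue_on S. w x * box_approx n a b x) \<ge> 0" for n
      by (rule test[OF box_approx_test[OF sub] box_approx_nonneg])
    ultimately show ?thesis by (metis (no_types, lifting) LIMSEQ_le_const)
  qed
  \<comment> \<open>An open set is a countable union of closed boxes, and the boundary lost in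
    passing to the open box is null for each of them.\<close>
  obtain \<D> where D: "countable \<D>" "\<D> \<subseteq> Pow S" "\<And>X. X \<in> \<D> \<Longrightarrow> \<exists>a b. X = cbox a b" "\<Union>\<D> = S"
    using open_countable_Union_open_cbox[OF \<open>open S\<close>] by metis
  have "AE x in lborel. x \<in> X \<longrightarrow> w x \<ge> 0" if XD: "X \<in> \<D>" for X
  proof -
    obtain a b where X: "X = cbox a b" using D(3)[OF XD] by blast
    have sub: "cbox a b \<subseteq> S" using XD D(2) X by auto
    have "AE x in lborel. x \<in> box a b \<longrightarrow> w x \<ge> 0"
      by (rule L1loc_cbox_ae[OF w sub box_nn])
    moreover have "AE x in lborel. x \<notin> cbox a b - box a b"
    proof -
      have "negligible (cbox a b - box a b)" by (rule negligible_frontier_interval)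
      then show ?thesis using AE_not_in[of "cbox a b - box a b" lebesgue]
        by (simp add: negligible_iff_null_sets AE_completion_iff)
    qed
    ultimately show ?thesis unfolding X by eventually_elim auto
  qed
  then have "AE x in lborel. \<forall>X\<in>\<D>. x \<in> X \<longrightarrow> w x \<ge> 0"
    using D(1) by (subst AE_ball_countable) auto
  then show ?thesis
    unfolding AE_lebesgue_on_iff[OF S] by eventually_elim (use D(4) in auto)
qed

section \<open>Derivatives of Lipschitz functions\<close>

text \<open>The lower bound makes G an increasing bijection, and pushing Lebesgue measure forward
  under its inverse gives the interval [a, b] the mass G b - G a. The upper bound makes G map null
  sets to null sets, so this measure is absolutely continuous, and its Radon-Nikodym density is the
  derivative sought.\<close>

lemma bilipschitz_density:
  fixes G :: "real \<Rightarrow> real"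
  assumes lower: "\<And>x y. x \<le> y \<Longrightarrow> y - x \<le> G y - G x"
    and upper: "\<And>x y. x \<le> y \<Longrightarrow> G y - G x \<le> C * (y - x)"
  obtains g where "\<And>a b. a \<le> b \<Longrightarrow> (g has_integral (G b - G a)) {a..b}"
proof -
  have mono: "x \<le> y \<longleftrightarrow> G x \<le> G y" for x y
    using lower[of x y] lower[of y x] by (cases x y rule: linorder_cases) auto
  have inj: "inj G"
    using mono by (metis injI order_antisym_conv order_refl)
  have lip: "\<bar>G x - G y\<bar> \<le> C * \<bar>x - y\<bar>" for x y
    using upper[of x y] upper[of y x] lower[of x y] lower[of y x]
    by (cases "x \<le> y") (auto simp: abs_if)
  have "C-lipschitz_on UNIV G"
    using lip lip[of 0 1] by (intro lipschitz_onI) (auto simp: dist_real_def intro: order_trans[OF abs_ge_zero])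
  then have cont: "continuous_on UNIV G"
    by (rule lipschitz_on_continuous_on)
  have surj: "surj G"
  proof (rule surj_def[THEN iffD2], rule allI)
    fix y
    define r where "r = \<bar>y - G 0\<bar>"
    have "G (- r) \<le> y" "y \<le> G r"
      using lower[of "- r" 0] lower[of 0 r] by (auto simp: r_def)
    then show "\<exists>x. y = G x"
      using IVT'[of G "- r" y r] cont continuous_on_subset[of UNIV G] by (auto simp: r_def)
  qed
  define H where "H = inv G"
  have HG: "H (G x) = x" for x by (simp add: H_def inj)
  have GH: "G (H y) = y" for y by (simp add: H_def surj_f_inv_f surj)
  have H_le: "H y \<le> x \<longleftrightarrow> y \<le> G x" "x \<le> H y \<longleftrightarrow> G x \<le> y" for x y
    using mono[of "H y" x] mono[of x "H y"] by (auto simp: GH)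
  have "mono H" by (rule monoI) (simp add: H_le GH)
  then have H[measurable]: "H \<in> borel_measurable borel" by (rule borel_measurable_mono)
  define \<mu> where "\<mu> = distr lborel borel H"
  have em: "emeasure \<mu> A = emeasure lborel (H -` A)" if "A \<in> sets borel" for A
    using that by (simp add: \<mu>_def emeasure_distr)
  have vim: "H -` A = G ` A" for A
    using HG GH by (auto simp: image_iff) (metis GH)
  have ac: "absolutely_continuous lborel \<mu>"
    unfolding absolutely_continuous_def
  proof
    fix A :: "real set" assume A: "A \<in> null_sets lborel"
    then have "negligible A" by (simp add: negligible_iff_null_sets null_sets_completionI)
    then have "negligible (G ` A)"
    proof (rule negligible_locally_Lipschitz_image[rotated])
      show "\<exists>T B. open T \<and> x \<in> T \<and> (\<forall>y\<in>A \<inter> T. norm (G y - G x) \<le> B * norm (y - x))" for x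
        using lip by (intro exI[of _ UNIV] exI[of _ C]) auto
    qed simp
    then have "H -` A \<in> null_sets lebesgue"
      unfolding vim by (simp add: negligible_iff_null_sets)
    moreover have "H -` A \<in> sets borel"
      using measurable_sets[OF H, of A] A by auto
    ultimately have "H -` A \<in> null_sets lborel"
      by (simp add: null_sets_completion_iff)
    then have "emeasure \<mu> A = 0"
      using A em[of A] null_setsD2[OF A] null_setsD1[of "H -` A" lborel] by simp
    then show "A \<in> null_sets \<mu>"
      using null_setsD2[OF A] by (intro null_setsI) (auto simp: \<mu>_def)
  qed
  then obtain f where f[measurable]: "f \<in> borel_measurable lborel" and dens: "density lborel f = \<mu>"
    using sigma_finite_measure.Radon_Nikodym[OF lborel.sigma_finite_measure_axioms ac] by (auto simp: \<mu>_def)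
  have int: "(\<integral>\<^sup>+x. f x * indicator {a..b} x \<partial>lborel) = ennreal (G b - G a)" if "a \<le> b" for a b
  proof -
    have "H -` {a..b} = {G a..G b}" by (auto simp: H_le)
    then have "emeasure \<mu> {a..b} = ennreal (G b - G a)"
      using that mono[of a b] by (simp add: em)
    then show ?thesis by (simp add: dens[symmetric] emeasure_density)
  qed
  \<comment> \<open>The density is extended-real valued; finite mass on every bounded interval makes
    it finite almost everywhere.\<close>
  have "AE x in lborel. f x * indicator {- real n..real n} x \<noteq> \<infinity>" for n
  proof (rule nn_integral_PInf_AE)
    show "(\<integral>\<^sup>+x. f x * indicator {- real n..real n} x \<partial>lborel) \<noteq> \<infinity>"
      by (subst int) auto
  qed measurable
  then have "AE x in lborel. \<forall>n::nat. f x * indicator {- real n..real n} x \<noteq> \<infinity>"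
    unfolding AE_all_countable by blast
  then have fin: "AE x in lborel. f x \<noteq> \<infinity>"
  proof eventually_elim
    case (elim x)
    obtain n :: nat where "\<bar>x\<bar> \<le> real n" using real_arch_simple by blast
    then show ?case using elim[rule_format, of n] by (auto simp: indicator_def abs_le_iff split: if_splits)
  qed
  have "((\<lambda>x. enn2real (f x)) has_integral (G b - G a)) {a..b}" if "a \<le> b" for a b
  proof -
    have "(\<integral>\<^sup>+x. ennreal (enn2real (f x) * indicator {a..b} x) \<partial>lborel) = (\<integral>\<^sup>+x. f x * indicator {a..b} x \<partial>lborel)"
      using fin by (intro nn_integral_cong_AE) (auto elim!: eventually_mono simp: indicator_def less_top)
    then have "has_bochner_integral lborel (\<lambda>x. enn2real (f x) * indicator {a..b} x) (G b - G a)"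
      using that mono[of a b] by (intro has_bochner_integral_nn_integral) (auto simp: int)
    then have "((\<lambda>x. enn2real (f x) * indicator {a..b} x) has_integral (G b - G a)) UNIV"
      using has_integral_integral_lborel by (metis has_bochner_integral_iff)
    then have "((\<lambda>x. if x \<in> {a..b} then enn2real (f x) else 0) has_integral (G b - G a)) UNIV"
      by (rule has_integral_eq[rotated]) auto
    then show ?thesis by (simp only: has_integral_restrict_UNIV)
  qed
  then show thesis by (rule that)
qed

text \<open>In dimension one the cubes of the differentiation theorem are the intervals [s, s + h],
  so what is obtained is a right derivative. The fixed step sizes 1/(n + 1) are enough and keep the
  limits Borel measurable.\<close>

lemma right_difference_quotients_tendsto:
  fixes g :: "real \<Rightarrow> real"
  assumes "\<And>a b. a \<le> b \<Longrightarrow> (g has_integral (G b - G a)) {a..b}"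
  shows "AE s in lborel. (\<lambda>n. (G (s + inverse (real (Suc n))) - G s) * real (Suc n)) \<longlonglongrightarrow> g s"
proof -
  have "g integrable_on cbox a b" for a b
    using assms[of a b] by (cases "a \<le> b") auto
  from integrable_ccontinuous_explicit[OF this] obtain N where N: "negligible N"
    "\<And>x e. x \<notin> N \<Longrightarrow> 0 < e \<Longrightarrow> \<exists>d>0. \<forall>h. 0 < h \<and> h < d \<longrightarrow>
        norm (integral (cbox x (x + h *\<^sub>R One)) g /\<^sub>R h ^ DIM(real) - g x) < e"
    by blast
  have "(\<lambda>n. (G (s + inverse (real (Suc n))) - G s) * real (Suc n)) \<longlonglongrightarrow> g s" if s: "s \<notin> N" for s
  proof (rule LIMSEQ_I)
    fix e :: real assume "e > 0"
    from N(2)[OF s this] obtain d where d: "d > 0"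
      "\<And>h. 0 < h \<Longrightarrow> h < d \<Longrightarrow> norm (integral {s..s + h} g / h - g s) < e"
      by (auto simp: divide_inverse mult.commute)
    obtain n0 where n0: "inverse (real (Suc n0)) < d" using reals_Archimedean[OF d(1)] by blast
    show "\<exists>no. \<forall>n\<ge>no. norm ((G (s + inverse (real (Suc n))) - G s) * real (Suc n) - g s) < e"
    proof (intro exI allI impI)
      fix n assume "n \<ge> n0"
      define h where "h = inverse (real (Suc n))"
      have "h \<le> inverse (real (Suc n0))"
        unfolding h_def using \<open>n \<ge> n0\<close> by (intro le_imp_inverse_le) auto
      then have "norm (integral {s..s + h} g / h - g s) < e"
        using n0 by (intro d(2) le_less_trans[OF _ n0]) (auto simp: h_def)
      moreover have "integral {s..s + h} g = G (s + h) - G s"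
        by (intro integral_unique assms) (simp add: h_def)
      moreover have "x / h = x * real (Suc n)" for x by (simp add: h_def field_simps)
      ultimately show "norm ((G (s + inverse (real (Suc n))) - G s) * real (Suc n) - g s) < e"
        by (simp only: h_def)
    qed
  qed
  moreover have "AE x in lborel. x \<notin> N"
    using N(1) AE_not_in[of N lebesgue] by (simp add: negligible_iff_null_sets AE_completion_iff)
  ultimately show ?thesis by (auto elim: eventually_mono)
qed

text \<open>Adding the slope L + 1 turns slopes between -L and L into slopes between 1 and 2 L + 1,
  which is the situation of \<open>bilipschitz_density\<close>; the slope is subtracted again from
  the limit.\<close>

lemma lipschitz_real_AE_convergent:
  fixes F :: "real \<Rightarrow> real"
  assumes "L-lipschitz_on UNIV F"
  shows "AE s in lborel. convergent (\<lambda>n. (F (s + inverse (real (Suc n))) - F s) * real (Suc n))"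
proof -
  define G where "G x = F x + (L + 1) * x" for x
  have F: "\<bar>F y - F x\<bar> \<le> L * (y - x)" if "x \<le> y" for x y
    using lipschitz_onD[OF assms, of y x] that by (simp add: dist_real_def)
  have lower: "y - x \<le> G y - G x" and upper: "G y - G x \<le> (2 * L + 1) * (y - x)" if "x \<le> y" for x y
    using F[OF that] by (auto simp: G_def abs_le_iff algebra_simps)
  obtain g where g: "\<And>a b. a \<le> b \<Longrightarrow> (g has_integral (G b - G a)) {a..b}"
    using bilipschitz_density[of G, OF lower upper] by metis
  have "AE s in lborel. (\<lambda>n. (G (s + inverse (real (Suc n))) - G s) * real (Suc n)) \<longlonglongrightarrow> g s"
    by (rule right_difference_quotients_tendsto[OF g])
  then show ?thesis
  proof eventually_elim
    case (elim s)
    have "(F (s + inverse (real (Suc n))) - F s) * real (Suc n) =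
        (G (s + inverse (real (Suc n))) - G s) * real (Suc n) - (L + 1)" for n
      by (simp add: G_def field_simps)
    then show ?case
      using tendsto_diff[OF elim tendsto_const[of "L + 1"]] by (simp only: convergentI)
  qed
qed

definition diff_quot :: "('a::euclidean_space \<Rightarrow> real) \<Rightarrow> 'a \<Rightarrow> nat \<Rightarrow> 'a \<Rightarrow> real" where
  "diff_quot u e n x = (u (x + inverse (real (Suc n)) *\<^sub>R e) - u x) * real (Suc n)"

text \<open>A one-sided directional derivative along the steps 1/(n + 1), with an arbitrary value
  where the limit fails to exist. It is a Borel function for Borel \<open>u\<close>, and for
  Lipschitz \<open>u\<close> it serves as a concrete weak derivative.\<close>

definition ddir :: "('a::euclidean_space \<Rightarrow> real) \<Rightarrow> 'a \<Rightarrow> 'a \<Rightarrow> real" where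
  "ddir u e x = lim (\<lambda>n. diff_quot u e n x)"

lemma lipschitz_borel_measurable:
  fixes u :: "'a::euclidean_space \<Rightarrow> real"
  shows "L-lipschitz_on UNIV u \<Longrightarrow> u \<in> borel_measurable borel"
  by (intro borel_measurable_continuous_onI lipschitz_on_continuous_on)

lemma diff_quot_measurable [measurable]:
  assumes [measurable]: "u \<in> borel_measurable borel"
  shows "diff_quot u e n \<in> borel_measurable borel"
  unfolding diff_quot_def[abs_def] by measurable

lemma ddir_measurable [measurable]:
  assumes [measurable]: "u \<in> borel_measurable borel"
  shows "ddir u e \<in> borel_measurable borel"
  unfolding ddir_def[abs_def] by measurable

lemma diff_quot_bound:
  assumes "L-lipschitz_on UNIV u" shows "\<bar>diff_quot u e n x\<bar> \<le> L * norm e"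
proof -
  have "\<bar>u (x + inverse (real (Suc n)) *\<^sub>R e) - u x\<bar> \<le> L * (inverse (real (Suc n)) * norm e)"
    using lipschitz_onD[OF assms, of "x + inverse (real (Suc n)) *\<^sub>R e" x] by (simp add: dist_norm)
  then have "\<bar>u (x + inverse (real (Suc n)) *\<^sub>R e) - u x\<bar> * real (Suc n)
      \<le> L * (inverse (real (Suc n)) * norm e) * real (Suc n)"
    by (intro mult_right_mono) auto
  also have "\<dots> = L * norm e" by simp
  finally show ?thesis by (simp add: diff_quot_def abs_mult)
qed

lemma nn_integral_lborel_shift:
  fixes f :: "'a::euclidean_space \<Rightarrow> ennreal"
  assumes "f \<in> borel_measurable borel"
  shows "(\<integral>\<^sup>+x. f (x + c) \<partial>lborel) = (\<integral>\<^sup>+x. f x \<partial>lborel)"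
proof -
  have "(\<integral>\<^sup>+x. f x \<partial>lborel) = (\<integral>\<^sup>+x. f x \<partial>distr lborel borel ((+) c))"
    by (simp add: lborel_distr_plus)
  also have "\<dots> = (\<integral>\<^sup>+x. f (x + c) \<partial>lborel)"
    using assms by (subst nn_integral_distr) (auto simp: add.commute)
  finally show ?thesis ..
qed

lemma lborel_shift:
  fixes f :: "'a::euclidean_space \<Rightarrow> real"
  assumes [measurable]: "f \<in> borel_measurable borel"
  shows "integrable lborel (\<lambda>x. f (x + c)) \<longleftrightarrow> integrable lborel f"
    and "(LINT x|lborel. f (x + c)) = (LINT x|lborel. f x)"
proof -
  have "integrable lborel f \<longleftrightarrow> integrable (distr lborel borel ((+) c)) f"
    by (simp add: lborel_distr_plus)
  also have "\<dots> \<longleftrightarrow> integrable lborel (\<lambda>x. f (x + c))"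
    by (subst integrable_distr_eq) (auto simp: add.commute)
  finally show "integrable lborel (\<lambda>x. f (x + c)) \<longleftrightarrow> integrable lborel f" by simp
  have "(LINT x|lborel. f x) = (LINT x|distr lborel borel ((+) c). f x)"
    by (simp add: lborel_distr_plus)
  also have "\<dots> = (LINT x|lborel. f (x + c))"
    by (subst integral_distr) (auto simp: add.commute)
  finally show "(LINT x|lborel. f (x + c)) = (LINT x|lborel. f x)" ..
qed

text \<open>A Borel set that meets every line parallel to \<open>e\<close> in a null set is a null set, by Tonelli
  and translation invariance.\<close>

lemma AE_lborel_lines:
  fixes e :: "'a::euclidean_space"
  assumes P[measurable]: "Measurable.pred borel P"
    and lines: "\<And>x. AE s in lborel. P (x + s *\<^sub>R e)"
  shows "AE x in lborel. P x"
proof -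
  define B where "B = {x. \<not> P x}"
  have B[measurable]: "B \<in> sets borel" unfolding B_def by measurable
  \<comment> \<open>The set is integrated over all its translates s e with s in [0, 1]. Integrating
    in s first gives 0 by the hypothesis on lines; integrating in x first gives the measure of B,
    because the window has length one.\<close>
  define J where "J = (\<integral>\<^sup>+s. (\<integral>\<^sup>+x. indicator {0..1::real} s * indicator B (x + s *\<^sub>R e) \<partial>lborel) \<partial>lborel)"
  have "J = (\<integral>\<^sup>+x. (\<integral>\<^sup>+s. indicator {0..1::real} s * indicator B (x + s *\<^sub>R e) \<partial>lborel) \<partial>lborel)"
    unfolding J_def by (rule lborel_pair.Fubini') measurable
  also have "\<dots> = (\<integral>\<^sup>+(x::'a). 0 \<partial>lborel)"
  proof (rule nn_integral_cong)
    fix x :: 'a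
    have "(\<integral>\<^sup>+s. indicator {0..1::real} s * indicator B (x + s *\<^sub>R e) \<partial>lborel) = (\<integral>\<^sup>+(s::real). 0 \<partial>lborel)"
      using lines[of x] by (intro nn_integral_cong_AE) (auto elim!: eventually_mono simp: B_def)
    then show "(\<integral>\<^sup>+s. indicator {0..1::real} s * indicator B (x + s *\<^sub>R e) \<partial>lborel) = 0" by simp
  qed
  finally have "J = 0" by simp
  have "J = (\<integral>\<^sup>+s. indicator {0..1::real} s * emeasure lborel B \<partial>lborel)"
    unfolding J_def
  proof (rule nn_integral_cong)
    fix s :: real
    have "(\<integral>\<^sup>+x. indicator {0..1} s * indicator B (x + s *\<^sub>R e) \<partial>lborel) =
        indicator {0..1} s * (\<integral>\<^sup>+x. indicator B (x + s *\<^sub>R e) \<partial>lborel)"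
      by (rule nn_integral_cmult) measurable
    also have "(\<integral>\<^sup>+x. indicator B (x + s *\<^sub>R e) \<partial>lborel) = emeasure lborel B"
      by (subst nn_integral_lborel_shift) auto
    finally show "(\<integral>\<^sup>+x. indicator {0..1} s * indicator B (x + s *\<^sub>R e) \<partial>lborel) =
        indicator {0..1} s * emeasure lborel B" .
  qed
  also have "\<dots> = emeasure lborel B"
    by (subst nn_integral_multc) auto
  finally have "emeasure lborel B = 0" using \<open>J = 0\<close> by simp
  then show ?thesis
    by (intro AE_I[of _ _ B]) (auto simp: B_def)
qed

text \<open>On each line parallel to e the function is a Lipschitz function of one variable, and the
  exceptional parameters form a null set. The Cauchy property is used because it is visibly a Borel
  condition, as the passage from lines to the whole space requires.\<close>

lemma lipschitz_AE_ddir: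
  fixes u :: "'a::euclidean_space \<Rightarrow> real"
  assumes u: "L-lipschitz_on UNIV u"
  shows "AE x in lborel. (\<lambda>n. diff_quot u e n x) \<longlonglongrightarrow> ddir u e x"
proof -
  have [measurable]: "u \<in> borel_measurable borel" by (rule lipschitz_borel_measurable[OF u])
  have "AE x in lborel. Cauchy (\<lambda>n. diff_quot u e n x)"
  proof (rule AE_lborel_lines)
    show "Measurable.pred borel (\<lambda>x. Cauchy (\<lambda>n. diff_quot u e n x))" by measurable
    fix x
    have "(L * norm e)-lipschitz_on UNIV (\<lambda>s. u (x + s *\<^sub>R e))"
    proof (rule lipschitz_onI)
      fix s t :: real
      have "dist (u (x + s *\<^sub>R e)) (u (x + t *\<^sub>R e)) \<le> L * dist (x + s *\<^sub>R e) (x + t *\<^sub>R e)"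
        by (rule lipschitz_onD[OF u]) auto
      also have "dist (x + s *\<^sub>R e) (x + t *\<^sub>R e) = dist s t * norm e"
        by (simp add: dist_norm scaleR_diff_left[symmetric])
      finally show "dist (u (x + s *\<^sub>R e)) (u (x + t *\<^sub>R e)) \<le> L * norm e * dist s t"
        by (simp add: ac_simps)
    qed (use lipschitz_on_nonneg[OF u] in auto)
    from lipschitz_real_AE_convergent[OF this]
    show "AE s in lborel. Cauchy (\<lambda>n. diff_quot u e n (x + s *\<^sub>R e))"
    proof eventually_elim
      case (elim s)
      then show ?case
        by (simp add: Cauchy_convergent_iff diff_quot_def scaleR_add_left add.assoc)
    qed
  qed
  then show ?thesis
    by eventually_elim (simp add: ddir_def Cauchy_convergent_iff convergent_LIMSEQ_iff)
qed

lemma AE_ddir_bound: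
  assumes "L-lipschitz_on UNIV u"
  shows "AE x in lborel. \<bar>ddir u e x\<bar> \<le> L * norm e"
  using lipschitz_AE_ddir[OF assms, of e]
proof eventually_elim
  case (elim x)
  then show ?case
    using diff_quot_bound[OF assms]
    by (intro LIMSEQ_le_const2[OF tendsto_rabs[OF elim]]) auto
qed

section \<open>Test functions against locally integrable functions\<close>

lemma continuous_compact_support_bounded:
  fixes f :: "'a::euclidean_space \<Rightarrow> real"
  assumes "continuous_on UNIV f" "compact C" "\<And>x. x \<notin> C \<Longrightarrow> f x = 0"
  obtains B where "B \<ge> 0" "\<And>x. \<bar>f x\<bar> \<le> B"
proof -
  have "bounded (f ` C)"
    using assms by (intro compact_imp_bounded compact_continuous_image) (auto intro: continuous_on_subset)
  then obtain B where B: "\<And>x. x \<in> C \<Longrightarrow> \<bar>f x\<bar> \<le> B"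
    by (auto simp: bounded_iff)
  have "\<bar>f x\<bar> \<le> max 0 B" for x
    using B[of x] assms(3)[of x] by (cases "x \<in> C") auto
  then show thesis by (intro that[of "max 0 B"]) auto
qed

lemma continuous_compact_support_integrable:
  fixes f :: "'a::euclidean_space \<Rightarrow> real"
  assumes "continuous_on UNIV f" "compact C" "\<And>x. x \<notin> C \<Longrightarrow> f x = 0"
  shows "integrable lborel f"
proof -
  have "integrable lborel (\<lambda>x. indicator C x *\<^sub>R f x)"
    using assms by (intro borel_integrable_compact) (auto intro: continuous_on_subset)
  moreover have "(\<lambda>x. indicator C x *\<^sub>R f x) = f"
    using assms(3) by (auto simp: fun_eq_iff indicator_def)
  ultimately show ?thesis by (simp only:)
qed

lemma frechet_derivative_components:
  fixes f :: "'a::euclidean_space \<Rightarrow> real"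
  assumes "f differentiable (at x)"
  shows "frechet_derivative f (at x) e = (\<Sum>i\<in>Basis. (e \<bullet> i) * frechet_derivative f (at x) i)"
proof -
  have bl: "bounded_linear (frechet_derivative f (at x))"
    using assms frechet_derivative_works has_derivative_bounded_linear by blast
  have "frechet_derivative f (at x) (\<Sum>i\<in>Basis. (e \<bullet> i) *\<^sub>R i)
      = (\<Sum>i\<in>Basis. frechet_derivative f (at x) ((e \<bullet> i) *\<^sub>R i))"
    by (rule linear_sum[OF bounded_linear.linear[OF bl]])
  also have "\<dots> = (\<Sum>i\<in>Basis. (e \<bullet> i) * frechet_derivative f (at x) i)"
    using linear_scale[OF bounded_linear.linear[OF bl]] by simp
  finally show ?thesis by (simp only: euclidean_representation)
qed

lemma smooth_differentiable: "smooth f \<Longrightarrow> f differentiable (at x)"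
  using smooth_has_derivative differentiable_def by blast

lemma smooth_frechet_derivative_continuous:
  assumes "smooth \<phi>"
  shows "continuous_on UNIV (\<lambda>x. frechet_derivative \<phi> (at x) e)"
proof -
  have "continuous_on UNIV (\<lambda>x. \<Sum>i\<in>Basis. (e \<bullet> i) * frechet_derivative \<phi> (at x) i)"
    using smooth_continuous[OF smooth_partial[OF assms]]
    by (intro continuous_on_sum continuous_on_mult continuous_on_const) auto
  then show ?thesis
    by (subst frechet_derivative_components[OF smooth_differentiable[OF assms]])
qed

lemma test_function_lipschitz:
  assumes \<phi>: "smooth \<phi>" "compact C" "\<And>x. x \<notin> C \<Longrightarrow> \<phi> x = 0"
  obtains B where "B-lipschitz_on UNIV \<phi>"
proof -
  have "\<exists>B\<ge>0. \<forall>x. \<bar>frechet_derivative \<phi> (at x) i\<bar> \<le> B" for i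
    using continuous_compact_support_bounded[OF smooth_frechet_derivative_continuous[OF \<phi>(1), of i] \<phi>(2)
        test_function_deriv_eq_0[OF \<phi>(2,3)]] by metis
  then obtain B where B: "\<And>i. B i \<ge> 0" "\<And>i x. \<bar>frechet_derivative \<phi> (at x) i\<bar> \<le> B i" by metis
  define K where "K = (\<Sum>i\<in>Basis. B i)"
  have "K \<ge> 0" unfolding K_def by (rule sum_nonneg) (rule B)
  have "onorm (frechet_derivative \<phi> (at x)) \<le> K" for x
  proof (rule onorm_le)
    fix h
    have "norm (frechet_derivative \<phi> (at x) h) \<le> (\<Sum>i\<in>Basis. \<bar>(h \<bullet> i) * frechet_derivative \<phi> (at x) i\<bar>)"
      unfolding frechet_derivative_components[OF smooth_differentiable[OF \<phi>(1)], of x h] real_norm_def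
      by (rule sum_abs)
    also have "\<dots> \<le> (\<Sum>i\<in>Basis. B i * norm h)"
    proof (rule sum_mono)
      fix i :: 'a assume "i \<in> Basis"
      then show "\<bar>(h \<bullet> i) * frechet_derivative \<phi> (at x) i\<bar> \<le> B i * norm h"
        unfolding abs_mult mult.commute[of "B i"] by (intro mult_mono Basis_le_norm B) auto
    qed
    also have "\<dots> = K * norm h" by (simp add: K_def sum_distrib_right)
    finally show "norm (frechet_derivative \<phi> (at x) h) \<le> K * norm h" .
  qed
  then have "norm (\<phi> x - \<phi> y) \<le> K * norm (x - y)" for x y
    by (intro differentiable_bound[of UNIV \<phi> "\<lambda>x. frechet_derivative \<phi> (at x)"] convex_UNIV
        smooth_has_derivative[OF \<phi>(1)]) auto
  then have "K-lipschitz_on UNIV \<phi>"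
    by (intro lipschitz_onI \<open>K \<ge> 0\<close>) (simp add: dist_norm)
  then show thesis by (rule that)
qed

lemma diff_quot_tendsto:
  assumes "f differentiable (at x)"
  shows "(\<lambda>n. diff_quot f e n x) \<longlonglongrightarrow> frechet_derivative f (at x) e"
proof -
  let ?D = "frechet_derivative f (at x)"
  have D: "(f has_derivative ?D) (at x)" using assms frechet_derivative_works by blast
  have "((\<lambda>s::real. x + s *\<^sub>R e) has_derivative (\<lambda>s. s *\<^sub>R e)) (at 0)"
    by (auto intro!: derivative_eq_intros)
  from diff_chain_at[OF this, of f ?D] D
  have "((\<lambda>s. f (x + s *\<^sub>R e)) has_derivative (\<lambda>s. ?D (s *\<^sub>R e))) (at 0)"
    by (simp add: o_def)
  moreover have "?D (s *\<^sub>R e) = ?D e * s" for s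
    using linear_scale[OF bounded_linear.linear[OF has_derivative_bounded_linear[OF D]], of s e]
    by simp
  ultimately have "((\<lambda>s. f (x + s *\<^sub>R e)) has_real_derivative ?D e) (at 0)"
    by (simp only: has_field_derivative_def)
  then have "((\<lambda>h. (f (x + h *\<^sub>R e) - f x) / h) \<longlongrightarrow> ?D e) (at 0)"
    by (simp add: DERIV_def)
  moreover have "filterlim (\<lambda>n. inverse (real (Suc n))) (at 0) sequentially"
    using LIMSEQ_inverse_real_of_nat by (auto simp: filterlim_at)
  ultimately have "(\<lambda>n. (f (x + inverse (real (Suc n)) *\<^sub>R e) - f x) / inverse (real (Suc n))) \<longlonglongrightarrow> ?D e"
    by (rule filterlim_compose)
  then show ?thesis by (simp only: diff_quot_def divide_inverse inverse_inverse_eq)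
qed

lemma L1loc_mult_continuous:
  fixes w :: "'a::euclidean_space \<Rightarrow> real"
  assumes S: "S \<in> sets borel" and w: "w \<in> L1loc S" and f: "continuous_on UNIV f"
    and C: "compact C" "C \<subseteq> S" "\<And>x. x \<notin> C \<Longrightarrow> f x = 0"
  shows "integrable (lebesgue_on S) (\<lambda>x. w x * f x)"
proof -
  obtain B where B: "B \<ge> 0" "\<And>x. \<bar>f x\<bar> \<le> B"
    using continuous_compact_support_bounded[OF f C(1,3)] by blast
  have Cb: "C \<in> sets borel" using C(1) by (simp add: compact_imp_closed)
  have "integrable (lebesgue_on C) w" using w C by (auto simp: L1loc_def)
  then have iw: "integrable lebesgue (\<lambda>x. indicator C x *\<^sub>R w x)"
    using Cb by (subst (asm) integrable_restrict_space) auto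
  have fm: "f \<in> borel_measurable lebesgue"
    using borel_measurable_continuous_onI[OF f] by (auto intro: measurable_completion)
  have "integrable lebesgue (\<lambda>x. (indicator C x *\<^sub>R w x) * f x)"
  proof (rule Bochner_Integration.integrable_bound[OF integrable_mult_right[OF iw, of B]])
    show "(\<lambda>x. (indicator C x *\<^sub>R w x) * f x) \<in> borel_measurable lebesgue"
      using iw fm by (intro borel_measurable_times) auto
    show "AE x in lebesgue. norm (indicator C x *\<^sub>R w x * f x) \<le> norm (B * (indicator C x *\<^sub>R w x))"
    proof (rule AE_I2)
      fix x
      have "\<bar>indicator C x *\<^sub>R w x\<bar> * \<bar>f x\<bar> \<le> B * \<bar>indicator C x *\<^sub>R w x\<bar>"
        by (subst mult.commute) (rule mult_right_mono[OF B(2) abs_ge_zero])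
      then show "norm (indicator C x *\<^sub>R w x * f x) \<le> norm (B * (indicator C x *\<^sub>R w x))"
        using B(1) by (simp only: real_norm_def abs_mult abs_of_nonneg)
    qed
  qed
  moreover have eq: "(indicator C x *\<^sub>R w x) * f x = indicator S x *\<^sub>R (w x * f x)" for x
    using C(2,3) by (cases "x \<in> C") auto
  ultimately show ?thesis using S by (subst integrable_restrict_space) (simp, simp only: eq)
qed

lemma L1loc_mult_test:
  assumes "S \<in> sets borel" "w \<in> L1loc S" "\<phi> \<in> test_functions S"
  shows "integrable (lebesgue_on S) (\<lambda>x. w x * \<phi> x)"
proof -
  obtain C where C: "smooth \<phi>" "compact C" "C \<subseteq> S" "\<And>x. x \<notin> C \<Longrightarrow> \<phi> x = 0"
    using test_functionsD[OF assms(3)] by blast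
  show ?thesis by (rule L1loc_mult_continuous[OF assms(1,2) smooth_continuous[OF C(1)] C(2-4)])
qed

lemma L1loc_mult_test_deriv:
  assumes "S \<in> sets borel" "w \<in> L1loc S" "\<phi> \<in> test_functions S"
  shows "integrable (lebesgue_on S) (\<lambda>x. w x * frechet_derivative \<phi> (at x) e)"
proof -
  obtain C where C: "smooth \<phi>" "compact C" "C \<subseteq> S" "\<And>x. x \<notin> C \<Longrightarrow> \<phi> x = 0"
    using test_functionsD[OF assms(3)] by blast
  show ?thesis
    by (rule L1loc_mult_continuous[OF assms(1,2) smooth_frechet_derivative_continuous[OF C(1)] C(2,3)
          test_function_deriv_eq_0[OF C(2,4)]])
qed

lemma L1loc_diff:
  assumes "u \<in> L1loc S" "v \<in> L1loc S" shows "(\<lambda>x. u x - v x) \<in> L1loc S"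
  using assms by (auto simp: L1loc_def)

lemma L1loc_sum:
  assumes "\<And>i. i \<in> I \<Longrightarrow> u i \<in> L1loc S" shows "(\<lambda>x. \<Sum>i\<in>I. c i * u i x) \<in> L1loc S"
  using assms by (auto simp: L1loc_def intro!: Bochner_Integration.integrable_sum)

lemma locally_bounded_L1loc:
  fixes g :: "'a::euclidean_space \<Rightarrow> real"
  assumes g: "g \<in> borel_measurable borel"
    and bnd: "\<And>C. compact C \<Longrightarrow> \<exists>M. AE x in lborel. x \<in> C \<longrightarrow> \<bar>g x\<bar> \<le> M"
  shows "g \<in> L1loc S"
  unfolding L1loc_def
proof (clarify)
  fix C :: "'a set" assume C: "compact C" "C \<subseteq> S"
  have Cb: "C \<in> sets borel" using C(1) by (simp add: compact_imp_closed)
  interpret finite_measure "lebesgue_on C"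
    by (rule finite_measure_bounded[OF Cb compact_imp_bounded[OF C(1)]])
  obtain M where "AE x in lborel. x \<in> C \<longrightarrow> \<bar>g x\<bar> \<le> M" using bnd[OF C(1)] by blast
  then show "integrable (lebesgue_on C) g"
    by (intro integrable_const_bound[of _ M] measurable_lebesgue_on_borel g)
      (simp add: AE_lebesgue_on_iff[OF Cb])
qed

lemma continuous_L1loc:
  fixes u :: "'a::euclidean_space \<Rightarrow> real"
  assumes "continuous_on UNIV u" shows "u \<in> L1loc S"
proof (rule locally_bounded_L1loc)
  fix C :: "'a set" assume "compact C"
  then have "bounded (u ` C)"
    using assms by (intro compact_imp_bounded compact_continuous_image) (auto intro: continuous_on_subset)
  then show "\<exists>M. AE x in lborel. x \<in> C \<longrightarrow> \<bar>u x\<bar> \<le> M"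
    by (auto simp: bounded_iff)
qed (use assms in \<open>rule borel_measurable_continuous_onI\<close>)

lemma ddir_L1loc:
  assumes "L-lipschitz_on UNIV u" shows "ddir u e \<in> L1loc S"
proof (rule locally_bounded_L1loc)
  show "ddir u e \<in> borel_measurable borel"
    using lipschitz_borel_measurable[OF assms] by measurable
  show "\<exists>M. AE x in lborel. x \<in> C \<longrightarrow> \<bar>ddir u e x\<bar> \<le> M" for C
    using AE_ddir_bound[OF assms, of e] by (intro exI[of _ "L * norm e"]) (auto elim: eventually_mono)
qed

lemma integral_lebesgue_on_support:
  fixes f :: "'a::euclidean_space \<Rightarrow> real"
  assumes "S \<in> sets borel" "f \<in> borel_measurable borel" "\<And>x. x \<notin> S \<Longrightarrow> f x = 0"
  shows "(LINT x|lebesgue_on S. f x) = (LINT x|lborel. f x)"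
proof -
  have "(\<lambda>x. indicator S x * f x) = f"
    using assms(3) by (auto simp: fun_eq_iff indicator_def)
  then show ?thesis by (simp only: lebesgue_on_integral_borel(2)[OF assms(1,2)])
qed

text \<open>Summation by parts moves the difference quotient from \<open>u\<close> to the test function; then both
  sides converge by dominated convergence.\<close>

lemma lipschitz_has_weak_deriv:
  fixes u :: "'a::euclidean_space \<Rightarrow> real"
  assumes S: "S \<in> sets borel" and u: "L-lipschitz_on UNIV u"
  shows "has_weak_deriv S e u (ddir u e)"
proof -
  have uc: "continuous_on UNIV u" by (rule lipschitz_on_continuous_on[OF u])
  have um[measurable]: "u \<in> borel_measurable borel" by (rule lipschitz_borel_measurable[OF u])
  have "(LINT x|lebesgue_on S. u x * frechet_derivative \<phi> (at x) e) =
        - (LINT x|lebesgue_on S. ddir u e x * \<phi> x)" if test: "\<phi> \<in> test_functions S" for \<phi>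
  proof -
    obtain C where C: "smooth \<phi>" "compact C" "C \<subseteq> S" "\<And>x. x \<notin> C \<Longrightarrow> \<phi> x = 0"
      using test_functionsD[OF test] by blast
    have \<phi>c: "continuous_on UNIV \<phi>" by (rule smooth_continuous[OF C(1)])
    have \<phi>m[measurable]: "\<phi> \<in> borel_measurable borel" by (rule borel_measurable_continuous_onI[OF \<phi>c])
    have fdm[measurable]: "(\<lambda>x. frechet_derivative \<phi> (at x) e) \<in> borel_measurable borel"
      by (rule borel_measurable_continuous_onI[OF smooth_frechet_derivative_continuous[OF C(1)]])
    obtain B where B: "B-lipschitz_on UNIV \<phi>" using test_function_lipschitz[OF C(1,2,4)] by blast
    obtain R where R: "\<And>x. x \<in> C \<Longrightarrow> norm x \<le> R"
      using compact_imp_bounded[OF C(2)] by (auto simp: bounded_iff)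
    \<comment> \<open>One compact set containing the supports of all translates of
      \<open>\<phi>\<close> by h e with h in [0, 1]; outside it all difference quotients
      vanish.\<close>
    define X where "X = cball (0::'a) (R + norm e)"
    have X: "compact X" by (simp add: X_def)
    have \<phi>X: "\<phi> (x - h *\<^sub>R e) = 0" if "x \<notin> X" "0 \<le> h" "h \<le> 1" for x h
    proof (rule C(4), rule notI)
      assume "x - h *\<^sub>R e \<in> C"
      then have "norm (x - h *\<^sub>R e) \<le> R" by (rule R)
      moreover have "norm x \<le> norm (x - h *\<^sub>R e) + norm (h *\<^sub>R e)"
        using norm_triangle_ineq[of "x - h *\<^sub>R e" "h *\<^sub>R e"] by simp
      moreover have "norm (h *\<^sub>R e) \<le> norm e"
        using that by (simp add: mult_left_le_one_le)
      ultimately show False using that(1) by (simp add: X_def)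
    qed
    have "compact (u ` X)" using X uc by (intro compact_continuous_image) (auto intro: continuous_on_subset)
    from compact_imp_bounded[OF this] obtain M where M: "\<And>x. x \<in> X \<Longrightarrow> \<bar>u x\<bar> \<le> M"
      by (auto simp: bounded_iff)
    have lim1: "(\<lambda>n. LINT x|lborel. diff_quot u e n x * \<phi> x) \<longlonglongrightarrow> (LINT x|lborel. ddir u e x * \<phi> x)"
    proof (rule integral_dominated_convergence[where w = "\<lambda>x. L * norm e * \<bar>\<phi> x\<bar>"])
      show "integrable lborel (\<lambda>x. L * norm e * \<bar>\<phi> x\<bar>)"
        using continuous_compact_support_integrable[OF \<phi>c C(2,4)] by simp
      show "AE x in lborel. (\<lambda>n. diff_quot u e n x * \<phi> x) \<longlonglongrightarrow> ddir u e x * \<phi> x"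
        using lipschitz_AE_ddir[OF u, of e] by eventually_elim (intro tendsto_mult tendsto_const)
      show "AE x in lborel. norm (diff_quot u e n x * \<phi> x) \<le> L * norm e * \<bar>\<phi> x\<bar>" for n
        using diff_quot_bound[OF u, of e n]
        by (intro AE_I2) (simp only: real_norm_def abs_mult, intro mult_right_mono abs_ge_zero)
    qed measurable
    \<comment> \<open>Translating the variable by h e in the term with u(x + h e) moves the shift
      onto the test function, as a quotient in direction -e. Both sides become the same combination
      of the integrals of \<open>k\<close> and of \<open>u * \<phi>\<close>.\<close>
    have shift: "(LINT x|lborel. diff_quot u e n x * \<phi> x) = (LINT x|lborel. u x * diff_quot \<phi> (- e) n x)" for n
    proof -
      define h where "h = inverse (real (Suc n))"
      have h: "0 \<le> h" "h \<le> 1" by (auto simp: h_def inverse_le_1_iff)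
      define k where "k x = u x * \<phi> (x - h *\<^sub>R e)" for x
      have km[measurable]: "k \<in> borel_measurable borel" unfolding k_def[abs_def] by measurable
      have "continuous_on UNIV k" unfolding k_def[abs_def]
        by (intro continuous_on_mult uc continuous_on_compose2[OF \<phi>c] continuous_intros) auto
      then have ik: "integrable lborel k"
        by (rule continuous_compact_support_integrable[OF _ X]) (simp add: k_def \<phi>X h)
      then have ik': "integrable lborel (\<lambda>x. k (x + h *\<^sub>R e))" by (simp add: lborel_shift(1))
      have iu: "integrable lborel (\<lambda>x. u x * \<phi> x)"
        by (rule continuous_compact_support_integrable[OF continuous_on_mult[OF uc \<phi>c] C(2)]) (simp add: C(4))
      have "(LINT x|lborel. diff_quot u e n x * \<phi> x) =
          (LINT x|lborel. real (Suc n) * (k (x + h *\<^sub>R e) - u x * \<phi> x))"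
        by (rule Bochner_Integration.integral_cong) (auto simp: diff_quot_def k_def h_def algebra_simps)
      also have "\<dots> = real (Suc n) * ((LINT x|lborel. k (x + h *\<^sub>R e)) - (LINT x|lborel. u x * \<phi> x))"
        using ik' iu by simp
      also have "(LINT x|lborel. k (x + h *\<^sub>R e)) = (LINT x|lborel. k x)" by (rule lborel_shift(2)[OF km])
      also have "real (Suc n) * ((LINT x|lborel. k x) - (LINT x|lborel. u x * \<phi> x)) =
          (LINT x|lborel. real (Suc n) * (k x - u x * \<phi> x))"
        using ik iu by simp
      also have "\<dots> = (LINT x|lborel. u x * diff_quot \<phi> (- e) n x)"
        by (rule Bochner_Integration.integral_cong) (auto simp: diff_quot_def k_def h_def algebra_simps)
      finally show ?thesis .
    qed
    have lim2: "(\<lambda>n. LINT x|lborel. u x * diff_quot \<phi> (- e) n x) \<longlonglongrightarrow>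
        (LINT x|lborel. u x * frechet_derivative \<phi> (at x) (- e))"
    proof (rule integral_dominated_convergence[where w = "\<lambda>x. indicator X x * (M * (B * norm e))"])
      have "(\<lambda>x. frechet_derivative \<phi> (at x) (- e)) \<in> borel_measurable borel"
        by (rule borel_measurable_continuous_onI[OF smooth_frechet_derivative_continuous[OF C(1)]])
      then show "(\<lambda>x. u x * frechet_derivative \<phi> (at x) (- e)) \<in> borel_measurable lborel"
        by measurable
      have "emeasure lborel X < \<infinity>" by (rule emeasure_lborel_bounded[OF compact_imp_bounded[OF X]])
      moreover have "X \<in> sets lborel" by (simp add: X_def)
      ultimately show "integrable lborel (\<lambda>x. indicator X x * (M * (B * norm e)))"
        by (intro integrable_mult_left integrable_real_indicator)
      show "AE x in lborel. (\<lambda>n. u x * diff_quot \<phi> (- e) n x) \<longlonglongrightarrow> u x * frechet_derivative \<phi> (at x) (- e)"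
        by (intro AE_I2 tendsto_mult tendsto_const diff_quot_tendsto smooth_differentiable[OF C(1)])
      show "AE x in lborel. norm (u x * diff_quot \<phi> (- e) n x) \<le> indicator X x * (M * (B * norm e))" for n
      proof (rule AE_I2)
        fix x
        show "norm (u x * diff_quot \<phi> (- e) n x) \<le> indicator X x * (M * (B * norm e))"
        proof (cases "x \<in> X")
          case True
          have "\<bar>u x\<bar> * \<bar>diff_quot \<phi> (- e) n x\<bar> \<le> M * (B * norm e)"
            using M[OF True] diff_quot_bound[OF B, of "- e" n x] abs_ge_zero[of "u x"]
            by (intro mult_mono) auto
          then show ?thesis using True by (simp add: abs_mult)
        next
          case False
          have "inverse (real (Suc n)) \<le> 1" by (simp add: inverse_le_1_iff)
          then have "diff_quot \<phi> (- e) n x = 0"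
            using \<phi>X[OF False, of "inverse (real (Suc n))"] \<phi>X[OF False, of 0] by (simp add: diff_quot_def)
          then show ?thesis using False by simp
        qed
      qed
    qed measurable
    have "(LINT x|lborel. ddir u e x * \<phi> x) = (LINT x|lborel. u x * frechet_derivative \<phi> (at x) (- e))"
      using LIMSEQ_unique[OF lim1[unfolded shift] lim2] .
    also have "\<dots> = (LINT x|lborel. - (u x * frechet_derivative \<phi> (at x) e))"
    proof (rule Bochner_Integration.integral_cong)
      fix x
      have "frechet_derivative \<phi> (at x) (- e) = - frechet_derivative \<phi> (at x) e"
        by (subst (1 2) frechet_derivative_components[OF smooth_differentiable[OF C(1)]])
          (simp add: sum_negf)
      then show "u x * frechet_derivative \<phi> (at x) (- e) = - (u x * frechet_derivative \<phi> (at x) e)"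
        by simp
    qed simp
    finally have main: "(LINT x|lborel. ddir u e x * \<phi> x) = - (LINT x|lborel. u x * frechet_derivative \<phi> (at x) e)"
      by simp
    have "(LINT x|lebesgue_on S. ddir u e x * \<phi> x) = (LINT x|lborel. ddir u e x * \<phi> x)"
      by (rule integral_lebesgue_on_support[OF S]) (measurable, use C in auto)
    moreover have "(LINT x|lebesgue_on S. u x * frechet_derivative \<phi> (at x) e) =
        (LINT x|lborel. u x * frechet_derivative \<phi> (at x) e)"
    proof (rule integral_lebesgue_on_support[OF S])
      fix x assume "x \<notin> S"
      then have "x \<notin> C" using C(3) by blast
      then show "u x * frechet_derivative \<phi> (at x) e = 0"
        using test_function_deriv_eq_0[OF C(2,4)] by simp
    qed measurable
    ultimately show ?thesis using main by simp
  qed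
  then show ?thesis
    unfolding has_weak_deriv_def using continuous_L1loc[OF uc] ddir_L1loc[OF u] by blast
qed

text \<open>The difference of two weak derivatives has integral zero against every test function, so
  the fundamental lemma applies to it and to its negative.\<close>

lemma has_weak_deriv_unique:
  assumes "open S" "has_weak_deriv S e u v" "has_weak_deriv S e u w"
  shows "AE x in lebesgue_on S. v x = w x"
proof -
  have S: "S \<in> sets borel" using \<open>open S\<close> by auto
  have le: "AE x in lebesgue_on S. v x - w x \<ge> 0" if v: "has_weak_deriv S e u v" and w: "has_weak_deriv S e u w" for v w
  proof (rule fundamental_lemma_nonneg[OF \<open>open S\<close>])
    show "(\<lambda>x. v x - w x) \<in> L1loc S" using v w by (intro L1loc_diff) (auto simp: has_weak_deriv_def)
    fix \<phi> assume \<phi>: "\<phi> \<in> test_functions S"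
    have "(LINT x|lebesgue_on S. (v x - w x) * \<phi> x) = (LINT x|lebesgue_on S. v x * \<phi> x - w x * \<phi> x)"
      by (simp add: left_diff_distrib)
    also have "\<dots> = (LINT x|lebesgue_on S. v x * \<phi> x) - (LINT x|lebesgue_on S. w x * \<phi> x)"
      using v w by (intro Bochner_Integration.integral_diff L1loc_mult_test[OF S _ \<phi>]) (auto simp: has_weak_deriv_def)
    also have "\<dots> = 0" using v w \<phi> by (simp add: has_weak_deriv_def)
    finally show "(LINT x|lebesgue_on S. (v x - w x) * \<phi> x) \<ge> 0" by simp
  qed
  show ?thesis
    using le[OF assms(2,3)] le[OF assms(3,2)] by eventually_elim auto
qed

lemma weak_deriv_works: "weakly_differentiable S e u \<Longrightarrow> has_weak_deriv S e u (weak_deriv S e u)"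
  unfolding weakly_differentiable_def weak_deriv_def by (erule exE) (rule someI[where P = "has_weak_deriv S e u"])

lemma weak_deriv_AE_eq:
  assumes "open S" "has_weak_deriv S e u w"
  shows "AE x in lebesgue_on S. weak_deriv S e u x = w x"
  using assms has_weak_deriv_unique[OF assms(1) weak_deriv_works assms(2)]
  by (auto simp: weakly_differentiable_def)

lemma lipschitz_weak_deriv:
  assumes "open S" "L-lipschitz_on UNIV u"
  shows "weakly_differentiable S e u" "AE x in lebesgue_on S. weak_deriv S e u x = ddir u e x"
  using lipschitz_has_weak_deriv[OF _ assms(2), of S e] weak_deriv_AE_eq[OF assms(1)] assms(1)
  by (auto simp: weakly_differentiable_def)

text \<open>One-sided limits along a line are not linear in the direction pointwise. Weak
  derivatives are, because the derivative of the test function is linear; uniqueness of weak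
  derivatives then carries linearity over almost everywhere.\<close>

lemma ddir_sum:
  fixes u :: "'a::euclidean_space \<Rightarrow> real"
  assumes u: "L-lipschitz_on UNIV u" and I: "finite I"
  shows "AE x in lborel. ddir u (\<Sum>i\<in>I. c i *\<^sub>R e i) x = (\<Sum>i\<in>I. c i * ddir u (e i) x)"
proof -
  let ?E = "\<Sum>i\<in>I. c i *\<^sub>R e i"
  have wd: "has_weak_deriv UNIV (e i) u (ddir u (e i))" for i
    by (rule lipschitz_has_weak_deriv[OF _ u]) simp
  have "has_weak_deriv UNIV ?E u (\<lambda>x. \<Sum>i\<in>I. c i * ddir u (e i) x)"
    unfolding has_weak_deriv_def
  proof (intro conjI ballI)
    show uL: "u \<in> L1loc UNIV" by (rule continuous_L1loc[OF lipschitz_on_continuous_on[OF u]])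
    show "(\<lambda>x. \<Sum>i\<in>I. c i * ddir u (e i) x) \<in> L1loc UNIV" by (rule L1loc_sum[OF ddir_L1loc[OF u]])
    fix \<phi> :: "'a \<Rightarrow> real" assume \<phi>: "\<phi> \<in> test_functions UNIV"
    have lin: "frechet_derivative \<phi> (at x) ?E = (\<Sum>i\<in>I. c i * frechet_derivative \<phi> (at x) (e i))" for x
    proof -
      have "linear (frechet_derivative \<phi> (at x))"
        using smooth_has_derivative[OF test_function_smooth[OF \<phi>]] has_derivative_linear by blast
      then show ?thesis by (simp add: linear_sum linear_scale)
    qed
    have "(LINT x|lebesgue_on UNIV. u x * frechet_derivative \<phi> (at x) ?E) =
        (LINT x|lebesgue_on UNIV. (\<Sum>i\<in>I. c i * (u x * frechet_derivative \<phi> (at x) (e i))))"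
      by (simp only: lin sum_distrib_left mult.left_commute)
    also have "\<dots> = (\<Sum>i\<in>I. c i * (LINT x|lebesgue_on UNIV. u x * frechet_derivative \<phi> (at x) (e i)))"
      using L1loc_mult_test_deriv[OF _ uL \<phi>]
      by (subst Bochner_Integration.integral_sum) auto
    also have "\<dots> = (\<Sum>i\<in>I. c i * - (LINT x|lebesgue_on UNIV. ddir u (e i) x * \<phi> x))"
      using wd \<phi> by (simp add: has_weak_deriv_def)
    also have "\<dots> = - (LINT x|lebesgue_on UNIV. (\<Sum>i\<in>I. c i * (ddir u (e i) x * \<phi> x)))"
      using L1loc_mult_test[OF _ ddir_L1loc[OF u] \<phi>]
      by (subst Bochner_Integration.integral_sum) (auto simp: sum_negf)
    finally show "(LINT x|lebesgue_on UNIV. u x * frechet_derivative \<phi> (at x) ?E) =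
        - (LINT x|lebesgue_on UNIV. (\<Sum>i\<in>I. c i * ddir u (e i) x) * \<phi> x)"
      by (simp only: sum_distrib_right mult.assoc)
  qed
  moreover have "has_weak_deriv UNIV ?E u (ddir u ?E)"
    by (rule lipschitz_has_weak_deriv[OF _ u]) simp
  ultimately have "AE x in lebesgue_on UNIV. ddir u ?E x = (\<Sum>i\<in>I. c i * ddir u (e i) x)"
    by (intro has_weak_deriv_unique) auto
  then show ?thesis by (subst (asm) AE_lebesgue_on_iff) auto
qed

text \<open>For each direction e of a countable dense set the component of the gradient along e is
  at most L times the norm of e. Off one null set this holds for all of them, by continuity for
  every e, and e is taken to be the gradient itself. Bounding the partial derivatives separately
  would lose a dimensional factor, and the exact constant 1 is needed in the constraint.\<close>

lemma lipschitz_ddir_grad_bound: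
  fixes u :: "'a::euclidean_space \<Rightarrow> real"
  assumes u: "L-lipschitz_on UNIV u"
  shows "AE x in lborel. norm (\<Sum>i\<in>Basis. ddir u i x *\<^sub>R i) \<le> L"
proof -
  obtain E :: "'a set" where E: "countable E" "\<And>X. open X \<Longrightarrow> X \<noteq> {} \<Longrightarrow> \<exists>e\<in>E. e \<in> X"
    using countable_dense_setE by blast
  define G where "G x = (\<Sum>i\<in>Basis. ddir u i x *\<^sub>R i)" for x
  have "AE x in lborel. \<bar>e \<bullet> G x\<bar> \<le> L * norm e" for e
    using ddir_sum[OF u finite_Basis, of "\<lambda>i. e \<bullet> i" "\<lambda>i. i"] AE_ddir_bound[OF u, of e]
  proof eventually_elim
    case (elim x)
    have "e \<bullet> G x = (\<Sum>i\<in>Basis. (e \<bullet> i) * ddir u i x)"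
      unfolding G_def inner_sum_right by (rule sum.cong) auto
    then show ?case using elim by (simp add: euclidean_representation)
  qed
  then have "AE x in lborel. \<forall>e\<in>E. \<bar>e \<bullet> G x\<bar> \<le> L * norm e"
    using E(1) by (subst AE_ball_countable) auto
  then show ?thesis
  proof eventually_elim
    case (elim x)
    have "closed {e. \<bar>e \<bullet> G x\<bar> \<le> L * norm e}"
      by (intro closed_Collect_le continuous_intros)
    moreover have "E \<subseteq> {e. \<bar>e \<bullet> G x\<bar> \<le> L * norm e}" using elim by auto
    moreover have "closure E = UNIV"
      using E(2) by (auto simp: closure_iff_nhds_not_empty) (metis Int_iff empty_iff open_UNIV interior_subset open_interior mem_interior subsetD)
    ultimately have "\<bar>G x \<bullet> G x\<bar> \<le> L * norm (G x)"
      using closure_minimal by blast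
    then have "norm (G x) * norm (G x) \<le> L * norm (G x)"
      by (simp add: dot_square_norm power2_eq_square)
    then show ?case
      using lipschitz_on_nonneg[OF u] mult_right_le_imp_le[of "norm (G x)" "norm (G x)" L]
      by (cases "norm (G x) = 0") (auto simp: G_def)
  qed
qed

section \<open>Mollification\<close>

lemma exists_mollifier:
  fixes \<delta> :: real assumes "\<delta> > 0"
  obtains \<rho> :: "'a::euclidean_space \<Rightarrow> real" where "smooth \<rho>" "\<And>x. \<rho> x \<ge> 0"
    "\<And>x. x \<notin> cball 0 \<delta> \<Longrightarrow> \<rho> x = 0" "(LINT x|lborel. \<rho> x) = 1"
proof -
  obtain a b :: 'a where ab: "0 \<in> box a b" "box a b \<subseteq> ball 0 \<delta>"
    using rational_boxes[OF assms, of 0] by blast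
  have out: "box_bump a b x = 0" if "x \<notin> cball 0 \<delta>" for x
    using that ab(2) by (intro box_bump_eq_0) (auto simp: subset_iff)
  have cont: "continuous_on UNIV (box_bump a b)" by (rule smooth_continuous[OF smooth_box_bump])
  have int: "integrable lborel (box_bump a b)"
    by (rule continuous_compact_support_integrable[OF cont compact_cball out])
  define I where "I = (LINT x|lborel. box_bump a b x)"
  have "I \<ge> 0" unfolding I_def by (rule Bochner_Integration.integral_nonneg) (rule box_bump_nonneg)
  moreover have "I \<noteq> 0"
  proof
    assume "I = 0"
    then have "AE x in lborel. box_bump a b x = 0"
      using integral_nonneg_eq_0_iff_AE[OF int] box_bump_nonneg by (auto simp: I_def)
    then have "AE x in lebesgue. x \<notin> box a b"
      by (intro AE_completion) (auto elim!: eventually_mono dest: box_bump_pos)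
    then have "negligible (box a b)"
      using AE_iff_null_sets[of "box a b" lebesgue] by (simp add: negligible_iff_null_sets)
    then show False using open_not_negligible[OF open_box] ab(1) by blast
  qed
  ultimately have "I > 0" by simp
  show thesis
  proof (rule that[of "\<lambda>x. inverse I * box_bump a b x"])
    show "smooth (\<lambda>x. inverse I * box_bump a b x)"
      using smooth_box_bump by (intro allI Ck_mult Ck_const) blast
    show "(LINT x|lborel. inverse I * box_bump a b x) = 1"
      using \<open>I > 0\<close> by (simp add: I_def)
    show "inverse I * box_bump a b x \<ge> 0" for x
      using \<open>I > 0\<close> by (intro mult_nonneg_nonneg box_bump_nonneg) simp
  qed (simp add: out)
qed

lemma test_function_translate:
  fixes \<rho> :: "'a::euclidean_space \<Rightarrow> real"
  assumes \<rho>: "smooth \<rho>" "\<And>y. y \<notin> cball 0 r \<Longrightarrow> \<rho> y = 0"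
  shows "(\<lambda>y. \<rho> (y - x)) \<in> test_functions UNIV"
    and "frechet_derivative (\<lambda>y. \<rho> (y - x)) (at y) i = frechet_derivative \<rho> (at (y - x)) i"
proof -
  have "Ck k (\<lambda>y. \<rho> (y + (- x)))" for k
    using Ck_affine[OF bounded_linear_ident, of k \<rho> "- x"] \<rho>(1) by simp
  then have "smooth (\<lambda>y. \<rho> (y - x))" by simp
  then show "(\<lambda>y. \<rho> (y - x)) \<in> test_functions UNIV"
    by (rule test_functionsI[OF _ compact_cball[of x r]]) (auto intro!: \<rho>(2) simp: dist_norm norm_minus_commute)
  have "((\<lambda>y. y - x) has_derivative (\<lambda>h. h)) (at y)"
    by (auto intro!: derivative_eq_intros)
  from diff_chain_at[OF this smooth_has_derivative[OF \<rho>(1)]]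
  have "((\<lambda>y. \<rho> (y - x)) has_derivative frechet_derivative \<rho> (at (y - x))) (at y)"
    by (simp add: o_def)
  then show "frechet_derivative (\<lambda>y. \<rho> (y - x)) (at y) i = frechet_derivative \<rho> (at (y - x)) i"
    using frechet_derivative_at by metis
qed

text \<open>The kernel is reflected compared with the usual convolution, so that in the variable y
  it is a translate of \<open>\<rho>\<close> and can be used directly as a test function.\<close>

definition mollify :: "('a::euclidean_space \<Rightarrow> real) \<Rightarrow> ('a \<Rightarrow> real) \<Rightarrow> 'a \<Rightarrow> real" where
  "mollify v \<rho> x = (LINT y|lborel. v y * \<rho> (y - x))"

text \<open>Differentiation under the integral sign, over a box containing the support of
  \<open>v\<close>. Each derivative is again a mollification of \<open>v\<close>, with a kernel that
  is minus a derivative of the old one; this is the closure property behind smoothness of all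
  orders.\<close>

lemma mollify_has_derivative:
  fixes v \<rho> :: "'a::euclidean_space \<Rightarrow> real"
  assumes v: "continuous_on UNIV v" "compact K" "\<And>y. y \<notin> K \<Longrightarrow> v y = 0" and \<rho>: "smooth \<rho>"
  shows "\<exists>D. (mollify v \<rho> has_derivative D) (at x) \<and>
    (\<forall>i. D i = mollify v (\<lambda>y. - frechet_derivative \<rho> (at y) i) x)"
proof -
  obtain a b where ab: "K \<subseteq> cbox a b"
    using bounded_subset_cbox_symmetric[OF compact_imp_bounded[OF v(2)]] by blast
  have moll: "mollify v \<sigma> x = integral (cbox a b) (\<lambda>y. v y * \<sigma> (y - x))"
    if "continuous_on UNIV \<sigma>" for \<sigma> x
  proof -
    have c: "continuous_on UNIV (\<lambda>y. v y * \<sigma> (y - x))"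
      by (intro continuous_on_mult v continuous_on_compose2[OF that] continuous_intros) auto
    have int: "integrable lborel (\<lambda>y. v y * \<sigma> (y - x))"
      by (rule continuous_compact_support_integrable[OF c v(2)]) (simp add: v(3))
    have "((\<lambda>y. v y * \<sigma> (y - x)) has_integral mollify v \<sigma> x) UNIV"
      unfolding mollify_def by (rule has_integral_integral_lborel[OF int])
    then have "((\<lambda>y. v y * \<sigma> (y - x)) has_integral mollify v \<sigma> x) (cbox a b)"
    proof (subst (asm) has_integral_restrict_UNIV[symmetric], subst has_integral_restrict_UNIV[symmetric])
      assume h: "((\<lambda>y. if y \<in> UNIV then v y * \<sigma> (y - x) else 0) has_integral mollify v \<sigma> x) UNIV"
      show "((\<lambda>y. if y \<in> cbox a b then v y * \<sigma> (y - x) else 0) has_integral mollify v \<sigma> x) UNIV"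
        by (rule has_integral_eq[OF _ h]) (use ab v(3) in auto)
    qed
    then show ?thesis by (simp add: integral_unique)
  qed
  let ?fd = "\<lambda>y. frechet_derivative \<rho> (at y)"
  have bl: "bounded_linear (\<lambda>h. - (v t * ?fd y h))" for t y
    using has_derivative_bounded_linear[OF smooth_has_derivative[OF \<rho>]]
    by (intro bounded_linear_minus bounded_linear_const_mult)
  \<comment> \<open>The Leibniz rule needs the derivative of the integrand as a continuous family of
    bounded linear maps.\<close>
  define fx where "fx x t = Blinfun (\<lambda>h. - (v t * ?fd (t - x) h))" for x t
  have fx: "blinfun_apply (fx x t) h = - (v t * ?fd (t - x) h)" for x t h
    by (simp add: fx_def bounded_linear_Blinfun_apply bl)
  have cont_fx: "continuous_on (UNIV \<times> cbox a b) (\<lambda>(x, t). fx x t)"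
  proof (rule continuous_on_blinfun_componentwise)
    fix i :: 'a assume "i \<in> Basis"
    show "continuous_on (UNIV \<times> cbox a b) (\<lambda>p. blinfun_apply (case p of (x, t) \<Rightarrow> fx x t) i)"
      unfolding case_prod_beta fx
      by (intro continuous_on_minus continuous_on_mult continuous_on_compose2[OF v(1)]
          continuous_on_compose2[OF smooth_frechet_derivative_continuous[OF \<rho>]] continuous_intros) auto
  qed
  have "((\<lambda>x. integral (cbox a b) (\<lambda>t. v t * \<rho> (t - x))) has_derivative
      blinfun_apply (integral (cbox a b) (fx x))) (at x within UNIV)"
  proof (rule leibniz_rule[OF _ _ cont_fx])
    fix x t :: 'a
    have "((\<lambda>x. t - x) has_derivative (\<lambda>h. - h)) (at x)"
      by (auto intro!: derivative_eq_intros)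
    from diff_chain_at[OF this smooth_has_derivative[OF \<rho>]]
    have "((\<lambda>x. \<rho> (t - x)) has_derivative (\<lambda>h. ?fd (t - x) (- h))) (at x)"
      by (simp add: o_def)
    moreover have "?fd (t - x) (- h) = - ?fd (t - x) h" for h
      using linear_neg[OF bounded_linear.linear[OF has_derivative_bounded_linear[OF smooth_has_derivative[OF \<rho>]]]] .
    ultimately have "((\<lambda>x. \<rho> (t - x)) has_derivative (\<lambda>h. - ?fd (t - x) h)) (at x)"
      by simp
    from has_derivative_mult_right[OF this, of "v t"]
    show "((\<lambda>x. v t * \<rho> (t - x)) has_derivative blinfun_apply (fx x t)) (at x within UNIV)"
      by (simp add: fx[abs_def])
    show "(\<lambda>t. v t * \<rho> (t - x)) integrable_on cbox a b" for x :: 'a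
      using v(1) smooth_continuous[OF \<rho>]
      by (intro integrable_continuous continuous_on_mult)
        (auto intro: continuous_on_subset intro!: continuous_on_compose2[of UNIV \<rho>] continuous_intros)
  qed auto
  then have der: "(mollify v \<rho> has_derivative blinfun_apply (integral (cbox a b) (fx x))) (at x)"
    unfolding moll[OF smooth_continuous[OF \<rho>], abs_def] .
  have "blinfun_apply (integral (cbox a b) (fx x)) i = mollify v (\<lambda>y. - ?fd y i) x" for i
  proof -
    have "continuous_on (cbox a b) (\<lambda>t. case (x, t) of (x, t) \<Rightarrow> fx x t)"
      by (rule continuous_on_compose2[OF cont_fx]) (auto intro!: continuous_intros)
    then have "continuous_on (cbox a b) (fx x)" by simp
    then have "fx x integrable_on cbox a b" by (rule integrable_continuous)
    then have "blinfun_apply (integral (cbox a b) (fx x)) i = integral (cbox a b) (\<lambda>t. blinfun_apply (fx x t) i)"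
      by (rule blinfun_apply_integral)
    also have "\<dots> = mollify v (\<lambda>y. - ?fd y i) x"
      using smooth_frechet_derivative_continuous[OF \<rho>]
      by (subst moll) (auto simp: fx intro: continuous_on_minus)
    finally show ?thesis .
  qed
  with der show ?thesis by blast
qed

lemma smooth_mollify:
  fixes v :: "'a::euclidean_space \<Rightarrow> real"
  assumes v: "continuous_on UNIV v" "compact K" "\<And>y. y \<notin> K \<Longrightarrow> v y = 0" and "smooth \<rho>"
  shows "smooth (mollify v \<rho>)"
proof (rule smooth_coinduct[where P = "\<lambda>f. \<exists>\<rho>. smooth \<rho> \<and> f = mollify v \<rho>"])
  fix f assume "\<exists>\<rho>. smooth \<rho> \<and> f = mollify v \<rho>"
  then obtain \<rho> where \<rho>: "smooth \<rho>" and f: "f = mollify v \<rho>" by blast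
  obtain D where D: "\<And>x. (mollify v \<rho> has_derivative D x) (at x)"
    "\<And>x i. D x i = mollify v (\<lambda>y. - frechet_derivative \<rho> (at y) i) x"
    using mollify_has_derivative[OF v \<rho>] by metis
  have "\<exists>\<rho>'. smooth \<rho>' \<and> (\<lambda>x. D x i) = mollify v \<rho>'" if "i \<in> Basis" for i
  proof (intro exI conjI allI)
    fix k
    have "Ck k (\<lambda>y. 0 - frechet_derivative \<rho> (at y) i)"
      using smooth_partial[OF \<rho> that] by (intro Ck_diff Ck_const) blast
    then show "Ck k (\<lambda>y. - frechet_derivative \<rho> (at y) i)" by simp
  qed (simp add: D(2) fun_eq_iff)
  then show "\<exists>f'. (\<forall>x. (f has_derivative f' x) (at x)) \<and>
      (\<forall>i\<in>Basis. \<exists>\<rho>. smooth \<rho> \<and> (\<lambda>x. f' x i) = mollify v \<rho>)"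
    unfolding f using D(1) by blast
qed (use assms in blast)

text \<open>The sign from differentiating the kernel in x cancels the sign of the integration by
  parts, so mollification commutes with taking the derivative.\<close>

lemma mollify_partial:
  fixes v :: "'a::euclidean_space \<Rightarrow> real"
  assumes u: "L-lipschitz_on UNIV v" and v: "compact K" "\<And>y. y \<notin> K \<Longrightarrow> v y = 0"
    and \<rho>: "smooth \<rho>" "\<And>y. y \<notin> cball 0 r \<Longrightarrow> \<rho> y = 0"
  shows "frechet_derivative (mollify v \<rho>) (at x) i = mollify (ddir v i) \<rho> x"
proof -
  have vc: "continuous_on UNIV v" by (rule lipschitz_on_continuous_on[OF u])
  obtain D where D: "(mollify v \<rho> has_derivative D) (at x)"
    "\<And>i. D i = mollify v (\<lambda>y. - frechet_derivative \<rho> (at y) i) x"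
    using mollify_has_derivative[OF vc v \<rho>(1)] by metis
  let ?\<tau> = "\<lambda>y. \<rho> (y - x)"
  have \<tau>: "?\<tau> \<in> test_functions UNIV" by (rule test_function_translate(1)[OF \<rho>])
  have [measurable]: "v \<in> borel_measurable borel" "\<rho> \<in> borel_measurable borel"
    using lipschitz_borel_measurable[OF u] borel_measurable_continuous_onI[OF smooth_continuous[OF \<rho>(1)]] .
  have [measurable]: "(\<lambda>y. frechet_derivative ?\<tau> (at y) i) \<in> borel_measurable borel"
    by (rule borel_measurable_continuous_onI[OF smooth_frechet_derivative_continuous[OF test_function_smooth[OF \<tau>]]])
  have tr: "frechet_derivative ?\<tau> (at y) i = frechet_derivative \<rho> (at (y - x)) i" for y
    by (rule test_function_translate(2)[OF \<rho>])
  have "frechet_derivative (mollify v \<rho>) (at x) i = D i"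
    using frechet_derivative_at[OF D(1)] by simp
  also have "\<dots> = - (LINT y|lborel. v y * frechet_derivative ?\<tau> (at y) i)"
    by (simp add: D(2) mollify_def tr)
  also have "\<dots> = - (LINT y|lebesgue_on UNIV. v y * frechet_derivative ?\<tau> (at y) i)"
    by (subst integral_lebesgue_on_support) auto
  also have "\<dots> = (LINT y|lebesgue_on UNIV. ddir v i y * ?\<tau> y)"
    using lipschitz_has_weak_deriv[of UNIV, OF _ u, of i] \<tau> by (auto simp: has_weak_deriv_def)
  also have "\<dots> = mollify (ddir v i) \<rho> x"
    unfolding mollify_def by (subst integral_lebesgue_on_support) auto
  finally show ?thesis .
qed

text \<open>A measurable function is almost everywhere a limit of continuous functions. Clipping
  these at M and multiplying by a cutoff makes the convergence dominated without disturbing the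
  limit.\<close>

lemma L1_dense_continuous:
  fixes g :: "'a::euclidean_space \<Rightarrow> real"
  assumes g: "g \<in> borel_measurable borel" and bnd: "\<And>x. \<bar>g x\<bar> \<le> M"
    and supp: "\<And>x. x \<notin> cball 0 R \<Longrightarrow> g x = 0" and "\<epsilon> > 0"
  obtains c where "continuous_on UNIV c" "\<And>x. x \<notin> cball 0 (R + 1) \<Longrightarrow> c x = 0"
    "(LINT x|lborel. \<bar>g x - c x\<bar>) < \<epsilon>"
proof -
  have M: "M \<ge> 0" using bnd[of 0] by linarith
  have "g measurable_on UNIV"
    using g by (intro lebesgue_measurable_imp_measurable_on) (auto intro: measurable_completion)
  then obtain N c where N: "negligible N" and cc: "\<And>n. continuous_on UNIV (c n)"
    and lim: "\<And>x. x \<notin> N \<Longrightarrow> (\<lambda>n. c n x) \<longlonglongrightarrow> g x"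
    by (auto simp: measurable_on_def)
  \<comment> \<open>Equal to 1 on the ball of radius R, where \<open>g\<close> lives, and 0 outside
    the ball of radius R + 1.\<close>
  define \<eta> where "\<eta> x = max 0 (min 1 (R + 1 - norm x))" for x :: 'a
  define k where "k n x = \<eta> x * max (- M) (min M (c n x))" for n x
  have kc: "continuous_on UNIV (k n)" for n
    unfolding k_def \<eta>_def by (intro continuous_intros cc)
  have ks: "k n x = 0" if "x \<notin> cball 0 (R + 1)" for n x
    using that by (simp add: k_def \<eta>_def)
  have \<eta>01: "0 \<le> \<eta> x" "\<eta> x \<le> 1" for x by (auto simp: \<eta>_def)
  have kM: "\<bar>k n x\<bar> \<le> M" for n x
  proof -
    have "\<bar>\<eta> x\<bar> * \<bar>max (- M) (min M (c n x))\<bar> \<le> 1 * M"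
      using \<eta>01[of x] M by (intro mult_mono) auto
    then show ?thesis by (simp add: k_def abs_mult)
  qed
  have klim: "(\<lambda>n. k n x) \<longlonglongrightarrow> g x" if "x \<notin> N" for x
  proof -
    have "(\<lambda>n. k n x) \<longlonglongrightarrow> \<eta> x * max (- M) (min M (g x))"
      unfolding k_def by (intro tendsto_intros lim that)
    moreover have "\<eta> x * max (- M) (min M (g x)) = g x"
      using bnd[of x] supp[of x] by (cases "x \<in> cball 0 R") (auto simp: \<eta>_def abs_le_iff)
    ultimately show ?thesis by simp
  qed
  have km[measurable]: "k n \<in> borel_measurable borel" for n
    by (rule borel_measurable_continuous_onI[OF kc])
  note g[measurable]
  have "(\<lambda>n. LINT x|lborel. \<bar>g x - k n x\<bar>) \<longlonglongrightarrow> (LINT x|(lborel :: 'a measure). 0)"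
  proof (rule integral_dominated_convergence[where w = "\<lambda>x::'a. indicator (cball 0 (R + 1)) x * (2 * M)"])
    show "integrable lborel (\<lambda>x::'a. indicator (cball 0 (R + 1)) x * (2 * M))"
      using emeasure_lborel_bounded[OF bounded_cball, of 0 "R + 1"]
      by (intro integrable_mult_left integrable_real_indicator) auto
    have "AE x in lborel. x \<notin> N"
      using N AE_not_in[of N lebesgue] by (simp add: negligible_iff_null_sets AE_completion_iff)
    then show "AE x in lborel. (\<lambda>n. \<bar>g x - k n x\<bar>) \<longlonglongrightarrow> 0"
    proof eventually_elim
      case (elim x)
      from tendsto_rabs[OF tendsto_diff[OF tendsto_const[of "g x"] klim[OF elim]]] show ?case by simp
    qed
    show "AE x in lborel. norm \<bar>g x - k n x\<bar> \<le> indicator (cball 0 (R + 1)) x * (2 * M)" for n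
    proof (rule AE_I2)
      fix x
      show "norm \<bar>g x - k n x\<bar> \<le> indicator (cball 0 (R + 1)) x * (2 * M)"
        using bnd[of x] kM[of n x] supp[of x] ks[of x n]
        by (cases "x \<in> cball 0 (R + 1)") auto
    qed
  qed measurable
  then have "(\<lambda>n. LINT x|lborel. \<bar>g x - k n x\<bar>) \<longlonglongrightarrow> 0" by simp
  from order_tendstoD(2)[OF this \<open>\<epsilon> > 0\<close>] obtain n where "(LINT x|lborel. \<bar>g x - k n x\<bar>) < \<epsilon>"
    by (auto simp: eventually_sequentially)
  then show thesis using kc ks by (intro that[of "k n"]) auto
qed

lemma L1_translation_continuous:
  fixes g :: "'a::euclidean_space \<Rightarrow> real"
  assumes g[measurable]: "g \<in> borel_measurable borel" and bnd: "\<And>x. \<bar>g x\<bar> \<le> M"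
    and supp: "\<And>x. x \<notin> cball 0 R \<Longrightarrow> g x = 0" and "\<epsilon> > 0"
  obtains \<delta> where "\<delta> > 0" "\<And>y. norm y \<le> \<delta> \<Longrightarrow> (LINT x|lborel. \<bar>g (x + y) - g x\<bar>) \<le> \<epsilon>"
proof -
  have "\<epsilon> / 3 > 0" using \<open>\<epsilon> > 0\<close> by simp
  from L1_dense_continuous[OF g bnd supp this]
  obtain c where c: "continuous_on UNIV c" "\<And>x. x \<notin> cball 0 (R + 1) \<Longrightarrow> c x = 0"
    and gc: "(LINT x|lborel. \<bar>g x - c x\<bar>) < \<epsilon> / 3"
    by blast
  have [measurable]: "c \<in> borel_measurable borel" by (rule borel_measurable_continuous_onI[OF c(1)])
  \<comment> \<open>The function \<open>c\<close> lives in the ball of radius R + 1, so for a shift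
    of length at most 1 both \<open>c\<close> and its translate vanish outside radius R + 2. Uniform
    continuity is used on radius R + 3, which contains x + y for x in X.\<close>
  define X where "X = cball (0::'a) (R + 2)"
  define V where "V = measure lborel X"
  have Xf: "emeasure lborel X < \<infinity>" unfolding X_def by (rule emeasure_lborel_bounded) simp
  have V: "V \<ge> 0" by (simp add: V_def)
  have "uniformly_continuous_on (cball (0::'a) (R + 3)) c"
    by (intro compact_uniformly_continuous continuous_on_subset[OF c(1)]) auto
  \<comment> \<open>Dividing by V + 1 rather than V keeps the bound meaningful when the volume V is
    0.\<close>
  moreover have "\<epsilon> / (3 * (V + 1)) > 0" using \<open>\<epsilon> > 0\<close> V by simp
  ultimately obtain d where d: "d > 0" "\<And>x x'. x \<in> cball 0 (R + 3) \<Longrightarrow> x' \<in> cball 0 (R + 3) \<Longrightarrow>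
      dist x' x < d \<Longrightarrow> dist (c x') (c x) < \<epsilon> / (3 * (V + 1))"
    unfolding uniformly_continuous_on_def by metis
  have ig: "integrable lborel g"
  proof (rule Bochner_Integration.integrable_bound)
    show "integrable lborel (\<lambda>x::'a. indicator X x * M)"
      using Xf by (intro integrable_mult_left integrable_real_indicator) (auto simp: X_def)
    show "AE x in lborel. norm (g x) \<le> norm (indicator X x * M)"
    proof (rule AE_I2)
      fix x
      show "norm (g x) \<le> norm (indicator X x * M)"
        using bnd[of x] supp[of x] by (cases "x \<in> X") (auto simp: X_def)
    qed
  qed simp
  have ic: "integrable lborel c"
    by (rule continuous_compact_support_integrable[OF c(1) compact_cball c(2)])
  show thesis
  proof (rule that[of "min 1 (d / 2)"])
    show "min 1 (d / 2) > 0" using d by simp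
    fix y :: 'a assume y: "norm y \<le> min 1 (d / 2)"
    have cb: "\<bar>c (x + y) - c x\<bar> \<le> indicator X x * (\<epsilon> / (3 * (V + 1)))" for x
    proof (cases "x \<in> X")
      case True
      have nxy: "norm (x + y) \<le> norm x + 1" using norm_triangle_ineq[of x y] y by linarith
      have "x \<in> cball 0 (R + 3)" "x + y \<in> cball 0 (R + 3)" "dist (x + y) x < d"
        using True y d(1) nxy by (simp_all add: X_def) (simp add: dist_norm)
      then have "dist (c (x + y)) (c x) < \<epsilon> / (3 * (V + 1))" by (rule d(2))
      then show ?thesis using True by (simp add: dist_real_def)
    next
      case False
      have "norm x \<le> norm (x + y) + norm y" using norm_triangle_ineq4[of "x + y" y] by simp
      then have "c x = 0" "c (x + y) = 0"
        using False y by (auto intro!: c(2) simp: X_def)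
      then show ?thesis using False by simp
    qed
    have isg: "integrable lborel (\<lambda>x. g (x + y))" "integrable lborel (\<lambda>x. c (x + y))"
      using ig ic by (auto simp: lborel_shift(1))
    have "(LINT x|lborel. \<bar>g (x + y) - g x\<bar>) \<le>
        (LINT x|lborel. \<bar>g (x + y) - c (x + y)\<bar> + (indicator X x * (\<epsilon> / (3 * (V + 1))) + \<bar>g x - c x\<bar>))"
    proof (rule integral_mono)
      show "integrable lborel (\<lambda>x. \<bar>g (x + y) - c (x + y)\<bar> + (indicator X x * (\<epsilon> / (3 * (V + 1))) + \<bar>g x - c x\<bar>))"
        using ig ic isg Xf
        by (intro Bochner_Integration.integrable_add integrable_abs Bochner_Integration.integrable_diff
            integrable_mult_left integrable_real_indicator) (auto simp: X_def)
      show "\<bar>g (x + y) - g x\<bar> \<le> \<bar>g (x + y) - c (x + y)\<bar> + (indicator X x * (\<epsilon> / (3 * (V + 1))) + \<bar>g x - c x\<bar>)" for x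
        using cb[of x] by linarith
    qed (use ig isg in auto)
    also have "\<dots> = (LINT x|lborel. \<bar>g (x + y) - c (x + y)\<bar>) +
        ((LINT x|lborel. indicator X x * (\<epsilon> / (3 * (V + 1)))) + (LINT x|lborel. \<bar>g x - c x\<bar>))"
    proof -
      have i1: "integrable lborel (\<lambda>x. \<bar>g (x + y) - c (x + y)\<bar>)" using isg by simp
      have i2: "integrable lborel (\<lambda>x::'a. indicator X x * (\<epsilon> / (3 * (V + 1))))"
        using Xf by (intro integrable_mult_left integrable_real_indicator) (auto simp: X_def)
      have i3: "integrable lborel (\<lambda>x. \<bar>g x - c x\<bar>)" using ig ic by simp
      show ?thesis
        by (subst Bochner_Integration.integral_add[OF i1 Bochner_Integration.integrable_add[OF i2 i3]],
            subst Bochner_Integration.integral_add[OF i2 i3]) simp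
    qed
    also have "(LINT x|lborel. \<bar>g (x + y) - c (x + y)\<bar>) = (LINT x|lborel. \<bar>g x - c x\<bar>)"
      using lborel_shift(2)[of "\<lambda>x. \<bar>g x - c x\<bar>" y] by measurable
    also have "(LINT x|lborel. indicator X x * (\<epsilon> / (3 * (V + 1)))) = V * (\<epsilon> / (3 * (V + 1)))"
      using Xf by (simp add: V_def X_def)
    also have "V * (\<epsilon> / (3 * (V + 1))) \<le> \<epsilon> / 3"
      using V \<open>\<epsilon> > 0\<close> by (simp add: field_simps)
    finally show "(LINT x|lborel. \<bar>g (x + y) - g x\<bar>) \<le> \<epsilon>" using gc by linarith
  qed
qed

text \<open>A mollification is an average of translates, so by Tonelli its distance in mean from
  \<open>g\<close> is at most that of the translates. Both functions are bounded by M, which turns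
  distance in mean into mean square distance at the cost of a factor 2 M. The radius
  \<open>\<delta>\<close> comes before the kernel, so that a single kernel can later serve all
  partial derivatives.\<close>

lemma mollify_L1_close:
  fixes g :: "'a::euclidean_space \<Rightarrow> real"
  assumes g[measurable]: "g \<in> borel_measurable borel" and bnd: "\<And>x. \<bar>g x\<bar> \<le> M"
    and supp: "\<And>x. x \<notin> cball 0 R \<Longrightarrow> g x = 0" and "\<epsilon> > 0"
  obtains \<delta> where "\<delta> > 0"
    "\<And>\<rho>. smooth \<rho> \<Longrightarrow> (\<And>x. \<rho> x \<ge> 0) \<Longrightarrow> (\<And>x. x \<notin> cball 0 \<delta> \<Longrightarrow> \<rho> x = 0) \<Longrightarrow>
      (LINT x|lborel. \<rho> x) = 1 \<Longrightarrow>
      integrable lborel (\<lambda>x. (g x - mollify g \<rho> x)\<^sup>2) \<and> (LINT x|lborel. (g x - mollify g \<rho> x)\<^sup>2) \<le> \<epsilon>"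
proof -
  have M: "M \<ge> 0" using bnd[of 0] by linarith
  \<comment> \<open>Chosen so that multiplication by 2 M leaves at most \<open>\<epsilon>\<close>,
    also for M = 0.\<close>
  have "\<epsilon> / (2 * M + 1) > 0" using \<open>\<epsilon> > 0\<close> M by simp
  from L1_translation_continuous[OF g bnd supp this]
  obtain \<delta> where \<delta>: "\<delta> > 0" "\<And>y. norm y \<le> \<delta> \<Longrightarrow> (LINT x|lborel. \<bar>g (x + y) - g x\<bar>) \<le> \<epsilon> / (2 * M + 1)"
    by blast
  have ig: "integrable lborel g"
  proof (rule Bochner_Integration.integrable_bound)
    show "integrable lborel (\<lambda>x::'a. indicator (cball 0 R) x * M)"
      using emeasure_lborel_bounded[of "cball (0::'a) R"]
      by (intro integrable_mult_left integrable_real_indicator) auto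
    show "AE x in lborel. norm (g x) \<le> norm (indicator (cball 0 R) x * M)"
    proof (rule AE_I2)
      fix x
      show "norm (g x) \<le> norm (indicator (cball 0 R) x * M)"
        using bnd[of x] supp[of x] by (cases "x \<in> cball 0 R") auto
    qed
  qed simp
  show thesis
  proof (rule that[OF \<delta>(1)])
    fix \<rho> :: "'a \<Rightarrow> real"
    assume \<rho>: "smooth \<rho>" "\<And>x. \<rho> x \<ge> 0" "\<And>x. x \<notin> cball 0 \<delta> \<Longrightarrow> \<rho> x = 0" "(LINT x|lborel. \<rho> x) = 1"
    have [measurable]: "\<rho> \<in> borel_measurable borel"
      by (rule borel_measurable_continuous_onI[OF smooth_continuous[OF \<rho>(1)]])
    have i\<rho>: "integrable lborel \<rho>"
      by (rule continuous_compact_support_integrable[OF smooth_continuous[OF \<rho>(1)] compact_cball \<rho>(3)])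
    have m_eq: "mollify g \<rho> x = (LINT y|lborel. g (x + y) * \<rho> y)" for x
      unfolding mollify_def
      using lborel_shift(2)[of "\<lambda>y. g y * \<rho> (y - x)" x] by (simp add: add.commute)
    have mm[measurable]: "mollify g \<rho> \<in> borel_measurable borel"
      unfolding mollify_def[abs_def] by measurable
    have ib: "integrable lborel (\<lambda>y. g (x + y) * \<rho> y)" for x
      by (rule Bochner_Integration.integrable_bound[OF integrable_mult_right[OF i\<rho>, of M]])
        (use bnd M in \<open>auto simp: abs_mult intro!: mult_right_mono\<close>)
    have mb: "\<bar>mollify g \<rho> x\<bar> \<le> M" for x
    proof -
      have "\<bar>mollify g \<rho> x\<bar> \<le> (LINT y|lborel. \<bar>g (x + y) * \<rho> y\<bar>)"
        unfolding m_eq by (rule integral_abs_bound)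
      also have "\<dots> \<le> (LINT y|lborel. M * \<rho> y)"
      proof (rule integral_mono[OF integrable_abs[OF ib[of x]] integrable_mult_right[OF i\<rho>]])
        show "\<bar>g (x + y) * \<rho> y\<bar> \<le> M * \<rho> y" for y
          using bnd[of "x + y"] \<rho>(2)[of y] by (simp add: abs_mult mult_right_mono)
      qed
      also have "\<dots> = M" using \<rho>(4) by simp
      finally show ?thesis .
    qed
    have diff: "\<bar>g x - mollify g \<rho> x\<bar> \<le> (LINT y|lborel. \<bar>g (x + y) - g x\<bar> * \<rho> y)" for x
    proof -
      have "mollify g \<rho> x - g x = (LINT y|lborel. g (x + y) * \<rho> y) - (LINT y|lborel. g x * \<rho> y)"
        using \<rho>(4) by (simp add: m_eq)
      also have "\<dots> = (LINT y|lborel. (g (x + y) - g x) * \<rho> y)"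
        using ib[of x] i\<rho> by (simp add: left_diff_distrib)
      finally have "\<bar>mollify g \<rho> x - g x\<bar> \<le> (LINT y|lborel. \<bar>(g (x + y) - g x) * \<rho> y\<bar>)"
        by (simp only: integral_abs_bound)
      then show ?thesis using \<rho>(2) by (simp add: abs_mult abs_minus_commute)
    qed
    have id: "integrable lborel (\<lambda>y. \<bar>g (x + y) - g x\<bar> * \<rho> y)" for x
    proof -
      have "integrable lborel (\<lambda>y. \<bar>g (x + y) * \<rho> y - g x * \<rho> y\<bar>)" using ib[of x] i\<rho> by auto
      moreover have "(\<lambda>y. \<bar>g (x + y) * \<rho> y - g x * \<rho> y\<bar>) = (\<lambda>y. \<bar>g (x + y) - g x\<bar> * \<rho> y)"
        using \<rho>(2) by (auto simp: fun_eq_iff left_diff_distrib[symmetric] abs_mult)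
      ultimately show ?thesis by simp
    qed
    have "(\<integral>\<^sup>+x. ennreal \<bar>g x - mollify g \<rho> x\<bar> \<partial>lborel) \<le>
        (\<integral>\<^sup>+x. (\<integral>\<^sup>+y. ennreal (\<bar>g (x + y) - g x\<bar> * \<rho> y) \<partial>lborel) \<partial>lborel)"
    proof (rule nn_integral_mono)
      fix x
      have "(\<integral>\<^sup>+y. ennreal (\<bar>g (x + y) - g x\<bar> * \<rho> y) \<partial>lborel) =
          ennreal (LINT y|lborel. \<bar>g (x + y) - g x\<bar> * \<rho> y)"
        using id[of x] \<rho>(2) by (intro nn_integral_eq_integral) auto
      then show "ennreal \<bar>g x - mollify g \<rho> x\<bar> \<le> (\<integral>\<^sup>+y. ennreal (\<bar>g (x + y) - g x\<bar> * \<rho> y) \<partial>lborel)"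
        using diff[of x] by (simp add: ennreal_leI)
    qed
    also have "\<dots> = (\<integral>\<^sup>+y. (\<integral>\<^sup>+x. ennreal (\<bar>g (x + y) - g x\<bar> * \<rho> y) \<partial>lborel) \<partial>lborel)"
      by (rule lborel_pair.Fubini') measurable
    also have "\<dots> \<le> (\<integral>\<^sup>+y. ennreal (\<epsilon> / (2 * M + 1) * \<rho> y) \<partial>lborel)"
    proof (rule nn_integral_mono)
      fix y
      show "(\<integral>\<^sup>+x. ennreal (\<bar>g (x + y) - g x\<bar> * \<rho> y) \<partial>lborel) \<le> ennreal (\<epsilon> / (2 * M + 1) * \<rho> y)"
      proof (cases "y \<in> cball 0 \<delta>")
        case True
        have i: "integrable lborel (\<lambda>x. \<bar>g (x + y) - g x\<bar>)" using ig by (simp add: lborel_shift(1))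
        then have "(\<integral>\<^sup>+x. ennreal (\<bar>g (x + y) - g x\<bar> * \<rho> y) \<partial>lborel) =
            ennreal (LINT x|lborel. \<bar>g (x + y) - g x\<bar> * \<rho> y)"
          using \<rho>(2) by (intro nn_integral_eq_integral) auto
        also have "(LINT x|lborel. \<bar>g (x + y) - g x\<bar> * \<rho> y) \<le> \<epsilon> / (2 * M + 1) * \<rho> y"
          unfolding integral_mult_left_zero
          by (rule mult_right_mono[OF \<delta>(2) \<rho>(2)]) (use True in simp)
        finally show ?thesis by (simp add: ennreal_leI)
      qed (simp add: \<rho>(3))
    qed
    also have "\<dots> = ennreal (LINT y|lborel. \<epsilon> / (2 * M + 1) * \<rho> y)"
      using i\<rho> \<rho>(2) \<open>\<epsilon> > 0\<close> M by (intro nn_integral_eq_integral) auto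
    also have "(LINT y|lborel. \<epsilon> / (2 * M + 1) * \<rho> y) = \<epsilon> / (2 * M + 1)" using \<rho>(4) by simp
    finally have L1: "(\<integral>\<^sup>+x. ennreal \<bar>g x - mollify g \<rho> x\<bar> \<partial>lborel) \<le> ennreal (\<epsilon> / (2 * M + 1))" .
    have "(\<integral>\<^sup>+x. ennreal ((g x - mollify g \<rho> x)\<^sup>2) \<partial>lborel) \<le>
        (\<integral>\<^sup>+x. ennreal (2 * M) * ennreal \<bar>g x - mollify g \<rho> x\<bar> \<partial>lborel)"
    proof (rule nn_integral_mono)
      fix x
      have "\<bar>g x - mollify g \<rho> x\<bar> * \<bar>g x - mollify g \<rho> x\<bar> \<le> (2 * M) * \<bar>g x - mollify g \<rho> x\<bar>"
        using bnd[of x] mb[of x] by (intro mult_right_mono) auto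
      then have "(g x - mollify g \<rho> x)\<^sup>2 \<le> 2 * M * \<bar>g x - mollify g \<rho> x\<bar>"
        by (simp add: power2_eq_square)
      then show "ennreal ((g x - mollify g \<rho> x)\<^sup>2) \<le> ennreal (2 * M) * ennreal \<bar>g x - mollify g \<rho> x\<bar>"
        using M by (subst ennreal_mult[symmetric]) (auto intro: ennreal_leI)
    qed
    also have "\<dots> = ennreal (2 * M) * (\<integral>\<^sup>+x. ennreal \<bar>g x - mollify g \<rho> x\<bar> \<partial>lborel)"
      by (rule nn_integral_cmult) measurable
    also have "\<dots> \<le> ennreal (2 * M) * ennreal (\<epsilon> / (2 * M + 1))"
      by (rule mult_left_mono[OF L1]) simp
    also have "\<dots> \<le> ennreal \<epsilon>"
      using M \<open>\<epsilon> > 0\<close> by (subst ennreal_mult[symmetric]) (auto intro!: ennreal_leI simp: field_simps)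
    finally have sq: "(\<integral>\<^sup>+x. ennreal ((g x - mollify g \<rho> x)\<^sup>2) \<partial>lborel) \<le> ennreal \<epsilon>" .
    then have int: "integrable lborel (\<lambda>x. (g x - mollify g \<rho> x)\<^sup>2)"
      by (intro integrableI_nonneg) (auto simp: le_less_trans[OF _ ennreal_less_top])
    moreover have "(LINT x|lborel. (g x - mollify g \<rho> x)\<^sup>2) \<le> \<epsilon>"
      using sq \<open>\<epsilon> > 0\<close> nn_integral_eq_integral[OF int] by simp
    ultimately show "integrable lborel (\<lambda>x. (g x - mollify g \<rho> x)\<^sup>2) \<and>
        (LINT x|lborel. (g x - mollify g \<rho> x)\<^sup>2) \<le> \<epsilon>" ..
  qed
qed

section \<open>Approximation of Lipschitz functions by test functions\<close>

lemma ddir_cong_open: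
  assumes "open U" "x \<in> U" "\<And>y. y \<in> U \<Longrightarrow> u y = v y"
  shows "ddir u e x = ddir v e x"
proof -
  have "(\<lambda>n. x + inverse (real (Suc n)) *\<^sub>R e) \<longlonglongrightarrow> x + 0 *\<^sub>R e"
    by (intro tendsto_intros LIMSEQ_inverse_real_of_nat)
  then have "\<forall>\<^sub>F n in sequentially. x + inverse (real (Suc n)) *\<^sub>R e \<in> U"
    using assms(1,2) by (intro topological_tendstoD[of _ x]) auto
  then have ev: "\<forall>\<^sub>F n in sequentially. diff_quot u e n x = diff_quot v e n x"
    by eventually_elim (simp add: diff_quot_def assms)
  have "(\<lambda>n. diff_quot u e n x) \<longlonglongrightarrow> l \<longleftrightarrow> (\<lambda>n. diff_quot v e n x) \<longlonglongrightarrow> l" for l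
    by (rule tendsto_cong[OF ev])
  then show ?thesis unfolding ddir_def lim_def by simp
qed

text \<open>Mollification at a sufficiently small radius: the values converge uniformly by the
  Lipschitz bound, and the partial derivatives are the mollified derivatives, which are bounded with
  compact support and hence converge in mean square.\<close>

lemma lipschitz_test_approx:
  fixes v :: "'a::euclidean_space \<Rightarrow> real"
  assumes v: "L-lipschitz_on UNIV v" and "open S" and K: "compact K" "K \<subseteq> S" "\<And>x. x \<notin> K \<Longrightarrow> v x = 0"
    and "\<epsilon> > 0"
  obtains \<phi> where "\<phi> \<in> test_functions S" "\<And>x. \<bar>v x - \<phi> x\<bar> \<le> \<epsilon>"
    "\<And>i. i \<in> Basis \<Longrightarrow> integrable lborel (\<lambda>x. (ddir v i x - frechet_derivative \<phi> (at x) i)\<^sup>2)"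
    "\<And>i. i \<in> Basis \<Longrightarrow> (LINT x|lborel. (ddir v i x - frechet_derivative \<phi> (at x) i)\<^sup>2) \<le> \<epsilon>"
proof -
  have L: "L \<ge> 0" by (rule lipschitz_on_nonneg[OF v])
  have vc: "continuous_on UNIV v" by (rule lipschitz_on_continuous_on[OF v])
  have [measurable]: "v \<in> borel_measurable borel" by (rule lipschitz_borel_measurable[OF v])
  obtain R where R: "K \<subseteq> cball 0 R"
    using compact_imp_bounded[OF K(1)] by (auto simp: bounded_iff subset_iff)
  \<comment> \<open>\<open>ddir v i\<close> satisfies its bound only almost everywhere, whereas the
    mollification estimate asks for a bound at every point; \<open>g i\<close> differs from it on a
    null set.\<close>
  define g where "g i x = (if \<bar>ddir v i x\<bar> \<le> L \<and> x \<in> K then ddir v i x else 0)" for i x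
  have Kb[measurable]: "K \<in> sets borel" using K(1) by (simp add: compact_imp_closed)
  have gm[measurable]: "g i \<in> borel_measurable borel" for i
    unfolding g_def[abs_def] by measurable
  have out0: "ddir v i x = 0" if "x \<notin> K" for i x
  proof -
    have "ddir v i x = ddir (\<lambda>x. 0) i x"
      using that K by (intro ddir_cong_open[of "- K"]) (auto simp: open_closed compact_imp_closed)
    also have "\<dots> = 0" by (simp add: ddir_def diff_quot_def)
    finally show ?thesis .
  qed
  have g_eq: "AE x in lborel. ddir v i x = g i x" if "i \<in> Basis" for i
    using AE_ddir_bound[OF v, of i]
    by eventually_elim (use that out0 in \<open>auto simp: g_def\<close>)
  have gb: "\<bar>g i x\<bar> \<le> L" and gs: "x \<notin> cball 0 R \<Longrightarrow> g i x = 0" for i x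
    using L R by (auto simp: g_def)
  define good where "good i \<delta> \<longleftrightarrow> \<delta> > 0 \<and> (\<forall>\<rho>. smooth \<rho> \<longrightarrow> (\<forall>x. \<rho> x \<ge> 0) \<longrightarrow>
      (\<forall>x. x \<notin> cball 0 \<delta> \<longrightarrow> \<rho> x = 0) \<longrightarrow> (LINT x|lborel. \<rho> x) = 1 \<longrightarrow>
      integrable lborel (\<lambda>x. (g i x - mollify (g i) \<rho> x)\<^sup>2) \<and>
      (LINT x|lborel. (g i x - mollify (g i) \<rho> x)\<^sup>2) \<le> \<epsilon>)" for i \<delta>
  have "\<exists>\<delta>. good i \<delta>" for i
  proof (rule mollify_L1_close[OF gm[of i] gb gs \<open>\<epsilon> > 0\<close>])
    fix \<delta> :: real
    assume "\<delta> > 0" and h: "\<And>\<rho>. smooth \<rho> \<Longrightarrow> (\<And>x. \<rho> x \<ge> 0) \<Longrightarrow> (\<And>x. x \<notin> cball 0 \<delta> \<Longrightarrow> \<rho> x = 0) \<Longrightarrow>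
      (LINT x|lborel. \<rho> x) = 1 \<Longrightarrow>
      integrable lborel (\<lambda>x. (g i x - mollify (g i) \<rho> x)\<^sup>2) \<and> (LINT x|lborel. (g i x - mollify (g i) \<rho> x)\<^sup>2) \<le> \<epsilon>"
    show "\<exists>\<delta>. good i \<delta>"
      unfolding good_def by (intro exI[of _ \<delta>] conjI[OF \<open>\<delta> > 0\<close>] allI impI h) auto
  qed
  then obtain \<delta> where good: "\<And>i. good i (\<delta> i)" by metis
  have \<delta>: "\<delta> i > 0" for i using good[of i] by (simp only: good_def)
  obtain d where d: "d > 0" "(\<Union>x\<in>K. cball x d) \<subseteq> S"
    using compact_subset_open_imp_cball_epsilon_subset[OF K(1) \<open>open S\<close> K(2)] by blast
  \<comment> \<open>The distance d keeps the enlarged support inside S,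
    \<open>\<epsilon> / (L + 1)\<close> gives uniform closeness, and each \<open>\<delta> i\<close>
    takes care of one partial derivative.\<close>
  define r where "r = Min (insert d (insert (\<epsilon> / (L + 1)) (\<delta> ` Basis)))"
  have fin: "finite (insert d (insert (\<epsilon> / (L + 1)) (\<delta> ` (Basis :: 'a set))))" by simp
  have r: "r > 0" unfolding r_def using \<open>\<epsilon> > 0\<close> L d(1) \<delta> by (subst Min_gr_iff[OF fin]) auto
  have rle: "r \<le> d" "r \<le> \<epsilon> / (L + 1)" "\<And>i. i \<in> Basis \<Longrightarrow> r \<le> \<delta> i"
    unfolding r_def by (rule Min_le[OF fin], simp)+
  obtain \<rho> :: "'a \<Rightarrow> real" where \<rho>: "smooth \<rho>" "\<And>x. \<rho> x \<ge> 0" "\<And>x. x \<notin> cball 0 r \<Longrightarrow> \<rho> x = 0"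
    "(LINT x|lborel. \<rho> x) = 1"
    using exists_mollifier[OF r] by blast
  have [measurable]: "\<rho> \<in> borel_measurable borel"
    by (rule borel_measurable_continuous_onI[OF smooth_continuous[OF \<rho>(1)]])
  define \<phi> where "\<phi> = mollify v \<rho>"
  have i\<rho>: "integrable lborel \<rho>"
    by (rule continuous_compact_support_integrable[OF smooth_continuous[OF \<rho>(1)] compact_cball \<rho>(3)])
  show thesis
  proof (rule that[of \<phi>])
    show "\<phi> \<in> test_functions S"
    proof (rule test_functionsI[of _ "\<Union>x\<in>K. cball x r"])
      show "smooth \<phi>" unfolding \<phi>_def by (rule smooth_mollify[OF vc K(1,3) \<rho>(1)])
      have eq: "(\<Union>x\<in>K. cball x r) = {x + y |x y. x \<in> K \<and> y \<in> cball 0 r}"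
      proof (safe)
        fix x y assume "x \<in> K" "y \<in> cball x r"
        then show "\<exists>x' y'. y = x' + y' \<and> x' \<in> K \<and> y' \<in> cball 0 r"
          by (intro exI[of _ x] exI[of _ "y - x"]) (auto simp: dist_norm norm_minus_commute)
      next
        fix x y :: 'a assume "x \<in> K" "y \<in> cball 0 r"
        then show "x + y \<in> (\<Union>x\<in>K. cball x r)" by (intro UN_I[of x]) (auto simp: dist_norm)
      qed
      show "compact (\<Union>x\<in>K. cball x r)" unfolding eq by (rule compact_sums[OF K(1) compact_cball])
      have "(\<Union>x\<in>K. cball x r) \<subseteq> (\<Union>x\<in>K. cball x d)"
        using rle(1) by (intro UN_mono subset_cball) auto
      then show "(\<Union>x\<in>K. cball x r) \<subseteq> S" using d(2) by (rule order_trans)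
      fix x assume x: "x \<notin> (\<Union>x\<in>K. cball x r)"
      have v\<rho>: "v y * \<rho> (y - x) = 0" for y
      proof (cases "y \<in> K")
        case True
        then have "y - x \<notin> cball 0 r" using x by (auto simp: dist_norm norm_minus_commute[of x y])
        then show ?thesis by (simp add: \<rho>(3))
      qed (simp add: K(3))
      show "\<phi> x = 0" unfolding \<phi>_def mollify_def v\<rho> by simp
    qed
    show "\<bar>v x - \<phi> x\<bar> \<le> \<epsilon>" for x
    proof -
      have m: "\<phi> x = (LINT y|lborel. v (x + y) * \<rho> y)"
        unfolding \<phi>_def mollify_def
        using lborel_shift(2)[of "\<lambda>y. v y * \<rho> (y - x)" x] by (simp add: add.commute)
      have i1: "integrable lborel (\<lambda>y. v (x + y) * \<rho> y)"
        by (rule continuous_compact_support_integrable[OF _ compact_cball[of 0 r]])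
          (auto intro!: continuous_on_mult smooth_continuous[OF \<rho>(1)] continuous_on_compose2[OF vc] continuous_intros simp: \<rho>(3))
      have "v x - \<phi> x = (LINT y|lborel. v x * \<rho> y) - (LINT y|lborel. v (x + y) * \<rho> y)"
        using \<rho>(4) by (simp add: m)
      also have "\<dots> = (LINT y|lborel. (v x - v (x + y)) * \<rho> y)"
        using i1 i\<rho> by (simp add: left_diff_distrib)
      finally have "\<bar>v x - \<phi> x\<bar> \<le> (LINT y|lborel. \<bar>(v x - v (x + y)) * \<rho> y\<bar>)"
        by (simp only: integral_abs_bound)
      also have "\<dots> \<le> (LINT y|lborel. \<epsilon> * \<rho> y)"
      proof (rule integral_mono)
        have "integrable lborel (\<lambda>y. v x * \<rho> y - v (x + y) * \<rho> y)" using i1 i\<rho> by auto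
        then show "integrable lborel (\<lambda>y. \<bar>(v x - v (x + y)) * \<rho> y\<bar>)"
          by (simp add: left_diff_distrib)
        show "\<bar>(v x - v (x + y)) * \<rho> y\<bar> \<le> \<epsilon> * \<rho> y" for y
        proof (cases "y \<in> cball 0 r")
          case True
          have "\<bar>v x - v (x + y)\<bar> \<le> L * norm y"
            using lipschitz_onD[OF v, of x "x + y"] by (simp add: dist_norm)
          also have "\<dots> \<le> L * (\<epsilon> / (L + 1))"
            using True rle(2) L by (intro mult_left_mono) auto
          also have "\<dots> \<le> \<epsilon>" using L \<open>\<epsilon> > 0\<close> by (simp add: field_simps)
          finally show ?thesis using \<rho>(2)[of y] by (simp add: abs_mult mult_right_mono)
        qed (simp add: \<rho>(3))
      qed (use i\<rho> in simp)
      also have "\<dots> = \<epsilon>" using \<rho>(4) by simp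
      finally show ?thesis .
    qed
    fix i :: 'a assume i: "i \<in> Basis"
    have ci: "frechet_derivative \<phi> (at x) i = mollify (g i) \<rho> x" for x
    proof -
      have "frechet_derivative \<phi> (at x) i = mollify (ddir v i) \<rho> x"
        unfolding \<phi>_def by (rule mollify_partial[OF v K(1,3) \<rho>(1,3)])
      also have "\<dots> = mollify (g i) \<rho> x"
        unfolding mollify_def using g_eq[OF i]
        by (intro integral_cong_AE) (measurable, auto elim: eventually_mono)
      finally show ?thesis .
    qed
    have *: "integrable lborel (\<lambda>x. (g i x - mollify (g i) \<rho> x)\<^sup>2) \<and> (LINT x|lborel. (g i x - mollify (g i) \<rho> x)\<^sup>2) \<le> \<epsilon>"
    proof -
      have "x \<notin> cball 0 (\<delta> i) \<Longrightarrow> \<rho> x = 0" for x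
        using rle(3)[OF i] by (intro \<rho>(3)) auto
      then show ?thesis using good[of i] \<rho>(1,2,4) unfolding good_def by blast
    qed
    have [measurable]: "mollify (g i) \<rho> \<in> borel_measurable borel"
      unfolding mollify_def[abs_def] by measurable
    have ae: "AE x in lborel. (ddir v i x - mollify (g i) \<rho> x)\<^sup>2 = (g i x - mollify (g i) \<rho> x)\<^sup>2"
      using g_eq[OF i] by eventually_elim simp
    have "integrable lborel (\<lambda>x. (ddir v i x - mollify (g i) \<rho> x)\<^sup>2) \<longleftrightarrow> integrable lborel (\<lambda>x. (g i x - mollify (g i) \<rho> x)\<^sup>2)"
      by (rule integrable_cong_AE[OF _ _ ae]) measurable
    moreover have "(LINT x|lborel. (ddir v i x - mollify (g i) \<rho> x)\<^sup>2) = (LINT x|lborel. (g i x - mollify (g i) \<rho> x)\<^sup>2)"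
      by (rule integral_cong_AE[OF _ _ ae]) measurable
    ultimately show "integrable lborel (\<lambda>x. (ddir v i x - frechet_derivative \<phi> (at x) i)\<^sup>2)"
      "(LINT x|lborel. (ddir v i x - frechet_derivative \<phi> (at x) i)\<^sup>2) \<le> \<epsilon>"
      using * by (simp_all add: ci)
  qed
qed

lemma sum_squares_split: "(a - c)\<^sup>2 \<le> 2 * (a - b)\<^sup>2 + 2 * (b - (c::real))\<^sup>2"
proof -
  have "2 * (a - b)\<^sup>2 + 2 * (b - c)\<^sup>2 - (a - c)\<^sup>2 = (a - b - (b - c))\<^sup>2"
    by (simp add: power2_eq_square algebra_simps)
  then show ?thesis using zero_le_power2[of "a - b - (b - c)"] by linarith
qed

text \<open>Multiplying by a cutoff that increases from 0 to 1 where the distance to the complement is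
  between \<open>1 / k\<close> and \<open>2 / k\<close> costs only a bounded factor in the Lipschitz constant, because there
  \<open>\<bar>u\<bar>\<close> is at most \<open>2 / k\<close>.\<close>

lemma cutoff_lipschitz:
  fixes u d :: "'a::euclidean_space \<Rightarrow> real"
  assumes u: "1-lipschitz_on UNIV u" and d: "1-lipschitz_on UNIV d"
    and ud: "\<And>x. \<bar>u x\<bar> \<le> d x" and k: "k > 0"
  shows "3-lipschitz_on UNIV (\<lambda>x. u x * max 0 (min 1 (k * d x - 1)))"
proof -
  define \<eta> where "\<eta> x = max 0 (min 1 (k * d x - 1))" for x
  have d0: "d x \<ge> 0" for x using ud[of x] by linarith
  have \<eta>01: "0 \<le> \<eta> x" "\<eta> x \<le> 1" for x by (auto simp: \<eta>_def)
  \<comment> \<open>By symmetry y is the point closer to the complement. If k d(y) > 2, both cutoffs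
    are 1; otherwise the size at most 2/k of u(y) compensates the slope k of the cutoff. The
    constant is 3 = 1 + 2, from the slope of u and from the cutoff.\<close>
  have main: "\<bar>u x * \<eta> x - u y * \<eta> y\<bar> \<le> 3 * dist x y" if "d y \<le> d x" for x y
  proof -
    have ulip: "\<bar>u x - u y\<bar> \<le> dist x y" and dlip: "\<bar>d x - d y\<bar> \<le> dist x y"
      using lipschitz_onD[OF u, of x y] lipschitz_onD[OF d, of x y] by (auto simp: dist_real_def)
    have "\<bar>u y\<bar> * \<bar>\<eta> x - \<eta> y\<bar> \<le> 2 * dist x y"
    proof (cases "k * d y \<le> 2")
      case True
      have "\<bar>\<eta> x - \<eta> y\<bar> \<le> \<bar>k * d x - k * d y\<bar>" unfolding \<eta>_def by linarith
      also have "\<dots> = k * \<bar>d x - d y\<bar>" using k by (simp add: abs_mult right_diff_distrib[symmetric])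
      finally have "\<bar>u y\<bar> * \<bar>\<eta> x - \<eta> y\<bar> \<le> d y * (k * dist x y)"
        using dlip k by (intro mult_mono ud d0) (auto intro: order_trans mult_left_mono)
      also have "\<dots> = (k * d y) * dist x y" by simp
      also have "\<dots> \<le> 2 * dist x y" using True by (intro mult_right_mono) auto
      finally show ?thesis .
    next
      case False
      then have "\<eta> y = 1" by (auto simp: \<eta>_def)
      moreover have "k * d y \<le> k * d x" using that k by (intro mult_left_mono) auto
      then have "\<eta> x = 1" using False by (auto simp: \<eta>_def)
      ultimately show ?thesis by simp
    qed
    moreover have "\<bar>u x - u y\<bar> * \<bar>\<eta> x\<bar> \<le> dist x y * 1"
      using ulip \<eta>01[of x] by (intro mult_mono) auto
    moreover have "u x * \<eta> x - u y * \<eta> y = (u x - u y) * \<eta> x + u y * (\<eta> x - \<eta> y)"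
      by (simp add: algebra_simps)
    ultimately show ?thesis
      using abs_triangle_ineq[of "(u x - u y) * \<eta> x" "u y * (\<eta> x - \<eta> y)"] unfolding abs_mult by linarith
  qed
  show ?thesis
  proof (rule lipschitz_onI)
    fix x y
    have "\<bar>u x * \<eta> x - u y * \<eta> y\<bar> \<le> 3 * dist x y"
      using main[of x y] main[of y x] by (cases "d y \<le> d x") (auto simp: abs_minus_commute dist_commute)
    then show "dist (u x * max 0 (min 1 (k * d x - 1))) (u y * max 0 (min 1 (k * d y - 1))) \<le> 3 * dist x y"
      by (simp add: \<eta>_def dist_real_def)
  qed simp
qed

lemma infdist_lipschitz: "1-lipschitz_on UNIV (\<lambda>x. infdist x A)"
  using infdist_triangle_abs by (intro lipschitz_onI) (auto simp: dist_real_def)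

lemma bounded_borel_L2:
  fixes g :: "'a::euclidean_space \<Rightarrow> real"
  assumes S: "S \<in> sets borel" "bounded S" and g: "f \<in> borel_measurable (lebesgue_on S)"
    and bnd: "AE x in lebesgue_on S. \<bar>f x\<bar> \<le> M"
  shows "f \<in> L2 S"
proof -
  interpret finite_measure "lebesgue_on S" by (rule finite_measure_bounded[OF S])
  have "integrable (lebesgue_on S) (\<lambda>x. (f x)\<^sup>2)"
  proof (rule integrable_const_bound[of _ "M\<^sup>2"])
    show "AE x in lebesgue_on S. norm ((f x)\<^sup>2) \<le> M\<^sup>2"
      using bnd
    proof eventually_elim
      case (elim x)
      then show ?case using power_mono[OF elim, of 2] by simp
    qed
  qed (use g in measurable)
  then show ?thesis using g by (simp add: L2_def)
qed

lemma lipschitz_weak_deriv_L2: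
  fixes u :: "'a::euclidean_space \<Rightarrow> real"
  assumes S: "open S" "bounded S" and u: "L-lipschitz_on UNIV u"
  shows "weak_deriv S e u \<in> borel_measurable (lebesgue_on S)"
    "AE x in lebesgue_on S. \<bar>weak_deriv S e u x\<bar> \<le> L * norm e" "weak_deriv S e u \<in> L2 S"
proof -
  have Sb: "S \<in> sets borel" using S by auto
  have eq: "AE x in lborel. x \<in> S \<longrightarrow> weak_deriv S e u x = ddir u e x"
    using lipschitz_weak_deriv(2)[OF S(1) u, of e] by (simp add: AE_lebesgue_on_iff[OF Sb])
  have dm: "ddir u e \<in> borel_measurable borel" using lipschitz_borel_measurable[OF u] by measurable
  show m: "weak_deriv S e u \<in> borel_measurable (lebesgue_on S)"
    by (rule lebesgue_on_cong_borel(1)[OF Sb dm eq])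
  show b: "AE x in lebesgue_on S. \<bar>weak_deriv S e u x\<bar> \<le> L * norm e"
    unfolding AE_lebesgue_on_iff[OF Sb]
    using eq AE_ddir_bound[OF u, of e] by eventually_elim auto
  show "weak_deriv S e u \<in> L2 S" by (rule bounded_borel_L2[OF Sb S(2) m b])
qed

lemma continuous_bounded_L2:
  fixes u :: "'a::euclidean_space \<Rightarrow> real"
  assumes S: "open S" "bounded S" and u: "continuous_on UNIV u"
  shows "u \<in> L2 S"
proof -
  have Sb: "S \<in> sets borel" using S by auto
  have "bounded (u ` closure S)"
    using S u by (intro compact_imp_bounded compact_continuous_image) (auto intro: continuous_on_subset)
  then obtain M where "\<And>x. x \<in> closure S \<Longrightarrow> \<bar>u x\<bar> \<le> M" by (auto simp: bounded_iff)
  then have "AE x in lebesgue_on S. \<bar>u x\<bar> \<le> M"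
    using closure_subset[of S] by (intro AE_I2) auto
  then show ?thesis
    by (intro bounded_borel_L2[OF Sb S(2)] measurable_lebesgue_on_borel borel_measurable_continuous_onI[OF u])
qed

lemma lipschitz_H1:
  fixes u :: "'a::euclidean_space \<Rightarrow> real"
  assumes S: "open S" "bounded S" and u: "L-lipschitz_on UNIV u"
  shows "u \<in> H1 S"
  using continuous_bounded_L2[OF S lipschitz_on_continuous_on[OF u]] lipschitz_weak_deriv(1)[OF S(1) u]
    lipschitz_weak_deriv_L2(3)[OF S u] by (simp add: H1_def)

text \<open>The cutoffs \<open>v n\<close> have compact support in S and stay 3-Lipschitz uniformly
  in n, and near each point of S they eventually equal \<open>u\<close>. Dominated convergence then
  gives convergence of values and gradients in mean square; replacing each \<open>v n\<close> by a
  test function with error 1/(n + 1) keeps both limits.\<close>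

lemma lipschitz_H10:
  fixes u :: "'a::euclidean_space \<Rightarrow> real"
  assumes S: "open S" "bounded S" and u: "1-lipschitz_on UNIV u" and ud: "\<And>x. \<bar>u x\<bar> \<le> infdist x (- S)"
  shows "u \<in> H10 S"
proof -
  have Sb[measurable]: "S \<in> sets borel" using S by auto
  define d where "d x = infdist x (- S)" for x
  have dl: "1-lipschitz_on UNIV d" unfolding d_def by (rule infdist_lipschitz)
  have dc: "continuous_on UNIV d" by (rule lipschitz_on_continuous_on[OF dl])
  have "S \<noteq> UNIV" using S(2) not_bounded_UNIV by auto
  then have d_pos: "d x > 0" if "x \<in> S" for x
    using that S(1) infdist_pos_not_in_closed[of "- S" x] by (auto simp: d_def closed_Compl)
  have d_out: "d x = 0" if "x \<notin> S" for x using that by (simp add: d_def)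
  define k where "k n = real (Suc n)" for n
  define v where "v n x = u x * max 0 (min 1 (k n * d x - 1))" for n x
  have vl: "3-lipschitz_on UNIV (v n)" for n
    unfolding v_def using ud by (intro cutoff_lipschitz[OF u dl]) (auto simp: k_def d_def)
  have um[measurable]: "u \<in> borel_measurable borel" by (rule lipschitz_borel_measurable[OF u])
  have vm[measurable]: "v n \<in> borel_measurable borel" for n by (rule lipschitz_borel_measurable[OF vl])
  have v_supp: "v n x = 0" if "x \<notin> {x. 1 \<le> k n * d x}" for n x
    using that by (auto simp: v_def)
  have Ksub: "{x. 1 \<le> k n * d x} \<subseteq> S" for n
  proof
    fix x assume "x \<in> {x. 1 \<le> k n * d x}"
    then show "x \<in> S" using d_out[of x] by (cases "x \<in> S") auto
  qed
  have Kc: "compact {x. 1 \<le> k n * d x}" for n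
    unfolding compact_eq_bounded_closed
    using bounded_subset[OF S(2) Ksub] by (auto intro!: closed_Collect_le continuous_intros dc)
  define good where "good n \<phi> \<longleftrightarrow> \<phi> \<in> test_functions S \<and> (\<forall>x. \<bar>v n x - \<phi> x\<bar> \<le> inverse (real (Suc n))) \<and>
      (\<forall>i\<in>Basis. integrable lborel (\<lambda>x. (ddir (v n) i x - frechet_derivative \<phi> (at x) i)\<^sup>2) \<and>
        (LINT x|lborel. (ddir (v n) i x - frechet_derivative \<phi> (at x) i)\<^sup>2) \<le> inverse (real (Suc n)))" for n \<phi>
  have "\<exists>\<phi>. good n \<phi>" for n
  proof (rule lipschitz_test_approx[OF vl[of n] S(1) Kc[of n] Ksub[of n], of "inverse (real (Suc n))"])
    show "v n x = 0" if "x \<notin> {x. 1 \<le> k n * d x}" for x using that by (rule v_supp)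
  qed (auto simp: good_def)
  then obtain \<phi> where good: "\<And>n. good n (\<phi> n)" by metis
  have \<phi>: "\<phi> n \<in> test_functions S" "\<bar>v n x - \<phi> n x\<bar> \<le> inverse (real (Suc n))"
    "i \<in> Basis \<Longrightarrow> integrable lborel (\<lambda>x. (ddir (v n) i x - frechet_derivative (\<phi> n) (at x) i)\<^sup>2)"
    "i \<in> Basis \<Longrightarrow> (LINT x|lborel. (ddir (v n) i x - frechet_derivative (\<phi> n) (at x) i)\<^sup>2) \<le> inverse (real (Suc n))"
    for n x i
    using good[of n] by (simp_all only: good_def)
  have \<phi>m[measurable]: "\<phi> n \<in> borel_measurable borel" for n
    by (rule borel_measurable_continuous_onI[OF smooth_continuous[OF test_function_smooth[OF \<phi>(1)]]])
  have fdm[measurable]: "(\<lambda>x. frechet_derivative (\<phi> n) (at x) i) \<in> borel_measurable borel" for n i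
    by (rule borel_measurable_continuous_onI[OF smooth_frechet_derivative_continuous[OF test_function_smooth[OF \<phi>(1)]]])
  have iS: "integrable lborel (\<lambda>x. indicator S x * (c::real))" for c
    using emeasure_lborel_bounded[OF S(2)] by (intro integrable_mult_left integrable_real_indicator) auto
  have inv0: "(\<lambda>n. inverse (real (Suc n))) \<longlonglongrightarrow> 0" by (rule LIMSEQ_inverse_real_of_nat)
  have ev: "\<forall>\<^sub>F n in sequentially. 2 < k n * d x" if "x \<in> S" for x
  proof -
    have "filterlim (\<lambda>n. k n * d x) at_top sequentially"
      unfolding k_def
      by (intro filterlim_at_top_mult_tendsto_pos[OF tendsto_const d_pos[OF that]]
          filterlim_compose[OF filterlim_real_sequentially filterlim_Suc])
    then show ?thesis by (simp add: filterlim_at_top_dense)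
  qed
  have veq: "v n x = u x" if "2 < k n * d x" for n x
    using that by (auto simp: v_def)
  obtain M where M: "\<And>x. x \<in> S \<Longrightarrow> \<bar>u x\<bar> \<le> M"
  proof -
    have "bounded (u ` closure S)"
      using S lipschitz_on_continuous_on[OF u]
      by (intro compact_imp_bounded compact_continuous_image) (auto intro: continuous_on_subset)
    then obtain M where "\<And>x. x \<in> closure S \<Longrightarrow> \<bar>u x\<bar> \<le> M" by (auto simp: bounded_iff)
    then show thesis using closure_subset[of S] by (intro that[of M]) auto
  qed
  have lim0: "(\<lambda>n. LINT x|lebesgue_on S. (u x - \<phi> n x)\<^sup>2) \<longlonglongrightarrow> 0"
  proof -
    have "(\<lambda>n. LINT x|lborel. indicator S x * (u x - \<phi> n x)\<^sup>2) \<longlonglongrightarrow> (LINT x|(lborel::'a measure). 0)"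
    proof (rule integral_dominated_convergence[where w = "\<lambda>x. indicator S x * (2 * M + 1)\<^sup>2"])
      show "AE x in lborel. (\<lambda>n. indicator S x * (u x - \<phi> n x)\<^sup>2) \<longlonglongrightarrow> 0"
      proof (rule AE_I2)
        fix x
        show "(\<lambda>n. indicator S x * (u x - \<phi> n x)\<^sup>2) \<longlonglongrightarrow> 0"
        proof (cases "x \<in> S")
          case True
          have "(\<lambda>n. u x - \<phi> n x) \<longlonglongrightarrow> 0"
          proof (rule Lim_null_comparison[OF _ inv0])
            show "\<forall>\<^sub>F n in sequentially. norm (u x - \<phi> n x) \<le> inverse (real (Suc n))"
              using ev[OF True]
            proof eventually_elim
              case (elim n)
              show ?case using \<phi>(2)[of n x] by (simp add: veq[OF elim])
            qed
          qed
          from tendsto_power[OF this, of 2] True show ?thesis by simp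
        qed simp
      qed
      show "AE x in lborel. norm (indicator S x * (u x - \<phi> n x)\<^sup>2) \<le> indicator S x * (2 * M + 1)\<^sup>2" for n
      proof (rule AE_I2)
        fix x
        show "norm (indicator S x * (u x - \<phi> n x)\<^sup>2) \<le> indicator S x * (2 * M + 1)\<^sup>2"
        proof (cases "x \<in> S")
          case True
          have "\<bar>v n x\<bar> \<le> \<bar>u x\<bar> * 1" unfolding v_def abs_mult by (intro mult_left_mono) auto
          moreover have "inverse (real (Suc n)) \<le> 1" by (simp add: inverse_le_1_iff)
          ultimately have "\<bar>u x - \<phi> n x\<bar> \<le> 2 * M + 1" using M[OF True] \<phi>(2)[of n x] by linarith
          from power_mono[OF this, of 2] True show ?thesis by simp
        qed simp
      qed
    qed (use iS in measurable)
    then show ?thesis by (subst lebesgue_on_integral_borel(2)[OF Sb]) auto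
  qed
  have limi: "(\<lambda>n. LINT x|lebesgue_on S. (weak_deriv S i u x - frechet_derivative (\<phi> n) (at x) i)\<^sup>2) \<longlonglongrightarrow> 0"
    if i: "i \<in> Basis" for i
  proof -
    \<comment> \<open>At each point the difference is eventually zero, because \<open>v n\<close>
      and \<open>u\<close> agree on a neighbourhood. The dominating constant 4 is the sum of the
      Lipschitz constants 1 and 3.\<close>
    have lv: "(\<lambda>n. LINT x|lborel. indicator S x * (ddir u i x - ddir (v n) i x)\<^sup>2) \<longlonglongrightarrow> (LINT x|(lborel::'a measure). 0)"
    proof (rule integral_dominated_convergence[where w = "\<lambda>x. indicator S x * 4\<^sup>2"])
      show "AE x in lborel. (\<lambda>n. indicator S x * (ddir u i x - ddir (v n) i x)\<^sup>2) \<longlonglongrightarrow> 0"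
      proof (rule AE_I2)
        fix x
        have "\<forall>\<^sub>F n in sequentially. indicator S x * (ddir u i x - ddir (v n) i x)\<^sup>2 = 0"
        proof (cases "x \<in> S")
          case True
          from ev[OF this] show ?thesis
          proof eventually_elim
            case (elim n)
            have "open {y. 2 < k n * d y}" by (intro open_Collect_less continuous_intros dc)
            then have "ddir (v n) i x = ddir u i x"
              using elim by (intro ddir_cong_open[of "{y. 2 < k n * d y}"]) (auto simp: veq)
            then show ?case by simp
          qed
        qed simp
        then show "(\<lambda>n. indicator S x * (ddir u i x - ddir (v n) i x)\<^sup>2) \<longlonglongrightarrow> 0"
          by (rule tendsto_eventually)
      qed
      show "AE x in lborel. norm (indicator S x * (ddir u i x - ddir (v n) i x)\<^sup>2) \<le> indicator S x * 4\<^sup>2" for n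
        using AE_ddir_bound[OF u, of i] AE_ddir_bound[OF vl[of n], of i]
      proof eventually_elim
        case (elim x)
        then have "\<bar>ddir u i x - ddir (v n) i x\<bar> \<le> 4" using i by simp
        from power_mono[OF this, of 2] show ?case by (cases "x \<in> S") auto
      qed
    qed (use iS in measurable)
    have idd: "integrable lborel (\<lambda>x. indicator S x * (ddir u i x - ddir (v n) i x)\<^sup>2)" for n
    proof (rule Bochner_Integration.integrable_bound[OF iS[of "4\<^sup>2"]])
      show "AE x in lborel. norm (indicator S x * (ddir u i x - ddir (v n) i x)\<^sup>2) \<le> norm (indicator S x * 4\<^sup>2 :: real)"
        using AE_ddir_bound[OF u, of i] AE_ddir_bound[OF vl[of n], of i]
      proof eventually_elim
        case (elim x)
        then have "\<bar>ddir u i x - ddir (v n) i x\<bar> \<le> 4" using i by simp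
        from power_mono[OF this, of 2] show ?case by (cases "x \<in> S") auto
      qed
    qed measurable
    have bound: "(LINT x|lebesgue_on S. (weak_deriv S i u x - frechet_derivative (\<phi> n) (at x) i)\<^sup>2) \<le>
        2 * (LINT x|lborel. indicator S x * (ddir u i x - ddir (v n) i x)\<^sup>2) + 2 * inverse (real (Suc n))" for n
    proof -
      let ?f = "\<lambda>x. frechet_derivative (\<phi> n) (at x) i"
      have "AE x in lborel. x \<in> S \<longrightarrow> (weak_deriv S i u x - ?f x)\<^sup>2 = (ddir u i x - ?f x)\<^sup>2"
        using lipschitz_weak_deriv(2)[OF S(1) u, of i] unfolding AE_lebesgue_on_iff[OF Sb]
        by eventually_elim simp
      then have "(LINT x|lebesgue_on S. (weak_deriv S i u x - ?f x)\<^sup>2) =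
          (LINT x|lborel. indicator S x * (ddir u i x - ?f x)\<^sup>2)"
        by (intro lebesgue_on_cong_borel(3)[OF Sb]) measurable
      also have "\<dots> \<le> (LINT x|lborel. 2 * (indicator S x * (ddir u i x - ddir (v n) i x)\<^sup>2) + 2 * (ddir (v n) i x - ?f x)\<^sup>2)"
      proof (rule integral_mono_AE')
        show "integrable lborel (\<lambda>x. 2 * (indicator S x * (ddir u i x - ddir (v n) i x)\<^sup>2) + 2 * (ddir (v n) i x - ?f x)\<^sup>2)"
          by (intro Bochner_Integration.integrable_add integrable_mult_right \<phi>(3)[OF i] idd)
        show "AE x in lborel. indicator S x * (ddir u i x - ?f x)\<^sup>2 \<le>
            2 * (indicator S x * (ddir u i x - ddir (v n) i x)\<^sup>2) + 2 * (ddir (v n) i x - ?f x)\<^sup>2"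
        proof (rule AE_I2)
          fix x
          show "indicator S x * (ddir u i x - ?f x)\<^sup>2 \<le>
              2 * (indicator S x * (ddir u i x - ddir (v n) i x)\<^sup>2) + 2 * (ddir (v n) i x - ?f x)\<^sup>2"
            using sum_squares_split[of "ddir u i x" "?f x" "ddir (v n) i x"] by (cases "x \<in> S") auto
        qed
      qed auto
      also have "\<dots> = 2 * (LINT x|lborel. indicator S x * (ddir u i x - ddir (v n) i x)\<^sup>2) + 2 * (LINT x|lborel. (ddir (v n) i x - ?f x)\<^sup>2)"
        using idd[of n] \<phi>(3)[OF i, of n] by simp
      finally show ?thesis using \<phi>(4)[OF i, of n] by linarith
    qed
    have "(\<lambda>n. 2 * (LINT x|lborel. indicator S x * (ddir u i x - ddir (v n) i x)\<^sup>2) + 2 * inverse (real (Suc n)))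
        \<longlonglongrightarrow> 2 * 0 + 2 * 0"
      using lv inv0 by (intro tendsto_add tendsto_mult tendsto_const) simp_all
    then have up: "(\<lambda>n. 2 * (LINT x|lborel. indicator S x * (ddir u i x - ddir (v n) i x)\<^sup>2) + 2 * inverse (real (Suc n)))
        \<longlonglongrightarrow> 0" by simp
    show ?thesis
      by (rule tendsto_sandwich[OF _ _ tendsto_const up])
        (intro always_eventually allI Bochner_Integration.integral_nonneg zero_le_power2,
          intro always_eventually allI bound)
  qed
  show ?thesis
    unfolding H10_def using lipschitz_H1[OF S u] \<phi>(1) lim0 limi by blast
qed

section \<open>Gradient constraint and Lipschitz continuity\<close>

lemma integral_abs_le_sqrt:
  fixes w :: "'a::euclidean_space \<Rightarrow> real"
  assumes S: "S \<in> sets borel" "bounded S" and w: "w \<in> borel_measurable (lebesgue_on S)"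
    "integrable (lebesgue_on S) (\<lambda>x. (w x)\<^sup>2)"
  shows "(LINT x|lebesgue_on S. \<bar>w x\<bar>) \<le> sqrt ((LINT x|lebesgue_on S. (w x)\<^sup>2) * measure lebesgue S)"
proof -
  interpret finite_measure "lebesgue_on S" by (rule finite_measure_bounded[OF S])
  have "(LINT x|lebesgue_on S. \<bar>w x * 1\<bar>)\<^sup>2 \<le> (LINT x|lebesgue_on S. (w x)\<^sup>2) * (LINT x|lebesgue_on S. 1\<^sup>2)"
    by (rule Cauchy_Schwarz_abs_integral[OF w]) auto
  moreover have "(LINT x|lebesgue_on S. (1::real)\<^sup>2) = measure lebesgue S"
    using S(1) by (simp add: measure_restrict_space)
  ultimately show ?thesis by (intro real_le_rsqrt) simp
qed

text \<open>The integral over the cube with corner x and side h, left unnormalised; the division by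
  the volume of the cube is made only when h is sent to zero.\<close>

definition box_int :: "real \<Rightarrow> ('a::euclidean_space \<Rightarrow> real) \<Rightarrow> 'a \<Rightarrow> real" where
  "box_int h w x = (LINT c|lborel. indicator (cbox 0 (h *\<^sub>R One)) c * w (x + c))"

text \<open>By the mean value theorem on the segment from y to x, the increment is an integral of
  the derivative of \<open>\<phi>\<close> in direction x - y over a translated cube. Splitting that
  gradient into the field W of norm at most 1 and an error gives the volume of the cube plus the
  errors in mean. Only the errors depend on \<open>\<phi>\<close>, so they vanish in a
  limit.\<close>

lemma box_int_smooth_bound:
  fixes \<phi> :: "'a::euclidean_space \<Rightarrow> real"
  assumes \<phi>: "smooth \<phi>" and W: "\<And>i. W i \<in> borel_measurable borel" "AE x in lborel. norm (\<Sum>i\<in>Basis. W i x *\<^sub>R i) \<le> 1"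
    and int: "\<And>i. i \<in> Basis \<Longrightarrow> integrable lborel (\<lambda>x. frechet_derivative \<phi> (at x) i - W i x)"
  shows "\<bar>box_int h \<phi> x - box_int h \<phi> y\<bar> \<le> norm (x - y) *
    (measure lborel (cbox (0::'a) (h *\<^sub>R One)) +
      (\<Sum>i\<in>Basis. LINT x|lborel. \<bar>frechet_derivative \<phi> (at x) i - W i x\<bar>))"
proof -
  define C where "C = cbox (0::'a) (h *\<^sub>R One)"
  have Cf: "emeasure lborel C < \<infinity>" unfolding C_def by (rule emeasure_lborel_cbox_finite)
  have [measurable]: "C \<in> sets borel" by (simp add: C_def)
  note W(1)[measurable]
  let ?D = "\<lambda>x. frechet_derivative \<phi> (at x)"
  have Dm[measurable]: "(\<lambda>x. ?D x i) \<in> borel_measurable borel" for i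
    by (rule borel_measurable_continuous_onI[OF smooth_frechet_derivative_continuous[OF \<phi>]])
  have HK: "box_int h \<psi> p = integral C (\<lambda>c. \<psi> (p + c))" if "continuous_on UNIV \<psi>" for \<psi> p
  proof -
    have "set_integrable lborel C (\<lambda>c. \<psi> (p + c))"
      unfolding C_def set_integrable_def
      by (intro borel_integrable_compact compact_cbox continuous_on_compose2[OF that] continuous_intros) auto
    from set_borel_integral_eq_integral(2)[OF this] show ?thesis
      by (simp add: box_int_def set_lebesgue_integral_def C_def)
  qed
  define A where "A s = box_int h \<phi> (y + s *\<^sub>R (x - y))" for s
  have der: "(A has_real_derivative integral C (\<lambda>c. ?D (y + s *\<^sub>R (x - y) + c) (x - y))) (at s)" for s
  proof -
    have "((\<lambda>s. integral (cbox 0 (h *\<^sub>R One)) (\<lambda>c. \<phi> (y + s *\<^sub>R (x - y) + c))) has_field_derivative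
        integral (cbox 0 (h *\<^sub>R One)) (\<lambda>c. ?D (y + s *\<^sub>R (x - y) + c) (x - y))) (at s within UNIV)"
    proof (rule leibniz_rule_field_derivative[where fx = "\<lambda>s c. ?D (y + s *\<^sub>R (x - y) + c) (x - y)"])
      fix s :: real and c :: 'a
      have "((\<lambda>s::real. y + s *\<^sub>R (x - y) + c) has_derivative (\<lambda>t. t *\<^sub>R (x - y))) (at s)"
        by (auto intro!: derivative_eq_intros)
      from diff_chain_at[OF this smooth_has_derivative[OF \<phi>]]
      have "((\<lambda>s. \<phi> (y + s *\<^sub>R (x - y) + c)) has_derivative (\<lambda>t. ?D (y + s *\<^sub>R (x - y) + c) (t *\<^sub>R (x - y)))) (at s)"
        by (simp add: o_def)
      moreover have "?D (y + s *\<^sub>R (x - y) + c) (t *\<^sub>R (x - y)) = ?D (y + s *\<^sub>R (x - y) + c) (x - y) * t" for t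
        using linear_scale[OF has_derivative_linear[OF smooth_has_derivative[OF \<phi>]]] by simp
      ultimately show "((\<lambda>s. \<phi> (y + s *\<^sub>R (x - y) + c)) has_field_derivative ?D (y + s *\<^sub>R (x - y) + c) (x - y)) (at s within UNIV)"
        by (simp only: has_field_derivative_def)
    next
      fix s :: real
      show "(\<lambda>c. \<phi> (y + s *\<^sub>R (x - y) + c)) integrable_on cbox 0 (h *\<^sub>R One)"
        by (intro integrable_continuous continuous_on_compose2[OF smooth_continuous[OF \<phi>]] continuous_intros) auto
    next
      show "continuous_on (UNIV \<times> cbox 0 (h *\<^sub>R One)) (\<lambda>(s, c). ?D (y + s *\<^sub>R (x - y) + c) (x - y))"
        unfolding case_prod_beta
        by (intro continuous_on_compose2[OF smooth_frechet_derivative_continuous[OF \<phi>]] continuous_intros) auto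
    qed auto
    then show ?thesis
      unfolding A_def HK[OF smooth_continuous[OF \<phi>], abs_def] by (simp add: C_def)
  qed
  obtain s where s: "A 1 - A 0 = (1 - 0) * integral C (\<lambda>c. ?D (y + s *\<^sub>R (x - y) + c) (x - y))"
    using MVT2[of 0 1 A, OF _ der] by auto
  define p where "p = y + s *\<^sub>R (x - y)"
  have ip: "integrable lborel (\<lambda>c. \<bar>?D (p + c) i - W i (p + c)\<bar>)" if "i \<in> Basis" for i
    using int[OF that] lborel_shift(1)[of "\<lambda>c. ?D c i - W i c" p] by (simp add: add.commute)
  have "box_int h \<phi> x - box_int h \<phi> y = integral C (\<lambda>c. ?D (p + c) (x - y))"
    using s by (simp add: A_def p_def)
  also have "\<dots> = box_int h (\<lambda>z. ?D z (x - y)) p"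
    by (rule HK[OF smooth_frechet_derivative_continuous[OF \<phi>], symmetric])
  finally have "\<bar>box_int h \<phi> x - box_int h \<phi> y\<bar> \<le> (LINT c|lborel. \<bar>indicator C c * ?D (p + c) (x - y)\<bar>)"
    unfolding box_int_def C_def by (simp only: integral_abs_bound)
  also have "\<dots> \<le> (LINT c|lborel. norm (x - y) * (indicator C c + (\<Sum>i\<in>Basis. \<bar>?D (p + c) i - W i (p + c)\<bar>)))"
  proof (rule integral_mono_AE')
    show "integrable lborel (\<lambda>c. norm (x - y) * (indicator C c + (\<Sum>i\<in>Basis. \<bar>?D (p + c) i - W i (p + c)\<bar>)))"
      using Cf by (intro integrable_mult_right Bochner_Integration.integrable_add Bochner_Integration.integrable_sum ip
          integrable_real_indicator) auto
    have "AE c in lborel. norm (\<Sum>i\<in>Basis. W i (p + c) *\<^sub>R i) \<le> 1"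
    proof -
      have "AE c in distr lborel borel ((+) p). norm (\<Sum>i\<in>Basis. W i c *\<^sub>R i) \<le> 1"
        unfolding lborel_distr_plus by (rule W(2))
      then show ?thesis by (subst (asm) AE_distr_iff) auto
    qed
    then show "AE c in lborel. \<bar>indicator C c * ?D (p + c) (x - y)\<bar> \<le>
        norm (x - y) * (indicator C c + (\<Sum>i\<in>Basis. \<bar>?D (p + c) i - W i (p + c)\<bar>))"
    proof eventually_elim
      case (elim c)
      let ?q = "p + c"
      have "?D ?q (x - y) = (x - y) \<bullet> (\<Sum>i\<in>Basis. W i ?q *\<^sub>R i) + (\<Sum>i\<in>Basis. ((x - y) \<bullet> i) * (?D ?q i - W i ?q))"
        unfolding frechet_derivative_components[OF smooth_differentiable[OF \<phi>], of ?q "x - y"] inner_sum_right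
          sum.distrib[symmetric] by (rule sum.cong) (auto simp: algebra_simps)
      moreover have "\<bar>(x - y) \<bullet> (\<Sum>i\<in>Basis. W i ?q *\<^sub>R i)\<bar> \<le> norm (x - y) * 1"
        by (rule order_trans[OF Cauchy_Schwarz_ineq2 mult_left_mono[OF elim]]) simp
      moreover have "\<bar>\<Sum>i\<in>Basis. ((x - y) \<bullet> i) * (?D ?q i - W i ?q)\<bar> \<le> norm (x - y) * (\<Sum>i\<in>Basis. \<bar>?D ?q i - W i ?q\<bar>)"
        unfolding sum_distrib_left
        by (rule order_trans[OF sum_abs sum_mono]) (auto simp: abs_mult intro!: mult_right_mono Basis_le_norm)
      ultimately have "\<bar>?D ?q (x - y)\<bar> \<le> norm (x - y) * (1 + (\<Sum>i\<in>Basis. \<bar>?D ?q i - W i ?q\<bar>))"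
        by (simp add: distrib_left)
      moreover have "0 \<le> norm (x - y) * (\<Sum>i\<in>Basis. \<bar>?D ?q i - W i ?q\<bar>)"
        by (intro mult_nonneg_nonneg sum_nonneg) auto
      ultimately show ?case by (cases "c \<in> C") auto
    qed
  qed simp
  also have "\<dots> = norm (x - y) * (measure lborel C + (\<Sum>i\<in>Basis. LINT c|lborel. \<bar>?D (p + c) i - W i (p + c)\<bar>))"
  proof -
    have i1: "integrable lborel (indicator C :: 'a \<Rightarrow> real)" using Cf by (intro integrable_real_indicator) auto
    show ?thesis
      using Cf ip by (subst integral_mult_right_zero, subst Bochner_Integration.integral_add[OF i1])
        (auto intro!: Bochner_Integration.integrable_sum simp: Bochner_Integration.integral_sum)
  qed
  also have "(\<Sum>i\<in>Basis. LINT c|lborel. \<bar>?D (p + c) i - W i (p + c)\<bar>) = (\<Sum>i\<in>Basis. LINT x|lborel. \<bar>?D x i - W i x\<bar>)"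
  proof (rule sum.cong[OF refl])
    fix i :: 'a
    show "(LINT c|lborel. \<bar>?D (p + c) i - W i (p + c)\<bar>) = (LINT x|lborel. \<bar>?D x i - W i x\<bar>)"
      using lborel_shift(2)[of "\<lambda>c. \<bar>?D c i - W i c\<bar>" p] by (simp add: add.commute)
  qed
  finally show ?thesis unfolding C_def .
qed

text \<open>The averages over cubes of the zero extension of \<open>v\<close> are limits of averages of test functions,
  whose Lipschitz constants tend to the bound for the gradient of \<open>v\<close>.\<close>

lemma H10_grad_le_imp_lipschitz:
  fixes v :: "'a::euclidean_space \<Rightarrow> real"
  assumes S: "open S" "bounded S" and v: "v \<in> H10 S" and grad: "AE x in lebesgue_on S. norm (weak_grad S v x) \<le> 1"
  obtains u where "1-lipschitz_on UNIV u" "AE x in lebesgue_on S. v x = u x" "AE x in lborel. x \<notin> S \<longrightarrow> u x = 0"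
proof -
  have Sb[measurable]: "S \<in> sets borel" using S by auto
  obtain \<phi> where \<phi>: "\<And>k. \<phi> k \<in> test_functions S"
    and lim0: "(\<lambda>k. LINT x|lebesgue_on S. (v x - \<phi> k x)\<^sup>2) \<longlonglongrightarrow> 0"
    and limi: "\<And>i. i \<in> Basis \<Longrightarrow> (\<lambda>k. LINT x|lebesgue_on S. (weak_deriv S i v x - frechet_derivative (\<phi> k) (at x) i)\<^sup>2) \<longlonglongrightarrow> 0"
    using v by (auto simp: H10_def)
  have vL2: "v \<in> L2 S" and wL2: "\<And>i. i \<in> Basis \<Longrightarrow> weak_deriv S i v \<in> L2 S"
    using v by (auto simp: H10_def H1_def)
  have \<phi>c: "continuous_on UNIV (\<phi> k)" for k by (rule smooth_continuous[OF test_function_smooth[OF \<phi>]])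
  have \<phi>m[measurable]: "\<phi> k \<in> borel_measurable borel" for k by (rule borel_measurable_continuous_onI[OF \<phi>c])
  let ?D = "\<lambda>k i x. frechet_derivative (\<phi> k) (at x) i"
  have Dc: "continuous_on UNIV (?D k i)" for k i
    by (rule smooth_frechet_derivative_continuous[OF test_function_smooth[OF \<phi>]])
  have Dm[measurable]: "?D k i \<in> borel_measurable borel" for k i by (rule borel_measurable_continuous_onI[OF Dc])
  have "\<phi> k x = 0 \<and> ?D k i x = 0" if "x \<notin> S" for k i x
  proof (rule test_functionsD[OF \<phi>[of k]])
    fix C assume C: "compact C" "C \<subseteq> S" "\<And>x. x \<notin> C \<Longrightarrow> \<phi> k x = 0"
    then have x: "x \<notin> C" using that by blast
    show "\<phi> k x = 0 \<and> ?D k i x = 0"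
      by (rule conjI[OF C(3)[OF x] test_function_deriv_eq_0[OF C(1) _ x]]) (rule C(3))
  qed
  then have \<phi>0: "x \<notin> S \<Longrightarrow> \<phi> k x = 0" "x \<notin> S \<Longrightarrow> ?D k i x = 0" for k i x by auto
  have rep: "\<exists>w. w \<in> borel_measurable borel \<and> (AE x in lborel. x \<in> S \<longrightarrow> q x = w x)" if "q \<in> L2 S" for q
  proof (rule borel_representative[OF Sb])
    show "q \<in> borel_measurable (lebesgue_on S)" using that by (simp add: L2_def)
  qed (rule exI, erule (1) conjI)
  obtain g where g[measurable]: "g \<in> borel_measurable borel" and g_eq: "AE x in lborel. x \<in> S \<longrightarrow> v x = g x"
    using rep[OF vL2] by (elim exE conjE) (rule that)
  have "\<exists>w. w \<in> borel_measurable borel \<and> (AE x in lborel. x \<in> S \<longrightarrow> weak_deriv S i v x = w x)" if "i \<in> Basis" for i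
    by (rule rep[OF wL2[OF that]])
  then obtain w where w: "\<And>i. i \<in> Basis \<Longrightarrow> w i \<in> borel_measurable borel"
    "\<And>i. i \<in> Basis \<Longrightarrow> AE x in lborel. x \<in> S \<longrightarrow> weak_deriv S i v x = w i x" by metis
  \<comment> \<open>\<open>G\<close> and \<open>W\<close> extend Borel representatives of
    \<open>v\<close> and of its partial derivatives by zero. The approximating test functions vanish
    off S too, so convergence on S becomes convergence on the whole space, where translations are
    available.\<close>
  define G where "G x = indicator S x * g x" for x
  define W where "W i x = (if i \<in> Basis then indicator S x * w i x else 0)" for i x
  have [measurable]: "G \<in> borel_measurable borel" unfolding G_def[abs_def] by measurable
  have Wm[measurable]: "W i \<in> borel_measurable borel" for i
    using w(1)[of i] unfolding W_def[abs_def] by (cases "i \<in> Basis") simp_all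
  \<comment> \<open>On a bounded set convergence in mean square implies convergence in mean. The
    same statement is used for the values and for every partial derivative.\<close>
  have L1lim: "integrable lborel (\<lambda>x. \<psi> k x - H x)" "(\<lambda>k. LINT x|lborel. \<bar>\<psi> k x - H x\<bar>) \<longlonglongrightarrow> 0"
    if \<psi>: "\<And>k. continuous_on UNIV (\<psi> k)" "\<And>k x. x \<notin> S \<Longrightarrow> \<psi> k x = 0" and H: "H \<in> borel_measurable borel"
      "\<And>x. x \<notin> S \<Longrightarrow> H x = 0" and q: "q \<in> L2 S" "AE x in lborel. x \<in> S \<longrightarrow> q x = H x"
      "(\<lambda>k. LINT x|lebesgue_on S. (q x - \<psi> k x)\<^sup>2) \<longlonglongrightarrow> 0" for \<psi> H q k
  proof -
    have \<psi>m: "\<psi> k \<in> borel_measurable borel" for k by (rule borel_measurable_continuous_onI[OF \<psi>(1)])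
    have \<psi>L2: "\<psi> k \<in> L2 S" for k by (rule continuous_bounded_L2[OF S \<psi>(1)])
    have sq: "integrable (lebesgue_on S) (\<lambda>x. (q x - \<psi> k x)\<^sup>2)" for k
      using q(1) \<psi>L2[of k] unfolding L2_def by (intro integrable_diff_squared) auto
    have meas: "(\<lambda>x. q x - \<psi> k x) \<in> borel_measurable (lebesgue_on S)" for k
      using q(1) \<psi>L2[of k] unfolding L2_def by auto
    have conv: "(LINT x|lebesgue_on S. \<bar>q x - \<psi> k x\<bar>) = (LINT x|lborel. \<bar>\<psi> k x - H x\<bar>)"
      and int: "integrable lborel (\<lambda>x. \<bar>\<psi> k x - H x\<bar>)" for k
    proof -
      have eq: "AE x in lborel. x \<in> S \<longrightarrow> \<bar>q x - \<psi> k x\<bar> = \<bar>\<psi> k x - H x\<bar>"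
        using q(2) by eventually_elim auto
      have m: "(\<lambda>x. \<bar>\<psi> k x - H x\<bar>) \<in> borel_measurable borel" using \<psi>m H(1) by measurable
      have ind: "(\<lambda>x. indicator S x * \<bar>\<psi> k x - H x\<bar>) = (\<lambda>x. \<bar>\<psi> k x - H x\<bar>)"
        using \<psi>(2) H(2) by (auto simp: fun_eq_iff indicator_def)
      show "(LINT x|lebesgue_on S. \<bar>q x - \<psi> k x\<bar>) = (LINT x|lborel. \<bar>\<psi> k x - H x\<bar>)"
        using lebesgue_on_cong_borel(3)[OF Sb m eq] unfolding ind .
      have "integrable (lebesgue_on S) (\<lambda>x. \<bar>q x - \<psi> k x\<bar>)"
        using L2_imp_integrable[OF Sb S(2) q(1)] L2_imp_integrable[OF Sb S(2) \<psi>L2[of k]] by auto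
      then show "integrable lborel (\<lambda>x. \<bar>\<psi> k x - H x\<bar>)"
        using lebesgue_on_cong_borel(2)[OF Sb m eq] unfolding ind by blast
    qed
    have "(\<lambda>x. \<psi> k x - H x) \<in> borel_measurable lborel" using \<psi>m H(1) by measurable
    then show "integrable lborel (\<lambda>x. \<psi> k x - H x)" using int[of k] by (simp only: integrable_abs_cancel)
    have "(\<lambda>k. sqrt ((LINT x|lebesgue_on S. (q x - \<psi> k x)\<^sup>2) * measure lebesgue S)) \<longlonglongrightarrow> sqrt (0 * measure lebesgue S)"
      by (rule tendsto_real_sqrt[OF tendsto_mult[OF q(3) tendsto_const]])
    then have "(\<lambda>k. sqrt ((LINT x|lebesgue_on S. (q x - \<psi> k x)\<^sup>2) * measure lebesgue S)) \<longlonglongrightarrow> 0" by simp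
    then show "(\<lambda>k. LINT x|lborel. \<bar>\<psi> k x - H x\<bar>) \<longlonglongrightarrow> 0"
    proof (rule tendsto_sandwich[OF _ _ tendsto_const, rotated -1])
      show "\<forall>\<^sub>F k in sequentially. (LINT x|lborel. \<bar>\<psi> k x - H x\<bar>) \<le> sqrt ((LINT x|lebesgue_on S. (q x - \<psi> k x)\<^sup>2) * measure lebesgue S)"
        unfolding conv[symmetric] by (intro always_eventually allI integral_abs_le_sqrt[OF Sb S(2) meas sq])
    qed simp
  qed
  have "AE x in lborel. x \<in> S \<longrightarrow> v x = G x" "\<And>x. x \<notin> S \<Longrightarrow> G x = 0"
    using g_eq by (auto simp: G_def elim: eventually_mono)
  note G_L1 = L1lim[OF \<phi>c \<phi>0(1) _ this(2) vL2 this(1) lim0]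
  have "AE x in lborel. x \<in> S \<longrightarrow> weak_deriv S i v x = W i x" "\<And>x. x \<notin> S \<Longrightarrow> W i x = 0" if "i \<in> Basis" for i
    using w(2)[OF that] that by (auto simp: W_def elim: eventually_mono)
  note W_L1 = L1lim[OF Dc \<phi>0(2) Wm this(2) wL2 this(1) limi]
  have G1: "integrable lborel (\<lambda>x. \<phi> k x - G x)" for k by (rule G_L1(1)) measurable
  have G2: "(\<lambda>k. LINT x|lborel. \<bar>\<phi> k x - G x\<bar>) \<longlonglongrightarrow> 0" by (rule G_L1(2)) measurable
  note G_L1 = G1 G2
  have W_int: "integrable lborel (\<lambda>x. ?D k i x - W i x)" if "i \<in> Basis" for k i
    by (rule W_L1(1)) (rule that | assumption)+
  have W_lim: "(\<lambda>k. LINT x|lborel. \<bar>?D k i x - W i x\<bar>) \<longlonglongrightarrow> 0" if "i \<in> Basis" for i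
    by (rule W_L1(2)) (rule that | assumption)+
  note W_L1 = W_int W_lim
  have W1: "AE x in lborel. norm (\<Sum>i\<in>Basis. W i x *\<^sub>R i) \<le> 1"
  proof -
    have "AE x in lborel. \<forall>i\<in>Basis. x \<in> S \<longrightarrow> weak_deriv S i v x = w i x"
      using w(2) by (intro AE_finite_allI) auto
    then show ?thesis
      using grad[unfolded AE_lebesgue_on_iff[OF Sb]]
    proof eventually_elim
      case (elim x)
      show ?case
      proof (cases "x \<in> S")
        case True
        then have "(\<Sum>i\<in>Basis. W i x *\<^sub>R i) = weak_grad S v x"
          unfolding weak_grad_def using elim(1) by (intro sum.cong) (auto simp: W_def)
        then show ?thesis using elim(2) True by simp
      next
        case False
        then have "(\<Sum>i\<in>Basis. W i x *\<^sub>R i) = 0" by (intro sum.neutral) (auto simp: W_def)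
        then show ?thesis by simp
      qed
    qed
  qed
  have ic: "integrable lborel (\<phi> k)" for k
    by (rule test_functionsD[OF \<phi>[of k]]) (rule continuous_compact_support_integrable[OF \<phi>c])
  have iG: "integrable lborel G"
    using Bochner_Integration.integrable_diff[OF ic[of 0] G_L1(1)[of 0]] by simp
  have box_lim: "(\<lambda>k. box_int h (\<phi> k) x) \<longlonglongrightarrow> box_int h G x" for h x
  proof -
    have "\<bar>box_int h (\<phi> k) x - box_int h G x\<bar> \<le> (LINT x|lborel. \<bar>\<phi> k x - G x\<bar>)" for k
    proof -
      have i1: "integrable lborel (\<lambda>c. \<phi> k (x + c))" "integrable lborel (\<lambda>c. G (x + c))"
        using ic[of k] iG lborel_shift(1)[of "\<phi> k" x] lborel_shift(1)[of G x] by (simp_all add: add.commute)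
      have i2: "integrable lborel (\<lambda>c. indicator (cbox 0 (h *\<^sub>R One)) c * f c)" if "integrable lborel f" for f :: "'a \<Rightarrow> real"
        using integrable_mult_indicator[OF _ that, of "cbox 0 (h *\<^sub>R One)"] by simp
      have "box_int h (\<phi> k) x - box_int h G x = (LINT c|lborel. indicator (cbox 0 (h *\<^sub>R One)) c * (\<phi> k (x + c) - G (x + c)))"
        unfolding box_int_def using i2[OF i1(1)] i2[OF i1(2)] by (simp add: right_diff_distrib)
      also have "\<bar>\<dots>\<bar> \<le> (LINT c|lborel. \<bar>indicator (cbox 0 (h *\<^sub>R One)) c * (\<phi> k (x + c) - G (x + c))\<bar>)"
        by (rule integral_abs_bound)
      also have "\<dots> \<le> (LINT c|lborel. \<bar>\<phi> k (x + c) - G (x + c)\<bar>)"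
      proof (rule integral_mono)
        show "integrable lborel (\<lambda>c. \<bar>indicator (cbox 0 (h *\<^sub>R One)) c * (\<phi> k (x + c) - G (x + c))\<bar>)"
          by (intro integrable_abs i2 Bochner_Integration.integrable_diff i1)
        show "integrable lborel (\<lambda>c. \<bar>\<phi> k (x + c) - G (x + c)\<bar>)"
          by (intro integrable_abs Bochner_Integration.integrable_diff i1)
        show "\<bar>indicator (cbox 0 (h *\<^sub>R One)) c * (\<phi> k (x + c) - G (x + c))\<bar> \<le> \<bar>\<phi> k (x + c) - G (x + c)\<bar>" for c
          by (auto simp: indicator_def)
      qed
      also have "\<dots> = (LINT x|lborel. \<bar>\<phi> k x - G x\<bar>)"
        using lborel_shift(2)[of "\<lambda>c. \<bar>\<phi> k c - G c\<bar>" x] by (simp add: add.commute)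
      finally show ?thesis .
    qed
    then have "(\<lambda>k. box_int h (\<phi> k) x - box_int h G x) \<longlonglongrightarrow> 0"
      by (intro Lim_null_comparison[OF always_eventually G_L1(2)]) simp
    then show ?thesis by (simp only: LIM_zero_iff)
  qed
  \<comment> \<open>In the limit the errors disappear, and the remaining constant is the volume of
    the cube, that is 1 for normalised averages.\<close>
  have box_lip: "\<bar>box_int h G x - box_int h G y\<bar> \<le> norm (x - y) * h ^ DIM('a)" if "h > 0" for h x y
  proof (rule LIMSEQ_le)
    show "(\<lambda>k. \<bar>box_int h (\<phi> k) x - box_int h (\<phi> k) y\<bar>) \<longlonglongrightarrow> \<bar>box_int h G x - box_int h G y\<bar>"
      by (intro tendsto_rabs tendsto_diff box_lim)
    have "(\<lambda>k. norm (x - y) * (measure lborel (cbox (0::'a) (h *\<^sub>R One)) + (\<Sum>i\<in>Basis. LINT x|lborel. \<bar>?D k i x - W i x\<bar>)))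
        \<longlonglongrightarrow> norm (x - y) * (measure lborel (cbox (0::'a) (h *\<^sub>R One)) + (\<Sum>i\<in>(Basis::'a set). 0))"
      by (intro tendsto_mult tendsto_add tendsto_const tendsto_sum W_L1(2))
    moreover have "measure lborel (cbox (0::'a) (h *\<^sub>R One)) = h ^ DIM('a)"
      using that by (simp add: measure_lborel_cbox_eq)
    ultimately show "(\<lambda>k. norm (x - y) * (measure lborel (cbox (0::'a) (h *\<^sub>R One)) + (\<Sum>i\<in>Basis. LINT x|lborel. \<bar>?D k i x - W i x\<bar>)))
        \<longlonglongrightarrow> norm (x - y) * h ^ DIM('a)" by simp
    show "\<exists>N. \<forall>k\<ge>N. \<bar>box_int h (\<phi> k) x - box_int h (\<phi> k) y\<bar> \<le>
        norm (x - y) * (measure lborel (cbox (0::'a) (h *\<^sub>R One)) + (\<Sum>i\<in>Basis. LINT x|lborel. \<bar>?D k i x - W i x\<bar>))"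
      by (intro exI allI impI box_int_smooth_bound[OF test_function_smooth[OF \<phi>] Wm W1 W_L1(1)])
  qed
  have "G integrable_on cbox a b" for a b
    using iG by (intro integrable_on_subcbox[of G UNIV] integrable_on_lborel) auto
  from integrable_ccontinuous_explicit[OF this] obtain N where N: "negligible N"
    "\<And>x e. x \<notin> N \<Longrightarrow> 0 < e \<Longrightarrow> \<exists>d>0. \<forall>h. 0 < h \<and> h < d \<longrightarrow>
        norm (integral (cbox x (x + h *\<^sub>R One)) G /\<^sub>R h ^ DIM('a) - G x) < e"
    by blast
  have box_eq: "integral (cbox x (x + h *\<^sub>R One)) G = box_int h G x" for x h
  proof -
    have "integral (cbox x (x + h *\<^sub>R One)) G = (LINT c|lborel. indicator (cbox x (x + h *\<^sub>R One)) c * G c)"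
      using set_borel_integral_eq_integral(2)[of "cbox x (x + h *\<^sub>R One)" G]
        integrable_mult_indicator[OF _ iG, of "cbox x (x + h *\<^sub>R One)"]
      by (simp add: set_lebesgue_integral_def set_integrable_def)
    also have "\<dots> = (LINT c|lborel. indicator (cbox x (x + h *\<^sub>R One)) (c + x) * G (c + x))"
      by (rule lborel_shift(2)[symmetric]) measurable
    also have "\<dots> = box_int h G x"
      unfolding box_int_def
      by (rule Bochner_Integration.integral_cong) (auto simp: indicator_def mem_box inner_add_left add.commute)
    finally show ?thesis .
  qed
  have avg: "\<exists>d>0. \<forall>h. 0 < h \<and> h < d \<longrightarrow> \<bar>box_int h G x / h ^ DIM('a) - G x\<bar> < e" if "x \<notin> N" "0 < e" for x e
    using N(2)[OF that] unfolding box_eq real_norm_def real_scaleR_def divide_inverse_commute .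
  \<comment> \<open>Off the null set N the values of \<open>G\<close> are limits of its averages,
    which share the constant 1. The complement of N is dense, so \<open>G\<close> restricted to it
    extends to a 1-Lipschitz function on the whole space.\<close>
  have G_lip: "1-lipschitz_on (- N) G"
  proof (rule lipschitz_onI)
    fix x y assume xy: "x \<in> - N" "y \<in> - N"
    show "dist (G x) (G y) \<le> 1 * dist x y"
    proof (rule field_le_epsilon)
      fix e :: real assume "e > 0"
      obtain d1 where d1: "d1 > 0" "\<And>h. 0 < h \<Longrightarrow> h < d1 \<Longrightarrow> \<bar>box_int h G x / h ^ DIM('a) - G x\<bar> < e / 2"
        using avg[of x "e / 2"] xy \<open>e > 0\<close> by auto
      obtain d2 where d2: "d2 > 0" "\<And>h. 0 < h \<Longrightarrow> h < d2 \<Longrightarrow> \<bar>box_int h G y / h ^ DIM('a) - G y\<bar> < e / 2"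
        using avg[of y "e / 2"] xy \<open>e > 0\<close> by auto
      define h where "h = min d1 d2 / 2"
      have h: "0 < h" "h < d1" "h < d2" using d1(1) d2(1) by (auto simp: h_def)
      have "\<bar>box_int h G x / h ^ DIM('a) - box_int h G y / h ^ DIM('a)\<bar> \<le> norm (x - y)"
        using box_lip[OF h(1), of x y] h(1)
        by (simp add: diff_divide_distrib[symmetric] abs_divide pos_divide_le_eq)
      then show "dist (G x) (G y) \<le> 1 * dist x y + e"
        using d1(2)[OF h(1,2)] d2(2)[OF h(1,3)] unfolding dist_real_def dist_norm[of x y] by linarith
    qed
  qed simp
  have "closure (- N) = UNIV"
  proof -
    have "interior N = {}" using N(1) negligible_subset[OF N(1) interior_subset] open_not_negligible[OF open_interior] by blast
    then show ?thesis by (simp add: closure_complement)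
  qed
  with lipschitz_extend_closure[OF G_lip] obtain u where u: "1-lipschitz_on UNIV u" "\<And>x. x \<notin> N \<Longrightarrow> u x = G x"
    by auto
  have Nae: "AE x in lborel. x \<notin> N"
    using N(1) AE_not_in[of N lebesgue] by (simp add: negligible_iff_null_sets AE_completion_iff)
  show thesis
  proof (rule that[OF u(1)])
    show "AE x in lebesgue_on S. v x = u x"
      unfolding AE_lebesgue_on_iff[OF Sb] using g_eq Nae by eventually_elim (auto simp: u(2) G_def)
    show "AE x in lborel. x \<notin> S \<longrightarrow> u x = 0"
      using Nae by eventually_elim (auto simp: u(2) G_def)
  qed
qed

text \<open>From a boundary point, a small step against the axis e keeps the foot point and lowers
  the height, so it lands strictly below the graph, in an open set disjoint from S. This rules out
  null pieces of the complement on which an almost everywhere statement would say nothing.\<close>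

lemma C2_boundary_compl_subset:
  fixes S :: "'a::euclidean_space set"
  assumes "open S" "C2_boundary S" shows "- S \<subseteq> closure (interior (- S))"
proof
  fix x assume "x \<in> - S"
  then have xS: "x \<notin> S" by simp
  show "x \<in> closure (interior (- S))"
  proof (cases "x \<in> interior (- S)")
    case True then show ?thesis using closure_subset by blast
  next
    case False
    then have "x \<in> frontier S"
      using xS \<open>open S\<close> by (auto simp: frontier_def interior_open interior_complement)
    from bspec[OF \<open>C2_boundary S\<close>[unfolded C2_boundary_def] this]
    obtain r e \<gamma> where r: "r > 0" "norm e = 1" "Ck 2 \<gamma>"
      "S \<inter> ball x r = {y \<in> ball x r. y \<bullet> e > \<gamma> (y - (y \<bullet> e) *\<^sub>R e)}"
      by (elim exE conjE) (rule that, assumption+)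
    have mem: "y \<in> S \<longleftrightarrow> \<gamma> (y - (y \<bullet> e) *\<^sub>R e) < y \<bullet> e" if "y \<in> ball x r" for y
      using that r(4) by (simp add: set_eq_iff) blast
    have ee: "e \<bullet> e = 1" using r(2) by (simp add: norm_eq_1)
    define U where "U = {y. y \<bullet> e < \<gamma> (y - (y \<bullet> e) *\<^sub>R e)} \<inter> ball x r"
    have "open U" unfolding U_def
      by (intro open_Int open_Collect_less open_ball continuous_intros continuous_on_compose2[OF Ck_continuous[OF r(3)]]) auto
    moreover have "U \<subseteq> - S"
      unfolding U_def by (auto simp del: mem_ball simp: mem)
    ultimately have U: "U \<subseteq> interior (- S)" by (rule interior_maximal[rotated])
    have \<gamma>x: "x \<bullet> e \<le> \<gamma> (x - (x \<bullet> e) *\<^sub>R e)" using xS r(1) mem[of x] by simp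
    show ?thesis
      unfolding closure_approachable
    proof (intro allI impI)
      fix \<epsilon> :: real assume "\<epsilon> > 0"
      define s where "s = min \<epsilon> r / 2"
      have s: "0 < s" "s < \<epsilon>" "s < r" using \<open>\<epsilon> > 0\<close> r(1) by (auto simp: s_def)
      define p where "p = x - s *\<^sub>R e"
      have pe: "p \<bullet> e = x \<bullet> e - s" by (simp add: p_def inner_diff_left ee)
      have "p - (p \<bullet> e) *\<^sub>R e = x - (x \<bullet> e) *\<^sub>R e" unfolding pe by (simp add: p_def algebra_simps)
      moreover have d: "dist p x = s" using s(1) r(2) by (simp add: p_def dist_norm)
      ultimately have "p \<in> U" using \<gamma>x pe s by (auto simp: U_def dist_commute)
      then show "\<exists>y\<in>interior (- S). dist y x < \<epsilon>" using U d s(2) by blast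
    qed
  qed
qed

lemma bounded_compl_nonempty:
  fixes S :: "'a::euclidean_space set"
  assumes "bounded S" shows "- S \<noteq> {}"
proof
  assume "- S = {}"
  then have "S = UNIV" by blast
  then show False using assms not_bounded_UNIV by simp
qed

text \<open>A segment from a point of S to a point outside meets the boundary no later than its end.
  This allows the obstacle of the definitions to be exchanged for the distance to the complement,
  which vanishes outside S.\<close>

lemma infdist_frontier:
  fixes S :: "'a::euclidean_space set"
  assumes S: "open S" "bounded S" and x: "x \<in> S"
  shows "infdist x (frontier S) = infdist x (- S)"
proof (rule antisym)
  have ne: "- S \<noteq> {}" by (rule bounded_compl_nonempty[OF S(2)])
  have "infdist x (frontier S) \<le> dist x p" if "p \<in> - S" for p
  proof -
    have "closed_segment x p \<inter> frontier S \<noteq> {}"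
      using x that by (intro connected_Int_frontier connected_segment) auto
    then obtain q where q: "q \<in> closed_segment x p" "q \<in> frontier S" by blast
    have "infdist x (frontier S) \<le> dist x q" by (rule infdist_le[OF q(2)])
    also have "\<dots> \<le> dist x p" using segment_bound(1)[OF q(1)] by (simp add: dist_norm norm_minus_commute)
    finally show ?thesis .
  qed
  then show "infdist x (frontier S) \<le> infdist x (- S)"
    unfolding infdist_notempty[OF ne] by (intro cINF_greatest[OF ne])
  have "frontier S \<noteq> {}" using frontier_not_empty[of S] x ne by auto
  moreover have "frontier S \<subseteq> - S" using S(1) by (auto simp: frontier_def interior_open)
  ultimately show "infdist x (- S) \<le> infdist x (frontier S)" by (intro infdist_mono) auto
qed

text \<open>The Lipschitz representative vanishes almost everywhere off S, by continuity on the
  interior of the complement, and by the regularity of the boundary on all of the complement.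
  Comparing with the nearest point of the complement then bounds it by the distance.\<close>

lemma K_grad_lipschitz:
  fixes S :: "'a::euclidean_space set"
  assumes S: "open S" "bounded S" "C2_boundary S" and v: "v \<in> K_grad S"
  obtains u where "1-lipschitz_on UNIV u" "AE x in lebesgue_on S. v x = u x" "\<And>x. \<bar>u x\<bar> \<le> infdist x (- S)"
proof -
  obtain u where u: "1-lipschitz_on UNIV u" "AE x in lebesgue_on S. v x = u x" "AE x in lborel. x \<notin> S \<longrightarrow> u x = 0"
    using H10_grad_le_imp_lipschitz[OF S(1,2), of v] v by (auto simp: K_grad_def)
  have uc: "continuous_on UNIV u" by (rule lipschitz_on_continuous_on[OF u(1)])
  have cl: "closed {x. u x = 0}" by (intro closed_Collect_eq uc continuous_intros)
  have "interior (- S) \<subseteq> {x. u x = 0}"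
  proof
    fix x assume x: "x \<in> interior (- S)"
    have "AE y\<in>interior (- S) in lebesgue. y \<in> {x. u x = 0}"
      using u(3) interior_subset[of "- S"] by (intro AE_completion) (auto elim!: eventually_mono)
    then show "x \<in> {x. u x = 0}" by (rule mem_closed_if_AE_lebesgue_open[OF open_interior cl _ x])
  qed
  then have "- S \<subseteq> {x. u x = 0}"
    using C2_boundary_compl_subset[OF S(1,3)] closure_minimal[OF _ cl] by blast
  then have u0: "u x = 0" if "x \<in> - S" for x using that by blast
  have ne: "- S \<noteq> {}" by (rule bounded_compl_nonempty[OF S(2)])
  have "\<bar>u x\<bar> \<le> infdist x (- S)" for x
  proof -
    have "\<bar>u x\<bar> \<le> dist x p" if "p \<in> - S" for p
      using lipschitz_onD[OF u(1), of x p] u0[OF that] by (simp add: dist_real_def)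
    then show ?thesis unfolding infdist_notempty[OF ne] by (intro cINF_greatest[OF ne])
  qed
  with u(1,2) show thesis by (rule that)
qed

section \<open>The two obstacles problem along characteristics\<close>

text \<open>The explicit solution of the Skorokhod problem on \<open>[0, \<infinity>)\<close> with driver 0, lower obstacle \<open>L\<close>,
  upper obstacle \<open>U\<close> and initial value \<open>w0\<close>: a Dynkin game in which the minimizer chooses when to
  stop at the upper obstacle.\<close>

definition sk :: "(real \<Rightarrow> real) \<Rightarrow> (real \<Rightarrow> real) \<Rightarrow> real \<Rightarrow> real \<Rightarrow> real" where
  "sk L U w0 t = min (max w0 (SUP r\<in>{0..t}. L r)) (INF s\<in>{0..t}. max (U s) (SUP r\<in>{s..t}. L r))"

context
  fixes L U :: "real \<Rightarrow> real"
  assumes L: "continuous_on UNIV L"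
begin

lemma sk_bdd_L: "bdd_above (L ` {s..t})"
  using compact_imp_bounded[OF compact_continuous_image[OF continuous_on_subset[OF L subset_UNIV] compact_Icc]]
  by (rule bounded_imp_bdd_above)

lemma sk_SUP_le: "s \<le> t \<Longrightarrow> (SUP r\<in>{s..t}. L r) \<le> c \<longleftrightarrow> (\<forall>r\<in>{s..t}. L r \<le> c)"
  by (subst cSUP_le_iff[OF _ sk_bdd_L]) auto

lemma sk_le_SUP: "r \<in> {s..t} \<Longrightarrow> L r \<le> (SUP r\<in>{s..t}. L r)"
  by (rule cSUP_upper[OF _ sk_bdd_L])

lemma sk_bdd_term: "bdd_below ((\<lambda>s. max (U s) (SUP r\<in>{s..t}. L r)) ` {0..t})"
proof (rule bdd_belowI2)
  fix s assume "s \<in> {0..t}"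
  then show "L t \<le> max (U s) (SUP r\<in>{s..t}. L r)"
    using sk_le_SUP[of t s t] by auto
qed

text \<open>There are two ways to be at most c at time t: start at most c, or be pushed to at most c
  by the upper obstacle at some time s, with the lower obstacle staying at most c from then on.
  These two rules and their converse \<open>sk_lessE\<close> replace the formula from here
  on.\<close>

lemma sk_leI1: "0 \<le> t \<Longrightarrow> w0 \<le> c \<Longrightarrow> \<forall>r\<in>{0..t}. L r \<le> c \<Longrightarrow> sk L U w0 t \<le> c"
  unfolding sk_def using sk_SUP_le[of 0 t c] by (auto simp: min_le_iff_disj)

lemma sk_leI2:
  assumes "s \<in> {0..t}" "U s \<le> c" "\<forall>r\<in>{s..t}. L r \<le> c" shows "sk L U w0 t \<le> c"
proof -
  have "(INF s\<in>{0..t}. max (U s) (SUP r\<in>{s..t}. L r)) \<le> max (U s) (SUP r\<in>{s..t}. L r)"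
    by (rule cINF_lower[OF sk_bdd_term assms(1)])
  also have "\<dots> \<le> c" using assms sk_SUP_le[of s t c] by auto
  finally show ?thesis unfolding sk_def by (simp add: min_le_iff_disj)
qed

text \<open>The converse is stated with strict inequalities because the infimum over s need not be
  attained; the proofs below therefore work with a small margin.\<close>

lemma sk_lessE:
  assumes "0 \<le> t" "sk L U w0 t < c"
  shows "(w0 < c \<and> (\<forall>r\<in>{0..t}. L r < c)) \<or> (\<exists>s\<in>{0..t}. U s < c \<and> (\<forall>r\<in>{s..t}. L r < c))"
proof (cases "max w0 (SUP r\<in>{0..t}. L r) < c")
  case True
  have "L r < c" if "r \<in> {0..t}" for r using sk_le_SUP[OF that] True by linarith
  with True show ?thesis by auto
next
  case False
  then have *: "(INF s\<in>{0..t}. max (U s) (SUP r\<in>{s..t}. L r)) < c"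
    using assms(2) unfolding sk_def by (auto simp: min_less_iff_disj)
  have "{0..t} \<noteq> {}" using assms(1) by simp
  from cINF_less_iff[OF this sk_bdd_term, THEN iffD1, OF *]
  obtain s where s: "s \<in> {0..t}" "max (U s) (SUP r\<in>{s..t}. L r) < c" by blast
  have "L r < c" if "r \<in> {s..t}" for r using sk_le_SUP[OF that] s(2) by linarith
  with s show ?thesis by (intro disjI2 bexI[of _ s]) auto
qed

lemma sk_upper: "0 \<le> t \<Longrightarrow> L t \<le> U t \<Longrightarrow> sk L U w0 t \<le> U t"
  by (rule sk_leI2[of t]) auto

lemma sk_lower: "0 \<le> t \<Longrightarrow> L t \<le> sk L U w0 t"
  using sk_lessE[of t w0 "L t"] by (force simp: not_less[symmetric])

lemma sk_0: "L 0 \<le> w0 \<Longrightarrow> w0 \<le> U 0 \<Longrightarrow> sk L U w0 0 = w0"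
  using sk_lessE[of 0 w0 w0] sk_leI1[of 0 w0 w0] by (force simp: not_less[symmetric])

text \<open>Half of the Skorokhod condition: the value can rise above c only if the lower obstacle
  exceeds c. In both cases of the criterion at time s, the bound on the lower obstacle simply
  extends from s to t.\<close>

lemma sk_step_le:
  assumes "0 \<le> s" "s \<le> t" "\<forall>r\<in>{s..t}. L r \<le> c" "sk L U w0 s \<le> c"
  shows "sk L U w0 t \<le> c"
proof (rule field_le_epsilon)
  fix e :: real assume "e > 0"
  then have "sk L U w0 s < c + e" using assms(4) by linarith
  from sk_lessE[OF assms(1) this] show "sk L U w0 t \<le> c + e"
  proof
    assume *: "w0 < c + e \<and> (\<forall>r\<in>{0..s}. L r < c + e)"
    have "L r \<le> c + e" if "r \<in> {0..t}" for r
    proof (cases "r \<le> s")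
      case True then show ?thesis using * that by (auto intro: less_imp_le)
    next
      case False
      then have "L r \<le> c" using that assms(3) by auto
      then show ?thesis using \<open>e > 0\<close> by linarith
    qed
    then show ?thesis using assms(1,2) * by (intro sk_leI1) auto
  next
    assume "\<exists>\<sigma>\<in>{0..s}. U \<sigma> < c + e \<and> (\<forall>r\<in>{\<sigma>..s}. L r < c + e)"
    then obtain \<sigma> where \<sigma>: "\<sigma> \<in> {0..s}" "U \<sigma> < c + e" "\<forall>r\<in>{\<sigma>..s}. L r < c + e" by blast
    have "L r \<le> c + e" if "r \<in> {\<sigma>..t}" for r
    proof (cases "r \<le> s")
      case True then show ?thesis using \<sigma> that by (auto intro: less_imp_le)
    next
      case False
      then have "L r \<le> c" using that assms(3) by auto
      then show ?thesis using \<open>e > 0\<close> by linarith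
    qed
    then show ?thesis using \<sigma> assms(2) by (intro sk_leI2[of \<sigma>]) auto
  qed
qed

text \<open>The mirror image: the value falls below c only if the upper obstacle does. With the
  symmetric formula out of sight, the argument is by contradiction, carrying the criterion at time t
  back to time s.\<close>

lemma sk_step_ge:
  assumes "0 \<le> s" "s \<le> t" "\<forall>r\<in>{s..t}. c \<le> U r" "c \<le> sk L U w0 s"
  shows "c \<le> sk L U w0 t"
proof (rule ccontr)
  assume "\<not> c \<le> sk L U w0 t"
  then have "sk L U w0 t < c" by simp
  have "0 \<le> t" using assms by simp
  obtain c' where c': "sk L U w0 t < c'" "c' < c" using dense[OF \<open>sk L U w0 t < c\<close>] by blast
  from sk_lessE[OF \<open>0 \<le> t\<close> c'(1)] have "sk L U w0 s \<le> c'"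
  proof
    assume "w0 < c' \<and> (\<forall>r\<in>{0..t}. L r < c')"
    then show ?thesis using assms(1,2) by (intro sk_leI1) (auto intro: less_imp_le)
  next
    assume "\<exists>\<sigma>\<in>{0..t}. U \<sigma> < c' \<and> (\<forall>r\<in>{\<sigma>..t}. L r < c')"
    then obtain \<sigma> where \<sigma>: "\<sigma> \<in> {0..t}" "U \<sigma> < c'" "\<forall>r\<in>{\<sigma>..t}. L r < c'" by blast
    \<comment> \<open>On [s, t] the upper obstacle is at least c > c', so the time at which it fell
      below c' is before s.\<close>
    have "\<sigma> \<le> s"
    proof (rule ccontr)
      assume "\<not> \<sigma> \<le> s"
      then have "c \<le> U \<sigma>" using \<sigma>(1) assms(3) by auto
      then show False using \<sigma>(2) c'(2) by linarith
    qed
    then show ?thesis using \<sigma> assms(2) by (intro sk_leI2[of \<sigma>]) (auto intro: less_imp_le)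
  qed
  then show False using assms(4) c'(2) by linarith
qed

end

text \<open>Comparison and shift in one statement: the formula is built from minima, maxima, infima
  and suprema, hence monotone and commuting with constants. Thus the solution depends on the data
  with constant 1 in the supremum norm, which is what preserves the gradient bound.\<close>

lemma sk_mono:
  assumes L: "continuous_on UNIV L" and L': "continuous_on UNIV L'" and "0 \<le> t"
    and le: "\<And>r. L r \<le> L' r + k" "\<And>r. U r \<le> U' r + k" "w0 \<le> w0' + k"
  shows "sk L U w0 t \<le> sk L' U' w0' t + k"
proof (rule field_le_epsilon)
  fix e :: real assume "e > 0"
  define c where "c = sk L' U' w0' t + e"
  have "sk L' U' w0' t < c" using \<open>e > 0\<close> by (simp add: c_def)
  from sk_lessE[OF L' \<open>0 \<le> t\<close> this] have "sk L U w0 t \<le> c + k"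
  proof
    assume "w0' < c \<and> (\<forall>r\<in>{0..t}. L' r < c)"
    then show ?thesis using le(1,3) \<open>0 \<le> t\<close>
      by (intro sk_leI1[OF L]) (auto intro: order_trans[OF _ add_right_mono] less_imp_le)
  next
    assume "\<exists>s\<in>{0..t}. U' s < c \<and> (\<forall>r\<in>{s..t}. L' r < c)"
    then obtain s where "s \<in> {0..t}" "U' s < c" "\<forall>r\<in>{s..t}. L' r < c" by blast
    then show ?thesis using le(1,2)
      by (intro sk_leI2[OF L, of s]) (auto intro: order_trans[OF _ add_right_mono] less_imp_le)
  qed
  then show "sk L U w0 t \<le> sk L' U' w0' t + k + e" by (simp add: c_def)
qed

text \<open>The problem is posed on the whole space, with an obstacle \<open>d\<close> that will
  vanish outside the domain. \<open>F\<close> is the primitive of the right-hand side and M a bound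
  for the latter.\<close>

locale obstacle_transport =
  fixes d z0 :: "'a::euclidean_space \<Rightarrow> real" and b :: 'a and F :: "real \<Rightarrow> real" and M T :: real
  assumes d: "1-lipschitz_on UNIV d" and z0: "1-lipschitz_on UNIV z0" and z0d: "\<And>x. \<bar>z0 x\<bar> \<le> d x"
    and F: "M-lipschitz_on UNIV F" and F0: "F 0 = 0" and T: "T > 0"
begin

definition low :: "'a \<Rightarrow> real \<Rightarrow> real" where "low y r = - d (y + r *\<^sub>R b) - F r"
definition upp :: "'a \<Rightarrow> real \<Rightarrow> real" where "upp y r = d (y + r *\<^sub>R b) - F r"
definition wchar :: "'a \<Rightarrow> real \<Rightarrow> real" where "wchar y = sk (low y) (upp y) (z0 y)"
text \<open>Undoes both changes of variables: x lies at time t on the characteristic that started at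
  \<open>x - t *\<^sub>R b\<close>, and adding F restores the right-hand side.\<close>

definition Z :: "'a \<Rightarrow> real \<Rightarrow> real" where "Z x t = F t + wchar (x - t *\<^sub>R b) t"
text \<open>Freezing the time outside [0, T] gives a function that is Lipschitz on the whole
  space-time, as the differentiation lemmas ask.\<close>

definition sol :: "'a \<times> real \<Rightarrow> real" where "sol p = Z (fst p) (max 0 (min T (snd p)))"

lemma d_nonneg: "d x \<ge> 0" using z0d[of x] by linarith

lemma low_cont: "continuous_on UNIV (low y)" and upp_cont: "continuous_on UNIV (upp y)"
  unfolding low_def[abs_def] upp_def[abs_def]
  by (intro continuous_intros continuous_on_compose2[OF lipschitz_on_continuous_on[OF d]]
      continuous_on_compose2[OF lipschitz_on_continuous_on[OF F]]; auto)+

lemma low_upp: "low y r \<le> upp y r" using d_nonneg[of "y + r *\<^sub>R b"] by (simp add: low_def upp_def)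

lemma F_diff: "\<bar>F r - F s\<bar> \<le> M * \<bar>r - s\<bar>"
  using lipschitz_onD[OF F, of r s] by (simp add: dist_real_def)

lemma d_diff: "\<bar>d x - d y\<bar> \<le> norm (x - y)"
  using lipschitz_onD[OF d, of x y] by (simp add: dist_real_def dist_norm)

lemma d_char_diff: "\<bar>d (y + r *\<^sub>R b) - d (y + s *\<^sub>R b)\<bar> \<le> norm b * \<bar>r - s\<bar>"
  using d_diff[of "y + r *\<^sub>R b" "y + s *\<^sub>R b"] by (simp add: scaleR_diff_left[symmetric] mult.commute)

lemma Z_char: "Z (y + t *\<^sub>R b) t = F t + wchar y t" by (simp add: Z_def)

lemma wchar_bounds: "0 \<le> t \<Longrightarrow> low y t \<le> wchar y t" "0 \<le> t \<Longrightarrow> wchar y t \<le> upp y t"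
  unfolding wchar_def using sk_lower[OF low_cont] sk_upper[OF low_cont] low_upp by blast+

lemma Z_bound: "0 \<le> t \<Longrightarrow> \<bar>Z x t\<bar> \<le> d x"
  using wchar_bounds[of t "x - t *\<^sub>R b"] by (auto simp: Z_def low_def upp_def)

lemma Z_0: "Z x 0 = z0 x"
  using z0d[of x] by (simp add: Z_def wchar_def F0 sk_0[OF low_cont] low_def upp_def abs_le_iff)

lemma Z_space: assumes "0 \<le> t" shows "\<bar>Z x t - Z y t\<bar> \<le> norm (x - y)"
proof -
  have "wchar (x - t *\<^sub>R b) t \<le> wchar (y - t *\<^sub>R b) t + norm (x - y)" for x y
    unfolding wchar_def
  proof (rule sk_mono[OF low_cont low_cont assms])
    fix r
    have "\<bar>d (x - t *\<^sub>R b + r *\<^sub>R b) - d (y - t *\<^sub>R b + r *\<^sub>R b)\<bar> \<le> norm (x - y)"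
      using d_diff[of "x - t *\<^sub>R b + r *\<^sub>R b" "y - t *\<^sub>R b + r *\<^sub>R b"] by simp
    then show "low (x - t *\<^sub>R b) r \<le> low (y - t *\<^sub>R b) r + norm (x - y)"
      "upp (x - t *\<^sub>R b) r \<le> upp (y - t *\<^sub>R b) r + norm (x - y)"
      unfolding low_def upp_def by linarith+
    show "z0 (x - t *\<^sub>R b) \<le> z0 (y - t *\<^sub>R b) + norm (x - y)"
      using lipschitz_onD[OF z0, of "x - t *\<^sub>R b" "y - t *\<^sub>R b"] by (simp add: dist_real_def dist_norm)
  qed
  from this[of x y] this[of y x] show ?thesis
    unfolding Z_def by (simp add: norm_minus_commute abs_le_iff)
qed

text \<open>Along a characteristic the shifted obstacles move with speed at most
  \<open>norm b + M\<close>, and the solution there moves only when an obstacle pushes it, so it is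
  no faster.\<close>

lemma wchar_lipschitz:
  assumes "0 \<le> s" "s \<le> t" shows "\<bar>wchar y t - wchar y s\<bar> \<le> (norm b + M) * (t - s)"
proof -
  have M: "M \<ge> 0" by (rule lipschitz_on_nonneg[OF F])
  have dev: "\<bar>low y r - low y s\<bar> \<le> (norm b + M) * (t - s)" "\<bar>upp y r - upp y s\<bar> \<le> (norm b + M) * (t - s)"
    if "r \<in> {s..t}" for r
  proof -
    have "norm b * \<bar>r - s\<bar> + M * \<bar>r - s\<bar> \<le> (norm b + M) * (t - s)"
      unfolding distrib_right[symmetric] using that M by (intro mult_left_mono) auto
    then show "\<bar>low y r - low y s\<bar> \<le> (norm b + M) * (t - s)" "\<bar>upp y r - upp y s\<bar> \<le> (norm b + M) * (t - s)"
      using d_char_diff[of y r s] F_diff[of r s] unfolding low_def upp_def by linarith+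
  qed
  have pos: "0 \<le> (norm b + M) * (t - s)" using M assms by simp
  have "wchar y t \<le> wchar y s + (norm b + M) * (t - s)"
    unfolding wchar_def
  proof (rule sk_step_le[OF low_cont assms])
    show "\<forall>r\<in>{s..t}. low y r \<le> sk (low y) (upp y) (z0 y) s + (norm b + M) * (t - s)"
      using dev(1) wchar_bounds(1)[OF assms(1), of y] unfolding wchar_def by force
  qed (use pos in simp)
  moreover have "wchar y s - (norm b + M) * (t - s) \<le> wchar y t"
    unfolding wchar_def
  proof (rule sk_step_ge[OF low_cont assms])
    show "\<forall>r\<in>{s..t}. sk (low y) (upp y) (z0 y) s - (norm b + M) * (t - s) \<le> upp y r"
      using dev(2) wchar_bounds(2)[OF assms(1), of y] unfolding wchar_def by force
  qed (use pos in simp)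
  ultimately show ?thesis by (simp add: abs_le_iff)
qed

text \<open>The increment at fixed x is compared with the one along the characteristic through (x,
  s). Leaving x costs \<open>norm b\<close>, the primitive costs M, and the solution along the
  characteristic costs \<open>norm b + M\<close>.\<close>

lemma Z_time:
  assumes "0 \<le> s" "0 \<le> t" shows "\<bar>Z x t - Z x s\<bar> \<le> 2 * (norm b + M) * \<bar>t - s\<bar>"
proof -
  have *: "\<bar>Z x t - Z x s\<bar> \<le> 2 * (norm b + M) * (t - s)" if "0 \<le> s" "s \<le> t" for s t
  proof -
    define y where "y = x - s *\<^sub>R b"
    have "Z x s = F s + wchar y s" by (simp add: Z_def y_def)
    moreover have "\<bar>Z (y + t *\<^sub>R b) t - Z x t\<bar> \<le> norm b * (t - s)"
    proof -
      have "y + t *\<^sub>R b - x = (t - s) *\<^sub>R b" by (simp add: y_def algebra_simps)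
      then show ?thesis using Z_space[of t "y + t *\<^sub>R b" x] that by (simp add: mult.commute)
    qed
    moreover have "\<bar>F t - F s\<bar> \<le> M * (t - s)" using F_diff[of t s] that by simp
    moreover have "\<bar>wchar y t - wchar y s\<bar> \<le> (norm b + M) * (t - s)" by (rule wchar_lipschitz[OF that])
    ultimately show ?thesis unfolding Z_char by (simp add: algebra_simps)
  qed
  show ?thesis using *[of s t] *[of t s] assms by (cases "s \<le> t") (auto simp: abs_minus_commute)
qed

lemma sol_lipschitz: "(1 + 2 * (norm b + M))-lipschitz_on UNIV sol"
proof (rule lipschitz_onI)
  have M: "M \<ge> 0" by (rule lipschitz_on_nonneg[OF F])
  then show "0 \<le> 1 + 2 * (norm b + M)" by simp
  fix p q :: "'a \<times> real"
  define t where "t = max 0 (min T (snd p))"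
  define s where "s = max 0 (min T (snd q))"
  have ts: "0 \<le> t" "0 \<le> s" "\<bar>t - s\<bar> \<le> \<bar>snd p - snd q\<bar>" by (auto simp: t_def s_def)
  have "\<bar>sol p - sol q\<bar> \<le> \<bar>Z (fst p) t - Z (fst q) t\<bar> + \<bar>Z (fst q) t - Z (fst q) s\<bar>"
    unfolding sol_def t_def s_def by linarith
  also have "\<dots> \<le> norm (fst p - fst q) + 2 * (norm b + M) * \<bar>t - s\<bar>"
    using Z_space[OF ts(1)] Z_time[OF ts(2,1)] by (intro add_mono)
  also have "\<dots> \<le> dist p q + 2 * (norm b + M) * dist p q"
  proof (intro add_mono mult_left_mono)
    show "norm (fst p - fst q) \<le> dist p q" using dist_fst_le[of p q] by (simp add: dist_norm)
    show "\<bar>t - s\<bar> \<le> dist p q" using dist_snd_le[of p q] ts(3) by (simp add: dist_real_def)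
  qed (use M in simp)
  finally show "dist (sol p) (sol q) \<le> (1 + 2 * (norm b + M)) * dist p q"
    by (simp add: dist_real_def algebra_simps)
qed

lemma sol_slice_lipschitz: "1-lipschitz_on UNIV (\<lambda>x. sol (x, t))"
  using Z_space by (intro lipschitz_onI) (auto simp: sol_def dist_real_def dist_norm)

lemma sol_bound: "\<bar>sol (x, t)\<bar> \<le> d x" by (simp add: sol_def Z_bound)

lemma sol_0: "sol (x, 0) = z0 x" using T by (simp add: sol_def Z_0)

lemma sol_shift:
  assumes "0 < t" "t < T" "0 \<le> h" "t + h < T"
  shows "sol (x + h *\<^sub>R b, t + h) - sol (x, t) =
    F (t + h) - F t + (wchar (x - t *\<^sub>R b) (t + h) - wchar (x - t *\<^sub>R b) t)"
proof -
  have eq: "x + h *\<^sub>R b - (t + h) *\<^sub>R b = x - t *\<^sub>R b" by (simp add: algebra_simps)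
  have "max 0 (min T (t + h)) = t + h" "max 0 (min T t) = t" using assms by auto
  then show ?thesis by (simp only: sol_def Z_def fst_conv snd_conv eq)
qed

text \<open>In direction (b, 1) the difference quotient is that of F plus that of
  \<open>wchar\<close> along one characteristic. Strictly above the lower obstacle, continuity keeps
  that obstacle below the current value for a short time, so \<open>wchar\<close> cannot increase;
  strictly below the upper obstacle it cannot decrease.\<close>

lemma sol_ddir_le:
  assumes t: "0 < t" "t < T" and D: "(\<lambda>n. diff_quot sol (b, 1) n (x, t)) \<longlonglongrightarrow> D"
    and f: "(\<lambda>n. (F (t + inverse (real (Suc n))) - F t) * real (Suc n)) \<longlonglongrightarrow> f"
  shows "- d x < sol (x, t) \<Longrightarrow> D \<le> f" and "sol (x, t) < d x \<Longrightarrow> f \<le> D"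
proof -
  define y where "y = x - t *\<^sub>R b"
  define h where "h n = inverse (real (Suc n))" for n
  have h0: "h \<longlonglongrightarrow> 0" unfolding h_def by (rule LIMSEQ_inverse_real_of_nat)
  have hpos: "h n > 0" "h n * real (Suc n) = 1" for n by (auto simp: h_def)
  have sol_y: "sol (x, t) = F t + wchar y t" using t by (simp add: sol_def Z_def y_def)
  have low_t: "low y t = - d x - F t" "upp y t = d x - F t" by (auto simp: low_def upp_def y_def)
  have hT: "\<forall>\<^sub>F n in sequentially. t + h n < T"
    using order_tendstoD(2)[OF h0, of "T - t"] t by (auto elim: eventually_mono)
  have dq: "diff_quot sol (b, 1) n (x, t) = (F (t + h n) - F t) * real (Suc n) +
      (wchar y (t + h n) - wchar y t) * real (Suc n)" if "t + h n < T" for n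
  proof -
    have "diff_quot sol (b, 1) n (x, t) = (sol (x + h n *\<^sub>R b, t + h n) - sol (x, t)) * real (Suc n)"
      by (simp only: diff_quot_def h_def scaleR_Pair add_Pair real_scaleR_def mult_1_right)
    then show ?thesis
      using sol_shift[OF t _ that, of x] hpos(1)[of n] by (simp only: y_def distrib_right less_imp_le)
  qed
  have small: "\<forall>\<^sub>F n in sequentially. \<forall>r\<in>{t..t + h n}. P r" if "eventually P (nhds t)" for P
  proof -
    from that obtain e where e: "e > 0" "\<And>r. dist r t < e \<Longrightarrow> P r" by (auto simp: eventually_nhds_metric)
    from order_tendstoD(2)[OF h0 e(1)] show ?thesis
      by eventually_elim (auto intro!: e(2) simp: dist_real_def)
  qed
  show "D \<le> f" if "- d x < sol (x, t)"
  proof (rule tendsto_le[OF _ f D])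
    have "low y t < wchar y t" using that sol_y low_t by linarith
    then have "eventually (\<lambda>r. low y r < wchar y t) (nhds t)"
      using low_cont[of y] by (intro order_tendstoD(2)) (auto simp: continuous_on_eq_continuous_at isCont_def tendsto_nhds_iff)
    from small[OF this] hT
    show "\<forall>\<^sub>F n in sequentially. diff_quot sol (b, 1) n (x, t) \<le> (F (t + inverse (real (Suc n))) - F t) * real (Suc n)"
    proof eventually_elim
      case (elim n)
      have "wchar y (t + h n) \<le> wchar y t"
        unfolding wchar_def
        by (rule sk_step_le[OF low_cont, of t]) (use t hpos[of n] elim(1) in \<open>auto simp: wchar_def intro: less_imp_le\<close>)
      then have "(wchar y (t + h n) - wchar y t) * real (Suc n) \<le> 0"
        by (simp add: mult_nonpos_nonneg)
      then show ?case using dq[OF elim(2)] by (simp add: h_def)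
    qed
  qed simp
  show "f \<le> D" if "sol (x, t) < d x"
  proof (rule tendsto_le[OF _ D f])
    have "wchar y t < upp y t" using that sol_y low_t by linarith
    then have "eventually (\<lambda>r. wchar y t < upp y r) (nhds t)"
      using upp_cont[of y] by (intro order_tendstoD(1)) (auto simp: continuous_on_eq_continuous_at isCont_def tendsto_nhds_iff)
    from small[OF this] hT
    show "\<forall>\<^sub>F n in sequentially. (F (t + inverse (real (Suc n))) - F t) * real (Suc n) \<le> diff_quot sol (b, 1) n (x, t)"
    proof eventually_elim
      case (elim n)
      have "wchar y t \<le> wchar y (t + h n)"
        unfolding wchar_def
        by (rule sk_step_ge[OF low_cont, of t]) (use t hpos[of n] elim(1) in \<open>auto simp: wchar_def intro: less_imp_le\<close>)
      then have "0 \<le> (wchar y (t + h n) - wchar y t) * real (Suc n)" by simp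
      then show ?case using dq[OF elim(2)] by (simp add: h_def)
    qed
  qed simp
qed

end

section \<open>Existence\<close>

lemma AE_lborel_slices:
  fixes P :: "'a::euclidean_space \<times> 'b::euclidean_space \<Rightarrow> bool"
  assumes "AE p in lborel. P p"
  shows "AE t in lborel. AE x in lborel. P (x, t)"
proof -
  obtain N where N: "N \<in> null_sets lborel" "{p. \<not> P p} \<subseteq> N"
    using assms by (auto simp: eventually_ae_filter)
  have Nb[measurable]: "N \<in> sets borel" using null_setsD2[OF N(1)] by simp
  have "AE p in lborel \<Otimes>\<^sub>M lborel. p \<notin> N"
    unfolding lborel_prod by (rule AE_not_in[OF N(1)])
  then have "AE x in lborel. AE t in lborel. (x, t) \<notin> N" by (rule lborel_pair.AE_pair)
  moreover have "{p \<in> space (lborel \<Otimes>\<^sub>M lborel). (fst p, snd p) \<notin> N} \<in> sets (lborel \<Otimes>\<^sub>M (lborel :: 'b measure))"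
  proof -
    have "- N \<in> sets (lborel :: ('a \<times> 'b) measure)" using Nb by auto
    then show ?thesis unfolding lborel_prod by (simp add: Compl_eq[symmetric])
  qed
  ultimately have "AE t in lborel. AE x in lborel. (x, t) \<notin> N"
    using lborel_pair.AE_commute[of "\<lambda>x t. (x, t) \<notin> N"] by blast
  then show ?thesis
  proof eventually_elim
    case (elim t)
    then show ?case by eventually_elim (use N(2) in auto)
  qed
qed

text \<open>Tonelli in the direction from slices to the product, which requires the exceptional set
  to be measurable.\<close>

lemma AE_lborel_of_slices:
  fixes P :: "'a::euclidean_space \<times> 'b::euclidean_space \<Rightarrow> bool"
  assumes P: "{p. P p} \<in> sets borel" and sl: "\<And>t. AE x in lborel. P (x, t)"
  shows "AE p in lborel. P p"
proof -
  have m: "{p \<in> space (lborel \<Otimes>\<^sub>M lborel). P (fst p, snd p)} \<in> sets (lborel \<Otimes>\<^sub>M (lborel :: 'b measure))"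
    using P unfolding lborel_prod by simp
  have "AE t in lborel. AE x in lborel. P (x, t)" using sl by simp
  then have "AE x in lborel. AE t in lborel. P (x, t)"
    using lborel_pair.AE_commute[of "\<lambda>x t. P (x, t)", OF m] by blast
  then have "AE p in lborel \<Otimes>\<^sub>M lborel. P p"
    using m by (intro lborel_pair.AE_pair_measure) simp_all
  then show ?thesis unfolding lborel_prod .
qed

lemma QT_open: "open S \<Longrightarrow> open (QT S T)" by (simp add: QT_def open_Times)

lemma QT_bounded: "bounded S \<Longrightarrow> bounded (QT S T)"
  unfolding QT_def by (intro bounded_Times) (auto intro: bounded_subset[OF bounded_closed_interval[of 0 T]])

lemma integrable_bounded_mult:
  fixes A h :: "'a \<Rightarrow> real"
  assumes "A \<in> borel_measurable M" "AE x in M. \<bar>A x\<bar> \<le> c" "integrable M h"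
  shows "integrable M (\<lambda>x. A x * h x)"
proof (rule Bochner_Integration.integrable_bound[OF integrable_mult_right[OF assms(3), of "\<bar>c\<bar>"]])
  show "(\<lambda>x. A x * h x) \<in> borel_measurable M" using assms by auto
  show "AE x in M. norm (A x * h x) \<le> norm (\<bar>c\<bar> * h x)"
    using assms(2)
  proof eventually_elim
    case (elim x)
    then have "\<bar>A x\<bar> * \<bar>h x\<bar> \<le> \<bar>c\<bar> * \<bar>h x\<bar>" by (intro mult_right_mono) auto
    then show ?case by (simp add: abs_mult)
  qed
qed

lemma lipschitz_weak_grad:
  fixes u :: "'a::euclidean_space \<Rightarrow> real"
  assumes S: "open S" and u: "L-lipschitz_on UNIV u"
  shows "AE x in lebesgue_on S. weak_grad S u x = (\<Sum>i\<in>Basis. ddir u i x *\<^sub>R i)"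
    and "AE x in lebesgue_on S. norm (weak_grad S u x) \<le> L"
proof -
  have "AE x in lebesgue_on S. \<forall>i\<in>Basis. weak_deriv S i u x = ddir u i x"
    using lipschitz_weak_deriv(2)[OF S u] by (intro AE_finite_allI) auto
  then show eq: "AE x in lebesgue_on S. weak_grad S u x = (\<Sum>i\<in>Basis. ddir u i x *\<^sub>R i)"
    by eventually_elim (simp add: weak_grad_def)
  have "AE x in lebesgue_on S. norm (\<Sum>i\<in>Basis. ddir u i x *\<^sub>R i) \<le> L"
    using lipschitz_ddir_grad_bound[OF u] S by (subst AE_lebesgue_on_iff) (auto elim: eventually_mono)
  with eq show "AE x in lebesgue_on S. norm (weak_grad S u x) \<le> L" by eventually_elim simp
qed

lemma lipschitz_K_grad:
  fixes u :: "'a::euclidean_space \<Rightarrow> real"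
  assumes S: "open S" "bounded S" and u: "1-lipschitz_on UNIV u" and ud: "\<And>x. \<bar>u x\<bar> \<le> infdist x (- S)"
  shows "u \<in> K_grad S"
  using lipschitz_H10[OF S u ud] lipschitz_weak_grad(2)[OF S(1) u] by (simp add: K_grad_def)

lemma K_obstI:
  assumes S: "open S" "bounded S" and v: "v \<in> H10 S" "AE x in lebesgue_on S. v x = u x" "\<And>x. \<bar>u x\<bar> \<le> infdist x (- S)"
  shows "v \<in> K_obst S"
proof -
  have "AE x in lebesgue_on S. - infdist x (frontier S) \<le> v x \<and> v x \<le> infdist x (frontier S)"
    using v(2) AE_space
  proof eventually_elim
    case (elim x)
    then show ?case using v(3)[of x] infdist_frontier[OF S, of x] by (auto simp: abs_le_iff)
  qed
  then show ?thesis using v(1) by (simp add: K_obst_def)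
qed

lemma K_grad_subset_K_obst:
  fixes S :: "'a::euclidean_space set"
  assumes S: "open S" "bounded S" "C2_boundary S"
  shows "K_grad S \<subseteq> K_obst S"
proof
  fix v assume v: "v \<in> K_grad S"
  obtain u where "1-lipschitz_on UNIV u" "AE x in lebesgue_on S. v x = u x" "\<And>x. \<bar>u x\<bar> \<le> infdist x (- S)"
    using K_grad_lipschitz[OF S v] by blast
  then show "v \<in> K_obst S" using v by (intro K_obstI[OF S(1,2), of v u]) (simp_all add: K_grad_def)
qed

text \<open>\<open>g\<close> is an integrand on the whole line for the global primitive F, and
  \<open>f\<close> agrees with it almost everywhere on (0, T). The difference quotients of F
  converge to \<open>g\<close>, and the exceptional times are absorbed by the variational
  inequality.\<close>

locale obstacle_problem = obstacle_transport d z0 b F M T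
  for d z0 :: "'a::euclidean_space \<Rightarrow> real" and b :: 'a and F :: "real \<Rightarrow> real" and M T :: real +
  fixes \<Omega> :: "'a set" and f g :: "real \<Rightarrow> real"
  assumes open_dom: "open \<Omega>" and bounded_dom: "bounded \<Omega>" and d_eq: "\<And>x. d x = infdist x (- \<Omega>)"
    and g: "\<And>s t. s \<le> t \<Longrightarrow> (g has_integral (F t - F s)) {s..t}"
    and fg: "AE t in lborel. t \<in> {0<..<T} \<longrightarrow> f t = g t"
begin

abbreviation C where "C \<equiv> 1 + 2 * (norm b + M)"

lemma dom_borel [measurable]: "\<Omega> \<in> sets borel" using open_dom by auto

lemma cyl_borel: "QT \<Omega> T \<in> sets borel" using QT_open[OF open_dom] by auto

lemma sol_measurable [measurable]: "sol \<in> borel_measurable borel"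
  by (rule lipschitz_borel_measurable[OF sol_lipschitz])

lemma slice_lipschitz: "1-lipschitz_on UNIV (time_slice sol t)"
  using sol_slice_lipschitz by (simp add: time_slice_def)

lemma slice_bound: "\<bar>time_slice sol t x\<bar> \<le> infdist x (- \<Omega>)"
  using sol_bound[of x t] by (simp add: time_slice_def d_eq)

lemma slice_K_grad: "time_slice sol t \<in> K_grad \<Omega>"
  by (rule lipschitz_K_grad[OF open_dom bounded_dom slice_lipschitz slice_bound])

lemma slice_K_obst: "time_slice sol t \<in> K_obst \<Omega>"
  using slice_K_grad by (intro K_obstI[OF open_dom bounded_dom _ _ slice_bound]) (auto simp: K_grad_def)

lemma d_pos: "x \<in> \<Omega> \<Longrightarrow> d x > 0"
  using infdist_pos_not_in_closed[of "- \<Omega>" x] bounded_compl_nonempty[OF bounded_dom] open_dom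
  by (auto simp: d_eq closed_Compl)

lemma ddir_slice: "ddir (time_slice sol t) e x = ddir sol (e, 0) (x, t)"
  by (simp add: ddir_def diff_quot_def time_slice_def)

lemma slice_weak_deriv:
  "AE x in lborel. x \<in> \<Omega> \<longrightarrow> weak_deriv \<Omega> i (time_slice sol t) x = ddir sol (i, 0) (x, t)"
  using lipschitz_weak_deriv(2)[OF open_dom slice_lipschitz, of i t]
  unfolding AE_lebesgue_on_iff[OF dom_borel] ddir_slice .

lemma slice_W1inf0: "time_slice sol t \<in> W1inf0 \<Omega>"
proof -
  let ?u = "time_slice sol t"
  have c: "continuous_on UNIV ?u" by (rule lipschitz_on_continuous_on[OF slice_lipschitz])
  have "bounded (?u ` closure \<Omega>)"
    using bounded_dom c by (intro compact_imp_bounded compact_continuous_image) (auto intro: continuous_on_subset)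
  then obtain B where "\<And>x. x \<in> closure \<Omega> \<Longrightarrow> \<bar>?u x\<bar> \<le> B" by (auto simp: bounded_iff)
  then have "AE x in lebesgue_on \<Omega>. \<bar>?u x\<bar> \<le> B"
    using closure_subset[of \<Omega>] by (intro AE_I2) auto
  then have "?u \<in> Linf \<Omega>"
    using measurable_lebesgue_on_borel[OF borel_measurable_continuous_onI[OF c]] by (auto simp: Linf_def)
  moreover have "weak_deriv \<Omega> i ?u \<in> Linf \<Omega>" for i
    using lipschitz_weak_deriv_L2(1,2)[OF open_dom bounded_dom slice_lipschitz, of i t] by (auto simp: Linf_def)
  moreover have "?u x = 0" if "x \<in> frontier \<Omega>" for x
  proof -
    have "x \<in> - \<Omega>" using that open_dom by (auto simp: frontier_def interior_open)
    then show ?thesis using slice_bound[of t x] by simp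
  qed
  ultimately show ?thesis
    using lipschitz_weak_deriv(1)[OF open_dom slice_lipschitz] continuous_on_subset[OF c]
    unfolding W1inf0_def W1inf_def by (auto intro!: exI[of _ ?u])
qed

text \<open>The weak derivative of each slice is an arbitrary choice made separately for every t, so
  its dependence on t is accessible only through integrals. There it can be exchanged for
  \<open>ddir sol (i, 0)\<close>, a Borel function on space-time, whose parameter integrals are
  measurable in t.\<close>

lemma sol_Linf_time: "sol \<in> Linf_time_W1inf0 \<Omega> T"
proof -
  have "bounded (d ` closure \<Omega>)"
    using bounded_dom lipschitz_on_continuous_on[OF d]
    by (intro compact_imp_bounded compact_continuous_image) (auto intro: continuous_on_subset)
  then obtain B where B: "\<And>x. x \<in> closure \<Omega> \<Longrightarrow> \<bar>d x\<bar> \<le> B" by (auto simp: bounded_iff)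
  have bnd: "AE x in lebesgue_on \<Omega>. \<bar>time_slice sol t x\<bar> \<le> max 1 B \<and> norm (weak_grad \<Omega> (time_slice sol t) x) \<le> max 1 B" for t
    using lipschitz_weak_grad(2)[OF open_dom slice_lipschitz[of t]] AE_space
  proof eventually_elim
    case (elim x)
    then have "x \<in> closure \<Omega>" using closure_subset by auto
    then show ?case using B[of x] sol_bound[of x t] elim(1) by (auto simp: time_slice_def)
  qed
  have meas: "(\<lambda>t. LINT x|lebesgue_on \<Omega>. k t x * q x) \<in> borel_measurable (lebesgue_on {0<..<T})"
    if q: "integrable (lebesgue_on \<Omega>) q" and K: "K \<in> borel_measurable borel"
      "\<And>t. AE x in lborel. x \<in> \<Omega> \<longrightarrow> k t x = K (x, t)" for q :: "'a \<Rightarrow> real" and k K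
  proof -
    obtain q' where [measurable]: "q' \<in> borel_measurable borel" and q': "AE x in lborel. x \<in> \<Omega> \<longrightarrow> q x = q' x"
      using borel_representative[OF dom_borel borel_measurable_integrable[OF q]] by blast
    note K(1)[measurable]
    have "(LINT x|lebesgue_on \<Omega>. k t x * q x) = (LINT x|lborel. indicator \<Omega> x * (K (x, t) * q' x))" for t
    proof (rule lebesgue_on_cong_borel(3)[OF dom_borel])
      show "AE x in lborel. x \<in> \<Omega> \<longrightarrow> k t x * q x = K (x, t) * q' x"
        using K(2)[of t] q' by eventually_elim simp
    qed measurable
    moreover have "(\<lambda>t. LINT x|lborel. indicator \<Omega> x * (K (x, t) * q' x)) \<in> borel_measurable borel"
      by measurable
    ultimately have "(\<lambda>t. LINT x|lebesgue_on \<Omega>. k t x * q x) \<in> borel_measurable borel" by simp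
    then show ?thesis by (rule measurable_lebesgue_on_borel)
  qed
  show ?thesis
    unfolding Linf_time_W1inf0_def mem_Collect_eq
  proof (intro conjI allI impI ballI exI[of _ "max 1 B"])
    show "AE t in lebesgue_on {0<..<T}. time_slice sol t \<in> W1inf0 \<Omega> \<and>
        (AE x in lebesgue_on \<Omega>. \<bar>time_slice sol t x\<bar> \<le> max 1 B \<and> norm (weak_grad \<Omega> (time_slice sol t) x) \<le> max 1 B)"
      using slice_W1inf0 bnd by simp
    fix q :: "'a \<Rightarrow> real" assume q: "integrable (lebesgue_on \<Omega>) q"
    show "(\<lambda>t. LINT x|lebesgue_on \<Omega>. time_slice sol t x * q x) \<in> borel_measurable (lebesgue_on {0<..<T})"
      by (rule meas[OF q sol_measurable]) (simp add: time_slice_def)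
    show "(\<lambda>t. LINT x|lebesgue_on \<Omega>. weak_deriv \<Omega> i (time_slice sol t) x * q x) \<in> borel_measurable (lebesgue_on {0<..<T})" for i
      by (rule meas[OF q ddir_measurable[OF sol_measurable] slice_weak_deriv])
  qed
qed

lemma sol_dt: "dt_in_L2 \<Omega> T sol"
  unfolding dt_in_L2_def
  using lipschitz_weak_deriv(1)[OF QT_open[OF open_dom] sol_lipschitz]
    lipschitz_weak_deriv_L2(3)[OF QT_open[OF open_dom] QT_bounded[OF bounded_dom] sol_lipschitz] by blast

lemma sol_H1_time: "sol \<in> H1_time_L2 \<Omega> T"
  using continuous_bounded_L2[OF QT_open[OF open_dom] QT_bounded[OF bounded_dom] lipschitz_on_continuous_on[OF sol_lipschitz]]
    sol_dt by (simp add: H1_time_L2_def)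

lemma sol_continuous: "continuous_on S sol"
  using lipschitz_on_continuous_on[OF sol_lipschitz] continuous_on_subset by blast

text \<open>The gradient bound is applied to each slice, which is 1-Lipschitz, and the slices are
  then put together. Applied to \<open>sol\<close> itself it would only give the larger space-time
  constant.\<close>

lemma sol_space_grad: "space_grad_le \<Omega> T sol 1"
  unfolding space_grad_le_def
proof (intro conjI ballI)
  show "weakly_differentiable (QT \<Omega> T) (i, 0) sol" for i
    by (rule lipschitz_weak_deriv(1)[OF QT_open[OF open_dom] sol_lipschitz])
  have "AE p in lebesgue_on (QT \<Omega> T). \<forall>i\<in>Basis. weak_deriv (QT \<Omega> T) (i, 0) sol p = ddir sol (i, 0) p"
    using lipschitz_weak_deriv(2)[OF QT_open[OF open_dom] sol_lipschitz] by (intro AE_finite_allI) auto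
  moreover have "AE p in lborel. norm (\<Sum>i\<in>Basis. ddir sol (i, 0) p *\<^sub>R i) \<le> 1"
  proof (rule AE_lborel_of_slices)
    have "(\<lambda>p. norm (\<Sum>i\<in>(Basis::'a set). ddir sol (i, 0) p *\<^sub>R i)) \<in> borel_measurable borel" by measurable
    then show "{p. norm (\<Sum>i\<in>(Basis::'a set). ddir sol (i, 0) p *\<^sub>R i) \<le> 1} \<in> sets borel"
      using borel_measurable_le[of _ borel "\<lambda>p. 1"] by (simp add: space_borel)
    show "AE x in lborel. norm (\<Sum>i\<in>Basis. ddir sol (i, 0) (x, t) *\<^sub>R i) \<le> 1" for t
      using lipschitz_ddir_grad_bound[OF slice_lipschitz[of t]] unfolding ddir_slice .
  qed
  then have "AE p in lebesgue_on (QT \<Omega> T). norm (\<Sum>i\<in>Basis. ddir sol (i, 0) p *\<^sub>R i) \<le> 1"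
    by (subst AE_lebesgue_on_iff[OF cyl_borel]) (auto elim: eventually_mono)
  ultimately show "AE p in lebesgue_on (QT \<Omega> T). norm (\<Sum>i\<in>Basis. weak_deriv (QT \<Omega> T) (i, 0) sol p *\<^sub>R i) \<le> 1"
    by eventually_elim simp
qed

lemma ddir_transport:
  "AE p in lborel. ddir sol (b, 1) p = ddir sol (0, 1) p + (\<Sum>i\<in>Basis. (b \<bullet> i) * ddir sol (i, 0) p)"
proof -
  \<comment> \<open>\<open>None\<close> stands for the time direction and \<open>Some i\<close> for
    a space direction; this writes (b, 1) as one finite sum, to which \<open>ddir_sum\<close>
    applies.\<close>
  define I where "I = insert None (Some ` (Basis :: 'a set))"
  define e :: "'a option \<Rightarrow> 'a \<times> real" where "e o' = (case o' of None \<Rightarrow> (0, 1) | Some i \<Rightarrow> (i, 0))" for o'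
  define c where "c o' = (case o' of None \<Rightarrow> 1 | Some i \<Rightarrow> b \<bullet> i)" for o'
  have fin: "finite I" by (simp add: I_def)
  have split: "(\<Sum>o'\<in>I. h o') = h None + (\<Sum>i\<in>Basis. h (Some i))" for h :: "'a option \<Rightarrow> 'b::ab_group_add"
    unfolding I_def by (subst sum.insert) (auto simp: sum.reindex)
  have "(\<Sum>o'\<in>I. c o' *\<^sub>R e o') = (0, 1) + (\<Sum>i\<in>Basis. (b \<bullet> i) *\<^sub>R (i, 0))"
    by (simp only: split c_def e_def option.case scaleR_one)
  also have "(\<Sum>i\<in>Basis. (b \<bullet> i) *\<^sub>R (i, 0::real)) = (b, 0)"
    by (simp add: prod_eq_iff fst_sum snd_sum euclidean_representation)
  finally have E: "(\<Sum>o'\<in>I. c o' *\<^sub>R e o') = (b, 1)" by simp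
  show ?thesis
    using ddir_sum[OF sol_lipschitz fin, of c e] unfolding E
    by (simp only: split c_def e_def option.case mult_1_left)
qed

text \<open>The real number y ranges inside the almost everywhere quantifiers, so the exceptional
  set does not depend on the function that will later be inserted for it.\<close>

lemma sol_pointwise:
  "AE t in lborel. t \<in> {0<..<T} \<longrightarrow> (AE x in lborel. x \<in> \<Omega> \<longrightarrow>
     (\<bar>ddir sol (0, 1) (x, t)\<bar> \<le> C \<and> weak_deriv (QT \<Omega> T) (0, 1) sol (x, t) = ddir sol (0, 1) (x, t)) \<and>
     (\<forall>y. \<bar>y\<bar> \<le> d x \<longrightarrow>
       0 \<le> (ddir sol (0, 1) (x, t) + (\<Sum>i\<in>Basis. (b \<bullet> i) * ddir sol (i, 0) (x, t)) - f t) * (y - sol (x, t))))"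
proof -
  have "AE p in lborel. p \<in> QT \<Omega> T \<longrightarrow> weak_deriv (QT \<Omega> T) (0, 1) sol p = ddir sol (0, 1) p"
    using lipschitz_weak_deriv(2)[OF QT_open[OF open_dom] sol_lipschitz, of T "(0, 1)"]
    by (simp add: AE_lebesgue_on_iff[OF cyl_borel])
  then have "AE p in lborel. (p \<in> QT \<Omega> T \<longrightarrow> weak_deriv (QT \<Omega> T) (0, 1) sol p = ddir sol (0, 1) p) \<and>
      \<bar>ddir sol (0, 1) p\<bar> \<le> C \<and> (\<lambda>n. diff_quot sol (b, 1) n p) \<longlonglongrightarrow> ddir sol (b, 1) p \<and>
      ddir sol (b, 1) p = ddir sol (0, 1) p + (\<Sum>i\<in>Basis. (b \<bullet> i) * ddir sol (i, 0) p)"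
    using AE_ddir_bound[OF sol_lipschitz, of "(0, 1)"] lipschitz_AE_ddir[OF sol_lipschitz, of "(b, 1)"] ddir_transport
    by eventually_elim simp
  note 1 = AE_lborel_slices[OF this]
  have "AE t in lborel. (\<lambda>n. (F (t + inverse (real (Suc n))) - F t) * real (Suc n)) \<longlonglongrightarrow> g t"
    by (rule right_difference_quotients_tendsto[OF g])
  from 1 this fg show ?thesis
  proof eventually_elim
    case (elim t)
    show ?case
    proof
      assume t: "t \<in> {0<..<T}"
      then have ft: "f t = g t" and t': "0 < t" "t < T" using elim(3) by auto
      from elim(1) show "AE x in lborel. x \<in> \<Omega> \<longrightarrow>
         (\<bar>ddir sol (0, 1) (x, t)\<bar> \<le> C \<and> weak_deriv (QT \<Omega> T) (0, 1) sol (x, t) = ddir sol (0, 1) (x, t)) \<and>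
         (\<forall>y. \<bar>y\<bar> \<le> d x \<longrightarrow>
           0 \<le> (ddir sol (0, 1) (x, t) + (\<Sum>i\<in>Basis. (b \<bullet> i) * ddir sol (i, 0) (x, t)) - f t) * (y - sol (x, t)))"
      proof eventually_elim
        case (elim x)
        show ?case
        proof (intro impI conjI allI)
          assume x: "x \<in> \<Omega>"
          then show "weak_deriv (QT \<Omega> T) (0, 1) sol (x, t) = ddir sol (0, 1) (x, t)"
            using elim t by (simp add: QT_def)
          show "\<bar>ddir sol (0, 1) (x, t)\<bar> \<le> C" using elim by blast
          fix y :: real assume y: "\<bar>y\<bar> \<le> d x"
          have "(\<lambda>n. diff_quot sol (b, 1) n (x, t)) \<longlonglongrightarrow> ddir sol (b, 1) (x, t)" using elim by blast
          note sd = sol_ddir_le[OF t' this \<open>(\<lambda>n. (F (t + inverse (real (Suc n))) - F t) * real (Suc n)) \<longlonglongrightarrow> g t\<close>]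
          \<comment> \<open>Strictly between the obstacles the first factor vanishes. On an obstacle
            both factors have the same sign, as y stays on the inner side. The two obstacles are
            never touched together, because the distance is positive in the domain.\<close>
          have "0 \<le> (ddir sol (b, 1) (x, t) - g t) * (y - sol (x, t))"
          proof (cases "- d x < sol (x, t)")
            case True
            show ?thesis
            proof (cases "sol (x, t) < d x")
              case False
              then have "y \<le> sol (x, t)" using y by linarith
              then show ?thesis using sd(1)[OF True] by (intro mult_nonpos_nonpos) auto
            qed (use sd(1)[OF True] sd(2) in simp)
          next
            case False
            then have "sol (x, t) < d x" "sol (x, t) \<le> y" using d_pos[OF x] y by auto
            then show ?thesis using sd(2) by (intro mult_nonneg_nonneg) auto
          qed
          then show "0 \<le> (ddir sol (0, 1) (x, t) + (\<Sum>i\<in>Basis. (b \<bullet> i) * ddir sol (i, 0) (x, t)) - f t) * (y - sol (x, t))"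
            using elim unfolding ft by metis
        qed
      qed
    qed
  qed
qed

lemma sol_VI:
  assumes v: "v \<in> K_obst \<Omega>"
  shows "AE t in lebesgue_on {0<..<T}.
        (LINT x|lebesgue_on \<Omega>. weak_deriv (QT \<Omega> T) (0, 1) sol (x, t) * (v x - time_slice sol t x)) +
        (LINT x|lebesgue_on \<Omega>. (b \<bullet> weak_grad \<Omega> (time_slice sol t) x) * (v x - time_slice sol t x))
        \<ge> (LINT x|lebesgue_on \<Omega>. f t * (v x - time_slice sol t x))"
proof -
  have vL2: "v \<in> L2 \<Omega>" using v by (auto simp: K_obst_def H10_def H1_def)
  have vb: "AE x in lebesgue_on \<Omega>. \<bar>v x\<bar> \<le> d x"
  proof -
    have "AE x in lebesgue_on \<Omega>. - infdist x (frontier \<Omega>) \<le> v x \<and> v x \<le> infdist x (frontier \<Omega>)"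
      using v by (simp add: K_obst_def)
    then show ?thesis
      using AE_space
    proof eventually_elim
      case (elim x)
      then show ?case using infdist_frontier[OF open_dom bounded_dom, of x] by (auto simp: d_eq abs_le_iff)
    qed
  qed
  have main: "(LINT x|lebesgue_on \<Omega>. weak_deriv (QT \<Omega> T) (0, 1) sol (x, t) * (v x - time_slice sol t x)) +
        (LINT x|lebesgue_on \<Omega>. (b \<bullet> weak_grad \<Omega> (time_slice sol t) x) * (v x - time_slice sol t x))
        \<ge> (LINT x|lebesgue_on \<Omega>. f t * (v x - time_slice sol t x))"
    if pt: "AE x in lborel. x \<in> \<Omega> \<longrightarrow>
     (\<bar>ddir sol (0, 1) (x, t)\<bar> \<le> C \<and> weak_deriv (QT \<Omega> T) (0, 1) sol (x, t) = ddir sol (0, 1) (x, t)) \<and>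
     (\<forall>y. \<bar>y\<bar> \<le> d x \<longrightarrow>
       0 \<le> (ddir sol (0, 1) (x, t) + (\<Sum>i\<in>Basis. (b \<bullet> i) * ddir sol (i, 0) (x, t)) - f t) * (y - sol (x, t)))" for t
  proof -
    let ?A = "\<lambda>x. weak_deriv (QT \<Omega> T) (0, 1) sol (x, t)"
    let ?B = "\<lambda>x. b \<bullet> weak_grad \<Omega> (time_slice sol t) x"
    let ?h = "\<lambda>x. v x - time_slice sol t x"
    note pt' = pt[folded AE_lebesgue_on_iff[OF dom_borel]]
    have ih: "integrable (lebesgue_on \<Omega>) ?h"
      using L2_imp_integrable[OF dom_borel bounded_dom vL2]
        L2_imp_integrable[OF dom_borel bounded_dom continuous_bounded_L2[OF open_dom bounded_dom lipschitz_on_continuous_on[OF slice_lipschitz[of t]]]]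
      by (rule Bochner_Integration.integrable_diff)
    have Am: "?A \<in> borel_measurable (lebesgue_on \<Omega>)"
    proof (rule lebesgue_on_cong_borel(1)[OF dom_borel])
      show "AE x in lborel. x \<in> \<Omega> \<longrightarrow> ?A x = ddir sol (0, 1) (x, t)" using pt by (auto elim: eventually_mono)
    qed measurable
    have Ab: "AE x in lebesgue_on \<Omega>. \<bar>?A x\<bar> \<le> C" using pt' by (auto elim: eventually_mono)
    have Beq: "AE x in lebesgue_on \<Omega>. ?B x = (\<Sum>i\<in>Basis. (b \<bullet> i) * ddir sol (i, 0) (x, t))"
      using lipschitz_weak_grad(1)[OF open_dom slice_lipschitz[of t]]
    proof eventually_elim
      case (elim x)
      show ?case unfolding elim ddir_slice inner_sum_right by (rule sum.cong) auto
    qed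
    have Bm: "?B \<in> borel_measurable (lebesgue_on \<Omega>)"
    proof (rule lebesgue_on_cong_borel(1)[OF dom_borel _ Beq[unfolded AE_lebesgue_on_iff[OF dom_borel]]])
    qed measurable
    have Bb: "AE x in lebesgue_on \<Omega>. \<bar>?B x\<bar> \<le> norm b"
      using lipschitz_weak_grad(2)[OF open_dom slice_lipschitz[of t]]
    proof eventually_elim
      case (elim x)
      then have "norm b * norm (weak_grad \<Omega> (time_slice sol t) x) \<le> norm b" by (intro mult_left_le) auto
      then show ?case using Cauchy_Schwarz_ineq2[of b "weak_grad \<Omega> (time_slice sol t) x"] by linarith
    qed
    have iA: "integrable (lebesgue_on \<Omega>) (\<lambda>x. ?A x * ?h x)" by (rule integrable_bounded_mult[OF Am Ab ih])
    have iB: "integrable (lebesgue_on \<Omega>) (\<lambda>x. ?B x * ?h x)" by (rule integrable_bounded_mult[OF Bm Bb ih])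
    have "0 \<le> (LINT x|lebesgue_on \<Omega>. ?A x * ?h x + ?B x * ?h x - f t * ?h x)"
    proof (rule integral_nonneg_AE)
      show "AE x in lebesgue_on \<Omega>. 0 \<le> ?A x * ?h x + ?B x * ?h x - f t * ?h x"
        using pt' Beq vb
      proof eventually_elim
        case (elim x)
        then have "0 \<le> (?A x + ?B x - f t) * ?h x" by (simp add: time_slice_def)
        then show ?case by (simp add: algebra_simps)
      qed
    qed
    also have "\<dots> = (LINT x|lebesgue_on \<Omega>. ?A x * ?h x) + (LINT x|lebesgue_on \<Omega>. ?B x * ?h x) - (LINT x|lebesgue_on \<Omega>. f t * ?h x)"
      using iA iB ih by (subst Bochner_Integration.integral_diff) auto
    finally show ?thesis by linarith
  qed
  show ?thesis
  proof (subst AE_lebesgue_on_iff)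
    show "AE t in lborel. t \<in> {0<..<T} \<longrightarrow>
        (LINT x|lebesgue_on \<Omega>. f t * (v x - time_slice sol t x)) \<le>
        (LINT x|lebesgue_on \<Omega>. weak_deriv (QT \<Omega> T) (0, 1) sol (x, t) * (v x - time_slice sol t x)) +
        (LINT x|lebesgue_on \<Omega>. (b \<bullet> weak_grad \<Omega> (time_slice sol t) x) * (v x - time_slice sol t x))"
      using sol_pointwise
    proof eventually_elim
      case (elim t)
      then show ?case using main[of t] by blast
    qed
  qed simp
qed

text \<open>One proof for both problems: shrinking the set of competitors only weakens the
  inequality, so it suffices that the slices of \<open>sol\<close> still belong to the smaller
  set.\<close>

lemma sol_solves:
  assumes init: "AE x in lebesgue_on \<Omega>. w0 x = z0 x" and K: "K \<subseteq> K_obst \<Omega>" "\<And>t. time_slice sol t \<in> K"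
  shows "solves_VI \<Omega> T b f w0 K sol"
  unfolding solves_VI_def
proof (intro conjI ballI)
  show "AE x in lebesgue_on \<Omega>. time_slice sol 0 x = w0 x"
    using init by eventually_elim (simp add: time_slice_def sol_0)
qed (use K sol_VI in auto)

end

section \<open>Uniqueness\<close>

text \<open>The primitive of a mollifier is a smooth transition from 0 to 1; differences of two
  translates of it will be the smoothed indicators of time intervals.\<close>

lemma smooth_step:
  fixes \<rho> :: "real \<Rightarrow> real"
  assumes \<rho>: "smooth \<rho>" "\<And>x. \<rho> x \<ge> 0" "\<And>x. x \<notin> cball 0 \<delta> \<Longrightarrow> \<rho> x = 0" "(LINT x|lborel. \<rho> x) = 1" and "\<delta> > 0"
  obtains A where "smooth A" "\<And>x. frechet_derivative A (at x) 1 = \<rho> x" "\<And>x. x < - \<delta> \<Longrightarrow> A x = 0"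
    "\<And>x. \<delta> < x \<Longrightarrow> A x = 1" "\<And>x. 0 \<le> A x" "\<And>x. A x \<le> 1"
proof -
  \<comment> \<open>The lower limit lies one unit to the left of the support, so the point
    \<open>- \<delta>\<close> is interior to the interval of integration and the derivative there is
    two-sided.\<close>
  define A where "A x = integral {- \<delta> - 1..x} \<rho>" for x
  have \<rho>c: "continuous_on S \<rho>" for S using smooth_continuous[OF \<rho>(1)] continuous_on_subset by blast
  have \<rho>0: "\<rho> x = 0" if "x < - \<delta> \<or> \<delta> < x" for x using that by (intro \<rho>(3)) auto
  have int: "\<rho> integrable_on {a..b}" for a b using \<rho>c integrable_continuous_real by blast
  have lower: "A x = 0" if "x < - \<delta>" for x
    unfolding A_def using that \<rho>0 by (intro integral_unique has_integral_is_0) auto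
  have der: "(A has_real_derivative \<rho> x) (at x)" for x
  proof (cases "x < - \<delta>")
    case True
    have "((\<lambda>x. 0) has_real_derivative \<rho> x) (at x)" using True \<rho>0 by simp
    then show ?thesis
      by (rule has_field_derivative_transform_within_open[where S = "{..<- \<delta>}"]) (use True lower in auto)
  next
    case False
    have "((\<lambda>x. integral {- \<delta> - 1..x} \<rho>) has_real_derivative \<rho> x) (at x within {- \<delta> - 1..x + 1})"
      by (rule integral_has_real_derivative[OF \<rho>c]) (use False in auto)
    moreover have "at x within {- \<delta> - 1..x + 1} = at x"
      using False by (intro at_within_interior) auto
    ultimately show ?thesis by (simp add: A_def[abs_def])
  qed
  have "integrable lborel \<rho>"
    by (rule continuous_compact_support_integrable[OF smooth_continuous[OF \<rho>(1)] compact_cball \<rho>(3)])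
  from has_integral_integral_lborel[OF this] have "((\<lambda>x. \<rho> x) has_integral 1) UNIV"
    using \<rho>(4) by simp
  then have one: "(\<rho> has_integral 1) {a..b}" if "a \<le> - \<delta>" "\<delta> \<le> b" for a b
  proof (subst has_integral_restrict_UNIV[symmetric])
    assume h: "((\<lambda>x. \<rho> x) has_integral 1) UNIV"
    show "((\<lambda>x. if x \<in> {a..b} then \<rho> x else 0) has_integral 1) UNIV"
      by (rule has_integral_eq[OF _ h]) (use that \<rho>0 in auto)
  qed
  have upper: "A x = 1" if "\<delta> < x" for x
    unfolding A_def using that \<open>\<delta> > 0\<close> by (intro integral_unique one) auto
  have mono: "A x \<le> A y" if "x \<le> y" for x y
    unfolding A_def using that \<rho>(2) by (intro integral_subset_le int) auto
  show thesis
  proof (rule that[of A])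
    show "smooth A"
    proof
      fix k show "Ck k A"
      proof (cases k)
        case 0 then show ?thesis
          using der by (auto intro!: continuous_at_imp_continuous_on DERIV_isCont)
      next
        case (Suc m)
        have "Ck (Suc m) A"
          by (rule Ck_SucI[OF der[unfolded has_field_derivative_def]]) (use \<rho>(1) in simp)
        then show ?thesis using Suc by simp
      qed
    qed
    show "frechet_derivative A (at x) 1 = \<rho> x" for x
      using frechet_derivative_at[OF der[of x, unfolded has_field_derivative_def]] by (metis mult.right_neutral)
    show "0 \<le> A x" for x
      using mono[of "min x (- \<delta> - 1)" x] lower[of "min x (- \<delta> - 1)"] by simp
    show "A x \<le> 1" for x
      using mono[of x "max x (\<delta> + 1)"] upper[of "max x (\<delta> + 1)"] by simp
  qed (use lower upper in auto)
qed

text \<open>The translated kernel sees \<open>m\<close> only within distance \<open>\<delta>\<close>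
  of s, so control near s is enough. This fits a function that is continuous only on an open time
  interval.\<close>

lemma bounded_mult_mollifier:
  fixes m \<rho> :: "real \<Rightarrow> real"
  assumes \<rho>: "\<rho> \<in> borel_measurable borel" "\<And>x. \<rho> x \<ge> 0" "\<And>x. x \<notin> cball 0 \<delta> \<Longrightarrow> \<rho> x = 0" "(LINT x|lborel. \<rho> x) = 1" "integrable lborel \<rho>"
    and m: "m \<in> borel_measurable borel" "\<And>r. r \<in> cball s \<delta> \<Longrightarrow> \<bar>m r - m s\<bar> \<le> \<epsilon>"
  shows "integrable lborel (\<lambda>r. m r * \<rho> (r - s))" "\<bar>(LINT r|lborel. m r * \<rho> (r - s)) - m s\<bar> \<le> \<epsilon>"
proof -
  have i\<rho>: "integrable lborel (\<lambda>r. \<rho> (r - s))" "(LINT r|lborel. \<rho> (r - s)) = 1"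
    using lborel_shift[OF \<rho>(1), of "- s"] \<rho>(4,5) by simp_all
  note \<rho>(1)[measurable] m(1)[measurable]
  have b: "\<bar>(m r - m s) * \<rho> (r - s)\<bar> \<le> \<epsilon> * \<rho> (r - s)" for r
  proof (cases "r \<in> cball s \<delta>")
    case True
    then show ?thesis using m(2)[OF True] \<rho>(2)[of "r - s"] by (simp add: abs_mult mult_right_mono)
  next
    case False
    then have "\<rho> (r - s) = 0" by (intro \<rho>(3)) (auto simp: dist_real_def)
    then show ?thesis by simp
  qed
  have i1: "integrable lborel (\<lambda>r. (m r - m s) * \<rho> (r - s))"
  proof (rule Bochner_Integration.integrable_bound[OF integrable_mult_right[OF i\<rho>(1), of \<epsilon>]])
    show "AE r in lborel. norm ((m r - m s) * \<rho> (r - s)) \<le> norm (\<epsilon> * \<rho> (r - s))"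
      using b by (intro AE_I2) (simp add: abs_le_iff order_trans[OF _ abs_ge_self])
  qed measurable
  have i2: "integrable lborel (\<lambda>r. (m r - m s) * \<rho> (r - s) + m s * \<rho> (r - s))"
    by (intro Bochner_Integration.integrable_add i1 integrable_mult_right i\<rho>)
  moreover have eq: "(\<lambda>r. (m r - m s) * \<rho> (r - s) + m s * \<rho> (r - s)) = (\<lambda>r. m r * \<rho> (r - s))"
    by (auto simp: algebra_simps)
  ultimately show "integrable lborel (\<lambda>r. m r * \<rho> (r - s))" by simp
  have "(LINT r|lborel. m r * \<rho> (r - s)) = (LINT r|lborel. (m r - m s) * \<rho> (r - s)) + m s"
    unfolding eq[symmetric] using i1 i\<rho> by simp
  moreover have "\<bar>LINT r|lborel. (m r - m s) * \<rho> (r - s)\<bar> \<le> (LINT r|lborel. \<epsilon> * \<rho> (r - s))"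
    using i1 i\<rho>(1) b by (intro order_trans[OF integral_abs_bound] integral_mono) auto
  ultimately show "\<bar>(LINT r|lborel. m r * \<rho> (r - s)) - m s\<bar> \<le> \<epsilon>" using i\<rho>(2) by simp
qed

text \<open>Du Bois-Reymond: a function with integrable weak derivative is its antiderivative; the test
  functions are smoothed indicators of \<open>[s, t]\<close>.\<close>

lemma weak_deriv_increment:
  fixes m c :: "real \<Rightarrow> real"
  assumes st: "0 < s" "s < t" "t < T" and m: "m \<in> borel_measurable borel" "continuous_on {0<..<T} m"
    and c: "integrable lborel c"
    and weak: "\<And>\<psi>. \<psi> \<in> test_functions {0<..<T} \<Longrightarrow>
      (LINT r|lborel. m r * frechet_derivative \<psi> (at r) 1) = - (LINT r|lborel. c r * \<psi> r)"
  shows "m t - m s = (LINT r|lborel. indicator {s..t} r * c r)"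
proof -
  have cm[measurable]: "c \<in> borel_measurable borel" using c by auto
  \<comment> \<open>Below s and below T - t, so the smoothed indicator of [s, t] has compact support
    in (0, T); below 1/(n + 1), so it becomes sharp.\<close>
  define \<delta> where "\<delta> n = min (min s (T - t)) (inverse (real (Suc n))) / 2" for n
  have \<delta>: "\<delta> n > 0" "\<delta> n < s" "\<delta> n < T - t" "\<delta> n \<le> inverse (real (Suc n))" for n
    using st by (auto simp: \<delta>_def min_def)
  have \<delta>0: "\<delta> \<longlonglongrightarrow> 0"
    by (rule tendsto_sandwich[OF always_eventually always_eventually tendsto_const LIMSEQ_inverse_real_of_nat])
      (use \<delta>(1,4) less_imp_le in blast)+
  have "\<exists>\<rho> A :: real \<Rightarrow> real. smooth \<rho> \<and> (\<forall>x. \<rho> x \<ge> 0) \<and> (\<forall>x. x \<notin> cball 0 (\<delta> n) \<longrightarrow> \<rho> x = 0) \<and> (LINT x|lborel. \<rho> x) = 1 \<and>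
      smooth A \<and> (\<forall>x. frechet_derivative A (at x) 1 = \<rho> x) \<and> (\<forall>x < - \<delta> n. A x = 0) \<and> (\<forall>x > \<delta> n. A x = 1) \<and> (\<forall>x. 0 \<le> A x \<and> A x \<le> 1)" for n
  proof (rule exists_mollifier[OF \<delta>(1)[of n], where ?'a = real])
    fix \<rho> :: "real \<Rightarrow> real"
    assume \<rho>: "smooth \<rho>" "\<And>x. \<rho> x \<ge> 0" "\<And>x. x \<notin> cball 0 (\<delta> n) \<Longrightarrow> \<rho> x = 0" "(LINT x|lborel. \<rho> x) = 1"
    show ?thesis
    proof (rule smooth_step[OF \<rho>(1,2) _ \<rho>(4) \<delta>(1)[of n]])
      fix A
      assume "smooth A" "\<And>x. frechet_derivative A (at x) 1 = \<rho> x" "\<And>x. x < - \<delta> n \<Longrightarrow> A x = 0"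
        "\<And>x. \<delta> n < x \<Longrightarrow> A x = 1" "\<And>x. 0 \<le> A x" "\<And>x. A x \<le> 1"
      then show ?thesis using \<rho> by (intro exI[of _ \<rho>] exI[of _ A]) simp
    qed (rule \<rho>(3))
  qed
  then obtain \<rho> A :: "nat \<Rightarrow> real \<Rightarrow> real" where \<rho>A: "\<And>n. smooth (\<rho> n) \<and> (\<forall>x. \<rho> n x \<ge> 0) \<and> (\<forall>x. x \<notin> cball 0 (\<delta> n) \<longrightarrow> \<rho> n x = 0) \<and> (LINT x|lborel. \<rho> n x) = 1 \<and>
      smooth (A n) \<and> (\<forall>x. frechet_derivative (A n) (at x) 1 = \<rho> n x) \<and> (\<forall>x < - \<delta> n. A n x = 0) \<and> (\<forall>x > \<delta> n. A n x = 1) \<and> (\<forall>x. 0 \<le> A n x \<and> A n x \<le> 1)"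
    by metis
  have \<rho>: "smooth (\<rho> n)" "\<rho> n x \<ge> 0" "x \<notin> cball 0 (\<delta> n) \<Longrightarrow> \<rho> n x = 0" "(LINT x|lborel. \<rho> n x) = 1" for n x
    using \<rho>A[of n] by blast+
  have A: "smooth (A n)" "frechet_derivative (A n) (at x) 1 = \<rho> n x" "x < - \<delta> n \<Longrightarrow> A n x = 0"
    "\<delta> n < x \<Longrightarrow> A n x = 1" "0 \<le> A n x" "A n x \<le> 1" for n x using \<rho>A[of n] by blast+
  have i\<rho>: "integrable lborel (\<rho> n)" for n
    by (rule continuous_compact_support_integrable[OF smooth_continuous[OF \<rho>(1)] compact_cball \<rho>(3)])
  have \<rho>m: "\<rho> n \<in> borel_measurable borel" for n using i\<rho>[of n] by auto
  \<comment> \<open>Its derivative is a mollifier at s minus a mollifier at t, so testing with it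
    evaluates m at the two ends in the limit, while the function itself tends to the indicator of
    [s, t].\<close>
  define \<psi> where "\<psi> n r = A n (r - s) - A n (r - t)" for n r
  have \<psi>_der: "(\<psi> n has_derivative (\<lambda>h. h * (\<rho> n (r - s) - \<rho> n (r - t)))) (at r)" for n r
  proof -
    have "((\<lambda>r. A n (r - a)) has_derivative (\<lambda>h. h * \<rho> n (r - a))) (at r)" for a
    proof -
      have "((\<lambda>r. r - a) has_derivative (\<lambda>h. h)) (at r)" by (auto intro!: derivative_eq_intros)
      from diff_chain_at[OF this smooth_has_derivative[OF A(1)]]
      have "((\<lambda>r. A n (r - a)) has_derivative frechet_derivative (A n) (at (r - a))) (at r)" by (simp add: o_def)
      moreover have "frechet_derivative (A n) (at (r - a)) = (\<lambda>h. h * \<rho> n (r - a))"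
        using frechet_derivative_components[OF smooth_differentiable[OF A(1)], of n "r - a"] A(2)
        by (intro ext) simp
      ultimately show ?thesis by simp
    qed
    from has_derivative_diff[OF this[of s] this[of t]] show ?thesis
      by (simp add: \<psi>_def[abs_def] right_diff_distrib)
  qed
  have \<psi>_fd: "frechet_derivative (\<psi> n) (at r) 1 = \<rho> n (r - s) - \<rho> n (r - t)" for n r
    using frechet_derivative_at[OF \<psi>_der[of n r]] by (metis mult_1)
  have \<psi>_test: "\<psi> n \<in> test_functions {0<..<T}" for n
  proof (rule test_functionsI[of _ "{s - \<delta> n..t + \<delta> n}"])
    have tr: "Ck k (\<lambda>r. A n (r - a))" for k a
      using Ck_affine[OF bounded_linear_ident, of k "A n" "- a"] A(1)[of n] by simp
    show "smooth (\<psi> n)" unfolding \<psi>_def[abs_def] by (intro allI Ck_diff tr)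
    show "\<psi> n r = 0" if "r \<notin> {s - \<delta> n..t + \<delta> n}" for r
    proof (cases "r < s - \<delta> n")
      case True
      then show ?thesis using st by (simp add: \<psi>_def A(3))
    next
      case False
      then show ?thesis using that st by (simp add: \<psi>_def A(4))
    qed
  qed (use \<delta>[of n] st in auto)
  have lim_m: "(\<lambda>n. LINT r|lborel. m r * \<rho> n (r - a)) \<longlonglongrightarrow> m a" and int_m: "\<forall>\<^sub>F n in sequentially. integrable lborel (\<lambda>r. m r * \<rho> n (r - a))"
    if a: "a \<in> {0<..<T}" for a
  proof -
    have *: "\<forall>\<^sub>F n in sequentially. \<forall>r\<in>cball a (\<delta> n). \<bar>m r - m a\<bar> \<le> e" if "e > 0" for e
    proof -
      have "isCont m a" using m(2) a by (simp add: continuous_on_eq_continuous_at)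
      then obtain d where d: "d > 0" "\<And>r. dist r a < d \<Longrightarrow> dist (m r) (m a) < e"
        using \<open>e > 0\<close> unfolding continuous_at_eps_delta by (auto simp: dist_real_def)
      from order_tendstoD(2)[OF \<delta>0 d(1)] show ?thesis
      proof eventually_elim
        case (elim n)
        show ?case
        proof
          fix r assume "r \<in> cball a (\<delta> n)"
          then have "dist r a < d" using elim by (simp add: dist_commute)
          from d(2)[OF this] show "\<bar>m r - m a\<bar> \<le> e" by (simp add: dist_real_def)
        qed
      qed
    qed
    show "\<forall>\<^sub>F n in sequentially. integrable lborel (\<lambda>r. m r * \<rho> n (r - a))"
      using *[OF zero_less_one]
    proof eventually_elim
      case (elim n)
      show ?case by (rule bounded_mult_mollifier(1)[OF \<rho>m \<rho>(2) \<rho>(3) \<rho>(4) i\<rho> m(1)]) (use elim in auto)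
    qed
    show "(\<lambda>n. LINT r|lborel. m r * \<rho> n (r - a)) \<longlonglongrightarrow> m a"
    proof (rule tendstoI)
      fix e :: real assume "e > 0"
      then have "e / 2 > 0" by simp
      from *[OF this] show "\<forall>\<^sub>F n in sequentially. dist (LINT r|lborel. m r * \<rho> n (r - a)) (m a) < e"
      proof eventually_elim
        case (elim n)
        have "\<bar>(LINT r|lborel. m r * \<rho> n (r - a)) - m a\<bar> \<le> e / 2"
          by (rule bounded_mult_mollifier(2)[OF \<rho>m \<rho>(2) \<rho>(3) \<rho>(4) i\<rho> m(1)]) (use elim in auto)
        then show ?case using \<open>e > 0\<close> by (simp add: dist_real_def)
      qed
    qed
  qed
  have s: "s \<in> {0<..<T}" and t: "t \<in> {0<..<T}" using st by auto
  have "(\<lambda>n. (LINT r|lborel. m r * \<rho> n (r - s)) - (LINT r|lborel. m r * \<rho> n (r - t))) \<longlonglongrightarrow> m s - m t"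
    by (intro tendsto_diff lim_m s t)
  moreover have "\<forall>\<^sub>F n in sequentially. (LINT r|lborel. m r * \<rho> n (r - s)) - (LINT r|lborel. m r * \<rho> n (r - t)) = - (LINT r|lborel. c r * \<psi> n r)"
    using int_m[OF s] int_m[OF t]
  proof eventually_elim
    case (elim n)
    then have "(LINT r|lborel. m r * \<rho> n (r - s)) - (LINT r|lborel. m r * \<rho> n (r - t)) = (LINT r|lborel. m r * frechet_derivative (\<psi> n) (at r) 1)"
      by (simp add: \<psi>_fd right_diff_distrib)
    then show ?case using weak[OF \<psi>_test] by simp
  qed
  ultimately have L: "(\<lambda>n. - (LINT r|lborel. c r * \<psi> n r)) \<longlonglongrightarrow> m s - m t"
    by (rule Lim_transform_eventually)
  have "(\<lambda>n. LINT r|lborel. c r * \<psi> n r) \<longlonglongrightarrow> (LINT r|lborel. indicator {s..t} r * c r)"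
  proof (rule integral_dominated_convergence[where w = "\<lambda>r. \<bar>c r\<bar>"])
    show "(\<lambda>r. c r * \<psi> n r) \<in> borel_measurable lborel" for n
      using borel_measurable_continuous_onI[OF smooth_continuous[OF test_function_smooth[OF \<psi>_test[of n]]]] by measurable
    have "AE r in lborel. r \<noteq> s \<and> r \<noteq> t"
      using AE_lborel_singleton[of s] AE_lborel_singleton[of t] by eventually_elim simp
    then show "AE r in lborel. (\<lambda>n. c r * \<psi> n r) \<longlonglongrightarrow> indicator {s..t} r * c r"
    proof eventually_elim
      case (elim r)
      have step: "\<forall>\<^sub>F n in sequentially. A n (r - a) = (if a < r then 1 else 0)" if "r \<noteq> a" for a
      proof -
        have "\<bar>r - a\<bar> > 0" using that by simp
        from order_tendstoD(2)[OF \<delta>0 this] show ?thesis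
          by eventually_elim (auto intro!: A(3,4) simp: abs_if split: if_splits)
      qed
      have "r \<noteq> s" "r \<noteq> t" using elim by auto
      from step[OF this(1)] step[OF this(2)]
      have "\<forall>\<^sub>F n in sequentially. c r * \<psi> n r = indicator {s..t} r * c r"
        by eventually_elim (use elim st in \<open>auto simp: \<psi>_def indicator_def\<close>)
      then show ?case by (rule tendsto_eventually)
    qed
    show "AE r in lborel. norm (c r * \<psi> n r) \<le> \<bar>c r\<bar>" for n
    proof (rule AE_I2)
      fix r
      have "\<bar>\<psi> n r\<bar> \<le> 1" using A(5,6)[of n "r - s"] A(5,6)[of n "r - t"] by (simp add: \<psi>_def abs_le_iff)
      then show "norm (c r * \<psi> n r) \<le> \<bar>c r\<bar>" by (simp add: abs_mult mult_left_le)
    qed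
  qed (use c in \<open>auto intro: integrable_abs\<close>)
  from LIMSEQ_unique[OF L tendsto_minus[OF this]] show ?thesis by simp
qed

lemma product_test_function:
  fixes \<eta> :: "'a::euclidean_space \<Rightarrow> real" and \<psi> :: "real \<Rightarrow> real"
  assumes \<eta>: "\<eta> \<in> test_functions S" and \<psi>: "\<psi> \<in> test_functions {0<..<T}"
  shows "(\<lambda>p. \<eta> (fst p) * \<psi> (snd p)) \<in> test_functions (QT S T)"
    and "frechet_derivative (\<lambda>p. \<eta> (fst p) * \<psi> (snd p)) (at p) (0, 1) = \<eta> (fst p) * frechet_derivative \<psi> (at (snd p)) 1"
proof -
  obtain C where C: "smooth \<eta>" "compact C" "C \<subseteq> S" "\<And>x. x \<notin> C \<Longrightarrow> \<eta> x = 0"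
    by (rule test_functionsD[OF \<eta>]) blast
  obtain D where D: "smooth \<psi>" "compact D" "D \<subseteq> {0<..<T}" "\<And>x. x \<notin> D \<Longrightarrow> \<psi> x = 0"
    by (rule test_functionsD[OF \<psi>]) blast
  show "(\<lambda>p. \<eta> (fst p) * \<psi> (snd p)) \<in> test_functions (QT S T)"
  proof (rule test_functionsI[of _ "C \<times> D"])
    show "smooth (\<lambda>p. \<eta> (fst p) * \<psi> (snd p))"
      using Ck_affine[OF bounded_linear_fst, of _ \<eta> 0] Ck_affine[OF bounded_linear_snd, of _ \<psi> 0] C(1) D(1)
      by (intro allI Ck_mult) auto
    show "\<eta> (fst p) * \<psi> (snd p) = 0" if "p \<notin> C \<times> D" for p
      using that C(4)[of "fst p"] D(4)[of "snd p"] by (cases p) auto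
  qed (use C D in \<open>auto simp: QT_def intro: compact_Times\<close>)
  have "((\<lambda>p. \<eta> (fst p)) has_derivative (\<lambda>h. frechet_derivative \<eta> (at (fst p)) (fst h))) (at p)"
    using diff_chain_at[OF has_derivative_fst[OF has_derivative_ident] smooth_has_derivative[OF C(1)], of p] by (simp add: o_def)
  moreover have "((\<lambda>p. \<psi> (snd p)) has_derivative (\<lambda>h. frechet_derivative \<psi> (at (snd p)) (snd h))) (at p)"
    using diff_chain_at[OF has_derivative_snd[OF has_derivative_ident] smooth_has_derivative[OF D(1)], of p] by (simp add: o_def)
  ultimately have "((\<lambda>p. \<eta> (fst p) * \<psi> (snd p)) has_derivative
      (\<lambda>h. \<eta> (fst p) * frechet_derivative \<psi> (at (snd p)) (snd h) + frechet_derivative \<eta> (at (fst p)) (fst h) * \<psi> (snd p))) (at p)"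
    by (rule has_derivative_mult)
  from frechet_derivative_at[OF this, symmetric]
  show "frechet_derivative (\<lambda>p. \<eta> (fst p) * \<psi> (snd p)) (at p) (0, 1) = \<eta> (fst p) * frechet_derivative \<psi> (at (snd p)) 1"
    using linear_0[OF has_derivative_linear[OF smooth_has_derivative[OF C(1)]]] by simp
qed

text \<open>Summing over a fine equidistant partition telescopes both sides, so the total increment
  is at most \<open>\<epsilon>\<close> times the fixed number N t - N s. No derivative of
  \<open>\<Phi>\<close> is involved, which is the point of the formulation.\<close>

lemma increments_nonpos:
  fixes \<Phi> N :: "real \<Rightarrow> real"
  assumes "s \<le> t" and small: "\<And>\<epsilon>. \<epsilon> > 0 \<Longrightarrow> \<exists>\<delta>>0. \<forall>a b. s \<le> a \<longrightarrow> a < b \<longrightarrow> b \<le> t \<longrightarrow> b - a < \<delta> \<longrightarrow> \<Phi> b - \<Phi> a \<le> \<epsilon> * (N b - N a)"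
  shows "\<Phi> t \<le> \<Phi> s"
proof (cases "s = t")
  case False
  then have st: "s < t" using assms(1) by simp
  have main: "\<Phi> t - \<Phi> s \<le> \<epsilon> * (N t - N s)" if \<epsilon>: "\<epsilon> > 0" for \<epsilon>
  proof -
    obtain \<delta> where \<delta>: "\<delta> > 0" "\<And>a b. s \<le> a \<Longrightarrow> a < b \<Longrightarrow> b \<le> t \<Longrightarrow> b - a < \<delta> \<Longrightarrow> \<Phi> b - \<Phi> a \<le> \<epsilon> * (N b - N a)"
      using small[OF \<epsilon>] by blast
    obtain n :: nat where n: "(t - s) / \<delta> < real n" using reals_Archimedean2 by blast
    moreover have "0 < (t - s) / \<delta>" using st \<delta>(1) by simp
    ultimately have n0: "real n > 0" by linarith
    define h where "h = (t - s) / real n"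
    have h: "0 < h" "h < \<delta>" using st n n0 \<delta>(1) by (auto simp: h_def field_simps)
    have hn: "h * real n = t - s" using n0 by (simp add: h_def)
    define p where "p k = s + h * real k" for k
    have step: "\<Phi> (p (Suc k)) - \<Phi> (p k) \<le> \<epsilon> * (N (p (Suc k)) - N (p k))" if "k < n" for k
    proof (rule \<delta>(2))
      show "s \<le> p k" "p k < p (Suc k)" "p (Suc k) - p k < \<delta>" using h by (auto simp: p_def algebra_simps)
      have "h * real (Suc k) \<le> h * real n" using that h by (intro mult_left_mono) auto
      then show "p (Suc k) \<le> t" using hn by (simp add: p_def)
    qed
    have "\<Phi> (p n) - \<Phi> (p 0) = (\<Sum>k<n. \<Phi> (p (Suc k)) - \<Phi> (p k))"
      by (rule sum_lessThan_telescope[symmetric])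
    also have "\<dots> \<le> (\<Sum>k<n. \<epsilon> * (N (p (Suc k)) - N (p k)))" by (rule sum_mono) (simp add: step)
    also have "\<dots> = \<epsilon> * (N (p n) - N (p 0))"
      using sum_lessThan_telescope[of "\<lambda>k. N (p k)" n] by (simp only: sum_distrib_left[symmetric])
    finally show ?thesis using hn by (simp add: p_def)
  qed
  show ?thesis
  proof (rule field_le_epsilon)
    fix e :: real assume "e > 0"
    define \<epsilon> where "\<epsilon> = e / (\<bar>N t - N s\<bar> + 1)"
    have "\<epsilon> > 0" using \<open>e > 0\<close> by (simp add: \<epsilon>_def)
    have "\<epsilon> * (N t - N s) \<le> \<epsilon> * (\<bar>N t - N s\<bar> + 1)" using \<open>\<epsilon> > 0\<close> by (intro mult_left_mono) auto
    also have "\<dots> = e" by (simp add: \<epsilon>_def)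
    finally show "\<Phi> t \<le> \<Phi> s + e" using main[OF \<open>\<epsilon> > 0\<close>] by linarith
  qed
qed simp

text \<open>The weak derivative of \<open>v\<close> is tested with the functions approximating
  \<open>u\<close>, and both sides pass to the limit. There is no boundary term because these have
  compact support; for u = v the integral vanishes.\<close>

lemma H10_skew:
  fixes u v :: "'a::euclidean_space \<Rightarrow> real"
  assumes S: "S \<in> sets borel" and u: "u \<in> H10 S" and v: "v \<in> H10 S" and i: "i \<in> Basis"
  shows "(LINT x|lebesgue_on S. weak_deriv S i u x * v x) = - (LINT x|lebesgue_on S. weak_deriv S i v x * u x)"
proof -
  obtain \<phi> where \<phi>: "\<And>k. \<phi> k \<in> test_functions S"
    and lim0: "(\<lambda>k. LINT x|lebesgue_on S. (u x - \<phi> k x)\<^sup>2) \<longlonglongrightarrow> 0"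
    and lim1: "(\<lambda>k. LINT x|lebesgue_on S. (weak_deriv S i u x - frechet_derivative (\<phi> k) (at x) i)\<^sup>2) \<longlonglongrightarrow> 0"
    using u i by (auto simp: H10_def)
  have uL: "u \<in> L2 S" "weak_deriv S i u \<in> L2 S" and vL: "v \<in> L2 S" "weak_deriv S i v \<in> L2 S"
    using u v i by (auto simp: H10_def H1_def)
  have wv: "has_weak_deriv S i v (weak_deriv S i v)"
    using v i by (intro weak_deriv_works) (auto simp: H10_def H1_def)
  have L2c: "f \<in> borel_measurable (lebesgue_on S) \<and> integrable (lebesgue_on S) (\<lambda>x. (f x)\<^sup>2)"
    if c: "continuous_on UNIV f" and C: "compact C" "\<And>x. x \<notin> C \<Longrightarrow> f x = 0" for f :: "'a \<Rightarrow> real" and C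
  proof -
    have fm: "f \<in> borel_measurable borel" by (rule borel_measurable_continuous_onI[OF c])
    have "integrable lborel (\<lambda>x. (f x)\<^sup>2)"
      by (rule continuous_compact_support_integrable[OF continuous_on_power[OF c] C(1)]) (simp add: C(2))
    then have "integrable lborel (\<lambda>x. indicator S x * (f x)\<^sup>2)"
      using integrable_mult_indicator[of S lborel "\<lambda>x. (f x)\<^sup>2"] S by simp
    then show ?thesis
      using fm by (subst lebesgue_on_integral_borel(1)[OF S]) (auto intro: measurable_lebesgue_on_borel)
  qed
  have \<phi>L: "\<phi> k \<in> borel_measurable (lebesgue_on S) \<and> integrable (lebesgue_on S) (\<lambda>x. (\<phi> k x)\<^sup>2)"
    "(\<lambda>x. frechet_derivative (\<phi> k) (at x) i) \<in> borel_measurable (lebesgue_on S) \<and>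
      integrable (lebesgue_on S) (\<lambda>x. (frechet_derivative (\<phi> k) (at x) i)\<^sup>2)" for k
  proof -
    obtain C where C: "smooth (\<phi> k)" "compact C" "C \<subseteq> S" "\<And>x. x \<notin> C \<Longrightarrow> \<phi> k x = 0"
      by (rule test_functionsD[OF \<phi>[of k]]) blast
    show "\<phi> k \<in> borel_measurable (lebesgue_on S) \<and> integrable (lebesgue_on S) (\<lambda>x. (\<phi> k x)\<^sup>2)"
      by (rule L2c[OF smooth_continuous[OF C(1)] C(2,4)])
    show "(\<lambda>x. frechet_derivative (\<phi> k) (at x) i) \<in> borel_measurable (lebesgue_on S) \<and>
        integrable (lebesgue_on S) (\<lambda>x. (frechet_derivative (\<phi> k) (at x) i)\<^sup>2)"
      by (rule L2c[OF smooth_frechet_derivative_continuous[OF C(1)] C(2) test_function_deriv_eq_0[OF C(2,4)]])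
  qed
  have "(\<lambda>k. LINT x|lebesgue_on S. v x * frechet_derivative (\<phi> k) (at x) i) \<longlonglongrightarrow> (LINT x|lebesgue_on S. v x * weak_deriv S i u x)"
    using vL(1) uL(2) \<phi>L(2) by (intro integral_mult_L2_tendsto lim1) (simp_all add: L2_def)
  moreover have "(\<lambda>k. LINT x|lebesgue_on S. weak_deriv S i v x * \<phi> k x) \<longlonglongrightarrow> (LINT x|lebesgue_on S. weak_deriv S i v x * u x)"
    using vL(2) uL(1) \<phi>L(1) by (intro integral_mult_L2_tendsto lim0) (simp_all add: L2_def)
  moreover have "(LINT x|lebesgue_on S. v x * frechet_derivative (\<phi> k) (at x) i) = - (LINT x|lebesgue_on S. weak_deriv S i v x * \<phi> k x)" for k
    using wv \<phi>[of k] by (simp add: has_weak_deriv_def)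
  ultimately have "(LINT x|lebesgue_on S. v x * weak_deriv S i u x) = - (LINT x|lebesgue_on S. weak_deriv S i v x * u x)"
    by (intro LIMSEQ_unique[OF _ tendsto_minus]) simp_all
  then show ?thesis by (simp add: mult.commute)
qed

lemma H10_transport_skew:
  fixes u v :: "'a::euclidean_space \<Rightarrow> real"
  assumes S: "S \<in> sets borel" and u: "u \<in> H10 S" and v: "v \<in> H10 S"
  shows "integrable (lebesgue_on S) (\<lambda>x. (b \<bullet> weak_grad S u x) * v x)"
    and "(LINT x|lebesgue_on S. (b \<bullet> weak_grad S u x) * v x) = - (LINT x|lebesgue_on S. (b \<bullet> weak_grad S v x) * u x)"
proof -
  have i: "integrable (lebesgue_on S) (\<lambda>x. weak_deriv S i u x * v x)"
    if "u \<in> H10 S" "v \<in> H10 S" "i \<in> Basis" for u v i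
    using that by (intro integrable_mult_squares) (auto simp: H10_def H1_def L2_def)
  have eq: "(b \<bullet> weak_grad S u x) * v x = (\<Sum>i\<in>Basis. (b \<bullet> i) * (weak_deriv S i u x * v x))" for u v :: "'a \<Rightarrow> real" and x
    unfolding weak_grad_def inner_sum_right sum_distrib_right by (rule sum.cong) auto
  show "integrable (lebesgue_on S) (\<lambda>x. (b \<bullet> weak_grad S u x) * v x)"
    unfolding eq by (intro Bochner_Integration.integrable_sum integrable_mult_right i u v)
  have "(LINT x|lebesgue_on S. (b \<bullet> weak_grad S u x) * v x) = (\<Sum>i\<in>Basis. (b \<bullet> i) * (LINT x|lebesgue_on S. weak_deriv S i u x * v x))"
    unfolding eq using i[OF u v] by (subst Bochner_Integration.integral_sum) auto
  also have "\<dots> = - (\<Sum>i\<in>Basis. (b \<bullet> i) * (LINT x|lebesgue_on S. weak_deriv S i v x * u x))"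
    using H10_skew[OF S u v] by (simp add: sum_negf[symmetric])
  also have "(\<Sum>i\<in>Basis. (b \<bullet> i) * (LINT x|lebesgue_on S. weak_deriv S i v x * u x)) = (LINT x|lebesgue_on S. (b \<bullet> weak_grad S v x) * u x)"
    unfolding eq using i[OF v u] by (subst Bochner_Integration.integral_sum) auto
  finally show "(LINT x|lebesgue_on S. (b \<bullet> weak_grad S u x) * v x) = - (LINT x|lebesgue_on S. (b \<bullet> weak_grad S v x) * u x)" .
qed

lemma borel_measurable_fst [measurable (raw)]:
  fixes f :: "'c \<Rightarrow> 'a::euclidean_space \<times> 'b::euclidean_space"
  assumes "f \<in> M \<rightarrow>\<^sub>M borel" shows "(\<lambda>x. fst (f x)) \<in> M \<rightarrow>\<^sub>M borel"
  by (rule measurable_compose[OF assms borel_measurable_continuous_onI]) (intro continuous_intros)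

lemma borel_measurable_snd [measurable (raw)]:
  fixes f :: "'c \<Rightarrow> 'a::euclidean_space \<times> 'b::euclidean_space"
  assumes "f \<in> M \<rightarrow>\<^sub>M borel" shows "(\<lambda>x. snd (f x)) \<in> M \<rightarrow>\<^sub>M borel"
  by (rule measurable_compose[OF assms borel_measurable_continuous_onI]) (intro continuous_intros)

lemma indicator_snd_measurable [measurable]:
  assumes "A \<in> sets borel"
  shows "(\<lambda>p :: 'a::euclidean_space \<times> real. indicator A (snd p) :: real) \<in> borel_measurable borel"
  by (rule measurable_compose[OF borel_measurable_snd[OF measurable_ident_sets[OF refl]]
        borel_measurable_indicator[OF assms]])

section \<open>Functions on the cylinder with an integrable time derivative\<close>

lemma lborel_Fubini:
  fixes f :: "'a::euclidean_space \<times> 'b::euclidean_space \<Rightarrow> real"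
  assumes "integrable lborel f"
  shows "(LINT x|lborel. LINT r|lborel. f (x, r)) = (LINT p|lborel. f p)"
    "(LINT r|lborel. LINT x|lborel. f (x, r)) = (LINT p|lborel. f p)"
    "integrable lborel (\<lambda>x. LINT r|lborel. f (x, r))" "integrable lborel (\<lambda>r. LINT x|lborel. f (x, r))"
proof -
  have eq: "case_prod (\<lambda>x r. f (x, r)) = f" by auto
  have "integrable (lborel \<Otimes>\<^sub>M lborel) (case_prod (\<lambda>x r. f (x, r)))"
    unfolding lborel_prod eq by (rule assms)
  from lborel_pair.integral_fst[OF this] lborel_pair.integral_snd[OF this]
    lborel_pair.integrable_fst[OF this] lborel_pair.integrable_snd[OF this]
  show "(LINT x|lborel. LINT r|lborel. f (x, r)) = (LINT p|lborel. f p)"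
    "(LINT r|lborel. LINT x|lborel. f (x, r)) = (LINT p|lborel. f p)"
    "integrable lborel (\<lambda>x. LINT r|lborel. f (x, r))" "integrable lborel (\<lambda>r. LINT x|lborel. f (x, r))"
    unfolding lborel_prod eq by simp_all
qed

lemma has_weak_deriv_diff:
  assumes S: "S \<in> sets borel" and u: "has_weak_deriv S e u a" and v: "has_weak_deriv S e v c"
  shows "has_weak_deriv S e (\<lambda>x. u x - v x) (\<lambda>x. a x - c x)"
proof -
  have L: "u \<in> L1loc S" "v \<in> L1loc S" "a \<in> L1loc S" "c \<in> L1loc S"
    using u v by (auto simp: has_weak_deriv_def)
  have "(LINT x|lebesgue_on S. (u x - v x) * frechet_derivative \<phi> (at x) e) =
      - (LINT x|lebesgue_on S. (a x - c x) * \<phi> x)" if \<phi>: "\<phi> \<in> test_functions S" for \<phi>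
    using u v \<phi> L1loc_mult_test_deriv[OF S L(1) \<phi>, of e] L1loc_mult_test_deriv[OF S L(2) \<phi>, of e]
      L1loc_mult_test[OF S L(3) \<phi>] L1loc_mult_test[OF S L(4) \<phi>]
    by (simp add: has_weak_deriv_def left_diff_distrib)
  then show ?thesis using L by (simp add: has_weak_deriv_def L1loc_diff)
qed

lemma closure_QT: "T > 0 \<Longrightarrow> closure (QT S T) = closure S \<times> {0..T}"
  by (simp add: QT_def closure_Times)

text \<open>\<open>\<gamma>\<close> is a Borel version of the time derivative of \<open>w\<close>,
  zero off the cylinder so that Fubini can be used on the whole space-time. The locale is
  instantiated with each of two solutions and with their difference.\<close>

locale cylinder_function =
  fixes S :: "'a::euclidean_space set" and T :: real and w \<gamma> :: "'a \<times> real \<Rightarrow> real"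
  assumes open_S: "open S" and bounded_S: "bounded S" and T: "T > 0"
    and w_cont: "continuous_on (closure (QT S T)) w"
    and \<gamma>: "\<gamma> \<in> borel_measurable borel" "integrable lborel \<gamma>" "\<And>p. p \<notin> QT S T \<Longrightarrow> \<gamma> p = 0"
    and weak: "has_weak_deriv (QT S T) (0, 1) w \<gamma>"
begin

lemma S_borel [measurable]: "S \<in> sets borel" using open_S by auto

lemma Q_borel: "QT S T \<in> sets borel" using QT_open[OF open_S] by auto

definition W where "W p = indicator (closure (QT S T)) p * w p"

lemma W_eq: "p \<in> closure (QT S T) \<Longrightarrow> W p = w p" by (simp add: W_def)

lemma W_measurable [measurable]: "W \<in> borel_measurable borel"
  using borel_measurable_continuous_on_indicator[OF _ w_cont] by (simp add: W_def[abs_def])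

lemma \<gamma>_measurable [measurable]: "\<gamma> \<in> borel_measurable borel" by (rule \<gamma>)

lemma compact_Q: "compact (closure (QT S T))"
  using QT_bounded[OF bounded_S] by (simp add: compact_closure)

lemma W_bounded: obtains B where "B \<ge> 0" "\<And>p. \<bar>W p\<bar> \<le> B"
proof -
  have "bounded (w ` closure (QT S T))"
    by (intro compact_imp_bounded compact_continuous_image w_cont compact_Q)
  then obtain B where B: "\<And>p. p \<in> closure (QT S T) \<Longrightarrow> \<bar>w p\<bar> \<le> B" by (auto simp: bounded_iff)
  have "\<bar>W p\<bar> \<le> max 0 B" for p
    using B[of p] by (cases "p \<in> closure (QT S T)") (auto simp: W_def)
  then show thesis by (intro that[of "max 0 B"]) auto
qed

lemma in_closure: "x \<in> S \<Longrightarrow> r \<in> {0..T} \<Longrightarrow> (x, r) \<in> closure (QT S T)"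
  using closure_subset[of S] by (auto simp: closure_QT[OF T])

lemma W_uniform:
  assumes "\<epsilon> > 0"
  obtains \<delta> where "\<delta> > 0" "\<And>x r r'. x \<in> S \<Longrightarrow> r \<in> {0..T} \<Longrightarrow> r' \<in> {0..T} \<Longrightarrow> \<bar>r - r'\<bar> < \<delta> \<Longrightarrow> \<bar>W (x, r) - W (x, r')\<bar> \<le> \<epsilon>"
proof -
  have "uniformly_continuous_on (closure (QT S T)) w"
    by (rule compact_uniformly_continuous[OF w_cont compact_Q])
  then obtain \<delta> where \<delta>: "\<delta> > 0" "\<And>p q. p \<in> closure (QT S T) \<Longrightarrow> q \<in> closure (QT S T) \<Longrightarrow> dist q p < \<delta> \<Longrightarrow> dist (w q) (w p) < \<epsilon>"
    using assms unfolding uniformly_continuous_on_def by metis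
  show thesis
  proof (rule that[OF \<delta>(1)])
    fix x r r' assume *: "x \<in> S" "r \<in> {0..T}" "r' \<in> {0..T}" "\<bar>r - r'\<bar> < \<delta>"
    have "dist (w (x, r)) (w (x, r')) < \<epsilon>"
      using * by (intro \<delta>(2) in_closure) (auto simp: dist_Pair_Pair dist_real_def)
    then show "\<bar>W (x, r) - W (x, r')\<bar> \<le> \<epsilon>"
      using W_eq[OF in_closure] * by (simp add: dist_real_def)
  qed
qed

lemma indicator_S_integrable: "integrable lborel (\<lambda>x. indicator S x * (c::real))"
  using emeasure_lborel_bounded[OF bounded_S] by (intro integrable_mult_left integrable_real_indicator) auto

lemma bounded_support_integrable:
  fixes f :: "'a \<Rightarrow> real"
  assumes "f \<in> borel_measurable borel" "\<And>x. \<bar>f x\<bar> \<le> B"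
  shows "integrable lborel (\<lambda>x. indicator S x * f x)"
proof (rule Bochner_Integration.integrable_bound[OF indicator_S_integrable[of B]])
  show "AE x in lborel. norm (indicator S x * f x) \<le> norm (indicator S x * B)"
    using assms(2) by (intro AE_I2) (auto simp: indicator_def intro: order_trans[OF _ abs_ge_self])
qed (use assms(1) in measurable)

lemma \<gamma>_bounded_mult:
  assumes "h \<in> borel_measurable borel" "\<And>p. \<bar>h p\<bar> \<le> B"
  shows "integrable lborel (\<lambda>p. \<gamma> p * h p)"
  using integrable_bounded_mult[of h lborel B \<gamma>] assms \<gamma>(2) by (simp add: mult.commute)

text \<open>Test functions of product form separate the variables: for fixed \<open>\<eta>\<close>
  the weighted mean \<open>m\<close> of the slices is continuous in time with weak derivative
  \<open>c\<close>, and the statement in one variable applies.\<close>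

lemma increment_tested:
  assumes st: "0 < s" "s < t" "t < T" and \<eta>: "\<eta> \<in> test_functions S"
  shows "(LINT x|lborel. (W (x, t) - W (x, s)) * \<eta> x) =
    (LINT p|lborel. \<gamma> p * (indicator {s..t} (snd p) * \<eta> (fst p)))"
proof -
  obtain K where K: "smooth \<eta>" "compact K" "K \<subseteq> S" "\<And>x. x \<notin> K \<Longrightarrow> \<eta> x = 0"
    by (rule test_functionsD[OF \<eta>]) blast
  have \<eta>m[measurable]: "\<eta> \<in> borel_measurable borel"
    by (rule borel_measurable_continuous_onI[OF smooth_continuous[OF K(1)]])
  obtain H where H: "H \<ge> 0" "\<And>x. \<bar>\<eta> x\<bar> \<le> H"
    using continuous_compact_support_bounded[OF smooth_continuous[OF K(1)] K(2,4)] by blast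
  obtain B where B: "B \<ge> 0" "\<And>p. \<bar>W p\<bar> \<le> B" using W_bounded by blast
  have \<eta>S: "\<eta> x = indicator S x * \<eta> x" for x using K(3,4) by (cases "x \<in> S") auto
  have iW: "integrable lborel (\<lambda>x. W (x, r) * \<eta> x)" for r
  proof -
    have "integrable lborel (\<lambda>x. indicator S x * (W (x, r) * \<eta> x))"
      by (rule bounded_support_integrable[of _ "B * H"]) (measurable, simp add: abs_mult mult_mono B H)
    moreover have "(\<lambda>x. indicator S x * (W (x, r) * \<eta> x)) = (\<lambda>x. W (x, r) * \<eta> x)"
      by (subst (2) \<eta>S) (simp add: mult.left_commute)
    ultimately show ?thesis by simp
  qed
  define m where "m r = (LINT x|lborel. W (x, r) * \<eta> x)" for r
  define c where "c r = (LINT x|lborel. \<gamma> (x, r) * \<eta> x)" for r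
  have i\<gamma>\<eta>: "integrable lborel (\<lambda>p. \<gamma> p * \<eta> (fst p))"
    by (rule \<gamma>_bounded_mult[of _ H]) (measurable, rule H(2))
  have mm: "m \<in> borel_measurable borel" unfolding m_def[abs_def] by measurable
  have mc: "continuous_on {0<..<T} m"
  proof -
    have "continuous_on {0..T} m"
      unfolding continuous_on_iff
    proof (intro ballI allI impI)
      fix r e :: real assume r: "r \<in> {0..T}" and "e > 0"
      \<comment> \<open>The summand 1 keeps V positive and makes the final estimate strict.\<close>
      define V where "V = measure lborel S * H + 1"
      have V: "V > 0" using H(1) by (simp add: V_def add_nonneg_pos)
      then have "e / V > 0" using \<open>e > 0\<close> by simp
      then obtain \<delta> where \<delta>: "\<delta> > 0" "\<And>x r r'. x \<in> S \<Longrightarrow> r \<in> {0..T} \<Longrightarrow> r' \<in> {0..T} \<Longrightarrow> \<bar>r - r'\<bar> < \<delta> \<Longrightarrow> \<bar>W (x, r) - W (x, r')\<bar> \<le> e / V"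
        using W_uniform by metis
      show "\<exists>d>0. \<forall>r'\<in>{0..T}. dist r' r < d \<longrightarrow> dist (m r') (m r) < e"
      proof (intro exI[of _ \<delta>] conjI \<delta>(1) ballI impI)
        fix r' assume r': "r' \<in> {0..T}" "dist r' r < \<delta>"
        have "m r' - m r = (LINT x|lborel. W (x, r') * \<eta> x - W (x, r) * \<eta> x)"
          using iW by (simp add: m_def)
        also have "\<bar>\<dots>\<bar> \<le> (LINT x|lborel. \<bar>W (x, r') * \<eta> x - W (x, r) * \<eta> x\<bar>)" by (rule integral_abs_bound)
        also have "\<dots> \<le> (LINT x|lborel. indicator S x * (e / V * H))"
        proof (rule integral_mono)
          show "integrable lborel (\<lambda>x. \<bar>W (x, r') * \<eta> x - W (x, r) * \<eta> x\<bar>)" using iW by simp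
          show "\<bar>W (x, r') * \<eta> x - W (x, r) * \<eta> x\<bar> \<le> indicator S x * (e / V * H)" for x
          proof (cases "x \<in> S")
            case True
            have "\<bar>W (x, r') - W (x, r)\<bar> * \<bar>\<eta> x\<bar> \<le> e / V * H"
              using \<delta>(2)[OF True r'(1) r] r'(2) H V \<open>e > 0\<close> by (intro mult_mono) (auto simp: dist_real_def)
            then show ?thesis using True by (simp add: abs_mult[symmetric] left_diff_distrib)
          next
            case False
            then have "\<eta> x = 0" using \<eta>S[of x] by simp
            then show ?thesis using False by simp
          qed
        qed (rule indicator_S_integrable)
        also have "\<dots> = measure lborel S * H * (e / V)"
          using emeasure_lborel_bounded[OF bounded_S] by simp
        also have "\<dots> < V * (e / V)"
          using \<open>e / V > 0\<close> by (intro mult_strict_right_mono) (auto simp: V_def)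
        also have "\<dots> = e" using V by simp
        finally show "dist (m r') (m r) < e" by (simp add: dist_real_def)
      qed
    qed
    then show ?thesis by (rule continuous_on_subset) auto
  qed
  have ic: "integrable lborel c"
    using lborel_Fubini(4)[OF i\<gamma>\<eta>] by (simp add: c_def[abs_def])
  have "m t - m s = (LINT r|lborel. indicator {s..t} r * c r)"
  proof (rule weak_deriv_increment[OF st mm mc ic])
    fix \<psi> :: "real \<Rightarrow> real" assume \<psi>: "\<psi> \<in> test_functions {0<..<T}"
    obtain D where D: "smooth \<psi>" "compact D" "D \<subseteq> {0<..<T}" "\<And>x. x \<notin> D \<Longrightarrow> \<psi> x = 0"
      by (rule test_functionsD[OF \<psi>]) blast
    let ?d = "\<lambda>r. frechet_derivative \<psi> (at r) 1"
    have dc: "continuous_on UNIV ?d" by (rule smooth_frechet_derivative_continuous[OF D(1)])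
    have d0: "?d r = 0" if "r \<notin> D" for r by (rule test_function_deriv_eq_0[OF D(2,4) that])
    have [measurable]: "\<psi> \<in> borel_measurable borel" "?d \<in> borel_measurable borel"
      using borel_measurable_continuous_onI[OF smooth_continuous[OF D(1)]] borel_measurable_continuous_onI[OF dc] .
    obtain P where P: "P \<ge> 0" "\<And>r. \<bar>\<psi> r\<bar> \<le> P"
      using continuous_compact_support_bounded[OF smooth_continuous[OF D(1)] D(2,4)] by blast
    obtain P' where P': "P' \<ge> 0" "\<And>r. \<bar>?d r\<bar> \<le> P'"
      using continuous_compact_support_bounded[OF dc D(2) d0] by blast
    note pt = product_test_function[OF \<eta> \<psi>]
    have Qd: "\<eta> (fst p) * ?d (snd p) = 0" if "p \<notin> QT S T" for p
    proof -
      have "fst p \<notin> K \<or> snd p \<notin> D" using that K(3) D(3) by (cases p) (auto simp: QT_def)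
      then show ?thesis using K(4) d0 by auto
    qed
    have "(LINT p|lebesgue_on (QT S T). w p * frechet_derivative (\<lambda>p. \<eta> (fst p) * \<psi> (snd p)) (at p) (0, 1)) =
        (LINT p|lborel. indicator (QT S T) p * (W p * (\<eta> (fst p) * ?d (snd p))))"
    proof (rule lebesgue_on_cong_borel(3)[OF Q_borel])
      show "AE p in lborel. p \<in> QT S T \<longrightarrow>
          w p * frechet_derivative (\<lambda>p. \<eta> (fst p) * \<psi> (snd p)) (at p) (0, 1) = W p * (\<eta> (fst p) * ?d (snd p))"
        unfolding pt(2) using W_eq closure_subset[of "QT S T"] by (intro AE_I2) auto
    qed measurable
    also have "(\<lambda>p. indicator (QT S T) p * (W p * (\<eta> (fst p) * ?d (snd p)))) = (\<lambda>p. W p * \<eta> (fst p) * ?d (snd p))"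
      using Qd by (force simp: fun_eq_iff indicator_def)
    also have "(LINT p|lborel. W p * \<eta> (fst p) * ?d (snd p)) = (LINT r|lborel. LINT x|lborel. W (x, r) * \<eta> x * ?d r)"
    proof -
      have "integrable lborel (\<lambda>p. indicator (QT S T) p * (B * (H * P')))"
        using emeasure_lborel_bounded[OF QT_bounded[OF bounded_S]] Q_borel
        by (intro integrable_mult_left integrable_real_indicator) auto
      then have "integrable lborel (\<lambda>p. W p * \<eta> (fst p) * ?d (snd p))"
      proof (rule Bochner_Integration.integrable_bound)
        show "AE p in lborel. norm (W p * \<eta> (fst p) * ?d (snd p)) \<le> norm (indicator (QT S T) p * (B * (H * P')))"
        proof (rule AE_I2)
          fix p
          have "\<bar>W p\<bar> * (\<bar>\<eta> (fst p)\<bar> * \<bar>?d (snd p)\<bar>) \<le> B * (H * P')"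
            using B H P' by (intro mult_mono mult_nonneg_nonneg) auto
          then show "norm (W p * \<eta> (fst p) * ?d (snd p)) \<le> norm (indicator (QT S T) p * (B * (H * P')))"
            using Qd[of p] B(1) H(1) P'(1) by (cases "p \<in> QT S T") (auto simp: abs_mult mult.assoc)
        qed
      qed measurable
      from lborel_Fubini(2)[OF this] show ?thesis by simp
    qed
    also have "\<dots> = (LINT r|lborel. m r * ?d r)" by (simp add: m_def)
    finally have l: "(LINT p|lebesgue_on (QT S T). w p * frechet_derivative (\<lambda>p. \<eta> (fst p) * \<psi> (snd p)) (at p) (0, 1)) =
        (LINT r|lborel. m r * ?d r)" .
    have "(LINT p|lebesgue_on (QT S T). \<gamma> p * (\<eta> (fst p) * \<psi> (snd p))) = (LINT p|lborel. \<gamma> p * (\<eta> (fst p) * \<psi> (snd p)))"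
      by (rule integral_lebesgue_on_support[OF Q_borel]) (measurable, simp add: \<gamma>(3))
    also have "\<dots> = (LINT r|lborel. LINT x|lborel. \<gamma> (x, r) * (\<eta> x * \<psi> r))"
    proof -
      have "integrable lborel (\<lambda>p. \<gamma> p * (\<eta> (fst p) * \<psi> (snd p)))"
        by (rule \<gamma>_bounded_mult[of _ "H * P"]) (measurable, simp add: abs_mult mult_mono H P)
      from lborel_Fubini(2)[OF this] show ?thesis by simp
    qed
    also have "\<dots> = (LINT r|lborel. c r * \<psi> r)" by (simp add: c_def mult.assoc[symmetric])
    finally have r: "(LINT p|lebesgue_on (QT S T). \<gamma> p * (\<eta> (fst p) * \<psi> (snd p))) = (LINT r|lborel. c r * \<psi> r)" .
    show "(LINT r|lborel. m r * ?d r) = - (LINT r|lborel. c r * \<psi> r)"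
      using weak pt(1) unfolding has_weak_deriv_def l[symmetric] r[symmetric] by blast
  qed
  also have "\<dots> = (LINT r|lborel. LINT x|lborel. \<gamma> (x, r) * (indicator {s..t} r * \<eta> x))"
    by (simp add: c_def integral_mult_right_zero[symmetric] mult.left_commute del: integral_mult_right_zero)
  also have "\<dots> = (LINT p|lborel. \<gamma> p * (indicator {s..t} (snd p) * \<eta> (fst p)))"
  proof -
    have "integrable lborel (\<lambda>p. \<gamma> p * (indicator {s..t} (snd p) * \<eta> (fst p)))"
      by (rule \<gamma>_bounded_mult[of _ H]) (measurable, use H in \<open>auto simp: indicator_def\<close>)
    from lborel_Fubini(2)[OF this] show ?thesis by simp
  qed
  finally show ?thesis using iW by (simp add: m_def left_diff_distrib)
qed

text \<open>The defect of the identity has zero integral against every test function in space, so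
  the fundamental lemma applies to it and to its negative. The null set depends on s and t, hence
  the identity is used for fixed endpoints.\<close>

lemma increment_AE:
  assumes st: "0 < s" "s < t" "t < T"
  shows "AE x in lborel. x \<in> S \<longrightarrow> W (x, t) - W (x, s) = (LINT r|lborel. indicator {s..t} r * \<gamma> (x, r))"
proof -
  define q where "q x = (LINT r|lborel. indicator {s..t} r * \<gamma> (x, r))" for x
  have "integrable lborel (\<lambda>p. \<gamma> p * indicator {s..t} (snd p))"
    by (rule \<gamma>_bounded_mult[of _ 1]) (rule indicator_snd_measurable, auto simp: indicator_def)
  from lborel_Fubini(3)[OF this] have iq: "integrable lborel q" by (simp add: q_def[abs_def] mult.commute)
  have qm[measurable]: "q \<in> borel_measurable borel" using iq by auto
  obtain B where B: "B \<ge> 0" "\<And>p. \<bar>W p\<bar> \<le> B" using W_bounded by blast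
  define h where "h x = W (x, t) - W (x, s) - q x" for x
  have hm[measurable]: "h \<in> borel_measurable borel" unfolding h_def[abs_def] by measurable
  have hL: "h \<in> L1loc S"
    unfolding L1loc_def
  proof (clarify)
    fix K assume K: "compact K" "K \<subseteq> S"
    have Kb: "K \<in> sets borel" using K(1) by (simp add: compact_imp_closed)
    interpret finite_measure "lebesgue_on K"
      by (rule finite_measure_bounded[OF Kb compact_imp_bounded[OF K(1)]])
    have "integrable (lebesgue_on K) (\<lambda>x. W (x, r))" for r
    proof (rule integrable_const_bound[of _ B])
      have "(\<lambda>x. W (x, r)) \<in> borel_measurable borel" by measurable
      then show "(\<lambda>x. W (x, r)) \<in> borel_measurable (lebesgue_on K)" by (rule measurable_lebesgue_on_borel)
    qed (simp add: B)
    moreover have "integrable (lebesgue_on K) q"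
      using integrable_mult_indicator[OF _ iq, of K] Kb by (subst lebesgue_on_integral_borel(1)[OF Kb qm]) simp
    ultimately show "integrable (lebesgue_on K) h" unfolding h_def by auto
  qed
  have zero: "(LINT x|lebesgue_on S. h x * \<eta> x) = 0" if \<eta>: "\<eta> \<in> test_functions S" for \<eta>
  proof -
    obtain K where K: "smooth \<eta>" "compact K" "K \<subseteq> S" "\<And>x. x \<notin> K \<Longrightarrow> \<eta> x = 0"
      by (rule test_functionsD[OF \<eta>]) blast
    have \<eta>c: "continuous_on UNIV \<eta>" by (rule smooth_continuous[OF K(1)])
    have \<eta>m[measurable]: "\<eta> \<in> borel_measurable borel" by (rule borel_measurable_continuous_onI[OF \<eta>c])
    obtain H where H: "H \<ge> 0" "\<And>x. \<bar>\<eta> x\<bar> \<le> H"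
      using continuous_compact_support_bounded[OF \<eta>c K(2,4)] by blast
    have "integrable lborel (\<lambda>x. \<eta> x)" by (rule continuous_compact_support_integrable[OF \<eta>c K(2,4)])
    then have iW: "integrable lborel (\<lambda>x. (W (x, t) - W (x, s)) * \<eta> x)"
    proof (intro integrable_bounded_mult[of _ _ "2 * B"])
      show "AE x in lborel. \<bar>W (x, t) - W (x, s)\<bar> \<le> 2 * B"
      proof (rule AE_I2)
        fix x show "\<bar>W (x, t) - W (x, s)\<bar> \<le> 2 * B" using B(2)[of "(x, t)"] B(2)[of "(x, s)"] by linarith
      qed
    qed measurable
    have iqe: "integrable lborel (\<lambda>x. q x * \<eta> x)"
      using integrable_bounded_mult[of \<eta> lborel H q] iq H by (simp add: mult.commute)
    have "integrable lborel (\<lambda>p. \<gamma> p * (indicator {s..t} (snd p) * \<eta> (fst p)))"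
      by (rule \<gamma>_bounded_mult[of _ H]) (measurable, use H in \<open>auto simp: indicator_def\<close>)
    from lborel_Fubini(1)[OF this]
    have "(LINT p|lborel. \<gamma> p * (indicator {s..t} (snd p) * \<eta> (fst p))) = (LINT x|lborel. LINT r|lborel. \<gamma> (x, r) * (indicator {s..t} r * \<eta> x))"
      by simp
    also have "\<dots> = (LINT x|lborel. q x * \<eta> x)"
      by (simp add: q_def integral_mult_left_zero[symmetric] ac_simps del: integral_mult_left_zero)
    finally have "(LINT x|lborel. (W (x, t) - W (x, s)) * \<eta> x) = (LINT x|lborel. q x * \<eta> x)"
      using increment_tested[OF st \<eta>] by simp
    then have "(LINT x|lborel. h x * \<eta> x) = 0"
      using iW iqe by (simp add: h_def left_diff_distrib)
    then show ?thesis
      using K by (subst integral_lebesgue_on_support) (auto simp: subset_iff)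
  qed
  have "AE x in lebesgue_on S. h x \<ge> 0"
    by (rule fundamental_lemma_nonneg[OF open_S hL]) (simp add: zero)
  moreover have "AE x in lebesgue_on S. - h x \<ge> 0"
    by (rule fundamental_lemma_nonneg[OF open_S]) (use hL in \<open>auto simp: L1loc_def zero\<close>)
  ultimately have "AE x in lebesgue_on S. h x = 0" by eventually_elim simp
  then show ?thesis
    unfolding AE_lebesgue_on_iff[OF S_borel] by eventually_elim (simp add: h_def q_def)
qed

definition energy where "energy r = (LINT x|lborel. indicator S x * (W (x, r))\<^sup>2)"

text \<open>The difference of squares is (W(b) - W(a)) (W(b) + W(a)), and the first factor is the
  time integral of \<open>\<gamma>\<close>. Under that integral the second factor is exchanged for 2
  W(r), against which the dissipation hypothesis applies.\<close>

lemma energy_step: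
  assumes ab: "0 < a" "a < b" "b < T"
    and \<epsilon>: "\<And>x r. x \<in> S \<Longrightarrow> r \<in> {a..b} \<Longrightarrow> \<bar>W (x, a) - W (x, r)\<bar> \<le> \<epsilon> \<and> \<bar>W (x, b) - W (x, r)\<bar> \<le> \<epsilon>"
    and diss: "AE r in lborel. r \<in> {0<..<T} \<longrightarrow> (LINT x|lborel. \<gamma> (x, r) * W (x, r)) \<le> 0"
  shows "energy b - energy a \<le> 2 * \<epsilon> * (LINT p|lborel. indicator {a..b} (snd p) * \<bar>\<gamma> p\<bar>)"
proof -
  obtain B where B: "B \<ge> 0" "\<And>p. \<bar>W p\<bar> \<le> B" using W_bounded by blast
  have \<gamma>S: "\<gamma> (x, r) = 0" if "x \<notin> S" for x r using that by (intro \<gamma>(3)) (auto simp: QT_def)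
  have iE: "integrable lborel (\<lambda>x. indicator S x * (W (x, r))\<^sup>2)" for r
    using power_mono[OF B(2) abs_ge_zero, of _ 2] by (intro bounded_support_integrable[of _ "B\<^sup>2"]) auto
  \<comment> \<open>\<open>k\<close> carries the sum of the endpoint values and \<open>l\<close>
    below its replacement by twice the current value. They differ by at most
    \<open>2 * \<epsilon>\<close> on the strip over S.\<close>
  define k where "k p = indicator {a..b} (snd p) * (W (fst p, b) + W (fst p, a))" for p
  have km: "k \<in> borel_measurable borel" unfolding k_def[abs_def] by measurable
  have kB: "\<bar>k p\<bar> \<le> 2 * B" for p
    using B(2)[of "(fst p, b)"] B(2)[of "(fst p, a)"] B(1) unfolding k_def by (cases "snd p \<in> {a..b}") auto
  have ik: "integrable lborel (\<lambda>p. \<gamma> p * k p)" by (rule \<gamma>_bounded_mult[OF km kB])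
  define l where "l p = indicator {a..b} (snd p) * (2 * W p)" for p
  have lm: "l \<in> borel_measurable borel" unfolding l_def[abs_def] by measurable
  have lB: "\<bar>l p\<bar> \<le> 2 * B" for p
    using B(2)[of p] B(1) unfolding l_def by (cases "snd p \<in> {a..b}") auto
  have il: "integrable lborel (\<lambda>p. \<gamma> p * l p)" by (rule \<gamma>_bounded_mult[OF lm lB])
  have "energy b - energy a = (LINT x|lborel. indicator S x * (W (x, b))\<^sup>2 - indicator S x * (W (x, a))\<^sup>2)"
    unfolding energy_def using iE by simp
  also have "\<dots> = (LINT x|lborel. LINT r|lborel. \<gamma> (x, r) * k (x, r))"
  proof (rule integral_cong_AE)
    show "AE x in lborel. indicator S x * (W (x, b))\<^sup>2 - indicator S x * (W (x, a))\<^sup>2 = (LINT r|lborel. \<gamma> (x, r) * k (x, r))"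
      using increment_AE[OF ab]
    proof eventually_elim
      case (elim x)
      show ?case
      proof (cases "x \<in> S")
        case True
        have "(LINT r|lborel. \<gamma> (x, r) * k (x, r)) = (LINT r|lborel. (indicator {a..b} r * \<gamma> (x, r)) * (W (x, b) + W (x, a)))"
          by (simp add: k_def ac_simps)
        also have "\<dots> = (W (x, b) - W (x, a)) * (W (x, b) + W (x, a))" using elim True by simp
        finally show ?thesis using True by (simp add: power2_eq_square algebra_simps)
      qed (simp add: \<gamma>S)
    qed
    note km[measurable]
    show "(\<lambda>x. LINT r|lborel. \<gamma> (x, r) * k (x, r)) \<in> borel_measurable lborel" by measurable
  qed measurable
  also have "\<dots> = (LINT p|lborel. \<gamma> p * k p)"
    by (rule lborel_Fubini(1)[OF ik])
  also have "\<dots> = (LINT p|lborel. \<gamma> p * l p) + (LINT p|lborel. \<gamma> p * (k p - l p))"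
    using ik il by (simp add: right_diff_distrib)
  also have "(LINT p|lborel. \<gamma> p * l p) \<le> 0"
  proof -
    have "(LINT p|lborel. \<gamma> p * l p) = (LINT r|lborel. LINT x|lborel. \<gamma> (x, r) * l (x, r))"
      by (rule lborel_Fubini(2)[OF il, symmetric])
    moreover have "0 \<le> (LINT r|lborel. - (LINT x|lborel. \<gamma> (x, r) * l (x, r)))"
    proof (rule integral_nonneg_AE)
      show "AE r in lborel. 0 \<le> - (LINT x|lborel. \<gamma> (x, r) * l (x, r))"
        using diss
      proof eventually_elim
        case (elim r)
        have eq: "(LINT x|lborel. \<gamma> (x, r) * l (x, r)) = indicator {a..b} r * 2 * (LINT x|lborel. \<gamma> (x, r) * W (x, r))"
          by (simp add: l_def integral_mult_right_zero[symmetric] ac_simps del: integral_mult_right_zero)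
        show ?case
        proof (cases "r \<in> {a..b}")
          case True
          then have "(LINT x|lborel. \<gamma> (x, r) * W (x, r)) \<le> 0" using elim ab by auto
          then show ?thesis unfolding eq using True by simp
        qed (simp add: eq)
      qed
    qed
    ultimately show ?thesis by simp
  qed
  also have "(LINT p|lborel. \<gamma> p * (k p - l p)) \<le> (LINT p|lborel. 2 * \<epsilon> * (indicator {a..b} (snd p) * \<bar>\<gamma> p\<bar>))"
  proof (rule integral_mono)
    show "integrable lborel (\<lambda>p. \<gamma> p * (k p - l p))" using ik il by (simp add: right_diff_distrib)
    have "integrable lborel (\<lambda>p. \<bar>\<gamma> p * indicator {a..b} (snd p)\<bar>)"
      by (rule integrable_abs, rule \<gamma>_bounded_mult[of _ 1]) (rule indicator_snd_measurable, auto simp: indicator_def)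
    then show "integrable lborel (\<lambda>p. 2 * \<epsilon> * (indicator {a..b} (snd p) * \<bar>\<gamma> p\<bar>))"
      by (intro integrable_mult_right) (simp add: abs_mult mult.commute)
    fix p :: "'a \<times> real"
    obtain x r where p: "p = (x, r)" by (cases p)
    show "\<gamma> p * (k p - l p) \<le> 2 * \<epsilon> * (indicator {a..b} (snd p) * \<bar>\<gamma> p\<bar>)"
    proof (cases "x \<in> S \<and> r \<in> {a..b}")
      case True
      then have "\<bar>k p - l p\<bar> \<le> 2 * \<epsilon>"
        using \<epsilon>[of x r] by (simp add: p k_def l_def abs_le_iff)
      then have "\<bar>\<gamma> p\<bar> * \<bar>k p - l p\<bar> \<le> \<bar>\<gamma> p\<bar> * (2 * \<epsilon>)" by (intro mult_left_mono) auto
      then have "\<gamma> p * (k p - l p) \<le> \<bar>\<gamma> p\<bar> * (2 * \<epsilon>)" unfolding abs_mult[symmetric] by linarith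
      then show ?thesis using True by (simp add: p ac_simps)
    next
      case False
      then show ?thesis using \<gamma>S[of x r] by (auto simp: p k_def l_def)
    qed
  qed
  finally show ?thesis by simp
qed

text \<open>\<open>N\<close> is the mass of the absolute value of \<open>\<gamma>\<close> up to time
  r, whose increments bound the errors of the single steps. Uniform continuity in time makes
  \<open>\<epsilon>\<close> as small as desired on all short intervals at once.\<close>

lemma energy_le:
  assumes st: "0 < s" "s \<le> t" "t < T"
    and diss: "AE r in lborel. r \<in> {0<..<T} \<longrightarrow> (LINT x|lborel. \<gamma> (x, r) * W (x, r)) \<le> 0"
  shows "energy t \<le> energy s"
proof -
  define N where "N r = (LINT p|lborel. indicator {..r} (snd p) * \<bar>\<gamma> p\<bar>)" for r
  have iN: "integrable lborel (\<lambda>p. indicator A (snd p) * \<bar>\<gamma> p\<bar>)" if [measurable]: "A \<in> sets borel" for A :: "real set"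
  proof -
    have "integrable lborel (\<lambda>p. \<bar>\<gamma> p * indicator A (snd p)\<bar>)"
      by (rule integrable_abs, rule \<gamma>_bounded_mult[of _ 1]) (rule indicator_snd_measurable, auto simp: indicator_def)
    then show ?thesis by (simp add: abs_mult mult.commute)
  qed
  have Nd: "(LINT p|lborel. indicator {a..b} (snd p) * \<bar>\<gamma> p\<bar>) = N b - N a" if "a < b" for a b
  proof -
    have "N b - N a = (LINT p|lborel. indicator {..b} (snd p) * \<bar>\<gamma> p\<bar> - indicator {..a} (snd p) * \<bar>\<gamma> p\<bar>)"
      unfolding N_def by (rule Bochner_Integration.integral_diff[symmetric]) (rule iN, simp)+
    also have "\<dots> = (LINT p|lborel. indicator {a<..b} (snd p) * \<bar>\<gamma> p\<bar>)"
      using that by (intro Bochner_Integration.integral_cong) (auto simp: indicator_def)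
    also have "\<dots> = (LINT p|lborel. indicator {a..b} (snd p) * \<bar>\<gamma> p\<bar>)"
    proof (rule integral_cong_AE)
      \<comment> \<open>Subtracting the masses leaves the half-open interval, while the step
        estimate has the closed one; a single time is a null set of space-time.\<close>
      have "AE p in (lborel :: ('a \<times> real) measure). snd p \<noteq> a"
      proof (rule AE_I'[of "UNIV \<times> {a}"])
        have "emeasure (lborel \<Otimes>\<^sub>M lborel) ((UNIV :: 'a set) \<times> {a}) = emeasure lborel (UNIV :: 'a set) * emeasure lborel {a}"
          by (rule lborel.emeasure_pair_measure_Times) auto
        then show "UNIV \<times> {a} \<in> null_sets (lborel :: ('a \<times> real) measure)"
          unfolding lborel_prod by (intro null_setsI) (auto simp: closed_Times)
      qed auto
      then show "AE p in lborel. indicator {a<..b} (snd p) * \<bar>\<gamma> p\<bar> = indicator {a..b} (snd p) * \<bar>\<gamma> p\<bar>"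
        by eventually_elim (auto simp: indicator_def)
    qed measurable
    finally show ?thesis ..
  qed
  show ?thesis
  proof (rule increments_nonpos[OF st(2), where N = N])
    fix \<epsilon> :: real assume "\<epsilon> > 0"
    then have "\<epsilon> / 2 > 0" by simp
    then obtain \<delta> where \<delta>: "\<delta> > 0" "\<And>x r r'. x \<in> S \<Longrightarrow> r \<in> {0..T} \<Longrightarrow> r' \<in> {0..T} \<Longrightarrow> \<bar>r - r'\<bar> < \<delta> \<Longrightarrow> \<bar>W (x, r) - W (x, r')\<bar> \<le> \<epsilon> / 2"
      using W_uniform by metis
    show "\<exists>\<delta>>0. \<forall>a b. s \<le> a \<longrightarrow> a < b \<longrightarrow> b \<le> t \<longrightarrow> b - a < \<delta> \<longrightarrow> energy b - energy a \<le> \<epsilon> * (N b - N a)"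
    proof (intro exI[of _ \<delta>] conjI \<delta>(1) allI impI)
      fix a b assume ab: "s \<le> a" "a < b" "b \<le> t" "b - a < \<delta>"
      have "energy b - energy a \<le> 2 * (\<epsilon> / 2) * (LINT p|lborel. indicator {a..b} (snd p) * \<bar>\<gamma> p\<bar>)"
      proof (rule energy_step[OF _ ab(2) _ _ diss])
        show "\<bar>W (x, a) - W (x, r)\<bar> \<le> \<epsilon> / 2 \<and> \<bar>W (x, b) - W (x, r)\<bar> \<le> \<epsilon> / 2" if "x \<in> S" "r \<in> {a..b}" for x r
          using that ab st by (intro conjI \<delta>(2)) auto
      qed (use ab st in auto)
      then show "energy b - energy a \<le> \<epsilon> * (N b - N a)" by (simp add: Nd[OF ab(2)])
    qed
  qed
qed

text \<open>Monotonicity of the energy is known between interior times only, so the initial time is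
  reached through a sequence decreasing to 0, along which the energy tends to its initial value 0.
  Continuity then turns zero almost everywhere into zero everywhere, up to the closure of the
  cylinder.\<close>

lemma zero_of_dissipative:
  assumes init: "AE x in lborel. x \<in> S \<longrightarrow> w (x, 0) = 0"
    and diss: "AE r in lborel. r \<in> {0<..<T} \<longrightarrow> (LINT x|lborel. \<gamma> (x, r) * W (x, r)) \<le> 0"
    and p: "p \<in> closure (QT S T)"
  shows "w p = 0"
proof -
  obtain B where B: "B \<ge> 0" "\<And>p. \<bar>W p\<bar> \<le> B" using W_bounded by blast
  have iE: "integrable lborel (\<lambda>x. indicator S x * (W (x, r))\<^sup>2)" for r
    using power_mono[OF B(2) abs_ge_zero, of _ 2] by (intro bounded_support_integrable[of _ "B\<^sup>2"]) auto
  have Wc: "continuous_on {0..T} (\<lambda>r. W (x, r))" if "x \<in> S" for x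
  proof -
    have "continuous_on {0..T} (\<lambda>r. w (x, r))"
      by (rule continuous_on_compose2[OF w_cont]) (use in_closure[OF that] in \<open>auto intro!: continuous_intros\<close>)
    then show ?thesis by (rule continuous_on_eq) (use W_eq in_closure[OF that] in auto)
  qed
  have "w (x, t) = 0" if xt: "x \<in> S" "0 < t" "t < T" for x t
  proof -
    define r where "r n = t * inverse (real (Suc n))" for n
    have r: "0 < r n" "r n \<le> t" for n
      using xt by (auto simp: r_def inverse_le_1_iff mult_left_le)
    have "(\<lambda>n. r n) \<longlonglongrightarrow> t * 0"
      unfolding r_def by (intro tendsto_mult tendsto_const LIMSEQ_inverse_real_of_nat)
    then have r0: "r \<longlonglongrightarrow> 0" by simp
    have "(\<lambda>n. energy (r n)) \<longlonglongrightarrow> energy 0"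
      unfolding energy_def
    proof (rule integral_dominated_convergence[where w = "\<lambda>x. indicator S x * B\<^sup>2"])
      show "AE x in lborel. (\<lambda>n. indicator S x * (W (x, r n))\<^sup>2) \<longlonglongrightarrow> indicator S x * (W (x, 0))\<^sup>2"
      proof (rule AE_I2)
        fix x
        show "(\<lambda>n. indicator S x * (W (x, r n))\<^sup>2) \<longlonglongrightarrow> indicator S x * (W (x, 0))\<^sup>2"
        proof (cases "x \<in> S")
          case True
          have "(\<lambda>n. W (x, r n)) \<longlonglongrightarrow> W (x, 0)"
            by (rule continuous_on_tendsto_compose[OF Wc[OF True] r0])
              (use T r(1) less_imp_le[OF le_less_trans[OF r(2) xt(3)]] in \<open>auto intro!: always_eventually less_imp_le\<close>)
          then show ?thesis by (intro tendsto_intros)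
        qed simp
      qed
      show "AE x in lborel. norm (indicator S x * (W (x, r n))\<^sup>2) \<le> indicator S x * B\<^sup>2" for n
        using power_mono[OF B(2) abs_ge_zero, of _ 2] by (intro AE_I2) (auto simp: indicator_def)
    qed (use indicator_S_integrable in measurable)
    moreover have "energy 0 = 0"
    proof -
      have "energy 0 = (LINT x|(lborel :: 'a measure). 0)"
        unfolding energy_def
      proof (rule integral_cong_AE)
        show "AE x in lborel. indicator S x * (W (x, 0))\<^sup>2 = 0"
          using init
        proof eventually_elim
          case (elim x)
          then show ?case using W_eq[OF in_closure, of x 0] T by (cases "x \<in> S") auto
        qed
      qed measurable
      then show ?thesis by simp
    qed
    moreover have "energy t \<le> energy (r n)" for n
      by (rule energy_le[OF r(1,2) xt(3) diss])
    ultimately have "energy t \<le> 0" by (metis LIMSEQ_le_const)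
    moreover have "energy t \<ge> 0" unfolding energy_def by (rule Bochner_Integration.integral_nonneg) simp
    ultimately have "energy t = 0" by linarith
    then have "AE x in lborel. indicator S x * (W (x, t))\<^sup>2 = 0"
      using integral_nonneg_eq_0_iff_AE[OF iE[of t]] by (simp add: energy_def)
    then have ae: "AE y\<in>S in lebesgue. y \<in> {y. y \<in> S \<longrightarrow> W (y, t) = 0}"
      by (intro AE_completion) (auto elim: eventually_mono)
    have "W (x, t) = 0"
    proof (rule ccontr)
      assume ne: "W (x, t) \<noteq> 0"
      have "continuous_on S (\<lambda>y. w (y, t))"
        by (rule continuous_on_compose2[OF w_cont]) (use in_closure xt in \<open>auto intro!: continuous_intros\<close>)
      then have "continuous_on S (\<lambda>y. W (y, t))"
        by (rule continuous_on_eq) (use W_eq in_closure xt in auto)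
      \<comment> \<open>The set where the slice is nonzero is open and null, hence empty.\<close>
      then have "open (S \<inter> (\<lambda>y. W (y, t)) -` (- {0}))"
        by (intro continuous_open_preimage[OF _ open_S]) auto
      moreover have "S \<inter> (\<lambda>y. W (y, t)) -` (- {0}) \<in> null_sets lebesgue"
      proof -
        have "AE y in lebesgue. y \<notin> S \<inter> (\<lambda>y. W (y, t)) -` (- {0})" using ae by eventually_elim auto
        then show ?thesis
          using \<open>open (S \<inter> (\<lambda>y. W (y, t)) -` (- {0}))\<close> by (subst AE_iff_null_sets) auto
      qed
      ultimately have "S \<inter> (\<lambda>y. W (y, t)) -` (- {0}) = {}"
        using open_not_negligible by (auto simp: negligible_iff_null_sets)
      then show False using ne xt(1) by auto
    qed
    then show ?thesis using W_eq[OF in_closure, of x t] xt by simp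
  qed
  then have "w q = 0" if "q \<in> QT S T" for q using that by (cases q) (auto simp: QT_def)
  then show ?thesis by (rule continuous_constant_on_closure[OF w_cont _ p])
qed

end

section \<open>Limits along time slices\<close>

lemma (in cylinder_function) slice_integrable_mult:
  assumes a: "integrable (lebesgue_on S) a" and r: "r \<in> {0..T}"
  shows "integrable (lebesgue_on S) (\<lambda>x. a x * w (x, r))"
proof -
  obtain B where B: "B \<ge> 0" "\<And>p. \<bar>W p\<bar> \<le> B" using W_bounded by blast
  have "(\<lambda>x. W (x, r)) \<in> borel_measurable borel" by measurable
  then have "(\<lambda>x. W (x, r)) \<in> borel_measurable (lebesgue_on S)" by (rule measurable_lebesgue_on_borel)
  then have "integrable (lebesgue_on S) (\<lambda>x. W (x, r) * a x)"
    by (rule integrable_bounded_mult[OF _ _ a]) (rule AE_I2, rule B(2))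
  then show ?thesis
    by (rule Bochner_Integration.integrable_cong[THEN iffD1, rotated 2])
      (use W_eq[OF in_closure[OF _ r]] in \<open>auto simp: mult.commute\<close>)
qed

lemma (in cylinder_function) slice_integral_tendsto:
  assumes a: "integrable (lebesgue_on S) a" and r: "\<And>n. r n \<in> {0..T}" "t \<in> {0..T}" and lim: "r \<longlonglongrightarrow> t"
  shows "(\<lambda>n. LINT x|lebesgue_on S. a x * w (x, r n)) \<longlonglongrightarrow> (LINT x|lebesgue_on S. a x * w (x, t))"
proof -
  obtain B where B: "B \<ge> 0" "\<And>p. \<bar>W p\<bar> \<le> B" using W_bounded by blast
  show ?thesis
  proof (rule integral_dominated_convergence[where w = "\<lambda>x. B * \<bar>a x\<bar>"])
    show "integrable (lebesgue_on S) (\<lambda>x. B * \<bar>a x\<bar>)" using a by simp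
    show "AE x in lebesgue_on S. (\<lambda>n. a x * w (x, r n)) \<longlonglongrightarrow> a x * w (x, t)"
    proof (rule AE_I2)
      fix x assume "x \<in> space (lebesgue_on S)"
      then have x: "x \<in> S" by simp
      have "continuous_on {0..T} (\<lambda>r. w (x, r))"
        by (rule continuous_on_compose2[OF w_cont]) (use in_closure[OF x] in \<open>auto intro!: continuous_intros\<close>)
      from continuous_on_tendsto_compose[OF this lim r(2)] r(1)
      show "(\<lambda>n. a x * w (x, r n)) \<longlonglongrightarrow> a x * w (x, t)"
        by (intro tendsto_mult tendsto_const) simp
    qed
    show "AE x in lebesgue_on S. norm (a x * w (x, r n)) \<le> B * \<bar>a x\<bar>" for n
    proof (rule AE_I2)
      fix x assume "x \<in> space (lebesgue_on S)"
      then have "\<bar>w (x, r n)\<bar> \<le> B" using B(2)[of "(x, r n)"] W_eq[OF in_closure, of x "r n"] r(1)[of n] by simp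
      then show "norm (a x * w (x, r n)) \<le> B * \<bar>a x\<bar>"
        by (simp add: abs_mult mult.commute[of B] mult_left_mono)
    qed
    show "(\<lambda>x. a x * w (x, t)) \<in> borel_measurable (lebesgue_on S)"
      by (rule borel_measurable_integrable[OF slice_integrable_mult[OF a r(2)]])
    show "(\<lambda>x. a x * w (x, r n)) \<in> borel_measurable (lebesgue_on S)" for n
      by (rule borel_measurable_integrable[OF slice_integrable_mult[OF a r(1)]])
  qed
qed

text \<open>The chosen weak derivative is only Lebesgue measurable on the cylinder, and its
  individual slices may be bad. A Borel version has measurable slices, agrees with it on almost
  every slice, and can be integrated iteratively.\<close>

lemma time_derivative_representative:
  fixes S :: "'a::euclidean_space set"
  assumes S: "open S" "bounded S" and z: "dt_in_L2 S T z"
  obtains h where "h \<in> borel_measurable borel" "integrable lborel h" "\<And>p. p \<notin> QT S T \<Longrightarrow> h p = 0"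
    "has_weak_deriv (QT S T) (0, 1) z h"
    "AE t in lborel. t \<in> {0<..<T} \<longrightarrow> (AE x in lborel. x \<in> S \<longrightarrow> weak_deriv (QT S T) (0, 1) z (x, t) = h (x, t))"
    "AE t in lborel. integrable lborel (\<lambda>x. h (x, t))"
proof -
  let ?Q = "QT S T" and ?g = "weak_deriv (QT S T) (0, 1) z"
  have Q: "?Q \<in> sets borel" "bounded ?Q" using QT_open[OF S(1)] QT_bounded[OF S(2)] by auto
  have gL2: "?g \<in> L2 ?Q" and wd: "has_weak_deriv ?Q (0, 1) z ?g"
    using z weak_deriv_works by (auto simp: dt_in_L2_def)
  have "?g \<in> borel_measurable (lebesgue_on ?Q)" using gL2 by (simp add: L2_def)
  from borel_representative[OF Q(1) this] obtain h0 where h0[measurable]: "h0 \<in> borel_measurable borel"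
    and eq: "AE p in lborel. p \<in> ?Q \<longrightarrow> ?g p = h0 p" by blast
  define h where "h p = indicator ?Q p * h0 p" for p
  have hm[measurable]: "h \<in> borel_measurable borel" unfolding h_def[abs_def] using Q(1) by measurable
  have ih: "integrable lborel h"
    using L2_imp_integrable[OF Q gL2] lebesgue_on_cong_borel(2)[OF Q(1) h0 eq] by (simp add: h_def[abs_def])
  have eq': "AE p in lborel. p \<in> ?Q \<longrightarrow> ?g p = h p" using eq by eventually_elim (simp add: h_def)
  show thesis
  proof (rule that[OF hm ih])
    show "h p = 0" if "p \<notin> ?Q" for p using that by (simp add: h_def)
    have "h \<in> L1loc ?Q"
      unfolding L1loc_def
    proof (clarify)
      fix C :: "('a \<times> real) set" assume "compact C"
      then have Cb: "C \<in> sets borel" by (simp add: compact_imp_closed)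
      show "integrable (lebesgue_on C) h"
        using integrable_mult_indicator[OF _ ih, of C] Cb by (subst lebesgue_on_integral_borel(1)[OF Cb hm]) simp
    qed
    moreover have "(LINT p|lebesgue_on ?Q. ?g p * \<phi> p) = (LINT p|lebesgue_on ?Q. h p * \<phi> p)" if \<phi>: "\<phi> \<in> test_functions ?Q" for \<phi>
    proof -
      have [measurable]: "\<phi> \<in> borel_measurable borel"
        by (rule borel_measurable_continuous_onI[OF smooth_continuous[OF test_function_smooth[OF \<phi>]]])
      have "AE p in lborel. p \<in> ?Q \<longrightarrow> ?g p * \<phi> p = h p * \<phi> p" using eq' by eventually_elim simp
      then have "(LINT p|lebesgue_on ?Q. ?g p * \<phi> p) = (LINT p|lborel. indicator ?Q p * (h p * \<phi> p))"
        by (intro lebesgue_on_cong_borel(3)[OF Q(1)]) measurable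
      also have "\<dots> = (LINT p|lebesgue_on ?Q. h p * \<phi> p)"
        by (rule lebesgue_on_integral_borel(2)[OF Q(1), symmetric]) measurable
      finally show ?thesis .
    qed
    ultimately show "has_weak_deriv ?Q (0, 1) z h" using wd by (simp add: has_weak_deriv_def)
    show "AE t in lborel. t \<in> {0<..<T} \<longrightarrow> (AE x in lborel. x \<in> S \<longrightarrow> ?g (x, t) = h (x, t))"
      using AE_lborel_slices[OF eq']
    proof eventually_elim
      case (elim t)
      show ?case
      proof
        assume "t \<in> {0<..<T}"
        with elim show "AE x in lborel. x \<in> S \<longrightarrow> ?g (x, t) = h (x, t)"
          by (auto elim!: eventually_mono simp: QT_def)
      qed
    qed
    have "case_prod (\<lambda>x t. h (x, t)) = h" by auto
    then have "integrable (lborel \<Otimes>\<^sub>M lborel) (case_prod (\<lambda>x t. h (x, t)))" unfolding lborel_prod using ih by simp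
    from lborel_pair.AE_integrable_snd[OF this] show "AE t in lborel. integrable lborel (\<lambda>x. h (x, t))" .
  qed
qed

text \<open>The variational inequality holds almost everywhere in time for each test function separately.
  Testing with the countably many slices \<open>y(\<tau>)\<close>, \<open>\<tau> \<in> E\<close>, and passing to the limit \<open>\<tau> \<rightarrow> t\<close> makes
  \<open>y(t)\<close> itself admissible at almost every \<open>t\<close>.\<close>

lemma VI_unique:
  fixes \<Omega> :: "'a::euclidean_space set"
  assumes \<Omega>: "open \<Omega>" "bounded \<Omega>" and T: "T > 0" and K: "K \<subseteq> H10 \<Omega>"
    and z: "continuous_on (closure (QT \<Omega> T)) z" "dt_in_L2 \<Omega> T z" "solves_VI \<Omega> T b f z0 K z"
    and y: "continuous_on (closure (QT \<Omega> T)) y" "dt_in_L2 \<Omega> T y" "solves_VI \<Omega> T b f z0 K y"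
    and p: "p \<in> closure (QT \<Omega> T)"
  shows "y p = z p"
proof -
  have \<Omega>b: "\<Omega> \<in> sets borel" using \<Omega> by auto
  have Qb: "QT \<Omega> T \<in> sets borel" using QT_open[OF \<Omega>(1)] by auto
  interpret fin: finite_measure "lebesgue_on \<Omega>" by (rule finite_measure_bounded[OF \<Omega>b \<Omega>(2)])
  obtain hz where hz: "hz \<in> borel_measurable borel" "integrable lborel hz" "\<And>p. p \<notin> QT \<Omega> T \<Longrightarrow> hz p = 0"
    "has_weak_deriv (QT \<Omega> T) (0, 1) z hz"
    "AE t in lborel. t \<in> {0<..<T} \<longrightarrow> (AE x in lborel. x \<in> \<Omega> \<longrightarrow> weak_deriv (QT \<Omega> T) (0, 1) z (x, t) = hz (x, t))"
    "AE t in lborel. integrable lborel (\<lambda>x. hz (x, t))"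
    using time_derivative_representative[OF \<Omega> z(2)] by blast
  obtain hy where hy: "hy \<in> borel_measurable borel" "integrable lborel hy" "\<And>p. p \<notin> QT \<Omega> T \<Longrightarrow> hy p = 0"
    "has_weak_deriv (QT \<Omega> T) (0, 1) y hy"
    "AE t in lborel. t \<in> {0<..<T} \<longrightarrow> (AE x in lborel. x \<in> \<Omega> \<longrightarrow> weak_deriv (QT \<Omega> T) (0, 1) y (x, t) = hy (x, t))"
    "AE t in lborel. integrable lborel (\<lambda>x. hy (x, t))"
    using time_derivative_representative[OF \<Omega> y(2)] by blast
  interpret Z: cylinder_function \<Omega> T z hz
    by unfold_locales (use \<Omega> T z(1) hz in auto)
  interpret Y: cylinder_function \<Omega> T y hy
    by unfold_locales (use \<Omega> T y(1) hy in auto)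
  interpret D: cylinder_function \<Omega> T "\<lambda>p. z p - y p" "\<lambda>p. hz p - hy p"
    by unfold_locales
      (use \<Omega> T z(1) y(1) hz hy has_weak_deriv_diff[OF Qb hz(4) hy(4)] in \<open>auto intro: continuous_on_diff\<close>)
  \<comment> \<open>Almost every time is in G. The countable set E is taken dense in G and inside G:
    the approximating times need admissible slices as well, since these are the functions inserted
    into the inequality.\<close>
  define G where "G = {\<tau>\<in>{0<..<T}. time_slice y \<tau> \<in> K \<and> time_slice z \<tau> \<in> K}"
  obtain E where E: "countable E" "E \<subseteq> G" "G \<subseteq> closure E" using separable[of G] by blast
  define VI where "VI u t v \<longleftrightarrow>
      (LINT x|lebesgue_on \<Omega>. weak_deriv (QT \<Omega> T) (0, 1) u (x, t) * (v x - time_slice u t x)) +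
      (LINT x|lebesgue_on \<Omega>. (b \<bullet> weak_grad \<Omega> (time_slice u t) x) * (v x - time_slice u t x))
      \<ge> (LINT x|lebesgue_on \<Omega>. f t * (v x - time_slice u t x))" for u t v
  have iI: "{0<..<T} \<in> sets borel" by simp
  have VIz: "AE t in lebesgue_on {0<..<T}. \<forall>\<tau>\<in>E. VI z t (time_slice y \<tau>)"
    using z(3) E unfolding solves_VI_def VI_def G_def by (subst AE_ball_countable[OF E(1)]) blast
  have VIy: "AE t in lebesgue_on {0<..<T}. \<forall>\<tau>\<in>E. VI y t (time_slice z \<tau>)"
    using y(3) E unfolding solves_VI_def VI_def G_def by (subst AE_ball_countable[OF E(1)]) blast
  have KG: "AE t in lebesgue_on {0<..<T}. time_slice y t \<in> K" "AE t in lebesgue_on {0<..<T}. time_slice z t \<in> K"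
    using y(3) z(3) unfolding solves_VI_def by blast+
  have limit: "(LINT x|lebesgue_on \<Omega>. h (x, t) * v (x, t)) + (LINT x|lebesgue_on \<Omega>. (b \<bullet> weak_grad \<Omega> (time_slice u t) x) * v (x, t))
        - (LINT x|lebesgue_on \<Omega>. f t * v (x, t)) \<ge>
      (LINT x|lebesgue_on \<Omega>. h (x, t) * u (x, t)) + (LINT x|lebesgue_on \<Omega>. (b \<bullet> weak_grad \<Omega> (time_slice u t) x) * u (x, t))
        - (LINT x|lebesgue_on \<Omega>. f t * u (x, t))"
    if t: "t \<in> G" and U: "cylinder_function \<Omega> T u h" and V: "cylinder_function \<Omega> T v k"
      and uK: "time_slice u t \<in> K" and ih: "integrable lborel (\<lambda>x. h (x, t))"
      and heq: "AE x in lborel. x \<in> \<Omega> \<longrightarrow> weak_deriv (QT \<Omega> T) (0, 1) u (x, t) = h (x, t)"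
      and vi: "\<forall>\<tau>\<in>E. VI u t (time_slice v \<tau>)" for t and u h v k :: "'a \<times> real \<Rightarrow> real"
  proof -
    interpret U: cylinder_function \<Omega> T u h by (rule U)
    interpret V: cylinder_function \<Omega> T v k by (rule V)
    have t01: "t \<in> {0..T}" using t by (auto simp: G_def)
    obtain r where r: "\<And>n. r n \<in> E" "r \<longlonglongrightarrow> t" using t E(3) closure_sequential by blast
    have r01: "r n \<in> {0..T}" for n using r(1)[of n] E(2) by (auto simp: G_def)
    have hm: "(\<lambda>x. h (x, t)) \<in> borel_measurable borel" using U.\<gamma>(1) by measurable
    have i1: "integrable (lebesgue_on \<Omega>) (\<lambda>x. h (x, t))"
      using integrable_mult_indicator[OF _ ih, of \<Omega>] \<Omega>b by (subst lebesgue_on_integral_borel(1)[OF \<Omega>b hm]) simp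
    have gL2: "weak_deriv \<Omega> i (time_slice u t) \<in> L2 \<Omega>" if "i \<in> Basis" for i
      using uK K that by (auto simp: H10_def H1_def)
    have i2: "integrable (lebesgue_on \<Omega>) (\<lambda>x. b \<bullet> weak_grad \<Omega> (time_slice u t) x)"
      unfolding weak_grad_def inner_sum_right inner_scaleR_right
      by (intro Bochner_Integration.integrable_sum integrable_mult_left L2_imp_integrable[OF \<Omega>b \<Omega>(2)] gL2)
    have i3: "integrable (lebesgue_on \<Omega>) (\<lambda>x. f t)" by (rule fin.integrable_const)
    have wh: "(LINT x|lebesgue_on \<Omega>. weak_deriv (QT \<Omega> T) (0, 1) u (x, t) * q x) = (LINT x|lebesgue_on \<Omega>. h (x, t) * q x)"
      if "integrable (lebesgue_on \<Omega>) (\<lambda>x. h (x, t) * q x)" "q \<in> borel_measurable (lebesgue_on \<Omega>)" for q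
    proof (rule integral_cong_AE)
      have "(\<lambda>x. weak_deriv (QT \<Omega> T) (0, 1) u (x, t)) \<in> borel_measurable (lebesgue_on \<Omega>)"
        by (rule lebesgue_on_cong_borel(1)[OF \<Omega>b hm heq])
      then show "(\<lambda>x. weak_deriv (QT \<Omega> T) (0, 1) u (x, t) * q x) \<in> borel_measurable (lebesgue_on \<Omega>)"
        using that(2) by measurable
      show "AE x in lebesgue_on \<Omega>. weak_deriv (QT \<Omega> T) (0, 1) u (x, t) * q x = h (x, t) * q x"
        using heq unfolding AE_lebesgue_on_iff[OF \<Omega>b] by eventually_elim simp
    qed (use that(1) in simp)
    \<comment> \<open>The inequality for \<open>u\<close> at the fixed time t reads J(u(t)) at most
      J(v(r n)). Only the slice of \<open>v\<close> varies with n, and J is continuous along it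
      because \<open>v\<close> is continuous up to the closed cylinder.\<close>
    define J where "J q = (LINT x|lebesgue_on \<Omega>. h (x, t) * q x) + (LINT x|lebesgue_on \<Omega>. (b \<bullet> weak_grad \<Omega> (time_slice u t) x) * q x)
        - (LINT x|lebesgue_on \<Omega>. f t * q x)" for q
    have one: "integrable (lebesgue_on \<Omega>) (\<lambda>x. 1 :: real)" by (rule fin.integrable_const)
    have ge: "J (\<lambda>x. u (x, t)) \<le> J (\<lambda>x. v (x, r n))" for n
    proof -
      have vi': "VI u t (time_slice v (r n))" using vi r(1) by blast
      have meas: "(\<lambda>x. v (x, r n) - u (x, t)) \<in> borel_measurable (lebesgue_on \<Omega>)"
        using V.slice_integrable_mult[OF one r01] U.slice_integrable_mult[OF one t01] by simp
      have ihd: "integrable (lebesgue_on \<Omega>) (\<lambda>x. h (x, t) * (v (x, r n) - u (x, t)))"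
        using V.slice_integrable_mult[OF i1 r01] U.slice_integrable_mult[OF i1 t01] by (simp add: right_diff_distrib)
      have split: "(LINT x|lebesgue_on \<Omega>. a x * (v (x, r n) - u (x, t))) =
          (LINT x|lebesgue_on \<Omega>. a x * v (x, r n)) - (LINT x|lebesgue_on \<Omega>. a x * u (x, t))"
        if a: "integrable (lebesgue_on \<Omega>) a" for a
        using V.slice_integrable_mult[OF a r01] U.slice_integrable_mult[OF a t01] by (simp add: right_diff_distrib)
      show ?thesis
        using vi' wh[OF ihd meas] split[OF i1] split[OF i2] split[OF i3]
        unfolding VI_def time_slice_def J_def by linarith
    qed
    have "(\<lambda>n. J (\<lambda>x. v (x, r n))) \<longlonglongrightarrow> J (\<lambda>x. v (x, t))"
      unfolding J_def
      by (intro tendsto_diff tendsto_add V.slice_integral_tendsto[OF i1 r01 t01 r(2)]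
          V.slice_integral_tendsto[OF i2 r01 t01 r(2)] V.slice_integral_tendsto[OF i3 r01 t01 r(2)])
    from LIMSEQ_le_const[OF this] ge show ?thesis unfolding J_def by blast
  qed
  have diss: "AE r in lborel. r \<in> {0<..<T} \<longrightarrow> (LINT x|lborel. (hz (x, r) - hy (x, r)) * D.W (x, r)) \<le> 0"
    using hz(5,6) hy(5,6) VIz[unfolded AE_lebesgue_on_iff[OF iI]] VIy[unfolded AE_lebesgue_on_iff[OF iI]]
      KG[unfolded AE_lebesgue_on_iff[OF iI]]
  proof eventually_elim
    case (elim t)
    show ?case
    proof
      assume t: "t \<in> {0<..<T}"
      then have tG: "t \<in> G" and t01: "t \<in> {0..T}" and yK: "time_slice y t \<in> K" and zK: "time_slice z t \<in> K"
        using elim by (auto simp: G_def)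
      have i: "integrable (lebesgue_on \<Omega>) (\<lambda>x. h (x, t))"
        if h: "h \<in> borel_measurable borel" "integrable lborel (\<lambda>x. h (x, t))" for h :: "'a \<times> real \<Rightarrow> real"
      proof -
        have hm: "(\<lambda>x. h (x, t)) \<in> borel_measurable borel" using h(1) by measurable
        show ?thesis
          using integrable_mult_indicator[OF _ h(2), of \<Omega>] \<Omega>b by (subst lebesgue_on_integral_borel(1)[OF \<Omega>b hm]) simp
      qed
      have iz: "integrable (lebesgue_on \<Omega>) (\<lambda>x. hz (x, t))" by (rule i[OF hz(1)]) (use elim in blast)
      have iy: "integrable (lebesgue_on \<Omega>) (\<lambda>x. hy (x, t))" by (rule i[OF hy(1)]) (use elim in blast)
      note I = Z.slice_integrable_mult[OF iz t01] Y.slice_integrable_mult[OF iz t01]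
        Z.slice_integrable_mult[OF iy t01] Y.slice_integrable_mult[OF iy t01]
      have 1: "(LINT x|lebesgue_on \<Omega>. hz (x, t) * z (x, t)) + (LINT x|lebesgue_on \<Omega>. (b \<bullet> weak_grad \<Omega> (time_slice z t) x) * z (x, t))
          - (LINT x|lebesgue_on \<Omega>. f t * z (x, t)) \<le>
        (LINT x|lebesgue_on \<Omega>. hz (x, t) * y (x, t)) + (LINT x|lebesgue_on \<Omega>. (b \<bullet> weak_grad \<Omega> (time_slice z t) x) * y (x, t))
          - (LINT x|lebesgue_on \<Omega>. f t * y (x, t))"
        by (rule limit[OF tG Z.cylinder_function_axioms Y.cylinder_function_axioms zK]) (use elim t in blast)+
      have 2: "(LINT x|lebesgue_on \<Omega>. hy (x, t) * y (x, t)) + (LINT x|lebesgue_on \<Omega>. (b \<bullet> weak_grad \<Omega> (time_slice y t) x) * y (x, t))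
          - (LINT x|lebesgue_on \<Omega>. f t * y (x, t)) \<le>
        (LINT x|lebesgue_on \<Omega>. hy (x, t) * z (x, t)) + (LINT x|lebesgue_on \<Omega>. (b \<bullet> weak_grad \<Omega> (time_slice y t) x) * z (x, t))
          - (LINT x|lebesgue_on \<Omega>. f t * z (x, t))"
        by (rule limit[OF tG Y.cylinder_function_axioms Z.cylinder_function_axioms yK]) (use elim t in blast)+
      have zH: "time_slice z t \<in> H10 \<Omega>" and yH: "time_slice y t \<in> H10 \<Omega>" using zK yK K by auto
      have 3: "(LINT x|lebesgue_on \<Omega>. (b \<bullet> weak_grad \<Omega> (time_slice u t) x) * v (x, t)) =
          - (LINT x|lebesgue_on \<Omega>. (b \<bullet> weak_grad \<Omega> (time_slice v t) x) * u (x, t))"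
        if "time_slice u t \<in> H10 \<Omega>" "time_slice v t \<in> H10 \<Omega>" for u v :: "'a \<times> real \<Rightarrow> real"
        using H10_transport_skew(2)[OF \<Omega>b that, of b] by (simp add: time_slice_def)
      have "(LINT x|lborel. (hz (x, t) - hy (x, t)) * D.W (x, t)) = (LINT x|lebesgue_on \<Omega>. (hz (x, t) - hy (x, t)) * D.W (x, t))"
      proof (rule integral_lebesgue_on_support[OF \<Omega>b, symmetric])
        show "(\<lambda>x. (hz (x, t) - hy (x, t)) * D.W (x, t)) \<in> borel_measurable borel"
          using hz(1) hy(1) by measurable
        show "(hz (x, t) - hy (x, t)) * D.W (x, t) = 0" if "x \<notin> \<Omega>" for x
          using that hz(3)[of "(x, t)"] hy(3)[of "(x, t)"] by (simp add: QT_def)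
      qed
      also have "\<dots> = (LINT x|lebesgue_on \<Omega>. (hz (x, t) * z (x, t) - hz (x, t) * y (x, t)) - (hy (x, t) * z (x, t) - hy (x, t) * y (x, t)))"
      proof (rule Bochner_Integration.integral_cong)
        fix x assume "x \<in> space (lebesgue_on \<Omega>)"
        then have "D.W (x, t) = z (x, t) - y (x, t)" using D.W_eq[OF D.in_closure[OF _ t01]] by simp
        then show "(hz (x, t) - hy (x, t)) * D.W (x, t) =
            (hz (x, t) * z (x, t) - hz (x, t) * y (x, t)) - (hy (x, t) * z (x, t) - hy (x, t) * y (x, t))"
          by (simp only:) (simp add: algebra_simps)
      qed simp
      also have "\<dots> = (LINT x|lebesgue_on \<Omega>. hz (x, t) * z (x, t)) - (LINT x|lebesgue_on \<Omega>. hz (x, t) * y (x, t)) -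
          ((LINT x|lebesgue_on \<Omega>. hy (x, t) * z (x, t)) - (LINT x|lebesgue_on \<Omega>. hy (x, t) * y (x, t)))"
        using I by simp
      \<comment> \<open>In the sum of the two inequalities the terms with f cancel; the transport
        terms of each function against itself vanish by skew-symmetry, and the mixed ones cancel
        each other.\<close>
      also have "\<dots> \<le> 0"
        using 1 2 3[OF zH zH] 3[OF yH yH] 3[OF zH yH] by linarith
      finally show "(LINT x|lborel. (hz (x, t) - hy (x, t)) * D.W (x, t)) \<le> 0" .
    qed
  qed
  have "AE x in lebesgue_on \<Omega>. time_slice z 0 x = z0 x" "AE x in lebesgue_on \<Omega>. time_slice y 0 x = z0 x"
    using z(3) y(3) unfolding solves_VI_def by blast+
  then have "AE x in lebesgue_on \<Omega>. z (x, 0) - y (x, 0) = 0"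
    by eventually_elim (simp add: time_slice_def)
  then have "z p - y p = 0"
    by (intro D.zero_of_dissipative[OF _ diss p]) (simp only: AE_lebesgue_on_iff[OF \<Omega>b])
  then show ?thesis by simp
qed

text \<open>Cutting a Borel representative at the essential bound, and to zero outside (0, T), gives
  an integrand bounded everywhere. Its primitive is then Lipschitz on the whole line, as needed for
  obstacles defined at all times.\<close>

lemma Linf_primitive:
  fixes f :: "real \<Rightarrow> real" and T :: real
  assumes f: "f \<in> Linf {0<..<T}"
  obtains F g M where "M-lipschitz_on UNIV F" "F 0 = (0::real)"
    "\<And>s t. s \<le> t \<Longrightarrow> (g has_integral (F t - F s)) {s..t}" "AE t in lborel. t \<in> {0<..<T} \<longrightarrow> f t = g t"
proof -
  obtain M0 where M0: "AE x in lebesgue_on {0<..<T}. \<bar>f x\<bar> \<le> M0" and fm: "f \<in> borel_measurable (lebesgue_on {0<..<T})"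
    using f by (auto simp: Linf_def)
  have I: "{0<..<T} \<in> sets borel" by simp
  obtain f1 where f1[measurable]: "f1 \<in> borel_measurable borel" and eq: "AE x in lborel. x \<in> {0<..<T} \<longrightarrow> f x = f1 x"
    using borel_representative[OF I fm] by blast
  define M where "M = max 0 M0"
  define g where "g x = (if x \<in> {0<..<T} \<and> \<bar>f1 x\<bar> \<le> M then f1 x else 0)" for x
  have gm[measurable]: "g \<in> borel_measurable borel" unfolding g_def[abs_def] by measurable
  have gM: "\<bar>g x\<bar> \<le> M" for x by (simp add: g_def M_def)
  have ig: "integrable lborel g"
  proof (rule Bochner_Integration.integrable_bound)
    show "integrable lborel (\<lambda>x. indicator {0<..<T} x * M)"
      using emeasure_lborel_bounded[of "{0<..<T}"] by (intro integrable_mult_left integrable_real_indicator) auto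
    show "AE x in lborel. norm (g x) \<le> norm (indicator {0<..<T} x * M)"
      by (rule AE_I2) (auto simp: g_def M_def indicator_def)
  qed measurable
  have ii: "integrable lborel (\<lambda>x. indicator A x * g x)" if "A \<in> sets borel" for A
    using integrable_mult_indicator[OF _ ig, of A] that by simp
  \<comment> \<open>Integrating from minus infinity makes increments plain differences; since the
    integrand vanishes up to time 0, the value at 0 is 0.\<close>
  define F where "F t = (LINT r|lborel. indicator {..t} r * g r)" for t
  have hi: "(g has_integral (F t - F s)) {s..t}" if "s \<le> t" for s t
  proof -
    have "F t - F s = (LINT r|lborel. indicator {..t} r * g r - indicator {..s} r * g r)"
      unfolding F_def using ii by simp
    also have "\<dots> = (LINT r|lborel. indicator {s..t} r * g r)"
    proof (rule integral_cong_AE)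
      show "AE r in lborel. indicator {..t} r * g r - indicator {..s} r * g r = indicator {s..t} r * g r"
        using AE_lborel_singleton[of s] by eventually_elim (use that in \<open>auto simp: indicator_def\<close>)
    qed measurable
    finally have "((\<lambda>r. indicator {s..t} r * g r) has_integral (F t - F s)) UNIV"
      using has_integral_integral_lborel[OF ii[of "{s..t}"]] by simp
    then have "((\<lambda>r. if r \<in> {s..t} then g r else 0) has_integral (F t - F s)) UNIV"
      by (rule has_integral_eq[rotated]) auto
    then show ?thesis by (simp only: has_integral_restrict_UNIV)
  qed
  show thesis
  proof (rule that[OF _ _ hi])
    have "\<bar>F t - F s\<bar> \<le> M * \<bar>t - s\<bar>" if "s \<le> t" for s t
      using has_integral_bound[OF _ hi[OF that, folded box_real(2)], of M] gM that by (simp add: M_def)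
    then have "\<bar>F t - F s\<bar> \<le> M * \<bar>t - s\<bar>" for s t by (metis abs_minus_commute linear)
    then show "M-lipschitz_on UNIV F" by (intro lipschitz_onI) (auto simp: dist_real_def M_def)
    have "(\<lambda>r. indicator {..0} r * g r) = (\<lambda>r. 0)" by (auto simp: g_def indicator_def)
    then show "F 0 = 0" by (simp add: F_def)
    show "AE t in lborel. t \<in> {0<..<T} \<longrightarrow> f t = g t"
      using eq M0[unfolded AE_lebesgue_on_iff[OF I]] by eventually_elim (auto simp: g_def M_def)
  qed
qed

theorem theorem4p1:
  fixes \<Omega> :: "(real ^ 'n) set" and T :: real and b :: "real ^ 'n"
    and f :: "real \<Rightarrow> real" and z0 :: "real ^ 'n \<Rightarrow> real"
  assumes "open \<Omega>" and "bounded \<Omega>" and "C2_boundary \<Omega>" and "T > 0"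
    and "f \<in> Linf {0<..<T}" and "z0 \<in> K_grad \<Omega>"
  shows "\<exists>z.
     unique_solution_in \<Omega> T b f z0 (K_obst \<Omega>)
       (Linf_time_W1inf0 \<Omega> T \<inter> H1_time_L2 \<Omega> T \<inter> {y. continuous_on (closure (QT \<Omega> T)) y}) z \<and>
     space_grad_le \<Omega> T z 1 \<and>
     unique_solution_in \<Omega> T b f z0 (K_grad \<Omega>)
       (Linf_time_W1inf0 \<Omega> T \<inter> {y. continuous_on (closure (QT \<Omega> T)) y} \<inter> {y. dt_in_L2 \<Omega> T y}) z"
proof -
  \<comment> \<open>\<open>z0\<close> is given up to null sets, but the formula evaluates it at
    single points, also outside the domain; hence its Lipschitz representative on the whole
    space.\<close>
  obtain u0 where u0: "1-lipschitz_on UNIV u0" "AE x in lebesgue_on \<Omega>. z0 x = u0 x"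
    "\<And>x. \<bar>u0 x\<bar> \<le> infdist x (- \<Omega>)"
    by (rule K_grad_lipschitz[OF assms(1,2,3,6)]) (rule that)
  obtain F g M where F: "M-lipschitz_on UNIV F" "F 0 = (0::real)"
    "\<And>s t. s \<le> t \<Longrightarrow> (g has_integral (F t - F s)) {s..t}" "AE t in lborel. t \<in> {0<..<T} \<longrightarrow> f t = g t"
    by (rule Linf_primitive[OF assms(5)]) (rule that)
  interpret obstacle_problem "\<lambda>x. infdist x (- \<Omega>)" u0 b F M T \<Omega> f g
    by unfold_locales (use infdist_lipschitz u0 F assms in auto)
  \<comment> \<open>The two uniqueness classes differ, but both supply continuity on the closed
    cylinder and a square integrable time derivative, so one argument serves for both convex
    sets.\<close>
  have unique: "\<forall>p\<in>closure (QT \<Omega> T). y p = sol p"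
    if "K \<subseteq> H10 \<Omega>" "continuous_on (closure (QT \<Omega> T)) y" "dt_in_L2 \<Omega> T y" "solves_VI \<Omega> T b f z0 K y"
      "solves_VI \<Omega> T b f z0 K sol" for K y
    using VI_unique[OF assms(1,2,4) that(1) sol_continuous sol_dt that(5) that(2,3,4)] by blast
  have obst: "solves_VI \<Omega> T b f z0 (K_obst \<Omega>) sol"
    by (rule sol_solves[OF u0(2) order_refl slice_K_obst])
  have grad: "solves_VI \<Omega> T b f z0 (K_grad \<Omega>) sol"
    by (rule sol_solves[OF u0(2) K_grad_subset_K_obst[OF assms(1-3)] slice_K_grad])
  have H: "K_obst \<Omega> \<subseteq> H10 \<Omega>" "K_grad \<Omega> \<subseteq> H10 \<Omega>" by (auto simp: K_obst_def K_grad_def)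
  show ?thesis
    unfolding unique_solution_in_def
    using sol_Linf_time sol_H1_time sol_continuous sol_dt sol_space_grad obst grad
      unique[OF H(1) _ _ _ obst] unique[OF H(2) _ _ _ grad]
    by (intro exI[of _ sol]) (auto simp: H1_time_L2_def)
qed

end
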